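(* Let $(X,\mathrm{dist})$ be a space, $r>0$, $c\ge1$, and let $\mathcal{F}$ be an $(r,cr,p_1,p_2,p_q,p_u)$-sensitive filter family. Then we can construct a fully dynamic data structure that solves the $(r,cr)$-near neighbor problem on $n$ points such that, with $k=\lceil\log(n)/\log(p_q/p_2)\rceil$: (i) it uses $O(kn(p_u/p_1)^k)$ words of space in addition to the space required to store $n$ data points and $O(k^2/p_1)$ filters from $\mathcal{F}$; (ii) the query operation uses $O(k^2(p_q/p_1)^k)$ word-RAM operations, $O(k(p_q/p_1)^k)$ distance computations, and $O(k^2/p_1)$ filter evaluations; (iii) the update operation uses $O(k^2(p_u/p_1)^k)$ word-RAM operations and $O(k^2/p_1)$ filter evaluations.
   Context: A probability distribution $\mathcal{F}$ over pairs $(Q,U)$ of subsets of $X$ is $(r,cr,p_1,p_2,p_q,p_u)$-sensitive if for all $x,y\in X$ and random $(Q,U)\sim\mathcal{F}$: if $\mathrm{dist}(x,y)\le r$ then $\Pr[x\in Q,y\in U]\ge p_1$; if $\mathrm{dist}(x,y)>cr$ then $\Pr[x\in Q,y\in U]\le p_2$; $\Pr[x\in Q]\le p_q$ and $\Pr[x\in U]\le p_u$. The $(r,cr)$-near neighbor problem: maintain a set of points under insertions and deletions and, given a query $x$, if some stored $y$ has $\mathrm{dist}(x,y)\le r$, report a stored $y'$ with $\mathrm{dist}(x,y')\le cr$, with constant success probability over the data structure's randomness. Model: word RAM with word size $\Theta(\log n)$, with access to random words for sampling filters and pairwise independent hash functions.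
   Formalization: Assumes n ≥ 2, p_1 > 0, 0 < p_2 < p_q, and words of order log(n + kn(p_u/p_1)^k + k²/p_1) bits (Θ(log n) if these are polynomial in n), so memory and filters are addressable; stepping to the next filter is charged to its evaluation, not as a RAM operation. *)

theory Defs
  imports "HOL-Probability.Probability"
begin

section \<open>Spaces and locality-sensitive filter families\<close>

text \<open>Only a symmetric dissimilarity measure is required, no triangle inequality.\<close>

definition dissimilarity_space :: "'a set \<Rightarrow> ('a \<Rightarrow> 'a \<Rightarrow> real) \<Rightarrow> bool" where
  "dissimilarity_space X d \<longleftrightarrow> X \<noteq> {} \<and>
     (\<forall>x\<in>X. d x x = 0) \<and> (\<forall>x\<in>X. \<forall>y\<in>X. 0 \<le> d x y \<and> d x y = d y x)"

text \<open>A filter is a pair \<open>(Q, U)\<close>; the two measurability clauses only say that the events in the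
  definition have a probability.\<close>

definition sensitive_filter_family ::
  "'a set \<Rightarrow> ('a \<Rightarrow> 'a \<Rightarrow> real) \<Rightarrow> ('a set \<times> 'a set) measure \<Rightarrow>
   real \<Rightarrow> real \<Rightarrow> real \<Rightarrow> real \<Rightarrow> real \<Rightarrow> real \<Rightarrow> bool" where
  "sensitive_filter_family X d F r cr p1 p2 pq pu \<longleftrightarrow>
     prob_space F \<and> space F \<subseteq> Pow X \<times> Pow X \<and>
     (\<forall>x\<in>X. {f \<in> space F. x \<in> fst f} \<in> sets F \<and> {f \<in> space F. x \<in> snd f} \<in> sets F) \<and>
     (\<forall>x\<in>X. \<forall>y\<in>X.
        (d x y \<le> r \<longrightarrow> measure F {f \<in> space F. x \<in> fst f \<and> y \<in> snd f} \<ge> p1) \<and>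
        (d x y > cr \<longrightarrow> measure F {f \<in> space F. x \<in> fst f \<and> y \<in> snd f} \<le> p2)) \<and>
     (\<forall>x\<in>X. measure F {f \<in> space F. x \<in> fst f} \<le> pq \<and>
             measure F {f \<in> space F. x \<in> snd f} \<le> pu)"

section \<open>The word RAM\<close>

text \<open>Words are the naturals below \<open>2 ^ w\<close>. A program text is finite and hence names only
  finitely many registers; memory is addressed by words. Points and filters are opaque: points
  live in slots named by one word, filters are numbered in the order in which they were sampled,
  and a program can only inspect them through the last three instructions.\<close>

type_synonym reg = nat

datatype alu = Add | Sub | Mul | Div | Mod | BAnd | BOr | BXor | Shl | Shr | Less | Equal

datatype side = QuerySide | UpdateSide

text \<open>\<open>Scan z t a b\<close> evaluates filters number \<open>a\<close>, \<open>a + 1\<close>, ... below \<open>b\<close> on the argument point of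
  the current operation and stops at the first one containing it. Every filter looked at is
  charged as one filter evaluation. The advance to the next filter is thus part of the filter
  evaluation; an operation bound such as \<open>k\<^sup>2 * (pq / p1) ^ k\<close>, which need not grow with
  \<open>1 / p1\<close>, could otherwise not coexist with \<open>k\<^sup>2 / p1\<close> filter evaluations.
  \<open>Near t i\<close> computes the distance from the argument point to the point in slot \<open>i\<close> and compares it
  with the threshold of the environment.\<close>

datatype instr =
    Const reg nat
  | Alu alu reg reg reg
  | Load reg reg
  | Store reg reg
  | RandomWord reg
  | SampleFilter
  | Scan side reg reg reg
  | Near reg reg

datatype com =
    Do instr
  | Seq com com
  | If reg com com
  | While reg com

record 'a env =
  word_size :: nat
  distance :: "'a \<Rightarrow> 'a \<Rightarrow> real"
  threshold :: real
  filter_stream :: "nat \<Rightarrow> 'a set \<times> 'a set"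
  word_stream :: "nat \<Rightarrow> nat"

text \<open>\<open>used_space\<close> is a strict upper bound of all memory addresses accessed so far. The counters
  \<open>ops\<close>, \<open>dists\<close> and \<open>evals\<close> are reset at the start of each operation.\<close>

record 'a state =
  regs :: "reg \<Rightarrow> nat"
  mem :: "nat \<Rightarrow> nat"
  slots :: "nat \<Rightarrow> 'a option"
  arg :: "'a option"
  words_drawn :: nat
  filters_drawn :: nat
  used_space :: nat
  ops :: nat
  dists :: nat
  evals :: nat

fun alu_result :: "nat \<Rightarrow> alu \<Rightarrow> nat \<Rightarrow> nat \<Rightarrow> nat" where
  "alu_result w Add a b = (a + b) mod 2 ^ w"
| "alu_result w Sub a b = (a + 2 ^ w - b) mod 2 ^ w"
| "alu_result w Mul a b = (a * b) mod 2 ^ w"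
| "alu_result w Div a b = a div b"
| "alu_result w Mod a b = a mod b"
| "alu_result w BAnd a b = Bit_Operations.and a b"
| "alu_result w BOr a b = Bit_Operations.or a b"
| "alu_result w BXor a b = Bit_Operations.xor a b"
| "alu_result w Shl a b = push_bit b a mod 2 ^ w"
| "alu_result w Shr a b = drop_bit b a"
| "alu_result w Less a b = of_bool (a < b)"
| "alu_result w Equal a b = of_bool (a = b)"

fun side_set :: "side \<Rightarrow> 'a set \<times> 'a set \<Rightarrow> 'a set" where
  "side_set QuerySide f = fst f"
| "side_set UpdateSide f = snd f"

definition scan_stop :: "(nat \<Rightarrow> bool) \<Rightarrow> nat \<Rightarrow> nat \<Rightarrow> nat" where
  "scan_stop P a b = (LEAST j. a \<le> j \<and> (b \<le> j \<or> P j))"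

definition set_reg :: "reg \<Rightarrow> nat \<Rightarrow> 'a state \<Rightarrow> 'a state" where
  "set_reg t v s = s\<lparr>regs := (regs s)(t := v)\<rparr>"

definition touch :: "nat \<Rightarrow> 'a state \<Rightarrow> 'a state" where
  "touch l s = s\<lparr>used_space := max (used_space s) (Suc l)\<rparr>"

definition tick :: "'a state \<Rightarrow> 'a state" where
  "tick s = s\<lparr>ops := Suc (ops s)\<rparr>"

text \<open>\<open>None\<close> means that the machine is stuck: it uses a filter that has not been sampled, an empty
  slot, or an argument point where there is none.\<close>

fun step :: "'a env \<Rightarrow> instr \<Rightarrow> 'a state \<Rightarrow> 'a state option" where
  "step E (Const t v) s = Some (set_reg t (v mod 2 ^ word_size E) s)"
| "step E (Alu f t a b) s = Some (set_reg t (alu_result (word_size E) f (regs s a) (regs s b)) s)"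
| "step E (Load t a) s = Some (touch (regs s a) (set_reg t (mem s (regs s a)) s))"
| "step E (Store a b) s =
     Some (touch (regs s a) (s\<lparr>mem := (mem s)(regs s a := regs s b)\<rparr>))"
| "step E (RandomWord t) s =
     Some ((set_reg t (word_stream E (words_drawn s)) s)\<lparr>words_drawn := Suc (words_drawn s)\<rparr>)"
| "step E SampleFilter s = Some (s\<lparr>filters_drawn := Suc (filters_drawn s)\<rparr>)"
| "step E (Scan z t a b) s =
     (case arg s of
        None \<Rightarrow> None
      | Some x \<Rightarrow>
          if regs s b \<le> filters_drawn s then
            let j = scan_stop (\<lambda>i. x \<in> side_set z (filter_stream E i)) (regs s a) (regs s b)
            in Some ((set_reg t j s)
                 \<lparr>evals := evals s + (min (Suc j) (regs s b) - regs s a)\<rparr>)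
          else None)"
| "step E (Near t i) s =
     (case (arg s, slots s (regs s i)) of
        (Some x, Some y) \<Rightarrow>
          Some ((set_reg t (of_bool (distance E x y \<le> threshold E)) s)\<lparr>dists := Suc (dists s)\<rparr>)
      | _ \<Rightarrow> None)"

inductive exec :: "'a env \<Rightarrow> com \<Rightarrow> 'a state \<Rightarrow> 'a state \<Rightarrow> bool" for E where
  exec_Do: "step E i s = Some s' \<Longrightarrow> exec E (Do i) s (tick s')"
| exec_Seq: "exec E c1 s s1 \<Longrightarrow> exec E c2 s1 s2 \<Longrightarrow> exec E (Seq c1 c2) s s2"
| exec_If_True: "regs s b \<noteq> 0 \<Longrightarrow> exec E c1 (tick s) s' \<Longrightarrow> exec E (If b c1 c2) s s'"
| exec_If_False: "regs s b = 0 \<Longrightarrow> exec E c2 (tick s) s' \<Longrightarrow> exec E (If b c1 c2) s s'"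
| exec_While_True: "regs s b \<noteq> 0 \<Longrightarrow> exec E c (tick s) s1 \<Longrightarrow> exec E (While b c) s1 s2
    \<Longrightarrow> exec E (While b c) s s2"
| exec_While_False: "regs s b = 0 \<Longrightarrow> exec E (While b c) s (tick s)"

lemma exec_deterministic: "exec E c s s1 \<Longrightarrow> exec E c s s2 \<Longrightarrow> s2 = s1"
proof (induction arbitrary: s2 rule: exec.induct)
  case (exec_Do i s s')
  from \<open>exec E (Do i) s s2\<close> obtain u where "step E i s = Some u" "s2 = tick u"
    by (rule exec.cases) simp_all
  with exec_Do.hyps show ?case by simp
next
  case (exec_Seq c1 s u c2 v)
  from \<open>exec E (Seq c1 c2) s s2\<close> obtain u' where "exec E c1 s u'" "exec E c2 u' s2"
    by (rule exec.cases) simp_all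
  then show ?case using exec_Seq.IH(1)[of u'] exec_Seq.IH(2)[of s2] by simp
next
  case (exec_If_True s b c1 v c2)
  from \<open>exec E (If b c1 c2) s s2\<close> exec_If_True.hyps have "exec E c1 (tick s) s2"
    by (cases rule: exec.cases) simp_all
  then show ?case by (rule exec_If_True.IH)
next
  case (exec_If_False s b c2 v c1)
  from \<open>exec E (If b c1 c2) s s2\<close> exec_If_False.hyps have "exec E c2 (tick s) s2"
    by (cases rule: exec.cases) simp_all
  then show ?case by (rule exec_If_False.IH)
next
  case (exec_While_True s b c u v)
  from \<open>exec E (While b c) s s2\<close> exec_While_True.hyps
  obtain u' where "exec E c (tick s) u'" "exec E (While b c) u' s2"
    by (cases rule: exec.cases) simp_all
  then show ?case using exec_While_True.IH(1)[of u'] exec_While_True.IH(2)[of s2] by simp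
next
  case (exec_While_False s b c)
  from \<open>exec E (While b c) s s2\<close> exec_While_False.hyps show ?case
    by (cases rule: exec.cases) simp_all
qed

section \<open>Dynamic data structures for near neighbors\<close>

text \<open>Stored points are named by identifiers below the capacity \<open>n\<close>.\<close>

datatype 'a operation = Insert nat 'a | Delete nat | Query 'a

fun contents_after :: "'a operation \<Rightarrow> (nat \<Rightarrow> 'a option) \<Rightarrow> nat \<Rightarrow> 'a option" where
  "contents_after (Insert i y) P = P(i := Some y)"
| "contents_after (Delete i) P = P(i := None)"
| "contents_after (Query x) P = P"

definition contents :: "'a operation list \<Rightarrow> nat \<Rightarrow> 'a option" where
  "contents os = fold contents_after os (\<lambda>_. None)"

fun admissible :: "'a set \<Rightarrow> nat \<Rightarrow> (nat \<Rightarrow> 'a option) \<Rightarrow> 'a operation \<Rightarrow> bool" where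
  "admissible X n P (Insert i y) \<longleftrightarrow> i < n \<and> P i = None \<and> y \<in> X"
| "admissible X n P (Delete i) \<longleftrightarrow> P i \<noteq> None"
| "admissible X n P (Query x) \<longleftrightarrow> x \<in> X"

definition valid_ops :: "'a set \<Rightarrow> nat \<Rightarrow> 'a operation list \<Rightarrow> bool" where
  "valid_ops X n os \<longleftrightarrow> (\<forall>j<length os. admissible X n (contents (take j os)) (os ! j))"

text \<open>\<open>params n p1 p2 pq pu w\<close> gives the initial register contents. It is how the real parameters
  reach the machine; only the constantly many registers named in the programs matter.\<close>

record data_structure =
  params :: "nat \<Rightarrow> real \<Rightarrow> real \<Rightarrow> real \<Rightarrow> real \<Rightarrow> nat \<Rightarrow> reg \<Rightarrow> nat"
  prepare_code :: com
  insert_code :: com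
  delete_code :: com
  query_code :: com

definition start_state :: "nat \<Rightarrow> (reg \<Rightarrow> nat) \<Rightarrow> 'a state" where
  "start_state w R = \<lparr>regs = (\<lambda>t. R t mod 2 ^ w), mem = (\<lambda>_. 0), slots = (\<lambda>_. None), arg = None,
     words_drawn = 0, filters_drawn = 0, used_space = 0, ops = 0, dists = 0, evals = 0\<rparr>"

definition begin_op :: "'a option \<Rightarrow> 'a state \<Rightarrow> 'a state" where
  "begin_op x s = s\<lparr>arg := x, ops := 0, dists := 0, evals := 0\<rparr>"

text \<open>Register 0 passes the identifier to an update. The point to be deleted is still in its slot
  while the deletion runs.\<close>

inductive perform :: "'a env \<Rightarrow> data_structure \<Rightarrow> 'a operation \<Rightarrow> 'a state \<Rightarrow> 'a state \<Rightarrow> bool"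
  for E D where
  perform_Insert:
    "exec E (insert_code D) (set_reg 0 i (begin_op (Some y) (s\<lparr>slots := (slots s)(i := Some y)\<rparr>))) s'
     \<Longrightarrow> perform E D (Insert i y) s s'"
| perform_Delete:
    "exec E (delete_code D) (set_reg 0 i (begin_op (slots s i) s)) s'
     \<Longrightarrow> perform E D (Delete i) s (s'\<lparr>slots := (slots s')(i := None)\<rparr>)"
| perform_Query:
    "exec E (query_code D) (begin_op (Some x) s) s' \<Longrightarrow> perform E D (Query x) s s'"

inductive reaches :: "'a env \<Rightarrow> data_structure \<Rightarrow> (reg \<Rightarrow> nat) \<Rightarrow> 'a operation list \<Rightarrow> 'a state \<Rightarrow> bool"
  for E D R where
  reaches_Nil: "exec E (prepare_code D) (start_state (word_size E) R) s \<Longrightarrow> reaches E D R [] s"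
| reaches_snoc: "reaches E D R os s \<Longrightarrow> perform E D a s s' \<Longrightarrow> reaches E D R (os @ [a]) s'"

text \<open>A query answers with register 0: the value \<open>Suc i\<close> reports the stored point with identifier
  \<open>i\<close>, and 0 reports nothing.\<close>

definition correct_answer ::
  "('a \<Rightarrow> 'a \<Rightarrow> real) \<Rightarrow> real \<Rightarrow> (nat \<Rightarrow> 'a option) \<Rightarrow> 'a \<Rightarrow> 'a state \<Rightarrow> bool" where
  "correct_answer d cr P x s \<longleftrightarrow> (\<exists>i y. regs s 0 = Suc i \<and> P i = Some y \<and> d x y \<le> cr)"

text \<open>Independent filters from \<open>F\<close> and independent uniform words.\<close>

definition randomness ::
  "('a set \<times> 'a set) measure \<Rightarrow> nat \<Rightarrow> ((nat \<Rightarrow> 'a set \<times> 'a set) \<times> (nat \<Rightarrow> nat)) measure" where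
  "randomness F w =
     (\<Pi>\<^sub>M i\<in>(UNIV::nat set). F) \<Otimes>\<^sub>M (\<Pi>\<^sub>M i\<in>(UNIV::nat set). uniform_count_measure {..<2 ^ w})"

definition make_env ::
  "nat \<Rightarrow> ('a \<Rightarrow> 'a \<Rightarrow> real) \<Rightarrow> real \<Rightarrow> (nat \<Rightarrow> 'a set \<times> 'a set) \<times> (nat \<Rightarrow> nat) \<Rightarrow> 'a env" where
  "make_env w d cr \<omega> = \<lparr>word_size = w, distance = d, threshold = cr,
     filter_stream = fst \<omega>, word_stream = snd \<omega>\<rparr>"

text \<open>The sequence of operations is fixed independently of the random choices.\<close>

definition solves_near_neighbor ::
  "data_structure \<Rightarrow> (reg \<Rightarrow> nat) \<Rightarrow> nat \<Rightarrow> nat \<Rightarrow> 'a set \<Rightarrow> ('a \<Rightarrow> 'a \<Rightarrow> real) \<Rightarrow>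
   ('a set \<times> 'a set) measure \<Rightarrow> real \<Rightarrow> real \<Rightarrow> real \<Rightarrow> bool" where
  "solves_near_neighbor D R w n X d F r cr \<delta> \<longleftrightarrow>
     (\<forall>os x. valid_ops X n os \<longrightarrow> x \<in> X \<longrightarrow> (\<exists>i y. contents os i = Some y \<and> d x y \<le> r) \<longrightarrow>
        measure (randomness F w)
          {\<omega> \<in> space (randomness F w).
             \<exists>s. reaches (make_env w d cr \<omega>) D R (os @ [Query x]) s \<and>
                 correct_answer d cr (contents os) x s} \<ge> \<delta>)"

text \<open>All operations terminate and satisfy the bounds for every outcome of the random choices.
  The arguments \<open>sp\<close> and \<open>fl\<close> bound the words of memory and the stored filters throughout;
  \<open>qo\<close>, \<open>qd\<close>, \<open>qf\<close> bound operations, distance computations and filter evaluations of a query,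
  \<open>uo\<close>, \<open>uf\<close> operations and filter evaluations of an update, which computes no distances.\<close>

definition within_bounds ::
  "data_structure \<Rightarrow> (reg \<Rightarrow> nat) \<Rightarrow> nat \<Rightarrow> nat \<Rightarrow> 'a set \<Rightarrow> ('a \<Rightarrow> 'a \<Rightarrow> real) \<Rightarrow>
   ('a set \<times> 'a set) measure \<Rightarrow> real \<Rightarrow> real \<Rightarrow> real \<Rightarrow> real \<Rightarrow> real \<Rightarrow> real \<Rightarrow> real \<Rightarrow> real \<Rightarrow> bool" where
  "within_bounds D R w n X d F cr sp fl qo qd qf uo uf \<longleftrightarrow>
     (\<forall>\<omega> \<in> space (randomness F w). \<forall>os. valid_ops X n os \<longrightarrow>
        (\<exists>s. reaches (make_env w d cr \<omega>) D R os s \<and>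
             real (used_space s) \<le> sp \<and> real (filters_drawn s) \<le> fl \<and>
             (os \<noteq> [] \<longrightarrow>
               (case last os of
                  Query x \<Rightarrow> real (ops s) \<le> qo \<and> real (dists s) \<le> qd \<and> real (evals s) \<le> qf
                | _ \<Rightarrow> real (ops s) \<le> uo \<and> dists s = 0 \<and> real (evals s) \<le> uf))))"

definition filter_depth :: "nat \<Rightarrow> real \<Rightarrow> real \<Rightarrow> nat" where
  "filter_depth n p2 pq = nat \<lceil>ln (real n) / ln (pq / p2)\<rceil>"

text \<open>Word size: the memory words and the filters must be addressable by a constant number of words,
  so the logarithm is taken of \<open>n\<close> plus these two quantities. As soon as they are polynomial in
  \<open>n\<close>, as they must be on any machine with words of length \<open>\<Theta>(log n)\<close>, the condition is a lower
  bound of order \<open>log n\<close>.\<close>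

definition sufficient_word_size :: "real \<Rightarrow> nat \<Rightarrow> nat \<Rightarrow> real \<Rightarrow> real \<Rightarrow> nat \<Rightarrow> bool" where
  "sufficient_word_size \<beta> n k p1 pu w \<longleftrightarrow>
     real w \<ge> \<beta> * log 2 (real n + real k * real n * (pu / p1) ^ k + (real k)\<^sup>2 / p1)"

end

theory Submission
  imports Defs
begin

text \<open>
  The structure is a forest of depth \<open>k\<close> whose nodes are named by words. Level \<open>j\<close> owns \<open>K\<close> blocks of about \<open>1 / p1\<close>
  filters, with \<open>k \<le> K \<le> 2 k\<close>; the name of a node selects a block, and every filter of the block containing the point leads to a
  child whose name is a multiply-shift hash of the node name and the filter number. Each level thus draws only \<open>O(k / p1)\<close>
  filters, yet paths interfere so little that the number of common leaves of a near pair has second moment at most a constant times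
  its squared mean, so that a near pair shares a leaf with constant probability. A pair at distance more than \<open>c r\<close> shares at most
  \<open>K (p2 / p1) ^ k \<le> K (pq / p1) ^ k / n\<close> leaves on average, apart from hash collisions. All resource bounds become worst-case
  bounds by cutting off every loop after a constant multiple of its expected length, at a small loss by Markov's
  inequality. If \<open>k (pq / p1) ^ k \<ge> n\<close>, a linear scan is within the bounds.

  A run depends on the filters only through their traces on the finitely many points of the operation sequence, which reduces the
  probability estimates to discrete distributions.
\<close>

section \<open>Straight-line programs and their cost\<close>

text \<open>With about \<open>1 / p1\<close> filters per node, the common nodes of a near pair form
  an almost critical branching process. In general such a process survives \<open>k\<close>
  generations only with probability of order \<open>1 / k\<close>, which is why about
  \<open>k\<close> roots are used instead of one. Near criticality also means that rounding
  \<open>1 / p1\<close> to an integer could cost a factor exponential in \<open>k\<close>, so two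
  adjacent block sizes are mixed over the levels. The obstacle is the sharing of filters: two nodes
  in one block see the same filters, and a pair of their children may then survive with probability
  \<open>z\<close> instead of \<open>s * s'\<close>. This costs a bounded factor, but distinct nodes
  fall into one block with probability at most \<open>2 / K\<close>, so each level inflates the
  second moment by \<open>1 + O(1 / k)\<close> and all levels together by a constant; this is the
  second use of \<open>K \<ge> k\<close>. A path of length \<open>k\<close> does not fit into a
  word, hence the hashed names. Paths merged by a collision of names behave like common paths and
  are made rare by long names. One multiply-shift function serves three purposes: its leading bits
  choose the block, all its bits form the name, and some leading bits of a leaf form its
  bucket.\<close>

text \<open>Memory is divided into eight interleaved arrays: cell \<open>c\<close> of array \<open>m\<close> has address \<open>8 * c + m\<close>.
  Registers 1 and 2 are scratch registers of the compiler. \<open>MulWrap\<close> and \<open>MulR\<close> compile to the same instruction, but only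
  \<open>MulWrap\<close> may overflow.\<close>

datatype cmd =
    SetC reg nat
  | AddI reg reg nat
  | SubI reg reg nat
  | AddR reg reg reg
  | SubR reg reg reg
  | MulR reg reg reg
  | MulWrap reg reg reg
  | DivR reg reg reg
  | ShrR reg reg reg
  | LessR reg reg reg
  | LoadC reg nat reg
  | StoreC nat reg reg
  | ScanR side reg reg reg
  | NearR reg reg
  | RandomR reg
  | SampleR
  | SeqC cmd cmd  (infixr \<open>;;\<close> 60)
  | IfC reg cmd cmd

primrec compile :: "cmd \<Rightarrow> com" where
  "compile (SetC t v) = Do (Const t v)"
| "compile (AddI t a v) = Seq (Do (Const 1 v)) (Do (Alu Add t a 1))"
| "compile (SubI t a v) = Seq (Do (Const 1 v)) (Do (Alu Sub t a 1))"
| "compile (AddR t a b) = Do (Alu Add t a b)"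
| "compile (SubR t a b) = Do (Alu Sub t a b)"
| "compile (MulR t a b) = Do (Alu Mul t a b)"
| "compile (MulWrap t a b) = Do (Alu Mul t a b)"
| "compile (DivR t a b) = Do (Alu Div t a b)"
| "compile (ShrR t a b) = Do (Alu Shr t a b)"
| "compile (LessR t a b) = Do (Alu Less t a b)"
| "compile (LoadC t m c) = Seq (Do (Const 1 8)) (Seq (Do (Alu Mul 1 c 1)) (Seq (Do (Const 2 m))
     (Seq (Do (Alu Add 1 1 2)) (Do (Load t 1)))))"
| "compile (StoreC m c v) = Seq (Do (Const 1 8)) (Seq (Do (Alu Mul 1 c 1)) (Seq (Do (Const 2 m))
     (Seq (Do (Alu Add 1 1 2)) (Do (Store 1 v)))))"
| "compile (ScanR z t a b) = Do (Scan z t a b)"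
| "compile (NearR t i) = Do (Near t i)"
| "compile (RandomR t) = Do (RandomWord t)"
| "compile SampleR = Do SampleFilter"
| "compile (a ;; b) = Seq (compile a) (compile b)"
| "compile (IfC r a b) = If r (compile a) (compile b)"

primrec cost :: "cmd \<Rightarrow> nat" where
  "cost (SetC t v) = 1"
| "cost (AddI t a v) = 2"
| "cost (SubI t a v) = 2"
| "cost (AddR t a b) = 1"
| "cost (SubR t a b) = 1"
| "cost (MulR t a b) = 1"
| "cost (MulWrap t a b) = 1"
| "cost (DivR t a b) = 1"
| "cost (ShrR t a b) = 1"
| "cost (LessR t a b) = 1"
| "cost (LoadC t m c) = 5"
| "cost (StoreC m c v) = 5"
| "cost (ScanR z t a b) = 1"
| "cost (NearR t i) = 1"
| "cost (RandomR t) = 1"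
| "cost SampleR = 1"
| "cost (a ;; b) = cost a + cost b"
| "cost (IfC r a b) = 1 + max (cost a) (cost b)"

section \<open>Verification conditions over interleaved arrays\<close>

type_synonym assertion =
  "(reg \<Rightarrow> nat) \<Rightarrow> (nat \<Rightarrow> nat \<Rightarrow> nat) \<Rightarrow> nat \<Rightarrow> nat \<Rightarrow> nat \<Rightarrow> nat \<Rightarrow> bool"

text \<open>Array numbers from 8 on read as zero, so that a write to one address changes exactly one
  cell of one array: an array number below 8 and a cell number are determined by their
  address.\<close>

definition areas :: "(nat \<Rightarrow> nat) \<Rightarrow> nat \<Rightarrow> nat \<Rightarrow> nat" where
  "areas m = (\<lambda>a c. if a < 8 then m (8 * c + a) else 0)"

lemma areas_upd:
  assumes "a < 8"
  shows "areas (m(8 * c + a := v)) = (areas m)(a := (areas m a)(c := v))"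
proof (intro ext)
  fix a' c'
  show "areas (m(8 * c + a := v)) a' c' = ((areas m)(a := (areas m a)(c := v))) a' c'"
  proof (cases "a' < 8 \<and> 8 * c' + a' = 8 * c + a")
    case True
    then have "a' = a" "c' = c" using assms by arith+
    then show ?thesis using assms by (simp add: areas_def)
  next
    case False
    then have "a' = a \<Longrightarrow> c' \<noteq> c" using assms by blast
    then show ?thesis using False by (auto simp: areas_def)
  qed
qed

text \<open>The argument point and the slots stay fixed during an operation, so they are parameters
  instead of arguments of the assertions; every operation of a run instantiates the locale anew.
  \<open>cells_fit\<close> keeps all addresses below the word limit, and with
  \<open>cells_ge\<close> the factor 8 of the address computation is itself a word.\<close>

locale machine =
  fixes E :: "'a env" and cells :: nat and point :: "'a option" and sl :: "nat \<Rightarrow> 'a option"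
  assumes cells_fit: "8 * cells \<le> 2 ^ word_size E" and cells_ge: "cells \<ge> 3"
begin

text \<open>Weakest preconditions. Apart from \<open>MulWrap\<close>, additions, subtractions and
  multiplications demand the absence of overflow, so that invariants can be stated over the
  naturals; the hash is the one place where reduction modulo the word range is wanted. The cases of
  compound instructions also record what is left in the scratch registers.\<close>

primrec vc :: "cmd \<Rightarrow> assertion \<Rightarrow> assertion" where
  "vc (SetC t v) Q R N d e f g \<longleftrightarrow> v < 2 ^ word_size E \<and> Q (R(t := v)) N d e f g"
| "vc (AddI t a v) Q R N d e f g \<longleftrightarrow> a \<noteq> 1 \<and> v < 2 ^ word_size E \<and> R a + v < 2 ^ word_size E \<and>
     Q (R(1 := v, t := R a + v)) N d e f g"
| "vc (SubI t a v) Q R N d e f g \<longleftrightarrow> a \<noteq> 1 \<and> v \<le> R a \<and> R a < 2 ^ word_size E \<and>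
     Q (R(1 := v, t := R a - v)) N d e f g"
| "vc (AddR t a b) Q R N d e f g \<longleftrightarrow> R a + R b < 2 ^ word_size E \<and> Q (R(t := R a + R b)) N d e f g"
| "vc (SubR t a b) Q R N d e f g \<longleftrightarrow> R b \<le> R a \<and> R a < 2 ^ word_size E \<and>
     Q (R(t := R a - R b)) N d e f g"
| "vc (MulR t a b) Q R N d e f g \<longleftrightarrow> R a * R b < 2 ^ word_size E \<and> Q (R(t := R a * R b)) N d e f g"
| "vc (MulWrap t a b) Q R N d e f g \<longleftrightarrow> Q (R(t := R a * R b mod 2 ^ word_size E)) N d e f g"
| "vc (DivR t a b) Q R N d e f g \<longleftrightarrow> Q (R(t := R a div R b)) N d e f g"
| "vc (ShrR t a b) Q R N d e f g \<longleftrightarrow> Q (R(t := R a div 2 ^ R b)) N d e f g"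
| "vc (LessR t a b) Q R N d e f g \<longleftrightarrow> Q (R(t := of_bool (R a < R b))) N d e f g"
| "vc (LoadC t m c) Q R N d e f g \<longleftrightarrow> m < 8 \<and> c \<noteq> 1 \<and> R c < cells \<and>
     Q (R(1 := 8 * R c + m, 2 := m, t := N m (R c))) N d e f g"
| "vc (StoreC m c v) Q R N d e f g \<longleftrightarrow> m < 8 \<and> c \<noteq> 1 \<and> v \<noteq> 1 \<and> v \<noteq> 2 \<and> R c < cells \<and>
     Q (R(1 := 8 * R c + m, 2 := m)) (N(m := (N m)(R c := R v))) d e f g"
| "vc (ScanR z t a b) Q R N d e f g \<longleftrightarrow> (\<exists>y. point = Some y \<and> R b \<le> f \<and>
     (let j = scan_stop (\<lambda>i. y \<in> side_set z (filter_stream E i)) (R a) (R b) in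
      Q (R(t := j)) N d (e + (min (Suc j) (R b) - R a)) f g))"
| "vc (NearR t i) Q R N d e f g \<longleftrightarrow> (\<exists>y y'. point = Some y \<and> sl (R i) = Some y' \<and>
     Q (R(t := of_bool (distance E y y' \<le> threshold E))) N (Suc d) e f g)"
| "vc (RandomR t) Q R N d e f g \<longleftrightarrow> Q (R(t := word_stream E g)) N d e f (Suc g)"
| "vc SampleR Q R N d e f g \<longleftrightarrow> Q R N d e (Suc f) g"
| "vc (a ;; b) Q R N d e f g \<longleftrightarrow> vc a (vc b Q) R N d e f g"
| "vc (IfC r a b) Q R N d e f g \<longleftrightarrow> (if R r \<noteq> 0 then vc a Q R N d e f g else vc b Q R N d e f g)"

text \<open>The operation counter is left out, because the time of a loop-free command is bounded by
  the recursion \<open>cost\<close>. The bound on the used space is part of every assertion, so it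
  survives all programs without an argument of its own.\<close>

definition holds :: "assertion \<Rightarrow> 'a state \<Rightarrow> bool" where
  "holds Q s \<longleftrightarrow> Q (regs s) (areas (mem s)) (dists s) (evals s) (filters_drawn s) (words_drawn s) \<and>
     arg s = point \<and> slots s = sl \<and> used_space s \<le> 8 * cells"

text \<open>Existence of one execution amounts to total correctness, since the machine is
  deterministic.\<close>

definition runs :: "com \<Rightarrow> assertion \<Rightarrow> assertion \<Rightarrow> nat \<Rightarrow> bool" where
  "runs c P Q t \<longleftrightarrow> (\<forall>s. holds P s \<longrightarrow> (\<exists>s'. exec E c s s' \<and> holds Q s' \<and> ops s' \<le> ops s + t))"

lemma runs_Seq: "runs c1 P Q t1 \<Longrightarrow> runs c2 Q S t2 \<Longrightarrow> runs (Seq c1 c2) P S (t1 + t2)"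
  unfolding runs_def
proof (intro allI impI)
  fix s
  assume 1: "\<forall>s. holds P s \<longrightarrow> (\<exists>s'. exec E c1 s s' \<and> holds Q s' \<and> ops s' \<le> ops s + t1)"
    and 2: "\<forall>s. holds Q s \<longrightarrow> (\<exists>s'. exec E c2 s s' \<and> holds S s' \<and> ops s' \<le> ops s + t2)"
    and s: "holds P s"
  from 1 s obtain s1 where s1: "exec E c1 s s1" "holds Q s1" "ops s1 \<le> ops s + t1" by blast
  from 2 s1(2) obtain s2 where s2: "exec E c2 s1 s2" "holds S s2" "ops s2 \<le> ops s1 + t2" by blast
  have "exec E (Seq c1 c2) s s2" using s1(1) s2(1) by (rule exec_Seq)
  then show "\<exists>s'. exec E (Seq c1 c2) s s' \<and> holds S s' \<and> ops s' \<le> ops s + (t1 + t2)"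
    using s2 s1(3) by (intro exI[of _ s2]) auto
qed

lemma runs_conseq:
  assumes "runs c P Q t" "t \<le> t'"
    and "\<And>R N d e f g. P' R N d e f g \<Longrightarrow> P R N d e f g" "\<And>R N d e f g. Q R N d e f g \<Longrightarrow> Q' R N d e f g"
  shows "runs c P' Q' t'"
  unfolding runs_def
proof (intro allI impI)
  fix s assume "holds P' s"
  then have "holds P s" using assms(3) by (auto simp: holds_def)
  then obtain s' where s': "exec E c s s'" "holds Q s'" "ops s' \<le> ops s + t"
    using assms(1) unfolding runs_def by blast
  moreover have "holds Q' s'" using s'(2) assms(4) by (auto simp: holds_def)
  ultimately show "\<exists>s'. exec E c s s' \<and> holds Q' s' \<and> ops s' \<le> ops s + t'"
    using assms(2) by (intro exI[of _ s']) auto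
qed

lemma word_Sub: "b \<le> a \<Longrightarrow> a < 2 ^ w \<Longrightarrow> (a + 2 ^ w - b) mod 2 ^ w = (a - b :: nat)"
proof -
  assume "b \<le> a" "a < 2 ^ w"
  then have "a + 2 ^ w - b = (a - b) + 2 ^ w" by simp
  then show ?thesis using \<open>a < 2 ^ w\<close> by (simp only: mod_add_self2) simp
qed

lemma runs_Do:
  assumes "\<And>s. holds P s \<Longrightarrow> \<exists>s'. step E i s = Some s' \<and> holds Q (tick s') \<and> ops s' = ops s"
  shows "runs (Do i) P Q (Suc 0)"
  unfolding runs_def
proof (intro allI impI)
  fix s assume "holds P s"
  then obtain s' where "step E i s = Some s'" "holds Q (tick s')" "ops s' = ops s" using assms by blast
  moreover from this(1) have "exec E (Do i) s (tick s')" by (rule exec_Do)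
  moreover have "ops (tick s') = Suc (ops s')" by (simp add: tick_def)
  ultimately show "\<exists>s'. exec E (Do i) s s' \<and> holds Q s' \<and> ops s' \<le> ops s + Suc 0"
    by (intro exI[of _ "tick s'"]) auto
qed

text \<open>The net effect of the four instructions that compute an address. Loads and stores thus
  share one symbolic execution.\<close>

definition address :: "nat \<Rightarrow> reg \<Rightarrow> 'a state \<Rightarrow> 'a state" where
  "address m c s = s\<lparr>regs := (regs s)(1 := 8 * regs s c + m, 2 := m), ops := ops s + 4\<rparr>"

lemma exec_address:
  assumes "8 * regs s c + m < 2 ^ word_size E" "m < 8" "c \<noteq> 1" "8 < (2::nat) ^ word_size E"
    "exec E c' (address m c s) s'"
  shows "exec E (Seq (Do (Const 1 8)) (Seq (Do (Alu Mul 1 c 1)) (Seq (Do (Const 2 m))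
     (Seq (Do (Alu Add 1 1 2)) c')))) s s'"
proof -
  define s1 where "s1 = tick (set_reg 1 8 s)"
  define s2 where "s2 = tick (set_reg 1 (8 * regs s c) s1)"
  define s3 where "s3 = tick (set_reg 2 m s2)"
  have r: "regs s1 c = regs s c" "regs s1 1 = 8" "regs s3 1 = 8 * regs s c" "regs s3 2 = m"
    using assms(3) by (simp_all add: s1_def s2_def s3_def set_reg_def tick_def)
  have m: "8 mod 2 ^ word_size E = (8::nat)" "m mod 2 ^ word_size E = m"
    "regs s c * 8 mod 2 ^ word_size E = 8 * regs s c"
    using assms(1,2,4) by (simp_all only: mod_less mult.commute[of _ 8] less_trans[OF assms(2,4)]
        le_less_trans[OF le_add1 assms(1)])
  have 1: "exec E (Do (Const 1 8)) s s1" unfolding s1_def by (rule exec_Do) (simp only: step.simps m)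
  have 2: "exec E (Do (Alu Mul 1 c 1)) s1 s2" unfolding s2_def
    by (rule exec_Do) (simp only: step.simps alu_result.simps r m)
  have 3: "exec E (Do (Const 2 m)) s2 s3" unfolding s3_def by (rule exec_Do) (simp only: step.simps m)
  have "exec E (Do (Alu Add 1 1 2)) s3 (tick (set_reg 1 (8 * regs s c + m) s3))"
    by (rule exec_Do) (simp only: step.simps alu_result.simps r mod_less[OF assms(1)])
  moreover have "tick (set_reg 1 (8 * regs s c + m) s3) = address m c s"
  proof -
    have "f(1 := a, 2 := m, 1 := b) = f(1 := b, 2 := m)" for f :: "nat \<Rightarrow> nat" and a b
      by (auto simp: fun_upd_def)
    note upd = this
    have "tick (set_reg 1 (8 * regs s c + m) s3) =
      s\<lparr>regs := (regs s)(1 := 8, 1 := 8 * regs s c, 2 := m, 1 := 8 * regs s c + m), ops := Suc (Suc (Suc (Suc (ops s))))\<rparr>"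
      unfolding s3_def s2_def s1_def set_reg_def tick_def by (cases s) (simp only: state.simps)
    also have "\<dots> = address m c s"
      unfolding address_def upd fun_upd_upd by (simp only: numeral_eq_Suc add_Suc_right add_0_right pred_numeral_simps BitM.simps arith_simps) 
    finally show ?thesis .
  qed
  ultimately have 4: "exec E (Do (Alu Add 1 1 2)) s3 (address m c s)" by (simp only:)
  show ?thesis by (rule exec_Seq[OF 1 exec_Seq[OF 2 exec_Seq[OF 3 exec_Seq[OF 4 assms(5)]]]])
qed

lemma vc_sound: "runs (compile c) (vc c Q) Q (cost c)"
proof (induction c arbitrary: Q)
  case (SeqC c1 c2)
  show ?case
    by (rule runs_conseq[OF runs_Seq[OF SeqC(1)[of "vc c2 Q"] SeqC(2)[of Q]], folded compile.simps]) auto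
next
  case (IfC r a b)
  show ?case
    unfolding runs_def
  proof (intro allI impI)
    fix s assume s: "holds (vc (IfC r a b) Q) s"
    have t: "holds P (tick s) = holds P s" "ops (tick s) = Suc (ops s)" for P
      by (auto simp: holds_def tick_def)
    show "\<exists>s'. exec E (compile (IfC r a b)) s s' \<and> holds Q s' \<and> ops s' \<le> ops s + cost (IfC r a b)"
    proof (cases "regs s r = 0")
      case True
      with s have "holds (vc b Q) (tick s)" by (auto simp: holds_def tick_def)
      with IfC(2)[of Q] obtain s' where "exec E (compile b) (tick s) s'" "holds Q s'"
        "ops s' \<le> ops (tick s) + cost b" unfolding runs_def by blast
      then show ?thesis using True t by (intro exI[of _ s']) (auto intro: exec_If_False)
    next
      case False
      with s have "holds (vc a Q) (tick s)" by (auto simp: holds_def tick_def)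
      with IfC(1)[of Q] obtain s' where "exec E (compile a) (tick s) s'" "holds Q s'"
        "ops s' \<le> ops (tick s) + cost a" unfolding runs_def by blast
      then show ?thesis using False t by (intro exI[of _ s']) (auto intro: exec_If_True)
    qed
  qed
next
  case (SubR t a b)
  then show ?case by (auto intro!: runs_Do simp: holds_def tick_def set_reg_def word_Sub)
next
  case (AddI t a v)
  have "runs (Do (Const 1 v)) (vc (AddI t a v) Q) (\<lambda>R N d e f g. R a + R 1 < 2 ^ word_size E \<and>
    Q (R(t := R a + R 1)) N d e f g) 1"
    by (auto intro!: runs_Do simp: holds_def tick_def set_reg_def)
  moreover have "runs (Do (Alu Add t a 1)) (\<lambda>R N d e f g. R a + R 1 < 2 ^ word_size E \<and>
    Q (R(t := R a + R 1)) N d e f g) Q 1"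
    by (auto intro!: runs_Do simp: holds_def tick_def set_reg_def)
  ultimately have "runs (Seq (Do (Const 1 v)) (Do (Alu Add t a 1))) (vc (AddI t a v) Q) Q (1 + 1)"
    by (rule runs_Seq)
  then show ?case by (simp only: compile.simps cost.simps one_add_one)
next
  case (SubI t a v)
  have "runs (Do (Const 1 v)) (vc (SubI t a v) Q) (\<lambda>R N d e f g. R 1 \<le> R a \<and> R a < 2 ^ word_size E \<and>
    Q (R(t := R a - R 1)) N d e f g) 1"
    by (auto intro!: runs_Do simp: holds_def tick_def set_reg_def)
  moreover have "runs (Do (Alu Sub t a 1)) (\<lambda>R N d e f g. R 1 \<le> R a \<and> R a < 2 ^ word_size E \<and>
    Q (R(t := R a - R 1)) N d e f g) Q 1"
    by (auto intro!: runs_Do simp: holds_def tick_def set_reg_def word_Sub)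
  ultimately have "runs (Seq (Do (Const 1 v)) (Do (Alu Sub t a 1))) (vc (SubI t a v) Q) Q (1 + 1)"
    by (rule runs_Seq)
  then show ?case by (simp only: compile.simps cost.simps one_add_one)
next
  case (LoadC t m c)
  show ?case
    unfolding runs_def
  proof (intro allI impI)
    fix s assume s: "holds (vc (LoadC t m c) Q) s"
    then have b: "8 * regs s c + m < 2 ^ word_size E" "m < 8" "c \<noteq> 1" "8 < (2::nat) ^ word_size E"
      "8 * regs s c + m < 8 * cells"
      using cells_fit cells_ge by (auto simp: holds_def)
    define s1 where "s1 = address m c s"
    have "holds Q (tick (touch (regs s1 1) (set_reg t (mem s1 (regs s1 1)) s1)))"
      using s b by (auto simp: s1_def holds_def tick_def set_reg_def touch_def address_def areas_def)
    moreover have "exec E (Do (Load t 1)) s1 (tick (touch (regs s1 1) (set_reg t (mem s1 (regs s1 1)) s1)))"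
      by (rule exec_Do) simp
    moreover from exec_address[OF b(1-4) this[unfolded s1_def]]
    have "exec E (compile (LoadC t m c)) s (tick (touch (regs s1 1) (set_reg t (mem s1 (regs s1 1)) s1)))"
      unfolding compile.simps s1_def .
    moreover have "ops (tick (touch (regs s1 1) (set_reg t (mem s1 (regs s1 1)) s1))) = ops s + 5"
      by (simp add: s1_def address_def tick_def touch_def set_reg_def)
    ultimately show "\<exists>s'. exec E (compile (LoadC t m c)) s s' \<and> holds Q s' \<and> ops s' \<le> ops s + cost (LoadC t m c)"
      unfolding cost.simps by (metis order_refl)
  qed
next
  case (StoreC m c v)
  show ?case
    unfolding runs_def
  proof (intro allI impI)
    fix s assume s: "holds (vc (StoreC m c v) Q) s"
    then have b: "8 * regs s c + m < 2 ^ word_size E" "m < 8" "c \<noteq> 1" "8 < (2::nat) ^ word_size E"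
      "8 * regs s c + m < 8 * cells"
      using cells_fit cells_ge by (auto simp: holds_def)
    define s1 where "s1 = address m c s"
    define s2 where "s2 = tick (touch (regs s1 1) (s1\<lparr>mem := (mem s1)(regs s1 1 := regs s1 v)\<rparr>))"
    have "holds Q s2"
      using s b by (auto simp: s2_def s1_def holds_def tick_def touch_def address_def areas_upd)
    moreover have "exec E (Do (Store 1 v)) s1 s2"
      unfolding s2_def by (rule exec_Do) simp
    moreover from exec_address[OF b(1-4) this[unfolded s1_def]]
    have "exec E (compile (StoreC m c v)) s s2" unfolding compile.simps .
    moreover have "ops s2 = ops s + 5"
      by (simp add: s2_def s1_def address_def tick_def touch_def)
    ultimately show "\<exists>s'. exec E (compile (StoreC m c v)) s s' \<and> holds Q s' \<and> ops s' \<le> ops s + cost (StoreC m c v)"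
      unfolding cost.simps by (metis order_refl)
  qed
next
  case (ScanR z t a b)
  then show ?case by (auto intro!: runs_Do simp: holds_def tick_def set_reg_def Let_def)
next
  case (NearR t i)
  then show ?case by (auto intro!: runs_Do simp: holds_def tick_def set_reg_def)
next
  case (ShrR t a b)
  then show ?case by (auto intro!: runs_Do simp: holds_def tick_def set_reg_def drop_bit_eq_div)
qed (auto intro!: runs_Do simp: holds_def tick_def set_reg_def)

lemma runs_vc:
  assumes "\<And>R N d e f g. P R N d e f g \<Longrightarrow> vc c Q R N d e f g"
  shows "runs (compile c) P Q (cost c)"
  by (rule runs_conseq[OF vc_sound[of c Q]]) (use assms in auto)

text \<open>The index of the invariant bounds the remaining iterations and drops in each round; the
  loop may stop early, so the postcondition knows only that some index is left. Where the index is
  the remaining budget, the resulting time bound is worst case, however large the tree is.\<close>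

lemma runs_While:
  assumes body: "\<And>m. runs c (\<lambda>R N d e f g. I (Suc m) R N d e f g \<and> R b \<noteq> 0) (I m) t"
    and stop: "\<And>R N d e f g. I 0 R N d e f g \<Longrightarrow> R b = 0"
  shows "runs (While b c) (I m) (\<lambda>R N d e f g. (\<exists>m. I m R N d e f g) \<and> R b = 0) (Suc (m * Suc t))"
proof (induction m)
  case 0
  show ?case unfolding runs_def
  proof (intro allI impI)
    fix s assume s: "holds (I 0) s"
    then have "regs s b = 0" using stop by (auto simp: holds_def)
    then have "exec E (While b c) s (tick s)" by (rule exec_While_False)
    with s \<open>regs s b = 0\<close> show "\<exists>s'. exec E (While b c) s s' \<and>
      holds (\<lambda>R N d e f g. (\<exists>m. I m R N d e f g) \<and> R b = 0) s' \<and> ops s' \<le> ops s + Suc (0 * Suc t)"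
      by (intro exI[of _ "tick s"]) (auto simp: holds_def tick_def)
  qed
next
  case (Suc m)
  show ?case unfolding runs_def
  proof (intro allI impI)
    fix s assume s: "holds (I (Suc m)) s"
    show "\<exists>s'. exec E (While b c) s s' \<and>
      holds (\<lambda>R N d e f g. (\<exists>m. I m R N d e f g) \<and> R b = 0) s' \<and> ops s' \<le> ops s + Suc (Suc m * Suc t)"
    proof (cases "regs s b = 0")
      case True
      then have "exec E (While b c) s (tick s)" by (rule exec_While_False)
      with s True show ?thesis
        by (intro exI[of _ "tick s"]) (auto simp: holds_def tick_def)
    next
      case False
      have "holds (\<lambda>R N d e f g. I (Suc m) R N d e f g \<and> R b \<noteq> 0) (tick s)"
        using s False by (auto simp: holds_def tick_def)
      with body[of m] obtain s1 where s1: "exec E c (tick s) s1" "holds (I m) s1"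
        "ops s1 \<le> ops (tick s) + t" unfolding runs_def by blast
      with Suc obtain s2 where s2: "exec E (While b c) s1 s2"
        "holds (\<lambda>R N d e f g. (\<exists>m. I m R N d e f g) \<and> R b = 0) s2" "ops s2 \<le> ops s1 + Suc (m * Suc t)"
        unfolding runs_def by blast
      have "exec E (While b c) s s2" using False s1(1) s2(1) by (rule exec_While_True)
      moreover have "ops s2 \<le> ops s + Suc (Suc m * Suc t)" using s1(3) s2(3) by (simp add: tick_def)
      ultimately show ?thesis using s2(2) by blast
    qed
  qed
qed

end

section \<open>The filter tree\<close>

text \<open>\<open>2 ^ kap\<close> is the number of roots and the number of blocks per level,
  \<open>l\<close> the length of a name within its level, \<open>lt\<close> the length of a bucket
  number. For \<open>A \<le> k\<close> every block has \<open>bl\<close> or \<open>bl + 1\<close>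
  filters, and \<open>A\<close> is the number of levels with the larger size.\<close>

locale lsf_tree =
  fixes w k kap l lt bl A :: nat
  assumes kap_le: "kap \<le> l" and lt_le: "lt \<le> l" and l_le: "l \<le> w"
begin

text \<open>The difference of quotients spreads the larger levels evenly: exactly
  \<open>j * A div k\<close> of them lie among the levels below \<open>j\<close>.\<close>

definition block_size :: "nat \<Rightarrow> nat" where
  "block_size j = bl + (Suc j * A div k - j * A div k)"

definition start :: "nat \<Rightarrow> nat" where
  "start G = (\<Sum>g<G. block_size (g div 2 ^ kap))"

definition nfilters :: nat where
  "nfilters = start (k * 2 ^ kap)"

text \<open>The multiply-shift function with multiplier \<open>a\<close>. Since it extracts leading
  bits, every prefix of its value is again a multiply-shift value.\<close>

definition hash :: "nat \<Rightarrow> nat \<Rightarrow> nat" where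
  "hash a v = v * a mod 2 ^ w div 2 ^ (w - l)"

text \<open>The level stands above the hash bits, so a name determines the multiplier to use, and
  nodes of different levels never coincide. The key \<open>N * nfilters + i\<close> determines both
  the node and the filter as long as \<open>i < nfilters\<close>.\<close>

definition child :: "(nat \<Rightarrow> nat) \<Rightarrow> nat \<Rightarrow> nat \<Rightarrow> nat" where
  "child ws N i = (N div 2 ^ l + 1) * 2 ^ l + hash (ws (N div 2 ^ l)) (N * nfilters + i)"

definition block :: "nat \<Rightarrow> nat" where
  "block N = N div 2 ^ (l - kap)"

definition children :: "(nat \<Rightarrow> bool) \<Rightarrow> (nat \<Rightarrow> nat) \<Rightarrow> nat \<Rightarrow> nat list" where
  "children S ws N = (if N < k * 2 ^ l
     then map (child ws N) (filter S [start (block N)..<start (Suc (block N))]) else [])"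

text \<open>All bits after the leading \<open>kap\<close> bits vanish, so every block of level 0
  contains exactly one root.\<close>

definition roots :: "nat list" where
  "roots = map (\<lambda>t. t * 2 ^ (l - kap)) [0..<2 ^ kap]"

text \<open>A list and not a set: several paths may lead to the same name, and it is paths that are
  counted by the moments.\<close>

primrec front :: "(nat \<Rightarrow> bool) \<Rightarrow> (nat \<Rightarrow> nat) \<Rightarrow> nat \<Rightarrow> nat list" where
  "front S ws 0 = roots"
| "front S ws (Suc j) = concat (map (children S ws) (front S ws j))"

definition bfs :: "(nat \<Rightarrow> bool) \<Rightarrow> (nat \<Rightarrow> nat) \<Rightarrow> nat list" where
  "bfs S ws = concat (map (front S ws) [0..<Suc k])"

definition bucket :: "nat \<Rightarrow> nat" where
  "bucket N = (N - k * 2 ^ l) div 2 ^ (l - lt)"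

definition leaves :: "(nat \<Rightarrow> bool) \<Rightarrow> (nat \<Rightarrow> nat) \<Rightarrow> nat list" where
  "leaves S ws = map bucket (front S ws k)"

text \<open>Bounds the loop iterations of a complete enumeration: one for each hit and each block
  during the scan, and two for each node, which is written to the queue and read from it.\<close>

definition work :: "(nat \<Rightarrow> bool) \<Rightarrow> (nat \<Rightarrow> nat) \<Rightarrow> nat" where
  "work S ws = length (filter S [0..<nfilters]) + k * 2 ^ kap + 2 * length (bfs S ws)"

lemma hash_less: "hash a v < 2 ^ l"
proof -
  have "v * a mod 2 ^ w < 2 ^ l * 2 ^ (w - l)"
    using l_le by (simp flip: power_add)
  then show ?thesis by (simp add: hash_def less_mult_imp_div_less)
qed

lemma child_level: "child ws N i div 2 ^ l = Suc (N div 2 ^ l)"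
proof -
  have "child ws N i div 2 ^ l = N div 2 ^ l + 1 + hash (ws (N div 2 ^ l)) (N * nfilters + i) div 2 ^ l"
    unfolding child_def by (rule div_mult_self3) simp
  then show ?thesis using hash_less by simp
qed

lemma front_level: "N \<in> set (front S ws j) \<Longrightarrow> N div 2 ^ l = j"
proof (induction j arbitrary: N)
  case 0
  then obtain t where t: "t < 2 ^ kap" "N = t * 2 ^ (l - kap)" by (auto simp: roots_def)
  then have "N < 2 ^ kap * 2 ^ (l - kap)" by simp
  then have "N < 2 ^ l" using kap_le by (simp flip: power_add)
  then show ?case by simp
next
  case (Suc j)
  then show ?case by (auto simp: children_def child_level split: if_splits)
qed

lemma block_less: "N < k * 2 ^ l \<Longrightarrow> block N < k * 2 ^ kap"
proof -
  assume "N < k * 2 ^ l"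
  also have "k * 2 ^ l = k * 2 ^ kap * 2 ^ (l - kap)" using kap_le by (simp flip: power_add)
  finally show ?thesis unfolding block_def by (simp add: less_mult_imp_div_less)
qed

lemma start_mono: "G \<le> G' \<Longrightarrow> start G \<le> start G'"
  unfolding start_def by (rule sum_mono2) auto

lemma start_le: "G \<le> k * 2 ^ kap \<Longrightarrow> start G \<le> nfilters"
  unfolding nfilters_def by (rule start_mono)

lemma child_less:
  assumes "N < k * 2 ^ l"
  shows "child ws N i < Suc k * 2 ^ l"
proof -
  have "N div 2 ^ l < k" using assms by (simp add: less_mult_imp_div_less)
  then have "(N div 2 ^ l + 1) * 2 ^ l \<le> k * 2 ^ l" by (intro mult_right_mono) auto
  then show ?thesis using hash_less[of "ws (N div 2 ^ l)" "N * nfilters + i"]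
    by (simp add: child_def)
qed

section \<open>Breadth-first order of the forest\<close>

lemma bfs_less: "N \<in> set (bfs S ws) \<Longrightarrow> N < Suc k * 2 ^ l"
proof -
  assume "N \<in> set (bfs S ws)"
  then obtain j where "j \<le> k" "N \<in> set (front S ws j)"
    unfolding bfs_def by (auto simp: less_Suc_eq_le simp del: upt_Suc)
  then have "N div 2 ^ l \<le> k" using front_level by auto
  then have "N div 2 ^ l < Suc k" by simp
  then show ?thesis by (simp add: div_less_iff_less_mult)
qed

lemma roots_children_front:
  "roots @ concat (map (children S ws) (concat (map (front S ws) [0..<j]))) =
   concat (map (front S ws) [0..<Suc j])"
  by (induction j) auto

lemma children_leaf: "N \<in> set (front S ws k) \<Longrightarrow> \<not> N < k * 2 ^ l"
  using front_level[of N S ws k] by (auto simp: div_less_iff_less_mult[symmetric])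

text \<open>Leaves have no children, so the children of all nodes, taken in order, are the fronts
  from level 1 on. A queue that starts with the roots therefore reproduces itself when it is
  read.\<close>

lemma bfs_unfold: "roots @ concat (map (children S ws) (bfs S ws)) = bfs S ws"
proof -
  have "concat (map (children S ws) (front S ws k)) = []"
    using children_leaf by (auto simp: children_def)
  then show ?thesis using roots_children_front[of S ws k]
    unfolding bfs_def by (simp del: concat_eq_Nil_conv)
qed

lemma filter_leaf_bfs: "filter (\<lambda>N. \<not> N < k * 2 ^ l) (bfs S ws) = front S ws k"
proof -
  have "\<forall>N\<in>set (concat (map (front S ws) [0..<k])). N < k * 2 ^ l"
    using front_level by (force simp: div_less_iff_less_mult[symmetric])
  then have "filter (\<lambda>N. \<not> N < k * 2 ^ l) (concat (map (front S ws) [0..<k])) = []"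
    by (simp add: filter_empty_conv)
  moreover have "filter (\<lambda>N. \<not> N < k * 2 ^ l) (front S ws k) = front S ws k"
    using children_leaf by (simp add: filter_id_conv)
  ultimately show ?thesis by (simp add: bfs_def)
qed

text \<open>For every read position the queue is a prefix of the full traversal. A loop that is cut
  off by its budget has therefore produced only correct nodes, in the correct order.\<close>

lemma bfs_prefix:
  "\<exists>ys. bfs S ws = (roots @ concat (map (children S ws) (take r (bfs S ws)))) @ ys"
proof -
  have "bfs S ws = roots @ concat (map (children S ws) (take r (bfs S ws) @ drop r (bfs S ws)))"
    by (simp add: bfs_unfold)
  then show ?thesis unfolding map_append concat_append by (metis append_assoc)
qed

text \<open>A queue that has been read to its end is complete. Level by level: if the part up to a
  front lies within the first \<open>r\<close> entries, then the children of that front have been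
  written as well, and by assumption the queue has no more than \<open>r\<close> entries.\<close>

lemma bfs_closed:
  assumes "length (roots @ concat (map (children S ws) (take r (bfs S ws)))) \<le> r"
  shows "length (bfs S ws) \<le> r"
proof -
  define off where "off j = length (concat (map (front S ws) [0..<j]))" for j
  have "off j \<le> r" if "j \<le> Suc k" for j
    using that
  proof (induction j)
    case 0 then show ?case by (simp add: off_def)
  next
    case (Suc j)
    then have r: "off j \<le> r" by simp
    have "[0..<Suc k] = [0..<j] @ [j..<Suc k]" using Suc.prems upt_add_eq_append[of 0 j "Suc k - j"] by simp
    then have t: "take (off j) (bfs S ws) = concat (map (front S ws) [0..<j])"
      by (simp add: bfs_def off_def del: upt_Suc)
    obtain zs where zs: "take r (bfs S ws) = take (off j) (bfs S ws) @ zs"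
      using r by (metis append_take_drop_id min.absorb1 take_take)
    have "off (Suc j) = length (roots @ concat (map (children S ws) (take (off j) (bfs S ws))))"
      by (simp only: t roots_children_front) (simp only: off_def)
    also have "\<dots> \<le> length (roots @ concat (map (children S ws) (take r (bfs S ws))))"
      unfolding zs by simp
    finally show ?case using assms by simp
  qed
  from this[of "Suc k"] show ?thesis by (simp add: off_def bfs_def)
qed

text \<open>Hits are recorded in increasing order, so those of one block are contiguous, and the
  slice begins and ends at the numbers of hits before the two block boundaries. One counter per
  boundary is enough to find the children of any node.\<close>

lemma slice_hits:
  assumes "b \<le> c" "c \<le> m"
  shows "map ((!) (filter S [0..<m])) [length (filter S [0..<b])..<length (filter S [0..<c])] =
    filter S [b..<c]"
proof -
  have 1: "[0..<c] = [0..<b] @ [b..<c]" using assms upt_add_eq_append[of 0 b "c - b"] by simp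
  have 2: "[0..<m] = [0..<c] @ [c..<m]" using assms upt_add_eq_append[of 0 c "m - c"] by simp
  have "filter S [0..<m] = filter S [0..<b] @ filter S [b..<c] @ filter S [c..<m]"
    unfolding 2 1 by simp
  moreover have "length (filter S [0..<c]) = length (filter S [0..<b]) + length (filter S [b..<c])"
    unfolding 1 by simp
  ultimately show ?thesis
    by (intro nth_equalityI) (auto simp: nth_append)
qed

end

lemma scan_stop_props:
  assumes "a \<le> b"
  shows "a \<le> scan_stop P a b" "scan_stop P a b \<le> b" "scan_stop P a b < b \<Longrightarrow> P (scan_stop P a b)"
    "\<And>i. a \<le> i \<Longrightarrow> i < scan_stop P a b \<Longrightarrow> \<not> P i"
proof -
  let ?Q = "\<lambda>j. a \<le> j \<and> (b \<le> j \<or> P j)"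
  have Q: "?Q b" using assms by simp
  have L: "?Q (scan_stop P a b)" unfolding scan_stop_def by (rule LeastI[of ?Q, OF Q])
  then show "a \<le> scan_stop P a b" "scan_stop P a b < b \<Longrightarrow> P (scan_stop P a b)" by auto
  show "scan_stop P a b \<le> b" unfolding scan_stop_def by (rule Least_le[of ?Q, OF Q])
  show "\<not> P i" if "a \<le> i" "i < scan_stop P a b" for i
    using not_less_Least[of i ?Q] that unfolding scan_stop_def by auto
qed

lemma filter_upt_none:
  assumes "a \<le> b" "\<And>i. a \<le> i \<Longrightarrow> i < b \<Longrightarrow> \<not> P i"
  shows "filter P [0..<b] = filter P [0..<a]"
proof -
  have "[0..<b] = [0..<a] @ [a..<b]" using assms(1) upt_add_eq_append[of 0 a "b - a"] by simp
  moreover have "filter P [a..<b] = []" using assms(2) by (simp add: filter_empty_conv)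
  ultimately show ?thesis by simp
qed

section \<open>Enumerating the filter tree\<close>

text \<open>Registers 20 to 37 hold the parameters, register 3 the loop condition and register 4 the remaining budget of
  loop iterations. Array 0 stores the multipliers of the hash functions, array 1 the number of the first filter of each block,
  array 3 the filters containing the argument, array 2 the first index of each block in array 3, array 4 the queue of tree nodes,
  array 5 the buckets of the leaves found, and arrays 6 and 7 the successors and predecessors in the bucket lists.\<close>

definition scan_init :: cmd where
  "scan_init = SetC 5 0 ;; SetC 6 0 ;; SetC 7 0 ;; SetC 9 1 ;; LoadC 8 1 9 ;; StoreC 2 6 5 ;;
     LessR 3 6 20 ;; MulR 3 3 4"

definition scan_body :: "side \<Rightarrow> cmd" where
  "scan_body z = ScanR z 9 7 8 ;; LessR 3 9 8 ;;
     IfC 3 (StoreC 3 5 9 ;; AddI 5 5 1 ;; AddI 7 9 1)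
           (AddI 6 6 1 ;; StoreC 2 6 5 ;; AddI 8 6 1 ;; LoadC 8 1 8 ;; AddI 7 9 0) ;;
     SubI 4 4 1 ;; LessR 3 6 20 ;; MulR 3 3 4"

definition tree_init :: cmd where
  "tree_init = SetC 10 0 ;; AddI 11 21 0 ;; SetC 12 0 ;; SetC 13 0 ;; SetC 14 0 ;;
     LessR 3 10 11 ;; MulR 3 3 4"

definition tree_body :: cmd where
  "tree_body = LessR 3 12 13 ;;
     IfC 3
       (LoadC 9 3 12 ;; MulR 5 15 27 ;; AddR 5 5 9 ;; MulWrap 5 5 16 ;; ShrR 5 5 24 ;; AddR 5 17 5 ;;
        StoreC 4 11 5 ;; AddI 11 11 1 ;; AddI 12 12 1)
       (LoadC 15 4 10 ;; AddI 10 10 1 ;; LessR 3 15 26 ;;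
        IfC 3
          (ShrR 6 15 23 ;; LoadC 12 2 6 ;; AddI 6 6 1 ;; LoadC 13 2 6 ;; ShrR 6 15 22 ;; LoadC 16 0 6 ;;
           AddI 6 6 1 ;; MulR 17 6 36)
          (SubR 5 15 26 ;; ShrR 5 5 25 ;; StoreC 5 14 5 ;; AddI 14 14 1)) ;;
     SubI 4 4 1 ;; LessR 3 10 11 ;; LessR 5 12 13 ;; AddR 3 3 5 ;; MulR 3 3 4"

definition enumerate_code :: "side \<Rightarrow> com" where
  "enumerate_code z = Seq (Seq (compile scan_init) (While 3 (compile (scan_body z))))
     (Seq (compile tree_init) (While 3 (compile tree_body)))"

text \<open>The conditions on \<open>cells\<close> make room for the block table and one entry
  beyond it, for a queue that outgrows its roots by at most the budget, and for the links with the
  null cell and one header per bucket. The conditions on \<open>w\<close> exclude overflow in the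
  keys, in the loop condition of a query, where the budget is multiplied by a sum of two flags, and
  in the computation of the block sizes.\<close>

locale lsf = lsf_tree +
  fixes n B FU FQ DQ cells :: nat
  assumes B_pos: "1 \<le> B"
    and cells_blocks: "k * 2 ^ kap + 2 \<le> cells"
    and cells_FU: "FU + 2 ^ kap < cells" and cells_FQ: "FQ + 2 ^ kap < cells"
    and cells_links: "n * B + 2 ^ lt + 1 \<le> cells" and cells_k: "k \<le> cells"
    and cells_word: "8 * cells \<le> 2 ^ w" and cells_3: "3 \<le> cells"
    and key_word: "Suc k * 2 ^ l * (nfilters + 1) < 2 ^ w"
    and DQ_word: "2 * DQ < 2 ^ w" and A_word: "Suc k * A < 2 ^ w"
begin

definition const_regs :: "(reg \<Rightarrow> nat) \<Rightarrow> bool" where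
  "const_regs R \<longleftrightarrow> R 20 = k * 2 ^ kap \<and> R 21 = 2 ^ kap \<and> R 22 = l \<and> R 23 = l - kap \<and> R 24 = w - l \<and>
     R 25 = l - lt \<and> R 26 = k * 2 ^ l \<and> R 27 = nfilters \<and> R 28 = B \<and> R 29 = n * B + 1 \<and>
     R 30 = FU \<and> R 31 = FQ \<and> R 32 = DQ \<and> R 33 = k \<and> R 34 = bl \<and> R 35 = A \<and> R 36 = 2 ^ l \<and>
     R 37 = 2 ^ (l - kap)"

lemma const_regs_upd [simp]: "t < 20 \<Longrightarrow> const_regs (R(t := v)) \<longleftrightarrow> const_regs R"
  by (simp add: const_regs_def)

text \<open>The roots occupy the beginning of the queue permanently; an enumeration only writes
  behind them.\<close>

definition tables :: "(nat \<Rightarrow> nat) \<Rightarrow> (nat \<Rightarrow> nat \<Rightarrow> nat) \<Rightarrow> bool" where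
  "tables ws N \<longleftrightarrow> (\<forall>j<k. N 0 j = ws j) \<and> (\<forall>G\<le>k * 2 ^ kap. N 1 G = start G) \<and>
     (\<forall>t<2 ^ kap. N 4 t = t * 2 ^ (l - kap))"

lemma tables_upd [simp]:
  "m \<in> {2, 3, 5, 6, 7} \<Longrightarrow> tables ws (N(m := v)) \<longleftrightarrow> tables ws N"
  by (auto simp: tables_def)

lemma tables_upd_queue [simp]:
  "2 ^ kap \<le> c \<Longrightarrow> tables ws (N(4 := (N 4)(c := v))) \<longleftrightarrow> tables ws N"
  by (auto simp: tables_def)

lemma key_less:
  assumes "N < k * 2 ^ l" "i < nfilters"
  shows "N * nfilters + i < 2 ^ w"
proof -
  have "N * nfilters + i \<le> N * nfilters + nfilters" using assms by simp
  also have "\<dots> = (N + 1) * nfilters" by simp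
  also have "\<dots> \<le> (Suc k * 2 ^ l) * (nfilters + 1)" using assms by (intro mult_mono) auto
  finally show ?thesis using key_word by simp
qed

lemma node_less: "N < Suc k * 2 ^ l \<Longrightarrow> N < 2 ^ w"
proof -
  assume "N < Suc k * 2 ^ l"
  also have "\<dots> \<le> Suc k * 2 ^ l * (nfilters + 1)" by simp
  finally show ?thesis using key_word by simp
qed

lemma nfilters_less: "nfilters < 2 ^ w"
proof -
  have "1 * (nfilters + 1) \<le> Suc k * 2 ^ l * (nfilters + 1)" by (rule mult_right_mono) (simp_all add: Suc_le_eq)
  then show ?thesis using key_word by simp
qed

end

locale lsf_run = lsf + machine E cells point sl
  for E :: "'a env" and point sl +
  assumes word_size: "word_size E = w"
begin

text \<open>What an enumeration must preserve, including the links and the identifier in register 0.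
  The arrays 2, 3 and 5 and the queue behind the roots are its working space.\<close>

definition stable :: "nat \<Rightarrow> (nat \<Rightarrow> nat) \<Rightarrow> (nat \<Rightarrow> nat) \<Rightarrow> (reg \<Rightarrow> nat) \<Rightarrow> (nat \<Rightarrow> nat \<Rightarrow> nat) \<Rightarrow>
    nat \<Rightarrow> nat \<Rightarrow> nat \<Rightarrow> bool" where
  "stable r0 nx pv R N d f g \<longleftrightarrow> const_regs R \<and> tables (word_stream E) N \<and> N 6 = nx \<and> N 7 = pv \<and> d = 0 \<and>
     f = nfilters \<and> g = k \<and> R 0 = r0"

lemma stable_upd [simp]:
  "0 < t \<Longrightarrow> t < 20 \<Longrightarrow> stable r0 nx pv (R(t := v)) N d f g \<longleftrightarrow> stable r0 nx pv R N d f g"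
  "m \<in> {2, 3, 5} \<Longrightarrow> stable r0 nx pv R (N(m := u)) d f g \<longleftrightarrow> stable r0 nx pv R N d f g"
  "2 ^ kap \<le> c \<Longrightarrow> stable r0 nx pv R (N(4 := (N 4)(c := v))) d f g \<longleftrightarrow> stable r0 nx pv R N d f g"
  by (auto simp: stable_def)

definition offsets :: "(nat \<Rightarrow> bool) \<Rightarrow> nat \<Rightarrow> nat \<Rightarrow> (nat \<Rightarrow> nat \<Rightarrow> nat) \<Rightarrow> bool" where
  "offsets S G a N \<longleftrightarrow> (\<forall>t<length (filter S [0..<a]). N 3 t = filter S [0..<a] ! t) \<and>
     (\<forall>g\<le>G. N 2 g = length (filter S [0..<start g]))"

text \<open>\<open>e = R 7\<close> says that every filter passed so far has been evaluated exactly
  once. The balance \<open>m + R 5 + R 6 = F\<close> charges one iteration to each recorded hit and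
  one to each finished block.\<close>

definition scan_inv where
  "scan_inv S F r0 nx pv m R N d e f g \<longleftrightarrow> stable r0 nx pv R N d f g \<and>
     R 4 = m \<and> R 3 = of_bool (R 6 < k * 2 ^ kap) * m \<and> R 6 \<le> k * 2 ^ kap \<and>
     (R 6 < k * 2 ^ kap \<longrightarrow> start (R 6) \<le> R 7 \<and> R 7 \<le> start (Suc (R 6)) \<and> R 8 = start (Suc (R 6))) \<and>
     (R 6 = k * 2 ^ kap \<longrightarrow> R 7 = nfilters) \<and> e = R 7 \<and> R 7 \<le> nfilters \<and>
     R 5 = length (filter S [0..<R 7]) \<and> offsets S (R 6) (R 7) N \<and> m + R 5 + R 6 = F"

lemma vc_ScanR:
  assumes "point = Some y"
  shows "vc (ScanR z t a b) Q R N d e f g \<longleftrightarrow> R b \<le> f \<and>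
     (let j = scan_stop (\<lambda>i. y \<in> side_set z (filter_stream E i)) (R a) (R b) in
      Q (R(t := j)) N d (e + (min (Suc j) (R b) - R a)) f g)"
  by (subst vc.simps(13)) (auto simp: assms)

lemma scan_init:
  assumes "F + 2 ^ kap < cells"
  shows "runs (compile scan_init) (\<lambda>R N d e f g. stable r0 nx pv R N d f g \<and> e = 0 \<and> R 4 = F)
    (scan_inv S F r0 nx pv F) (cost scan_init)"
proof (rule runs_vc, elim conjE)
  fix R N d f g and e :: nat
  assume a: "stable r0 nx pv R N d f g" "e = 0" "R 4 = F"
  have w: "8 * cells \<le> 2 ^ w" "3 \<le> cells" using cells_word cells_3 by auto
  have c: "R 20 = k * 2 ^ kap" and t: "0 < k \<Longrightarrow> N 1 (Suc 0) = start (Suc 0)"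
    using a(1) by (auto simp: stable_def const_regs_def tables_def)
  have s0: "start 0 = 0" by (simp add: start_def)
  have n0: "k = 0 \<Longrightarrow> nfilters = 0" unfolding nfilters_def by (metis mult_0 s0)
  show "vc scan_init (scan_inv S F r0 nx pv F) R N d e f g"
    unfolding scan_init_def
    using a w c assms t n0
    by (auto simp: word_size scan_inv_def offsets_def s0)
qed

lemma scan_body:
  assumes F: "F + 2 ^ kap < cells" and y: "point = Some y"
    and S: "S = (\<lambda>i. y \<in> side_set z (filter_stream E i))"
  shows "runs (compile (scan_body z)) (\<lambda>R N d e f g. scan_inv S F r0 nx pv (Suc m) R N d e f g \<and> R 3 \<noteq> 0)
    (scan_inv S F r0 nx pv m) (cost (scan_body z))"
proof (rule runs_vc, elim conjE)
  fix R N d e f g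
  assume inv: "scan_inv S F r0 nx pv (Suc m) R N d e f g" and "R 3 \<noteq> 0"
  let ?KK = "k * 2 ^ kap"
  have st: "stable r0 nx pv R N d f g" and R4: "R 4 = Suc m" and G: "R 6 < ?KK"
    and a: "start (R 6) \<le> R 7" "R 7 \<le> start (Suc (R 6))" "R 8 = start (Suc (R 6))" "e = R 7"
    and R5: "R 5 = length (filter S [0..<R 7])" and off: "offsets S (R 6) (R 7) N"
    and sum: "Suc m + R 5 + R 6 = F"
    using inv \<open>R 3 \<noteq> 0\<close> by (auto simp: scan_inv_def)
  have w: "8 * cells \<le> 2 ^ w" "3 \<le> cells" using cells_word cells_3 by auto
  have c: "R 20 = ?KK" and f: "f = nfilters" and t: "\<And>G. G \<le> ?KK \<Longrightarrow> N 1 G = start G"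
    using st by (auto simp: stable_def const_regs_def tables_def)
  have e: "start (Suc (R 6)) \<le> nfilters" using G by (intro start_le) simp
  \<comment> \<open>On finishing the last block the body still loads the end of the following one.
    The address of this read must exist, which is the reason for the summand 2 in
    \<open>cells_blocks\<close>.\<close>
  have idx: "R 5 < cells" "R 6 + 3 \<le> cells" "Suc m < cells" using sum F G cells_blocks by auto
  define j where "j = scan_stop S (R 7) (R 8)"
  have ab: "R 7 \<le> R 8" using a by simp
  note j = scan_stop_props[OF ab, where P = S, folded j_def]
  have jd: "scan_stop S (R 7) (start (Suc (R 6))) = j" using a by (simp add: j_def)
  have nw: "nfilters < 2 ^ w" by (rule nfilters_less)
  show "vc (scan_body z) (scan_inv S F r0 nx pv m) R N d e f g"
  proof (cases "j < R 8")
    case True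
    have fil: "filter S [0..<Suc j] = filter S [0..<R 7] @ [j]"
      using filter_upt_none[of "R 7" j S] j True by simp
    have "offsets S (R 6) (Suc j) (N(3 := (N 3)(R 5 := j)))"
      using off R5 by (auto simp: offsets_def fil nth_append less_Suc_eq simp del: upt_Suc)
    moreover have "Suc j \<le> start (Suc (R 6))" "start (R 6) \<le> Suc j" using True a j by auto
    ultimately show ?thesis
      unfolding scan_body_def
      using True st R4 G a R5 sum w c f e idx ab j nw
      by (auto simp: word_size scan_inv_def vc_ScanR[OF y] S[symmetric] jd Let_def fil simp del: upt_Suc vc.simps(13))
  next
    case False
    then have jb: "j = R 8" using j by simp
    have fil: "filter S [0..<j] = filter S [0..<R 7]"
      using j by (intro filter_upt_none) auto
    have "offsets S (Suc (R 6)) j (N(2 := (N 2)(Suc (R 6) := R 5)))"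
      using off R5 jb a fil by (auto simp: offsets_def le_Suc_eq)
    moreover have "start (Suc (R 6)) \<le> start (Suc (Suc (R 6)))" by (rule start_mono) simp
    moreover have "Suc (R 6) = ?KK \<Longrightarrow> j = nfilters" using jb a by (simp add: nfilters_def)
    ultimately show ?thesis
      unfolding scan_body_def
      using False jb st R4 G a R5 sum w c f e idx ab j nw t fil
      by (auto simp: word_size scan_inv_def vc_ScanR[OF y] S[symmetric] jd Let_def simp del: vc.simps(13))
  qed
qed

text \<open>The second alternative records why a scan stopped early: hits and blocks alone exceed
  the budget, hence so does \<open>work\<close>, and no complete enumeration has been
  promised.\<close>

lemma scan_phase:
  assumes F: "F + 2 ^ kap < cells" and y: "point = Some y"
    and S: "S = (\<lambda>i. y \<in> side_set z (filter_stream E i))"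
  shows "runs (Seq (compile scan_init) (While 3 (compile (scan_body z))))
    (\<lambda>R N d e f g. stable r0 nx pv R N d f g \<and> e = 0 \<and> R 4 = F)
    (\<lambda>R N d e f g. stable r0 nx pv R N d f g \<and> e \<le> nfilters \<and>
       (offsets S (k * 2 ^ kap) nfilters N \<and>
          R 4 + length (filter S [0..<nfilters]) + k * 2 ^ kap = F \<or>
        R 4 = 0 \<and> F < length (filter S [0..<nfilters]) + k * 2 ^ kap))
    (cost scan_init + Suc (F * Suc (cost (scan_body z))))"
proof (rule runs_Seq[OF scan_init[OF F] runs_conseq[OF runs_While order_refl]])
  show "runs (compile (scan_body z)) (\<lambda>R N d e f g. scan_inv S F r0 nx pv (Suc m) R N d e f g \<and> R 3 \<noteq> 0)
    (scan_inv S F r0 nx pv m) (cost (scan_body z))" for m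
    using F y S by (rule scan_body)
  show "R 3 = 0" if "scan_inv S F r0 nx pv 0 R N d e f g" for R N d e f g
    using that by (simp add: scan_inv_def)
  show "stable r0 nx pv R N d f g \<and> e \<le> nfilters \<and>
       (offsets S (k * 2 ^ kap) nfilters N \<and>
          R 4 + length (filter S [0..<nfilters]) + k * 2 ^ kap = F \<or>
        R 4 = 0 \<and> F < length (filter S [0..<nfilters]) + k * 2 ^ kap)"
    if "(\<exists>m. scan_inv S F r0 nx pv m R N d e f g) \<and> R 3 = 0" for R N d e f g
  proof -
    from that obtain m where inv: "scan_inv S F r0 nx pv m R N d e f g" and R3: "R 3 = 0" by blast
    show ?thesis
    proof (cases "R 6 = k * 2 ^ kap")
      case True
      then show ?thesis using inv by (auto simp: scan_inv_def)
    next
      case False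
      then have "m = 0" "R 6 < k * 2 ^ kap" using inv R3 by (auto simp: scan_inv_def)
      moreover have "length (filter S [0..<R 7]) \<le> length (filter S [0..<nfilters])"
      proof -
        have "R 7 \<le> nfilters" using inv by (simp add: scan_inv_def)
        then have "[0..<nfilters] = [0..<R 7] @ [R 7..<nfilters]"
          using upt_add_eq_append[of 0 "R 7" "nfilters - R 7"] by simp
        then show ?thesis by simp
      qed
      ultimately show ?thesis using inv by (auto simp: scan_inv_def)
    qed
  qed
qed auto

text \<open>The queue followed by the pending children of the current node equals the roots followed
  by the children of all nodes read. An iteration either reads a node or writes a child, whence the
  balance \<open>m + R 10 + R 11 = F + 2 ^ kap\<close>, in which the roots count as written in
  advance. For \<open>m = 0\<close> nothing is claimed about the hit tables, because an exhausted
  scan may have left them incomplete.\<close>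

definition tree_inv where
  "tree_inv S F r0 nx pv m R N d e f g \<longleftrightarrow> stable r0 nx pv R N d f g \<and> e \<le> nfilters \<and> R 4 = m \<and>
     (m = 0 \<or> offsets S (k * 2 ^ kap) nfilters N \<and> length (filter S [0..<nfilters]) < cells) \<and>
     R 3 = (of_bool (R 10 < R 11) + of_bool (R 12 < R 13)) * m \<and> 2 ^ kap \<le> R 11 \<and> R 10 \<le> R 11 \<and>
     R 13 \<le> length (filter S [0..<nfilters]) \<and>
     (R 12 < R 13 \<longrightarrow> R 15 < k * 2 ^ l \<and> R 16 = word_stream E (R 15 div 2 ^ l) \<and>
        R 17 = (R 15 div 2 ^ l + 1) * 2 ^ l) \<and>
     map (N 4) [0..<R 11] @
       map (\<lambda>t. child (word_stream E) (R 15) (filter S [0..<nfilters] ! t)) [R 12..<R 13] =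
       roots @ concat (map (children S (word_stream E)) (take (R 10) (bfs S (word_stream E)))) \<and>
     R 10 \<le> length (bfs S (word_stream E)) \<and>
     map (N 5) [0..<R 14] =
       map bucket (filter (\<lambda>N. \<not> N < k * 2 ^ l) (take (R 10) (bfs S (word_stream E)))) \<and>
     m + R 10 + R 11 = F + 2 ^ kap"

lemma tree_init:
  assumes "F + 2 ^ kap < cells"
  shows "runs (compile tree_init)
    (\<lambda>R N d e f g. stable r0 nx pv R N d f g \<and> e \<le> nfilters \<and> R 4 = F \<and>
       (F = 0 \<or> offsets S (k * 2 ^ kap) nfilters N \<and> length (filter S [0..<nfilters]) < cells))
    (tree_inv S F r0 nx pv F) (cost tree_init)"
proof (rule runs_vc, elim conjE)
  fix R N d e f g
  assume a: "stable r0 nx pv R N d f g" "e \<le> nfilters" "R 4 = F"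
    "F = 0 \<or> offsets S (k * 2 ^ kap) nfilters N \<and> length (filter S [0..<nfilters]) < cells"
  have w: "8 * cells \<le> 2 ^ w" "3 \<le> cells" using cells_word cells_3 by auto
  have c: "R 21 = 2 ^ kap" and r: "map (N 4) [0..<2 ^ kap] = roots"
    using a(1) by (auto simp: stable_def const_regs_def tables_def roots_def)
  have F: "F < cells" "2 ^ kap < (2::nat) ^ w" using assms w by linarith+
  show "vc tree_init (tree_inv S F r0 nx pv F) R N d e f g"
    unfolding tree_init_def
    using a w c assms r F
    by (auto simp: word_size tree_inv_def)
qed

lemma tree_body:
  assumes F: "F + 2 ^ kap < cells"
  shows "runs (compile tree_body) (\<lambda>R N d e f g. tree_inv S F r0 nx pv (Suc m) R N d e f g \<and> R 3 \<noteq> 0)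
    (tree_inv S F r0 nx pv m) (cost tree_body)"
proof (rule runs_vc, elim conjE)
  fix R N d e f g
  assume inv: "tree_inv S F r0 nx pv (Suc m) R N d e f g" and R3: "R 3 \<noteq> 0"
  let ?KK = "k * 2 ^ kap" let ?ws = "word_stream E"
  define hits where "hits = filter S [0..<nfilters]"
  define bs where "bs = bfs S ?ws"
  let ?pend = "map (\<lambda>t. child ?ws (R 15) (hits ! t)) [R 12..<R 13]"
  have st: "stable r0 nx pv R N d f g" and e: "e \<le> nfilters" and R4: "R 4 = Suc m"
    and off: "offsets S ?KK nfilters N" and hc2: "length hits < cells" and K: "2 ^ kap \<le> R 11" and rw: "R 10 \<le> R 11"
    and R13: "R 13 \<le> length hits"
    and cur: "R 12 < R 13 \<Longrightarrow> R 15 < k * 2 ^ l \<and> R 16 = ?ws (R 15 div 2 ^ l) \<and>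
        R 17 = (R 15 div 2 ^ l + 1) * 2 ^ l"
    and eq: "map (N 4) [0..<R 11] @ ?pend = roots @ concat (map (children S ?ws) (take (R 10) bs))"
    and R10: "R 10 \<le> length bs"
    and lv: "map (N 5) [0..<R 14] = map bucket (filter (\<lambda>N. \<not> N < k * 2 ^ l) (take (R 10) bs))"
    and sum: "Suc m + R 10 + R 11 = F + 2 ^ kap"
    and or: "R 10 < R 11 \<or> R 12 < R 13"
    using inv R3 unfolding tree_inv_def hits_def[symmetric] bs_def[symmetric] by (auto split: if_splits)
  have w: "8 * cells \<le> 2 ^ w" "3 \<le> cells" using cells_word cells_3 by auto
  have c: "R 22 = l" "R 23 = l - kap" "R 24 = w - l" "R 25 = l - lt" "R 26 = k * 2 ^ l" "R 27 = nfilters"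
    "R 36 = 2 ^ l"
    and t0: "\<And>j. j < k \<Longrightarrow> N 0 j = ?ws j"
    using st by (auto simp: stable_def const_regs_def tables_def)
  have R14: "R 14 \<le> R 10"
  proof -
    have "length (map (N 5) [0..<R 14]) \<le> R 10" unfolding lv by (simp add: le_trans[OF length_filter_le])
    then show ?thesis by simp
  qed
  have idx: "R 10 < cells" "R 11 < cells" "R 14 < cells" "Suc m < cells"
    using sum F rw R14 by linarith+
  have w2: "R 10 + 2 < 2 ^ w" "R 11 + 2 < 2 ^ w" "R 14 + 2 < 2 ^ w" "2 * m + 2 < 2 ^ w" "2 < (2::nat) ^ w"
    using idx w by linarith+
  \<comment> \<open>This identifies the node at the read head with the node at the same position of
    the traversal.\<close>
  obtain ys where ys: "bs = (map (N 4) [0..<R 11] @ ?pend) @ ys"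
    using bfs_prefix[of S ?ws "R 10"] unfolding eq bs_def by blast
  have hits_len: "length hits \<le> nfilters" unfolding hits_def
    using length_filter_le[of S "[0..<nfilters]"] by simp
  show "vc tree_body (tree_inv S F r0 nx pv m) R N d e f g"
  proof (cases "R 12 < R 13")
    case True
    note cur = cur[OF True]
    define i where "i = hits ! R 12"
    have tl: "R 12 < length hits" using True R13 by simp
    have i: "i < nfilters" using nth_mem[OF tl] unfolding i_def hits_def by auto
    have hc: "N 3 (R 12) = i" using off tl by (simp add: offsets_def i_def hits_def)
    have tlc: "R 12 < cells" using tl hc2 by simp
    have up: "[R 12..<R 13] = R 12 # [Suc (R 12)..<R 13]" using True by (simp add: upt_conv_Cons)
    define ch where "ch = child ?ws (R 15) i"
    have eq': "map ((N 4)(R 11 := ch)) [0..<Suc (R 11)] @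
        map (\<lambda>t. child ?ws (R 15) (hits ! t)) [Suc (R 12)..<R 13] =
        roots @ concat (map (children S ?ws) (take (R 10) bs))"
      using eq unfolding up by (simp add: ch_def i_def)
    have chl: "ch < 2 ^ w" unfolding ch_def using child_less node_less cur by blast
    have chv: "ch = R 17 + (R 15 * nfilters + i) * R 16 mod 2 ^ w div 2 ^ (w - l)"
      unfolding ch_def child_def hash_def using cur by simp
    have key: "R 15 * nfilters + i < 2 ^ w" "R 15 * nfilters < 2 ^ w"
      using key_less[of "R 15" i] cur i by auto
    show ?thesis
      unfolding tree_body_def
      using True st e R4 c w2 w idx hc hc2 tlc key chl chv[symmetric] cur i off K rw R13 eq' R10 lv sum
      by (simp add: word_size tree_inv_def hits_def[symmetric] bs_def[symmetric] offsets_def del: upt_Suc)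
  next
    case False
    then have pend: "?pend = []" by simp
    have rl: "R 10 < R 11" using or False by simp
    define V where "V = N 4 (R 10)"
    have "bs ! R 10 = V" using rl unfolding ys pend V_def by (simp add: nth_append)
    moreover have rb: "R 10 < length bs" unfolding ys pend using rl by simp
    ultimately have tk: "take (Suc (R 10)) bs = take (R 10) bs @ [V]" by (simp add: take_Suc_conv_app_nth)
    have Vs: "V \<in> set bs" using nth_mem[OF rb] \<open>bs ! R 10 = V\<close> by simp
    then have Vw: "V < Suc k * 2 ^ l" "V < 2 ^ w" using bfs_less node_less unfolding bs_def by blast+
    have eq': "map (N 4) [0..<R 11] @ children S ?ws V =
        roots @ concat (map (children S ?ws) (take (Suc (R 10)) bs))"
      using eq unfolding tk pend by simp
    show ?thesis
    proof (cases "V < k * 2 ^ l")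
      case True
      let ?G = "block V" let ?j = "V div 2 ^ l"
      have G: "?G < ?KK" using True by (rule block_less)
      have j: "?j < k" using True by (simp add: less_mult_imp_div_less)
      have o: "N 2 ?G = length (filter S [0..<start ?G])" "N 2 (Suc ?G) = length (filter S [0..<start (Suc ?G)])"
        using off G by (auto simp: offsets_def)
      have sm: "start ?G \<le> start (Suc ?G)" "start (Suc ?G) \<le> nfilters"
        using G by (auto intro: start_mono start_le)
      have en: "N 2 (Suc ?G) \<le> length hits"
      proof -
        have "[0..<nfilters] = [0..<start (Suc ?G)] @ [start (Suc ?G)..<nfilters]"
          using sm upt_add_eq_append[of 0 "start (Suc ?G)" "nfilters - start (Suc ?G)"] by simp
        then show ?thesis unfolding o hits_def by simp
      qed
      \<comment> \<open>Loading two offsets makes all children of \<open>V\<close> pending at once;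
        they are written one per iteration.\<close>
      have ch: "children S ?ws V = map (\<lambda>t. child ?ws V (hits ! t)) [N 2 ?G..<N 2 (Suc ?G)]"
        using True slice_hits[OF sm, of S, symmetric] unfolding children_def o hits_def by simp
      have jl: "(?j + 1) * 2 ^ l < 2 ^ w"
      proof (rule node_less)
        have "(?j + 1) * 2 ^ l \<le> k * 2 ^ l" using j by (intro mult_right_mono) auto
        also have "\<dots> < Suc k * 2 ^ l" by simp
        finally show "(?j + 1) * 2 ^ l < Suc k * 2 ^ l" .
      qed
      have jc: "?j < cells" "?G + 2 < cells + 1" "?j + 2 < 2 ^ w" "?G + 2 < 2 ^ w"
        using j G cells_k cells_blocks w by linarith+
      have lv': "map (N 5) [0..<R 14] = map bucket (filter (\<lambda>N. \<not> N < k * 2 ^ l) (take (Suc (R 10)) bs))"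
        using lv True unfolding tk by simp
      show ?thesis
        unfolding tree_body_def
        using False True st e R4 c w2 w idx off hc2 K rw R13 eq'[unfolded ch] rb lv' sum Vw jl jc t0[OF j] j rl en
        by (simp add: word_size tree_inv_def hits_def[symmetric] bs_def[symmetric] V_def[symmetric]
           block_def[symmetric])
    next
      case leaf: False
      have lv': "map ((N 5)(R 14 := bucket V)) [0..<Suc (R 14)] =
         map bucket (filter (\<lambda>N. \<not> N < k * 2 ^ l) (take (Suc (R 10)) bs))"
        using lv leaf unfolding tk by simp
      have ch: "children S ?ws V = []" using leaf by (simp add: children_def)
      show ?thesis
        unfolding tree_body_def
        using False leaf st e R4 c w2 w idx off hc2 K rw R13 eq'[unfolded ch] rb lv' sum Vw rl
        by (simp add: word_size tree_inv_def hits_def[symmetric] bs_def[symmetric] V_def[symmetric]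
           bucket_def[symmetric] offsets_def)
    qed
  qed
qed

lemma tree_phase:
  assumes F: "F + 2 ^ kap < cells"
  shows "runs (Seq (compile tree_init) (While 3 (compile tree_body)))
    (\<lambda>R N d e f g. stable r0 nx pv R N d f g \<and> e \<le> nfilters \<and> R 4 = F \<and>
       (F = 0 \<or> offsets S (k * 2 ^ kap) nfilters N \<and> length (filter S [0..<nfilters]) < cells))
    (\<lambda>R N d e f g. stable r0 nx pv R N d f g \<and> e \<le> nfilters \<and> R 14 \<le> F \<and>
       map (N 5) [0..<R 14] = take (R 14) (leaves S (word_stream E)) \<and>
       R 14 \<le> length (leaves S (word_stream E)) \<and>
       (2 * length (bfs S (word_stream E)) \<le> F \<longrightarrow> R 14 = length (leaves S (word_stream E))))
    (cost tree_init + Suc (F * Suc (cost tree_body)))"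
proof (rule runs_Seq[OF tree_init[OF F] runs_conseq[OF runs_While order_refl]])
  show "runs (compile tree_body) (\<lambda>R N d e f g. tree_inv S F r0 nx pv (Suc m) R N d e f g \<and> R 3 \<noteq> 0)
    (tree_inv S F r0 nx pv m) (cost tree_body)" for m
    using F by (rule tree_body)
  show "R 3 = 0" if "tree_inv S F r0 nx pv 0 R N d e f g" for R N d e f g
    using that by (simp add: tree_inv_def)
  show "stable r0 nx pv R N d f g \<and> e \<le> nfilters \<and> R 14 \<le> F \<and>
       map (N 5) [0..<R 14] = take (R 14) (leaves S (word_stream E)) \<and>
       R 14 \<le> length (leaves S (word_stream E)) \<and>
       (2 * length (bfs S (word_stream E)) \<le> F \<longrightarrow> R 14 = length (leaves S (word_stream E)))"
    if "(\<exists>m. tree_inv S F r0 nx pv m R N d e f g) \<and> R 3 = 0" for R N d e f g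
  proof -
    let ?ws = "word_stream E"
    define bs where "bs = bfs S ?ws"
    from that obtain m where inv: "tree_inv S F r0 nx pv m R N d e f g" and R3: "R 3 = 0" by blast
    have st: "stable r0 nx pv R N d f g" and e: "e \<le> nfilters" and K: "2 ^ kap \<le> R 11" and rw: "R 10 \<le> R 11"
      and eq: "map (N 4) [0..<R 11] @ map (\<lambda>t. child ?ws (R 15) (filter S [0..<nfilters] ! t)) [R 12..<R 13] =
         roots @ concat (map (children S ?ws) (take (R 10) bs))"
      and R10: "R 10 \<le> length bs"
      and lv: "map (N 5) [0..<R 14] = map bucket (filter (\<lambda>N. \<not> N < k * 2 ^ l) (take (R 10) bs))"
      and sum: "m + R 10 + R 11 = F + 2 ^ kap"
      and stop: "m = 0 \<or> \<not> R 10 < R 11 \<and> \<not> R 12 < R 13"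
      using inv R3 unfolding tree_inv_def bs_def[symmetric] by (auto split: if_splits)
    define q where "q = length (filter (\<lambda>N. \<not> N < k * 2 ^ l) (take (R 10) bs))"
    have "length (map (N 5) [0..<R 14]) = q" unfolding lv q_def by simp
    then have R14: "R 14 = q" by simp
    have fb: "filter (\<lambda>N. \<not> N < k * 2 ^ l) bs = filter (\<lambda>N. \<not> N < k * 2 ^ l) (take (R 10) bs) @
      filter (\<lambda>N. \<not> N < k * 2 ^ l) (drop (R 10) bs)"
      by (simp flip: filter_append)
    then have lvs: "leaves S ?ws = map bucket (filter (\<lambda>N. \<not> N < k * 2 ^ l) (take (R 10) bs)) @
      map bucket (filter (\<lambda>N. \<not> N < k * 2 ^ l) (drop (R 10) bs))"
      unfolding leaves_def bs_def filter_leaf_bfs by simp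
    have 1: "map (N 5) [0..<R 14] = take (R 14) (leaves S ?ws)" "R 14 \<le> length (leaves S ?ws)"
      using lv unfolding R14 lvs by (simp_all add: q_def)
    have "q \<le> R 10" unfolding q_def by (simp add: le_trans[OF length_filter_le])
    then have 2: "R 14 \<le> F" using R14 sum K by simp
    have "R 14 = length (leaves S ?ws)" if len: "2 * length bs \<le> F"
    proof -
      have "length bs \<le> R 10"
      proof (cases "m = 0")
        \<comment> \<open>An exhausted budget is impossible here: reads and writes together number
          at most twice the traversal, which is less than \<open>F + 2 ^ kap\<close>.\<close>
        case True
        obtain ys where "bs = (map (N 4) [0..<R 11] @
            map (\<lambda>t. child ?ws (R 15) (filter S [0..<nfilters] ! t)) [R 12..<R 13]) @ ys"
          using bfs_prefix[of S ?ws "R 10"] unfolding eq bs_def by blast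
        from arg_cong[OF this, of length] have "R 11 \<le> length bs" by simp
        moreover have "(0::nat) < 2 ^ kap" by simp
        ultimately show ?thesis using True sum len R10 by linarith
      next
        case False
        then have "R 10 = R 11" "\<not> R 12 < R 13" using stop rw by auto
        then have "length (roots @ concat (map (children S ?ws) (take (R 10) bs))) \<le> R 10"
          unfolding eq[symmetric] by simp
        then show ?thesis unfolding bs_def by (rule bfs_closed)
      qed
      then show ?thesis unfolding R14 lvs q_def by simp
    qed
    with 1 2 st e show ?thesis unfolding bs_def by blast
  qed
qed auto

text \<open>A prefix of the leaves in any event, and all of them if the budget suffices. In this way
  the probabilistic part only has to bound \<open>work\<close>.\<close>

definition enumerated :: "(nat \<Rightarrow> bool) \<Rightarrow> nat \<Rightarrow> (reg \<Rightarrow> nat) \<Rightarrow> (nat \<Rightarrow> nat \<Rightarrow> nat) \<Rightarrow> bool" where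
  "enumerated S F R N \<longleftrightarrow> R 14 \<le> F \<and> map (N 5) [0..<R 14] = take (R 14) (leaves S (word_stream E)) \<and>
     R 14 \<le> length (leaves S (word_stream E)) \<and>
     (work S (word_stream E) \<le> F \<longrightarrow> R 14 = length (leaves S (word_stream E)))"

definition enumerate_cost :: "nat \<Rightarrow> nat" where
  "enumerate_cost F = cost scan_init + cost tree_init + 2 +
     F * (Suc (cost (scan_body QuerySide)) + Suc (cost tree_body))"

lemma enumerate_code:
  assumes F: "F + 2 ^ kap < cells" and y: "point = Some y"
    and S: "S = (\<lambda>i. y \<in> side_set z (filter_stream E i))"
  shows "runs (enumerate_code z)
    (\<lambda>R N d e f g. stable r0 nx pv R N d f g \<and> e = 0 \<and> R 4 = F)
    (\<lambda>R N d e f g. stable r0 nx pv R N d f g \<and> e \<le> nfilters \<and> enumerated S F R N)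
    (enumerate_cost F)"
proof -
  let ?h = "length (filter S [0..<nfilters])"
  let ?mid = "\<lambda>R N d e f g. stable r0 nx pv R N d f g \<and> e \<le> nfilters \<and>
       (offsets S (k * 2 ^ kap) nfilters N \<and> R 4 + ?h + k * 2 ^ kap = F \<or>
        R 4 = 0 \<and> F < ?h + k * 2 ^ kap)"
  have "runs (Seq (compile tree_init) (While 3 (compile tree_body))) ?mid
    (\<lambda>R N d e f g. stable r0 nx pv R N d f g \<and> e \<le> nfilters \<and> enumerated S F R N)
    (cost tree_init + Suc (F * Suc (cost tree_body)))"
    unfolding runs_def
  proof (intro allI impI)
    fix s assume s: "holds ?mid s"
    \<comment> \<open>How much of the budget the scan leaves depends on the filters, so the
      traversal is verified for the amount found in register 4.\<close>
    define F' where "F' = regs s 4"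
    have F': "F' \<le> F" using s by (auto simp: holds_def F'_def)
    then have "F' + 2 ^ kap < cells" using F by simp
    note run = tree_phase[OF this, of r0 nx pv S]
    have "holds (\<lambda>R N d e f g. stable r0 nx pv R N d f g \<and> e \<le> nfilters \<and> R 4 = F' \<and>
       (F' = 0 \<or> offsets S (k * 2 ^ kap) nfilters N \<and> length (filter S [0..<nfilters]) < cells)) s"
      using s F by (auto simp: holds_def F'_def)
    with run obtain s' where ex: "exec E (Seq (compile tree_init) (While 3 (compile tree_body))) s s'"
      and h: "holds (\<lambda>R N d e f g. stable r0 nx pv R N d f g \<and> e \<le> nfilters \<and> R 14 \<le> F' \<and>
       map (N 5) [0..<R 14] = take (R 14) (leaves S (word_stream E)) \<and>
       R 14 \<le> length (leaves S (word_stream E)) \<and>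
       (2 * length (bfs S (word_stream E)) \<le> F' \<longrightarrow> R 14 = length (leaves S (word_stream E)))) s'"
      and o: "ops s' \<le> ops s + (cost tree_init + Suc (F' * Suc (cost tree_body)))"
      unfolding runs_def by meson
    have wk: "work S (word_stream E) \<le> F \<Longrightarrow> 2 * length (bfs S (word_stream E)) \<le> F'"
      using s by (auto simp: holds_def F'_def work_def)
    have "holds (\<lambda>R N d e f g. stable r0 nx pv R N d f g \<and> e \<le> nfilters \<and> enumerated S F R N) s'"
      using h wk F' by (auto simp: holds_def enumerated_def)
    moreover have "ops s' \<le> ops s + (cost tree_init + Suc (F * Suc (cost tree_body)))"
      using o mult_right_mono[OF F', of "Suc (cost tree_body)"] by linarith
    ultimately show "\<exists>s'. exec E (Seq (compile tree_init) (While 3 (compile tree_body))) s s' \<and>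
      holds (\<lambda>R N d e f g. stable r0 nx pv R N d f g \<and> e \<le> nfilters \<and> enumerated S F R N) s' \<and>
      ops s' \<le> ops s + (cost tree_init + Suc (F * Suc (cost tree_body)))" using ex by blast
  qed
  from runs_Seq[OF scan_phase[OF F y S, of r0 nx pv] this] show ?thesis
    unfolding enumerate_code_def
    by (rule runs_conseq) (auto simp: enumerate_cost_def scan_body_def algebra_simps)
qed

end

section \<open>Bucket lists\<close>

text \<open>\<open>p\<close> does not belong to the segment: it is the header cell or the preceding
  element. Insertion at the front and removal then need no case distinction on the position.\<close>

primrec lseg :: "(nat \<Rightarrow> nat) \<Rightarrow> (nat \<Rightarrow> nat) \<Rightarrow> nat \<Rightarrow> nat list \<Rightarrow> nat \<Rightarrow> bool" where
  "lseg nx pv p [] q \<longleftrightarrow> nx p = q"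
| "lseg nx pv p (e # es) q \<longleftrightarrow> nx p = e \<and> pv e = p \<and> lseg nx pv e es q"

lemma lseg_cong:
  "(\<And>c. c \<in> insert p (set xs) \<Longrightarrow> nx c = nx' c) \<Longrightarrow> (\<And>c. c \<in> set xs \<Longrightarrow> pv c = pv' c) \<Longrightarrow>
   lseg nx pv p xs q \<longleftrightarrow> lseg nx' pv' p xs q"
  by (induction xs arbitrary: p) auto

lemma lseg_append:
  "lseg nx pv p (xs @ e # ys) q \<longleftrightarrow> lseg nx pv p xs e \<and> pv e = last (p # xs) \<and> lseg nx pv e ys q"
  by (induction xs arbitrary: p) auto

lemma lseg_redirect:
  "distinct (p # xs) \<Longrightarrow> lseg nx pv p xs q \<Longrightarrow> lseg (nx(last (p # xs) := q')) pv p xs q'"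
proof (induction xs arbitrary: p)
  case (Cons e es)
  then have "last (e # es) \<noteq> p" by (metis distinct.simps(2) last_in_set list.distinct(1))
  with Cons show ?case by auto
qed auto

context lsf
begin

text \<open>Cell 0 is the null pointer and carries no constraint; the headers of the buckets follow
  the \<open>n * B\<close> element cells. Free element cells have null links, so that unlinking them
  is harmless.\<close>

definition links :: "(nat \<Rightarrow> nat list) \<Rightarrow> (nat \<Rightarrow> nat) \<Rightarrow> (nat \<Rightarrow> nat) \<Rightarrow> (nat \<Rightarrow> nat option) \<Rightarrow> bool" where
  "links L nx pv bk \<longleftrightarrow>
     (\<forall>h<2 ^ lt. lseg nx pv (n * B + 1 + h) (L h) 0 \<and> distinct (L h) \<and> set (L h) = {e. bk e = Some h}) \<and>
     (\<forall>e h. bk e = Some h \<longrightarrow> h < 2 ^ lt \<and> 1 \<le> e \<and> e \<le> n * B) \<and>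
     (\<forall>e. 1 \<le> e \<and> e \<le> n * B \<and> bk e = None \<longrightarrow> nx e = 0 \<and> pv e = 0)"

lemma links_head_le:
  assumes "links L nx pv bk" "h < 2 ^ lt"
  shows "nx (n * B + 1 + h) \<le> n * B"
proof -
  have "lseg nx pv (n * B + 1 + h) (L h) 0" "set (L h) = {e. bk e = Some h}"
    and bk: "\<And>e h. bk e = Some h \<Longrightarrow> e \<le> n * B"
    using assms unfolding links_def by blast+
  then show ?thesis by (cases "L h") auto
qed

text \<open>The predecessor of \<open>q\<close> is overwritten unconditionally: if the list was
  empty, \<open>q\<close> is 0 and the null cell absorbs the write.\<close>

lemma links_insert:
  assumes li: "links L nx pv bk" and h: "h < 2 ^ lt" and e: "1 \<le> e" "e \<le> n * B" "bk e = None"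
    and hc: "hc = n * B + 1 + h" and q: "q = nx hc"
  shows "links (L(h := e # L h)) (nx(e := q, hc := e)) (pv(e := hc, q := e)) (bk(e := Some h))"
proof -
  let ?nx = "nx(e := q, hc := e)" let ?pv = "pv(e := hc, q := e)"
  have L: "lseg nx pv (n * B + 1 + h') (L h') 0" "distinct (L h')" "set (L h') = {e. bk e = Some h'}"
    if "h' < 2 ^ lt" for h' using li that unfolding links_def by blast+
  have bk: "h < 2 ^ lt" "1 \<le> e" "e \<le> n * B" if "bk e = Some h" for e h
    using li that unfolding links_def by blast+
  have free: "nx e = 0" "pv e = 0" if "1 \<le> e" "e \<le> n * B" "bk e = None" for e
    using li that unfolding links_def by blast+
  have e_hd: "e \<noteq> hc" using e hc by simp
  have q': "q = (case L h of [] \<Rightarrow> 0 | x # _ \<Rightarrow> x)"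
    using L(1)[OF h] q hc by (cases "L h") auto
  have q_bk: "q \<noteq> 0 \<Longrightarrow> bk q = Some h" using L(3)[OF h] q' by (cases "L h") auto
  then have qe: "q \<noteq> e" using e by auto
  have "lseg ?nx ?pv hc (e # L h) 0"
  proof (cases "L h")
    case Nil
    then show ?thesis using e_hd qe q' by simp
  next
    case (Cons x xs)
    then have x: "q = x" using q' by simp
    have "lseg nx pv x xs 0" using L(1)[OF h] Cons by simp
    moreover have "x \<notin> set xs" "e \<notin> set (L h)" "hc \<notin> set (L h)"
      using L(2,3)[OF h] Cons e bk hc by (auto dest: bk)
    ultimately have "lseg ?nx ?pv x xs 0"
      using Cons x by (subst lseg_cong[where nx' = nx and pv' = pv]) auto
    then show ?thesis using Cons x e_hd qe by simp
  qed
  moreover have "lseg ?nx ?pv (n * B + 1 + h') (L h') 0" if h': "h' < 2 ^ lt" "h' \<noteq> h" for h'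
  proof -
    have "bk 0 \<noteq> Some h'" using bk(2)[of 0 h'] by auto
    then have "bk q \<noteq> Some h'" using q_bk h' by (cases "q = 0") auto
    then have "e \<notin> set (L h')" "hc \<notin> set (L h')" "q \<notin> set (L h')"
      using L(3)[OF h'(1)] e bk hc by (auto dest: bk)
    then show ?thesis using L(1)[OF h'(1)] h' e hc
      by (subst lseg_cong[where nx' = nx and pv' = pv]) auto
  qed
  moreover have "distinct (e # L h)" using L(2,3)[OF h] e by simp
  moreover have "?nx e' = 0 \<and> ?pv e' = 0" if "1 \<le> e'" "e' \<le> n * B" "(bk(e := Some h)) e' = None" for e'
    using that free hc q_bk by (auto split: if_splits)
  ultimately show ?thesis
    unfolding links_def using L bk h e hc by (auto split: if_splits)
qed

text \<open>Occupied and free cells are treated alike, since for a free cell \<open>p\<close> and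
  \<open>q\<close> are 0 and the null cell absorbs both writes. A deletion can thus sweep over all
  \<open>B\<close> cells of an identifier without knowing how many of them are linked.\<close>

lemma links_remove:
  assumes li: "links L nx pv bk" and e: "1 \<le> e" "e \<le> n * B"
    and p: "p = pv e" and q: "q = nx e"
  shows "\<exists>L. links L (nx(p := q, e := 0)) (pv(q := p, e := 0)) (bk(e := None))"
    and "p < n * B + 1 + 2 ^ lt" "q \<le> n * B"
proof -
  let ?nx = "nx(p := q, e := 0)" let ?pv = "pv(q := p, e := 0)"
  have L: "lseg nx pv (n * B + 1 + h') (L h') 0" "distinct (L h')" "set (L h') = {e. bk e = Some h'}"
    if "h' < 2 ^ lt" for h' using li that unfolding links_def by blast+
  have bk: "h < 2 ^ lt" "1 \<le> e" "e \<le> n * B" if "bk e = Some h" for e h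
    using li that unfolding links_def by blast+
  have free: "nx e = 0" "pv e = 0" if "1 \<le> e" "e \<le> n * B" "bk e = None" for e
    using li that unfolding links_def by blast+
  have "(\<exists>L. links L ?nx ?pv (bk(e := None))) \<and> p < n * B + 1 + 2 ^ lt \<and> q \<le> n * B"
  proof (cases "bk e")
    case None
    then have pq: "p = 0" "q = 0" using free e p q by auto
    have "lseg ?nx ?pv (n * B + 1 + h) (L h) 0" if h: "h < 2 ^ lt" for h
    proof -
      have "e \<notin> set (L h)" "0 \<notin> set (L h)" using L(3)[OF h] None bk by fastforce+
      then show ?thesis using L(1)[OF h] pq e
        by (subst lseg_cong[where nx' = nx and pv' = pv]) auto
    qed
    then have "links L ?nx ?pv (bk(e := None))"
      unfolding links_def using L bk free None pq by (auto simp: fun_upd_idem[of bk])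
    then show ?thesis using pq by auto
  next
    case (Some h)
    then have h: "h < 2 ^ lt" by (rule bk)
    let ?hc = "n * B + 1 + h"
    have "e \<in> set (L h)" using L(3)[OF h] Some by simp
    then obtain xs ys where Lh: "L h = xs @ e # ys" by (meson split_list)
    have d: "distinct (xs @ e # ys)" using L(2)[OF h] Lh by simp
    have in_h: "bk c = Some h" if "c \<in> set xs \<or> c \<in> set ys" for c using L(3)[OF h] Lh that by auto
    have le: "1 \<le> c \<and> c \<le> n * B" if "c \<in> set xs \<or> c \<in> set ys" for c using bk[OF in_h[OF that]] by simp
    have seg: "lseg nx pv ?hc xs e" "pv e = last (?hc # xs)" "lseg nx pv e ys 0"
      using L(1)[OF h] unfolding Lh lseg_append by auto
    have p': "p = last (?hc # xs)" using seg p by simp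
    have p_in: "p = ?hc \<or> p \<in> set xs" using p' by (cases xs rule: rev_cases) auto
    have q': "q = (case ys of [] \<Rightarrow> 0 | y # _ \<Rightarrow> y)" using seg(3) q by (cases ys) auto
    have q_in: "q = 0 \<or> q \<in> set ys" using q' by (cases ys) auto
    have pe: "p \<noteq> e" using p_in e d by auto
    have qe: "q \<noteq> e" using q_in e d by auto
    have hdx: "distinct (?hc # xs)" using d le by fastforce
    have s1: "lseg ?nx ?pv ?hc xs q"
    proof -
      have "lseg (nx(p := q)) pv ?hc xs q" unfolding p' using hdx seg(1) by (rule lseg_redirect)
      moreover have "e \<notin> insert ?hc (set xs)" "q \<notin> set xs"
        using d e q_in le by auto
      ultimately show ?thesis by (subst lseg_cong[where nx' = "nx(p := q)" and pv' = pv]) auto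
    qed
    have main: "lseg ?nx ?pv ?hc (xs @ ys) 0"
    proof (cases ys)
      case Nil
      then show ?thesis using s1 q' by simp
    next
      case (Cons y ys')
      then have y: "q = y" using q' by simp
      have "lseg nx pv y ys' 0" using seg(3) Cons by simp
      moreover have "p \<notin> set ys" using p_in d le Cons by fastforce
      moreover have "e \<notin> set ys" "y \<notin> set ys'" using d Cons by auto
      ultimately have "lseg ?nx ?pv y ys' 0" using Cons y
        by (subst lseg_cong[where nx' = nx and pv' = pv]) auto
      then show ?thesis using s1 y p' qe unfolding Cons lseg_append by simp
    qed
    have other: "lseg ?nx ?pv (n * B + 1 + h') (L h') 0" if h': "h' < 2 ^ lt" "h' \<noteq> h" for h'
    proof -
      have "c \<notin> set (L h')" if "bk c = Some h \<or> c = 0 \<or> c > n * B" for c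
        using L(3)[OF h'(1)] h' bk that by fastforce
      then have "e \<notin> set (L h')" "p \<notin> set (L h')" "q \<notin> set (L h')"
        using Some p_in q_in in_h by auto
      moreover have "p \<noteq> n * B + 1 + h'" using p_in h' le by fastforce
      ultimately show ?thesis using L(1)[OF h'(1)] e
        by (subst lseg_cong[where nx' = nx and pv' = pv]) auto
    qed
    have "links (L(h := xs @ ys)) ?nx ?pv (bk(e := None))"
      unfolding links_def
    proof (intro conjI allI impI)
      fix h' :: nat assume h': "h' < 2 ^ lt"
      show "lseg ?nx ?pv (n * B + 1 + h') ((L(h := xs @ ys)) h') 0"
        using main other h' by auto
      show "distinct ((L(h := xs @ ys)) h')" using d L(2)[OF h'] by auto
      show "set ((L(h := xs @ ys)) h') = {e'. (bk(e := None)) e' = Some h'}"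
      proof (cases "h' = h")
        case True
        have "set (xs @ ys) = set (L h) - {e}" using d Lh by auto
        then show ?thesis using True L(3)[OF h] by auto
      next
        case False
        then show ?thesis using L(3)[OF h'] Some by auto
      qed
    next
      fix e' h' assume "(bk(e := None)) e' = Some h'"
      then show "h' < 2 ^ lt" "1 \<le> e'" "e' \<le> n * B" using bk[of e' h'] by (auto split: if_splits)
    next
      fix e' assume a: "1 \<le> e' \<and> e' \<le> n * B \<and> (bk(e := None)) e' = None"
      have "e' = e \<or> bk e' = None \<and> e' \<noteq> p \<and> e' \<noteq> q"
        using a p_in q_in in_h by (auto split: if_splits)
      then show "?nx e' = 0" "?pv e' = 0" using a free[of e'] by auto
    qed
    moreover have "p \<le> n * B + 1 + h" using p_in le[of p] by auto
    moreover have "q \<le> n * B" using q_in le[of q] by auto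
    ultimately show ?thesis using h by (intro conjI exI) auto
  qed
  then show "\<exists>L. links L ?nx ?pv (bk(e := None))" "p < n * B + 1 + 2 ^ lt" "q \<le> n * B" by auto
qed

text \<open>Identifier \<open>i\<close> owns the \<open>B\<close> cells from
  \<open>i * B + 1\<close> on, one for each leaf that is kept. The identifier of an element found in
  a bucket is recovered by a division.\<close>

definition entries :: "(nat \<Rightarrow> nat list) \<Rightarrow> nat \<Rightarrow> nat option" where
  "entries lvs e = (if 1 \<le> e \<and> e \<le> n * B \<and> (e - 1) mod B < length (lvs ((e - 1) div B))
     then Some (lvs ((e - 1) div B) ! ((e - 1) mod B)) else None)"

lemma cell_decomp:
  assumes "t < B"
  shows "(i * B + 1 + t - 1) div B = i" "(i * B + 1 + t - 1) mod B = t"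
  using assms by auto

lemma cell_range: "i < n \<Longrightarrow> t < B \<Longrightarrow> 1 \<le> i * B + 1 + t \<and> i * B + 1 + t \<le> n * B"
proof -
  assume "i < n" "t < B"
  then have "i * B + 1 + t \<le> i * B + B" by simp
  also have "\<dots> = Suc i * B" by simp
  also have "\<dots> \<le> n * B" using \<open>i < n\<close> by (intro mult_right_mono) auto
  finally show ?thesis by simp
qed

lemma cell_block: "1 \<le> e \<Longrightarrow> (e - 1) div B = i \<longleftrightarrow> i * B + 1 \<le> e \<and> e < i * B + 1 + B"
proof -
  assume "1 \<le> e"
  have "(e - 1) div B = i \<longleftrightarrow> i * B \<le> e - 1 \<and> e - 1 < Suc i * B"
    using B_pos by (auto simp: div_nat_eqI less_eq_div_iff_mult_less_eq dividend_less_times_div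
       div_less_iff_less_mult[symmetric] mult.commute)
  also have "\<dots> \<longleftrightarrow> i * B \<le> e - 1 \<and> e - 1 < i * B + B" by (simp add: add.commute)
  also have "\<dots> \<longleftrightarrow> i * B + 1 \<le> e \<and> e < i * B + 1 + B" using \<open>1 \<le> e\<close> by linarith
  finally show ?thesis .
qed

lemma entries_step:
  assumes "i < n" "t < B" "t < length lv"
  shows "entries (lvs(i := take (Suc t) lv)) = (entries (lvs(i := take t lv)))(i * B + 1 + t := Some (lv ! t))"
proof
  fix e
  show "entries (lvs(i := take (Suc t) lv)) e = ((entries (lvs(i := take t lv)))(i * B + 1 + t := Some (lv ! t))) e"
  proof (cases "e = i * B + 1 + t")
    case True
    then show ?thesis using assms cell_decomp[OF assms(2), of i] cell_range[OF assms(1,2)]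
      by (simp add: entries_def)
  next
    case False
    have "(e - 1) mod B \<noteq> t" if "1 \<le> e" "(e - 1) div B = i"
    proof
      assume "(e - 1) mod B = t"
      then have "e - 1 = i * B + t" using that(2) by (metis div_mult_mod_eq)
      then show False using False that(1) by simp
    qed
    then show ?thesis using False assms by (auto simp: entries_def nth_append less_Suc_eq)
  qed
qed

lemma entries_fresh:
  assumes "t < B"
  shows "entries (lvs(i := take t lv)) (i * B + 1 + t) = None"
  using cell_decomp[OF assms, of i] by (simp add: entries_def)

lemma entries_removed:
  assumes "i < n"
  shows "(\<lambda>e. if i * B + 1 \<le> e \<and> e < i * B + 1 + B then None else entries lvs e) = entries (lvs(i := []))"
proof
  fix e
  show "(if i * B + 1 \<le> e \<and> e < i * B + 1 + B then None else entries lvs e) = entries (lvs(i := [])) e"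
    using cell_block[of e i] by (auto simp: entries_def)
qed

lemma bucket_less: "N \<in> set (front S ws k) \<Longrightarrow> bucket N < 2 ^ lt"
proof -
  assume "N \<in> set (front S ws k)"
  then have d: "N div 2 ^ l = k" by (rule front_level)
  have "N < Suc (N div 2 ^ l) * 2 ^ l" using dividend_less_div_times[of "2 ^ l" N] by simp
  moreover have "N div 2 ^ l * 2 ^ l \<le> N" by simp
  ultimately have "N - k * 2 ^ l < 2 ^ l" unfolding d by (simp add: less_diff_conv2 add.commute)
  also have "(2::nat) ^ l = 2 ^ lt * 2 ^ (l - lt)" using lt_le by (simp flip: power_add)
  finally show ?thesis unfolding bucket_def by (simp add: less_mult_imp_div_less)
qed

lemma leaves_less: "h \<in> set (leaves S ws) \<Longrightarrow> h < 2 ^ lt"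
  by (auto simp: leaves_def bucket_less)

end

section \<open>Updates and queries\<close>

definition link_init :: cmd where
  "link_init = MulR 5 0 28 ;; AddI 5 5 1 ;; SetC 6 0 ;; LessR 3 6 14 ;; LessR 7 6 28 ;; MulR 3 3 7"

definition link_body :: cmd where
  "link_body = LoadC 7 5 6 ;; AddR 7 29 7 ;; LoadC 8 6 7 ;; StoreC 6 5 8 ;; StoreC 7 5 7 ;;
     StoreC 6 7 5 ;; StoreC 7 8 5 ;; AddI 5 5 1 ;; AddI 6 6 1 ;; LessR 3 6 14 ;; LessR 9 6 28 ;; MulR 3 3 9"

definition unlink_init :: cmd where
  "unlink_init = MulR 5 0 28 ;; AddI 5 5 1 ;; SetC 6 0 ;; LessR 3 6 28"

definition unlink_body :: cmd where
  "unlink_body = LoadC 7 7 5 ;; LoadC 8 6 5 ;; StoreC 6 7 8 ;; StoreC 7 8 7 ;; SetC 9 0 ;; StoreC 6 5 9 ;;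
     StoreC 7 5 9 ;; AddI 5 5 1 ;; AddI 6 6 1 ;; LessR 3 6 28"

definition walk_init :: cmd where
  "walk_init = SetC 6 0 ;; SetC 5 0 ;; SetC 0 0 ;; AddI 4 32 0 ;; LessR 3 6 14 ;; MulR 3 3 4"

text \<open>A comparison of points spends budget, opening the next bucket does not. An answer clears
  the budget in register 4, which ends the loop.\<close>

definition walk_body :: cmd where
  "walk_body = IfC 5
       (SubI 7 5 1 ;; DivR 7 7 28 ;; NearR 8 7 ;; SubI 4 4 1 ;;
        IfC 8 (AddI 0 7 1 ;; SetC 4 0) (LoadC 5 6 5))
       (LoadC 7 5 6 ;; AddI 6 6 1 ;; AddR 7 29 7 ;; LoadC 5 6 7) ;;
     SetC 9 0 ;; LessR 3 6 14 ;; LessR 9 9 5 ;; AddR 3 3 9 ;; MulR 3 3 4"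

definition lsf_insert :: com where
  "lsf_insert = Seq (compile (AddI 4 30 0)) (Seq (enumerate_code UpdateSide)
     (Seq (compile link_init) (While 3 (compile link_body))))"

text \<open>The cells of an identifier are contiguous, so a deletion consults neither the filters
  nor the tree.\<close>

definition lsf_delete :: com where
  "lsf_delete = Seq (compile unlink_init) (While 3 (compile unlink_body))"

definition lsf_query :: com where
  "lsf_query = Seq (compile (AddI 4 31 0)) (Seq (enumerate_code QuerySide)
     (Seq (compile walk_init) (While 3 (compile walk_body))))"

context machine
begin

text \<open>Fixes a value that is hidden in a precondition, such as the current lists, so that a
  loop can be verified for this value.\<close>

lemma runs_ex: "(\<And>a. runs c (P a) Q t) \<Longrightarrow> runs c (\<lambda>R N d e f g. \<exists>a. P a R N d e f g) Q t"
  unfolding runs_def holds_def by blast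

lemma runs_pure: "(A \<Longrightarrow> runs c P Q t) \<Longrightarrow> runs c (\<lambda>R N d e f g. A \<and> P R N d e f g) Q t"
  unfolding runs_def holds_def by blast

end

context lsf_run
begin

text \<open>The invariant between operations; \<open>lvs i\<close> lists the buckets under which
  identifier \<open>i\<close> is filed.\<close>

definition idle :: "(reg \<Rightarrow> nat) \<Rightarrow> (nat \<Rightarrow> nat \<Rightarrow> nat) \<Rightarrow> nat \<Rightarrow> nat \<Rightarrow> (nat \<Rightarrow> nat list) \<Rightarrow> bool" where
  "idle R N f g lvs \<longleftrightarrow> const_regs R \<and> tables (word_stream E) N \<and> f = nfilters \<and> g = k \<and>
     (\<exists>L. links L (N 6) (N 7) (entries lvs))"

lemma enumerated_upd [simp]:
  "t \<noteq> 14 \<Longrightarrow> enumerated S F (R(t := v)) N \<longleftrightarrow> enumerated S F R N"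
  "m \<noteq> 5 \<Longrightarrow> enumerated S F R (N(m := u)) \<longleftrightarrow> enumerated S F R N"
  by (simp_all add: enumerated_def)

definition link_inv where
  "link_inv S lvs i m R N d e f g \<longleftrightarrow> idle R N f g (lvs(i := take (R 6) (leaves S (word_stream E)))) \<and>
     d = (0::nat) \<and> e \<le> nfilters \<and> enumerated S FU R N \<and> R 5 = i * B + 1 + R 6 \<and>
     R 3 = of_bool (R 6 < R 14) * of_bool (R 6 < B) \<and> R 6 + m = min (R 14) B"

lemma const_regs_29: "const_regs R \<Longrightarrow> R 29 = n * B + 1 \<and> R 28 = B \<and> R 30 = FU \<and> R 31 = FQ \<and> R 32 = DQ"
  by (simp add: const_regs_def)

lemma link_init:
  assumes i: "i < n" and lvs: "lvs i = []" and L: "links L nx pv (entries lvs)"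
  shows "runs (compile link_init)
    (\<lambda>R N d e f g. stable i nx pv R N d f g \<and> e \<le> nfilters \<and> enumerated S FU R N)
    (\<lambda>R N d e f g. \<exists>m. m \<le> B \<and> link_inv S lvs i m R N d e f g) (cost link_init)"
proof (rule runs_vc, elim conjE)
  fix R N d e f g
  assume a: "stable i nx pv R N d f g" "e \<le> nfilters" "enumerated S FU R N"
  have w: "8 * cells \<le> 2 ^ w" "3 \<le> cells" using cells_word cells_3 by auto
  have c: "const_regs R" "R 28 = B" "R 0 = i" using a(1) const_regs_29 by (auto simp: stable_def)
  have "i * B \<le> n * B" using i by simp
  then have b: "i * B + 1 < 2 ^ w" using cells_links w by linarith
  have upd: "lvs(i := []) = lvs" using lvs by auto
  have id: "idle R N f g lvs" using a(1) L by (auto simp: stable_def idle_def)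
  have cr: "const_regs (R(1 := u, 3 := v, 5 := x, 6 := y, 7 := z))" for u v x y z using c(1) by simp
  show "vc link_init (\<lambda>R N d e f g. \<exists>m. m \<le> B \<and> link_inv S lvs i m R N d e f g) R N d e f g"
    unfolding link_init_def
    using a w c b id B_pos
    by (auto simp: word_size link_inv_def idle_def upd enumerated_def stable_def)
qed

lemma link_body:
  assumes i: "i < n"
  shows "runs (compile link_body) (\<lambda>R N d e f g. link_inv S lvs i (Suc m) R N d e f g \<and> R 3 \<noteq> 0)
    (link_inv S lvs i m) (cost link_body)"
proof (rule runs_vc, elim conjE)
  fix R N d e f g
  assume inv: "link_inv S lvs i (Suc m) R N d e f g" and R3: "R 3 \<noteq> 0"
  let ?lv = "leaves S (word_stream E)" let ?t = "R 6"
  have id: "idle R N f g (lvs(i := take ?t ?lv))" and de: "d = 0" "e \<le> nfilters" and en: "enumerated S FU R N"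
    and R5: "R 5 = i * B + 1 + ?t" and sum: "?t + Suc m = min (R 14) B" and t: "?t < R 14" "?t < B"
    using inv R3 by (auto simp: link_inv_def split: if_splits)
  have w: "8 * cells \<le> 2 ^ w" "3 \<le> cells" using cells_word cells_3 by auto
  have cr: "const_regs R" and c: "R 28 = B" "R 29 = n * B + 1" using id const_regs_29[of R] by (auto simp: idle_def)
  obtain L where L: "links L (N 6) (N 7) (entries (lvs(i := take ?t ?lv)))" using id by (auto simp: idle_def)
  have R14: "R 14 \<le> FU" "R 14 \<le> length ?lv" "map (N 5) [0..<R 14] = take (R 14) ?lv"
    using en by (auto simp: enumerated_def)
  define h where "h = N 5 ?t"
  have "h = take (R 14) ?lv ! ?t" unfolding h_def R14(3)[symmetric] using t by simp
  then have hl: "h = ?lv ! ?t" using t by simp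
  have tl: "?t < length ?lv" using t R14 by simp
  then have h: "h < 2 ^ lt" using leaves_less[OF nth_mem[OF tl]] hl by simp
  define hc where "hc = n * B + 1 + h"
  define q where "q = N 6 hc"
  have range: "1 \<le> R 5" "R 5 \<le> n * B" using cell_range[OF i t(2)] R5 by auto
  have fresh: "entries (lvs(i := take ?t ?lv)) (R 5) = None" unfolding R5 using t(2) by (rule entries_fresh)
  have L': "links (L(h := R 5 # L h)) ((N 6)(R 5 := q, hc := R 5)) ((N 7)(R 5 := hc, q := R 5))
      (entries (lvs(i := take (Suc ?t) ?lv)))"
    unfolding entries_step[OF i t(2) tl] R5[symmetric] hl[symmetric]
    by (rule links_insert[OF L h range fresh hc_def q_def])
  define M where "M = min (R 14) B"
  have min: "min (R 14) B = M" unfolding M_def ..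
  have sum': "Suc (R 6 + m) = M" using sum min by simp
  have hc': "Suc (n * B + h) = hc" unfolding hc_def by simp
  have tab: "tables (word_stream E) N" "f = nfilters" "g = k" using id by (auto simp: idle_def)
  have L'': "\<exists>L. links L ((N 6)(R 5 := q, hc := R 5)) ((N 7)(R 5 := hc, q := R 5))
      (entries (lvs(i := take (Suc ?t) ?lv)))" by (rule exI[of _ "L(h := R 5 # L h)"]) (rule L')
  have q: "q \<le> n * B" using links_head_le[OF L h] unfolding q_def hc_def .
  have idx: "?t < cells" "hc < cells" "q < cells" "R 5 < cells" "hc < 2 ^ w" "R 5 + 1 < 2 ^ w" "?t + 1 < 2 ^ w"
    using t R14 cells_FU cells_links w h q range unfolding hc_def by linarith+
  have neq: "R 5 \<noteq> hc" "hc \<noteq> R 5" using range unfolding hc_def by auto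
  show "vc link_body (link_inv S lvs i m) R N d e f g"
    unfolding link_body_def
    using tab de en R5[symmetric] sum' min cr c idx L'' neq h_def[symmetric] hc' q_def[symmetric]
    by (simp add: word_size link_inv_def idle_def)
qed

definition insert_cost :: nat where
  "insert_cost = 2 + enumerate_cost FU + cost link_init + Suc (B * Suc (cost link_body))"

text \<open>A truncated insertion files a prefix of the leaves. This is all that queries require of
  far points, because a prefix only reduces the number of candidates; completeness matters for the
  near point alone.\<close>

lemma lsf_insert:
  assumes i: "i < n" and lvs: "lvs i = []" and y: "point = Some y"
    and S: "S = (\<lambda>j. y \<in> side_set UpdateSide (filter_stream E j))"
  shows "runs lsf_insert (\<lambda>R N d e f g. idle R N f g lvs \<and> R 0 = i \<and> d = 0 \<and> e = 0)
    (\<lambda>R N d e f g. d = 0 \<and> e \<le> nfilters \<and> (\<exists>q. let lv = take q (leaves S (word_stream E)) in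
       idle R N f g (lvs(i := lv)) \<and> length lv \<le> B \<and>
       (work S (word_stream E) \<le> FU \<and> length (leaves S (word_stream E)) \<le> B \<longrightarrow>
          lv = leaves S (word_stream E))))
    insert_cost"
proof -
  let ?lv = "leaves S (word_stream E)"
  let ?post = "\<lambda>R N d e f g. d = 0 \<and> e \<le> nfilters \<and> (\<exists>q. let lv = take q ?lv in
       idle R N f g (lvs(i := lv)) \<and> length lv \<le> B \<and>
       (work S (word_stream E) \<le> FU \<and> length ?lv \<le> B \<longrightarrow> lv = ?lv))"
  have loop: "runs (While 3 (compile link_body)) (\<lambda>R N d e f g. \<exists>m. m \<le> B \<and> link_inv S lvs i m R N d e f g)
    ?post (Suc (B * Suc (cost link_body)))"
  proof (intro runs_ex runs_pure)
    fix m assume m: "m \<le> B"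
    show "runs (While 3 (compile link_body)) (link_inv S lvs i m) ?post (Suc (B * Suc (cost link_body)))"
    proof (rule runs_conseq[OF runs_While])
      show "runs (compile link_body) (\<lambda>R N d e f g. link_inv S lvs i (Suc m) R N d e f g \<and> R 3 \<noteq> 0)
        (link_inv S lvs i m) (cost link_body)" for m using i by (rule link_body)
      show "R 3 = 0" if "link_inv S lvs i 0 R N d e f g" for R N d e f g
        using that by (auto simp: link_inv_def)
      show "Suc (m * Suc (cost link_body)) \<le> Suc (B * Suc (cost link_body))"
        using m by (simp add: mult_right_mono del: mult_Suc_right)
      show "link_inv S lvs i m R N d e f g" if "link_inv S lvs i m R N d e f g" for R N d e f g
        using that .
      fix R N d e f g
      assume "(\<exists>m. link_inv S lvs i m R N d e f g) \<and> R 3 = 0"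
      then obtain m where inv: "link_inv S lvs i m R N d e f g" and "R 3 = 0" by blast
      then have t: "R 6 = min (R 14) B" by (auto simp: link_inv_def split: if_splits)
      have en: "enumerated S FU R N" "idle R N f g (lvs(i := take (R 6) ?lv))" "d = 0" "e \<le> nfilters"
        using inv by (simp_all add: link_inv_def)
      have "length (take (R 6) ?lv) \<le> B" using t by simp
      moreover have "take (R 6) ?lv = ?lv" if "work S (word_stream E) \<le> FU" "length ?lv \<le> B"
        using that en(1) t by (simp add: enumerated_def)
      ultimately show "?post R N d e f g"
        unfolding Let_def using en by (intro conjI exI[of _ "R 6"]) blast+
    qed
  qed
  have mid: "runs (Seq (enumerate_code UpdateSide) (Seq (compile link_init) (While 3 (compile link_body))))
    (\<lambda>R N d e f g. \<exists>nx pv L. links L nx pv (entries lvs) \<and> (stable i nx pv R N d f g \<and> e = 0 \<and> R 4 = FU)) ?post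
    (enumerate_cost FU + (cost link_init + Suc (B * Suc (cost link_body))))"
  proof (intro runs_ex runs_pure)
    fix nx pv L assume L: "links L nx pv (entries lvs)"
    show "runs (Seq (enumerate_code UpdateSide) (Seq (compile link_init) (While 3 (compile link_body))))
      (\<lambda>R N d e f g. stable i nx pv R N d f g \<and> e = 0 \<and> R 4 = FU) ?post
      (enumerate_cost FU + (cost link_init + Suc (B * Suc (cost link_body))))"
      by (rule runs_Seq[OF enumerate_code[OF cells_FU y S] runs_Seq[OF link_init[OF i lvs L] loop]])
  qed
  have "runs (compile (AddI 4 30 0)) (\<lambda>R N d e f g. idle R N f g lvs \<and> R 0 = i \<and> d = 0 \<and> e = 0)
    (\<lambda>R N d e f g. \<exists>nx pv L. links L nx pv (entries lvs) \<and> (stable i nx pv R N d f g \<and> e = 0 \<and> R 4 = FU))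
    (cost (AddI 4 30 0))"
  proof (rule runs_vc, elim conjE)
    fix R N f g and d e :: nat assume a: "idle R N f g lvs" "R 0 = i" "d = 0" "e = 0"
    have "FU < 2 ^ w" using cells_FU cells_word by linarith
    moreover have "R 30 = FU" using a const_regs_29 by (auto simp: idle_def)
    ultimately show "vc (AddI 4 30 0) (\<lambda>R N d e f g. \<exists>nx pv L. links L nx pv (entries lvs) \<and>
      (stable i nx pv R N d f g \<and> e = 0 \<and> R 4 = FU)) R N d e f g"
      using a by (auto simp: word_size idle_def stable_def)
  qed
  from runs_Seq[OF this mid] show ?thesis unfolding lsf_insert_def
    by (rule runs_conseq) (auto simp: insert_cost_def)
qed

definition unlink_inv where
  "unlink_inv lvs i m R N d e f g \<longleftrightarrow> const_regs R \<and> tables (word_stream E) N \<and> f = nfilters \<and> g = k \<and>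
     d = (0::nat) \<and> e = (0::nat) \<and>
     (\<exists>L. links L (N 6) (N 7) (\<lambda>e. if i * B + 1 \<le> e \<and> e < i * B + 1 + R 6 then None else entries lvs e)) \<and>
     R 5 = i * B + 1 + R 6 \<and> R 3 = of_bool (R 6 < B) \<and> R 6 + m = B"

definition delete_cost :: nat where
  "delete_cost = cost unlink_init + Suc (B * Suc (cost unlink_body))"

lemma lsf_delete:
  assumes i: "i < n"
  shows "runs lsf_delete (\<lambda>R N d e f g. idle R N f g lvs \<and> R 0 = i \<and> d = 0 \<and> e = 0)
    (\<lambda>R N d e f g. d = 0 \<and> e = 0 \<and> idle R N f g (lvs(i := []))) delete_cost"
  unfolding lsf_delete_def delete_cost_def
proof (rule runs_Seq[OF runs_vc runs_conseq[OF runs_While order_refl]])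
  have w: "8 * cells \<le> 2 ^ w" "3 \<le> cells" using cells_word cells_3 by auto
  fix R N f g and d e :: nat assume a: "idle R N f g lvs \<and> R 0 = i \<and> d = 0 \<and> e = 0"
  have "i * B \<le> n * B" using i by simp
  then have b: "i * B + 1 < 2 ^ w" using cells_links w by linarith
  have e: "(\<lambda>e. if Suc (i * B) \<le> e \<and> e < Suc (i * B) then None else entries lvs e) = entries lvs"
    by (rule ext) auto
  have "R 28 = B" using a const_regs_29 by (auto simp: idle_def)
  then show "vc unlink_init (unlink_inv lvs i B) R N d e f g"
    unfolding unlink_init_def using a b B_pos w by (auto simp: word_size unlink_inv_def idle_def e)
next
  fix m
  have w: "8 * cells \<le> 2 ^ w" "3 \<le> cells" using cells_word cells_3 by auto
  show "runs (compile unlink_body) (\<lambda>R N d e f g. unlink_inv lvs i (Suc m) R N d e f g \<and> R 3 \<noteq> 0)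
    (unlink_inv lvs i m) (cost unlink_body)"
  proof (rule runs_vc, elim conjE)
    fix R N d e f g
    assume inv: "unlink_inv lvs i (Suc m) R N d e f g" and R3: "R 3 \<noteq> 0"
    let ?t = "R 6"
    let ?bk = "\<lambda>t e. if i * B + 1 \<le> e \<and> e < i * B + 1 + t then None else entries lvs e"
    obtain L where L: "links L (N 6) (N 7) (?bk ?t)" using inv by (auto simp: unlink_inv_def)
    have R5: "R 5 = i * B + 1 + ?t" and sum: "?t + Suc m = B" and t: "?t < B"
      using inv by (auto simp: unlink_inv_def)
    have cr: "const_regs R" "tables (word_stream E) N" "f = nfilters" "g = k" "d = 0" "e = 0"
      and c: "R 28 = B" using inv const_regs_29 by (auto simp: unlink_inv_def)
    have range: "1 \<le> R 5" "R 5 \<le> n * B" using cell_range[OF i t] R5 by auto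
    define p where "p = N 7 (R 5)"
    define q where "q = N 6 (R 5)"
    note rm = links_remove[OF L range p_def q_def]
    have "(?bk ?t)(R 5 := None) = ?bk (Suc ?t)" unfolding R5 by (auto simp: fun_eq_iff)
    then have L': "\<exists>L. links L ((N 6)(p := q, R 5 := 0)) ((N 7)(q := p, R 5 := 0)) (?bk (Suc ?t))"
      using rm(1) by simp
    have idx: "p < cells" "q < cells" "R 5 < cells" "R 5 + 1 < 2 ^ w" "?t + 1 < 2 ^ w"
      using rm cells_links w range t R5 by linarith+
    show "vc unlink_body (unlink_inv lvs i m) R N d e f g"
      unfolding unlink_body_def
      using R5[symmetric] sum t cr c idx L' w p_def[symmetric] q_def[symmetric]
      by (simp add: word_size unlink_inv_def)
  qed
next
  show "R 3 = 0" if "unlink_inv lvs i 0 R N d e f g" for R N d e f g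
    using that by (auto simp: unlink_inv_def)
next
  fix R N d e f g
  assume "(\<exists>m. unlink_inv lvs i m R N d e f g) \<and> R 3 = 0"
  then obtain m where inv: "unlink_inv lvs i m R N d e f g" and "R 3 = 0" by blast
  then have "R 6 = B" by (auto simp: unlink_inv_def)
  then show "d = 0 \<and> e = 0 \<and> idle R N f g (lvs(i := []))"
    using inv unfolding unlink_inv_def idle_def entries_removed[OF i, symmetric] by auto
qed auto

text \<open>The forward half of a list segment, started at the element itself instead of the cell
  before it, which is what the register of the walk holds.\<close>

primrec chain :: "(nat \<Rightarrow> nat) \<Rightarrow> nat \<Rightarrow> nat list \<Rightarrow> bool" where
  "chain nx c [] \<longleftrightarrow> c = 0"
| "chain nx c (x # xs) \<longleftrightarrow> c = x \<and> x \<noteq> 0 \<and> chain nx (nx x) xs"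

lemma lseg_chain: "lseg nx pv p xs 0 \<Longrightarrow> 0 \<notin> set xs \<Longrightarrow> chain nx (nx p) xs"
  by (induction xs arbitrary: p) auto

definition near :: "'a \<Rightarrow> nat \<Rightarrow> bool" where
  "near x j \<longleftrightarrow> (\<exists>y. sl j = Some y \<and> distance E x y \<le> threshold E)"

text \<open>The concatenated lists of the leaves are split into cells already compared, the
  remainder of the current list, and the lists not yet opened. Every iteration compares a point or
  opens a list, so \<open>(R 14 - R 6) + R 4\<close> decreases. As long as there is no answer,
  \<open>d + R 4 = DQ\<close> converts spent budget into distance computations.\<close>

definition walk_inv where
  "walk_inv L lvl x nx pv m R N d e f g \<longleftrightarrow> const_regs R \<and> tables (word_stream E) N \<and> f = nfilters \<and> g = k \<and>
     N 6 = nx \<and> N 7 = pv \<and> e \<le> nfilters \<and> R 14 = length lvl \<and> map (N 5) [0..<R 14] = lvl \<and> R 6 \<le> R 14 \<and>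
     (R 14 - R 6) + R 4 \<le> m \<and> R 3 = (of_bool (R 6 < R 14) + of_bool (0 < R 5)) * R 4 \<and> d + R 4 \<le> DQ \<and>
     (R 0 = 0 \<longrightarrow> d + R 4 = DQ \<and> (\<exists>vis rest. concat (map L lvl) = vis @ rest @ concat (map L (drop (R 6) lvl)) \<and>
        chain nx (R 5) rest \<and> length vis = d \<and> (\<forall>c\<in>set vis. \<not> near x ((c - 1) div B)))) \<and>
     (R 0 \<noteq> 0 \<longrightarrow> R 4 = 0 \<and> near x (R 0 - 1))"

lemma vc_NearR:
  assumes "point = Some x"
  shows "vc (NearR t i) Q R N d e f g \<longleftrightarrow> (\<exists>y'. sl (R i) = Some y' \<and>
     Q (R(t := of_bool (distance E x y' \<le> threshold E))) N (Suc d) e f g)"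
  by (subst vc.simps(14)) (auto simp: assms)

lemma walk_init:
  assumes "map (N 5) [0..<R 14] = lvl" "stable r0 nx pv R N 0 f g" "e \<le> nfilters"
  shows "vc walk_init (walk_inv L lvl x nx pv (length lvl + DQ)) R N 0 e f g"
proof -
  have c: "const_regs R" "R 32 = DQ" using assms(2) const_regs_29 by (auto simp: stable_def)
  have "length lvl = R 14" using arg_cong[OF assms(1), of length] by simp
  then show ?thesis
    unfolding walk_init_def using assms c DQ_word
    by (auto simp: word_size walk_inv_def stable_def)
qed

lemma walk_body:
  assumes x: "point = Some x" and L: "links L nx pv (entries lvs)" and lvl: "\<And>h. h \<in> set lvl \<Longrightarrow> h < 2 ^ lt"
    and occ: "\<And>j. lvs j \<noteq> [] \<Longrightarrow> sl j \<noteq> None" and len: "length lvl < cells"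
  shows "runs (compile walk_body) (\<lambda>R N d e f g. walk_inv L lvl x nx pv (Suc m) R N d e f g \<and> R 3 \<noteq> 0)
    (walk_inv L lvl x nx pv m) (cost walk_body)"
proof (rule runs_vc, elim conjE)
  fix R N d e f g
  assume inv: "walk_inv L lvl x nx pv (Suc m) R N d e f g" and R3: "R 3 \<noteq> 0"
  have w: "8 * cells \<le> 2 ^ w" "3 \<le> cells" using cells_word cells_3 by auto
  have cr: "const_regs R" "tables (word_stream E) N" "f = nfilters" "g = k" "N 6 = nx" "N 7 = pv" "e \<le> nfilters"
    and R14: "R 14 = length lvl" and arr: "map (N 5) [0..<length lvl] = lvl" and R6: "R 6 \<le> length lvl"
    and m: "(length lvl - R 6) + R 4 \<le> Suc m" and R4: "R 4 \<noteq> 0" and or: "R 6 < length lvl \<or> 0 < R 5"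
    and R0: "R 0 = 0" and dR: "d + R 4 = DQ"
    using inv R3 unfolding walk_inv_def by (auto split: if_splits)
  obtain vis rest where W: "concat (map L lvl) = vis @ rest @ concat (map L (drop (R 6) lvl))"
    and ch: "chain nx (R 5) rest" and vis: "length vis = d" "\<forall>c\<in>set vis. \<not> near x ((c - 1) div B)"
    using inv R0 unfolding walk_inv_def by auto
  have c: "R 28 = B" "R 29 = n * B + 1" using cr(1) const_regs_29 by auto
  have Lh: "lseg nx pv (n * B + 1 + h) (L h) 0" "set (L h) = {e. entries lvs e = Some h}" if "h < 2 ^ lt" for h
    using L that unfolding links_def by blast+
  have w4: "R 4 < 2 ^ w" "2 * (R 4 - 1) < 2 ^ w" "2 < (2::nat) ^ w" "R 6 + 1 < 2 ^ w"
    using dR DQ_word w R6 len by linarith+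
  show "vc walk_body (walk_inv L lvl x nx pv m) R N d e f g"
  proof (cases "R 5 = 0")
    case False
    then obtain xs where rest: "rest = R 5 # xs" and ch': "chain nx (nx (R 5)) xs"
      using ch by (cases rest) auto
    have "R 5 \<in> set (concat (map L lvl))" unfolding W rest by simp
    then obtain h where "h \<in> set lvl" "R 5 \<in> set (L h)" by auto
    then have en: "entries lvs (R 5) = Some h" using Lh lvl by auto
    then have range: "1 \<le> R 5" "R 5 \<le> n * B" "lvs ((R 5 - 1) div B) \<noteq> []"
      by (auto simp: entries_def split: if_splits)
    define j where "j = (R 5 - 1) div B"
    obtain y' where y': "sl j = Some y'" using occ[OF range(3)] j_def by auto
    have idx: "R 5 < cells" "R 5 < 2 ^ w" using range cells_links w by linarith+
    have jd: "(R 5 - Suc 0) div B = j" unfolding j_def by simp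
    have "j \<le> R 5 - 1" unfolding j_def by simp
    then have jw: "j + 1 < 2 ^ w" using idx w range cells_links by linarith
    show ?thesis
    proof (cases "distance E x y' \<le> threshold E")
      case True
      then have "near x j" using y' by (auto simp: near_def)
      then show ?thesis
        unfolding walk_body_def
        using False True cr R14 arr R6 m R4 R0 dR c w4 w range idx jw y'
        by (simp add: word_size walk_inv_def vc_NearR[OF x] jd del: vc.simps(14)) (intro conjI impI; linarith)
    next
      case far: False
      then have nn: "\<not> near x j" using y' by (auto simp: near_def)
      have "concat (map L lvl) = (vis @ [R 5]) @ xs @ concat (map L (drop (R 6) lvl))"
        unfolding W rest by simp
      moreover have "length (vis @ [R 5]) = Suc d" "\<forall>c\<in>set (vis @ [R 5]). \<not> near x ((c - 1) div B)"
        using vis nn unfolding j_def by auto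
      ultimately have ex: "\<exists>vis rest. concat (map L lvl) = vis @ rest @ concat (map L (drop (R 6) lvl)) \<and>
        chain nx (nx (R 5)) rest \<and> length vis = Suc d \<and> (\<forall>c\<in>set vis. \<not> near x ((c - 1) div B))"
        using ch' by blast
      have "Suc (d + (R 4 - Suc 0)) = DQ" using dR R4 by simp
      then show ?thesis
        unfolding walk_body_def
        using False far cr R14 arr R6 m R4 R0 dR c w4 w range idx jw y' ex
        by (simp add: word_size walk_inv_def vc_NearR[OF x] jd del: vc.simps(14))
          (intro conjI impI; linarith)
    qed
  next
    case True
    then have r: "rest = []" using ch by (cases rest) auto
    have t: "R 6 < length lvl" using or True by simp
    define h where "h = N 5 (R 6)"
    have "h = map (N 5) [0..<length lvl] ! R 6" unfolding h_def using t by simp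
    then have hl: "h = lvl ! R 6" unfolding arr .
    then have h: "h < 2 ^ lt" using lvl t by simp
    have "drop (R 6) lvl = h # drop (Suc (R 6)) lvl" unfolding hl using t by (simp add: Cons_nth_drop_Suc)
    then have W': "concat (map L lvl) = vis @ L h @ concat (map L (drop (Suc (R 6)) lvl))"
      unfolding W r by simp
    have "0 \<notin> set (L h)" using Lh(2)[OF h] by (auto simp: entries_def)
    then have "chain nx (nx (n * B + 1 + h)) (L h)" using Lh(1)[OF h] lseg_chain by blast
    then have ex: "\<exists>vis rest. concat (map L lvl) = vis @ rest @ concat (map L (drop (Suc (R 6)) lvl)) \<and>
        chain nx (nx (Suc (n * B + h))) rest \<and> length vis = d \<and> (\<forall>c\<in>set vis. \<not> near x ((c - 1) div B))"
      using W' vis by auto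
    have idx: "R 6 < cells" "n * B + 1 + h < cells" "n * B + 1 + h < 2 ^ w"
      using t len cells_links h w by linarith+
    have w5: "2 * R 4 < 2 ^ w" using dR DQ_word by linarith
    show ?thesis
      unfolding walk_body_def
      using True cr R14 arr R6 m R4 R0 dR c w4 w5 w t idx ex h_def[symmetric]
      by (simp add: word_size walk_inv_def) (intro conjI impI; linarith)
  qed
qed

definition query_cost :: nat where
  "query_cost = 2 + enumerate_cost FQ + cost walk_init + Suc ((FQ + DQ) * Suc (cost walk_body))"

text \<open>A query without an answer has either walked all lists to their ends or compared
  \<open>DQ\<close> cells, and none of the visited cells belongs to a point within the threshold.
  Both possibilities are excluded later for favourable outcomes.\<close>

lemma lsf_query:
  assumes x: "point = Some x" and S: "S = (\<lambda>j. x \<in> side_set QuerySide (filter_stream E j))"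
    and occ: "\<And>j. lvs j \<noteq> [] \<Longrightarrow> sl j \<noteq> None"
  shows "runs lsf_query (\<lambda>R N d e f g. idle R N f g lvs \<and> d = 0 \<and> e = 0)
    (\<lambda>R N d e f g. d \<le> DQ \<and> e \<le> nfilters \<and> idle R N f g lvs \<and> (R 0 \<noteq> 0 \<longrightarrow> near x (R 0 - 1)) \<and>
       (R 0 = 0 \<longrightarrow> (\<exists>L q lvl. lvl = take q (leaves S (word_stream E)) \<and>
          (work S (word_stream E) \<le> FQ \<longrightarrow> lvl = leaves S (word_stream E)) \<and>
          (\<forall>h<2 ^ lt. distinct (L h) \<and> set (L h) = {e. entries lvs e = Some h}) \<and>
          (\<exists>vis rest. concat (map L lvl) = vis @ rest \<and> (\<forall>c\<in>set vis. \<not> near x ((c - 1) div B)) \<and>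
             (rest = [] \<or> length vis = DQ)))))
    query_cost"
proof -
  let ?lv = "leaves S (word_stream E)"
  let ?post = "\<lambda>R N d e f g. d \<le> DQ \<and> e \<le> nfilters \<and> idle R N f g lvs \<and> (R 0 \<noteq> 0 \<longrightarrow> near x (R 0 - 1)) \<and>
       (R 0 = 0 \<longrightarrow> (\<exists>L q lvl. lvl = take q ?lv \<and> (work S (word_stream E) \<le> FQ \<longrightarrow> lvl = ?lv) \<and>
          (\<forall>h<2 ^ lt. distinct (L h) \<and> set (L h) = {e. entries lvs e = Some h}) \<and>
          (\<exists>vis rest. concat (map L lvl) = vis @ rest \<and> (\<forall>c\<in>set vis. \<not> near x ((c - 1) div B)) \<and>
             (rest = [] \<or> length vis = DQ))))"
  let ?start = "\<lambda>R N d e f g. \<exists>nx pv r0 L. links L nx pv (entries lvs) \<and>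
    (stable r0 nx pv R N d f g \<and> e = 0 \<and> R 4 = FQ)"
  have loop: "runs (Seq (compile walk_init) (While 3 (compile walk_body)))
    (\<lambda>R N d e f g. stable r0 nx pv R N d f g \<and> e \<le> nfilters \<and> enumerated S FQ R N) ?post
    (cost walk_init + Suc ((FQ + DQ) * Suc (cost walk_body)))"
    if L: "links L nx pv (entries lvs)" for r0 nx pv L
  proof -
    let ?pre = "\<lambda>R N d e f g. \<exists>lvl. (\<exists>q. lvl = take q ?lv \<and> length lvl \<le> FQ \<and> (work S (word_stream E) \<le> FQ \<longrightarrow> lvl = ?lv)) \<and>
       (stable r0 nx pv R N d f g \<and> e \<le> nfilters \<and> map (N 5) [0..<R 14] = lvl)"
    have "runs (Seq (compile walk_init) (While 3 (compile walk_body))) ?pre ?post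
      (cost walk_init + Suc ((FQ + DQ) * Suc (cost walk_body)))"
    proof (intro runs_ex runs_pure)
      fix lvl assume "\<exists>q. lvl = take q ?lv \<and> length lvl \<le> FQ \<and> (work S (word_stream E) \<le> FQ \<longrightarrow> lvl = ?lv)"
      then obtain q where q: "lvl = take q ?lv" "length lvl \<le> FQ" "work S (word_stream E) \<le> FQ \<longrightarrow> lvl = ?lv"
        by blast
      have lt: "h < 2 ^ lt" if "h \<in> set lvl" for h
        using that q(1) leaves_less by (auto dest: in_set_takeD)
      have len: "length lvl < cells" using q(2) cells_FQ by linarith
      show "runs (Seq (compile walk_init) (While 3 (compile walk_body)))
        (\<lambda>R N d e f g. stable r0 nx pv R N d f g \<and> e \<le> nfilters \<and> map (N 5) [0..<R 14] = lvl) ?post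
        (cost walk_init + Suc ((FQ + DQ) * Suc (cost walk_body)))"
      proof (rule runs_Seq[OF runs_vc runs_conseq[OF runs_While]])
        fix R N d e f g
        assume a: "stable r0 nx pv R N d f g \<and> e \<le> nfilters \<and> map (N 5) [0..<R 14] = lvl"
        then have "d = 0" by (auto simp: stable_def)
        with a show "vc walk_init (walk_inv L lvl x nx pv (length lvl + DQ)) R N d e f g"
          using walk_init[of N R lvl r0 nx pv f g e L x] by simp
      next
        show "runs (compile walk_body) (\<lambda>R N d e f g. walk_inv L lvl x nx pv (Suc m) R N d e f g \<and> R 3 \<noteq> 0)
          (walk_inv L lvl x nx pv m) (cost walk_body)" for m
          using x L lt occ len by (rule walk_body)
      next
        show "R 3 = 0" if "walk_inv L lvl x nx pv 0 R N d e f g" for R N d e f g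
          using that by (auto simp: walk_inv_def)
      next
        show "Suc ((length lvl + DQ) * Suc (cost walk_body)) \<le> Suc ((FQ + DQ) * Suc (cost walk_body))"
          using q(2) by (simp add: mult_right_mono del: mult_Suc_right)
      next
        fix R N d e f g
        assume "(\<exists>m. walk_inv L lvl x nx pv m R N d e f g) \<and> R 3 = 0"
        then obtain m where inv: "walk_inv L lvl x nx pv m R N d e f g" and R3: "R 3 = 0" by blast
        have 1: "d \<le> DQ" "e \<le> nfilters" "idle R N f g lvs" "R 0 \<noteq> 0 \<longrightarrow> near x (R 0 - 1)"
          using inv L by (auto simp: walk_inv_def idle_def)
        have 2: "\<exists>vis rest. concat (map L lvl) = vis @ rest \<and> (\<forall>c\<in>set vis. \<not> near x ((c - 1) div B)) \<and>
             (rest = [] \<or> length vis = DQ)" if "R 0 = 0"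
        proof -
          from that inv obtain vis rest where W: "concat (map L lvl) = vis @ rest @ concat (map L (drop (R 6) lvl))"
            and ch: "chain nx (R 5) rest" and vis: "length vis = d" "\<forall>c\<in>set vis. \<not> near x ((c - 1) div B)"
            and d: "d + R 4 = DQ" "R 14 = length lvl"
            unfolding walk_inv_def by auto
          have "R 4 = 0 \<or> \<not> R 6 < R 14 \<and> R 5 = 0" using inv R3 by (auto simp: walk_inv_def)
          moreover have "rest = []" if "R 5 = 0" using ch that by (cases rest) auto
          ultimately show ?thesis using W vis d
            by (intro exI[of _ vis] exI[of _ "rest @ concat (map L (drop (R 6) lvl))"]) auto
        qed
        have 3: "\<forall>h<2 ^ lt. distinct (L h) \<and> set (L h) = {e. entries lvs e = Some h}"
          using L unfolding links_def by blast
        show "?post R N d e f g"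
          by (intro conjI 1 impI[OF exI[of _ L], OF exI[of _ q], OF exI[of _ lvl]] q(1) q(3) 3 2)
      qed
    qed
    then show ?thesis
    proof (rule runs_conseq)
      fix R N d e f g
      assume a: "stable r0 nx pv R N d f g \<and> e \<le> nfilters \<and> enumerated S FQ R N"
      then show "?pre R N d e f g"
        by (intro exI[of _ "take (R 14) ?lv"] conjI exI[of _ "R 14"]) (auto simp: enumerated_def)
    qed auto
  qed
  have mid: "runs (Seq (enumerate_code QuerySide) (Seq (compile walk_init) (While 3 (compile walk_body)))) ?start ?post
    (enumerate_cost FQ + (cost walk_init + Suc ((FQ + DQ) * Suc (cost walk_body))))"
  proof (intro runs_ex runs_pure)
    fix nx pv r0 L assume L: "links L nx pv (entries lvs)"
    show "runs (Seq (enumerate_code QuerySide) (Seq (compile walk_init) (While 3 (compile walk_body))))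
     (\<lambda>R N d e f g. stable r0 nx pv R N d f g \<and> e = 0 \<and> R 4 = FQ) ?post
     (enumerate_cost FQ + (cost walk_init + Suc ((FQ + DQ) * Suc (cost walk_body))))"
      by (rule runs_Seq[OF enumerate_code[OF cells_FQ x S] loop[OF L]])
  qed
  have "runs (compile (AddI 4 31 0)) (\<lambda>R N d e f g. idle R N f g lvs \<and> d = 0 \<and> e = 0) ?start
    (cost (AddI 4 31 0))"
  proof (rule runs_vc, elim conjE)
    fix R N f g and d e :: nat assume a: "idle R N f g lvs" "d = 0" "e = 0"
    have "FQ < 2 ^ w" using cells_FQ cells_word by linarith
    moreover have "R 31 = FQ" using a const_regs_29 by (auto simp: idle_def)
    ultimately show "vc (AddI 4 31 0) ?start R N d e f g"
      using a by (auto simp: word_size idle_def stable_def)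
  qed
  from runs_Seq[OF this mid] show ?thesis unfolding lsf_query_def
    by (rule runs_conseq) (auto simp: query_cost_def)
qed

end

section \<open>Initialization\<close>

definition words_init :: cmd where
  "words_init = SetC 6 0 ;; LessR 3 6 33"

definition words_body :: cmd where
  "words_body = RandomR 5 ;; StoreC 0 6 5 ;; AddI 6 6 1 ;; LessR 3 6 33"

definition blocks_init :: cmd where
  "blocks_init = SetC 6 0 ;; SetC 5 0 ;; StoreC 1 6 5 ;; LessR 3 6 20"

definition blocks_body :: cmd where
  "blocks_body = DivR 7 6 21 ;; MulR 8 7 35 ;; DivR 8 8 33 ;; AddI 9 7 1 ;; MulR 9 9 35 ;; DivR 9 9 33 ;;
     SubR 9 9 8 ;; AddR 9 34 9 ;; AddR 5 5 9 ;; AddI 6 6 1 ;; StoreC 1 6 5 ;; LessR 3 6 20"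

definition sample_init :: cmd where
  "sample_init = SetC 6 0 ;; LessR 3 6 27"

definition sample_body :: cmd where
  "sample_body = SampleR ;; AddI 6 6 1 ;; LessR 3 6 27"

definition roots_init :: cmd where
  "roots_init = SetC 6 0 ;; LessR 3 6 21"

definition roots_body :: cmd where
  "roots_body = MulR 7 6 37 ;; StoreC 4 6 7 ;; AddI 6 6 1 ;; LessR 3 6 21"

definition lsf_prepare :: com where
  "lsf_prepare = Seq (Seq (compile words_init) (While 3 (compile words_body)))
     (Seq (Seq (compile blocks_init) (While 3 (compile blocks_body)))
     (Seq (Seq (compile sample_init) (While 3 (compile sample_body)))
          (Seq (compile roots_init) (While 3 (compile roots_body)))))"

context machine
begin

text \<open>The counting loops that build the tables run once, before all operations. Their time is
  left existential; what matters is the state they produce.\<close>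

lemma runs_count:
  assumes init: "\<And>R N d e f g. P R N d e f g \<Longrightarrow> vc ini (J 0) R N d e f g"
    and cond: "\<And>c R N d e f g. J c R N d e f g \<Longrightarrow> R 3 = of_bool (c < M)"
    and body: "\<And>c R N d e f g. c < M \<Longrightarrow> J c R N d e f g \<Longrightarrow> vc body (J (Suc c)) R N d e f g"
  shows "\<exists>t. runs (Seq (compile ini) (While 3 (compile body))) P (J M) t"
proof -
  let ?I = "\<lambda>m R N d e f g. \<exists>c. c + m = M \<and> J c R N d e f g"
  have "runs (Seq (compile ini) (While 3 (compile body))) P (J M) (cost ini + Suc (M * Suc (cost body)))"
  proof (rule runs_Seq[OF runs_vc runs_conseq[OF runs_While[where I = ?I and m = M] order_refl]])
    show "vc ini (J 0) R N d e f g" if "P R N d e f g" for R N d e f g using that by (rule init)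
    show "?I M R N d e f g" if "J 0 R N d e f g" for R N d e f g using that by auto
    show "R 3 = 0" if "?I 0 R N d e f g" for R N d e f g
      using that cond by fastforce
    show "runs (compile body) (\<lambda>R N d e f g. ?I (Suc m) R N d e f g \<and> R 3 \<noteq> 0) (?I m) (cost body)" for m
    proof (rule runs_conseq[OF _ order_refl])
      show "runs (compile body) (\<lambda>R N d e f g. \<exists>c. c + Suc m = M \<and> J c R N d e f g) (?I m) (cost body)"
      proof (intro runs_ex runs_pure)
        fix c assume c: "c + Suc m = M"
        have "runs (compile body) (J c) (J (Suc c)) (cost body)"
          by (rule runs_vc) (use c body in auto)
        then show "runs (compile body) (J c) (?I m) (cost body)"
        proof (rule runs_conseq[OF _ order_refl])
          show "?I m R N d e f g" if "J (Suc c) R N d e f g" for R N d e f g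
            using that c by (intro exI[of _ "Suc c"]) auto
        qed
      qed
    qed auto
    show "J M R N d e f g" if a: "(\<exists>m. ?I m R N d e f g) \<and> R 3 = 0" for R N d e f g
    proof -
      from a obtain c m where c: "c + m = M" "J c R N d e f g" "R 3 = 0" by blast
      then have "\<not> c < M" using cond[OF c(2)] by auto
      then show ?thesis using c by auto
    qed
  qed
  then show ?thesis by blast
qed

end

context lsf_run
begin

definition fresh :: "(reg \<Rightarrow> nat) \<Rightarrow> (nat \<Rightarrow> nat \<Rightarrow> nat) \<Rightarrow> bool" where
  "fresh R N \<longleftrightarrow> const_regs R \<and> N 6 = (\<lambda>_. 0) \<and> N 7 = (\<lambda>_. 0)"

lemma fresh_upd [simp]:
  "t < 20 \<Longrightarrow> fresh (R(t := v)) N \<longleftrightarrow> fresh R N"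
  "m < 6 \<Longrightarrow> fresh R (N(m := u)) \<longleftrightarrow> fresh R N"
  by (auto simp: fresh_def)

lemma w_basic: "8 * cells \<le> 2 ^ w" "3 \<le> cells" "2 < (2::nat) ^ w"
  using cells_word cells_3 by auto

lemma words_phase:
  "\<exists>t. runs (Seq (compile words_init) (While 3 (compile words_body)))
    (\<lambda>R N d e f g. fresh R N \<and> f = 0 \<and> g = 0)
    (\<lambda>R N d e f g. fresh R N \<and> f = 0 \<and> g = k \<and> R 6 = k \<and> R 3 = of_bool (k < k) \<and> (\<forall>j<k. N 0 j = word_stream E j)) t"
proof (rule runs_count[where J = "\<lambda>c R N d e f g. fresh R N \<and> f = 0 \<and> g = c \<and> R 6 = c \<and>
    R 3 = of_bool (c < k) \<and> (\<forall>j<c. N 0 j = word_stream E j)"])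
  note w = w_basic
  show "vc words_init (\<lambda>R N d e f g. fresh R N \<and> f = 0 \<and> g = 0 \<and> R 6 = 0 \<and> R 3 = of_bool (0 < k) \<and>
      (\<forall>j<0. N 0 j = word_stream E j)) R N d e f g" if "fresh R N \<and> f = 0 \<and> g = 0" for R N d e f g
  proof -
    have "R 33 = k" using that by (simp add: fresh_def const_regs_def)
    then show ?thesis using that w by (simp add: words_init_def word_size)
  qed
  show "vc words_body (\<lambda>R N d e f g. fresh R N \<and> f = 0 \<and> g = Suc c \<and> R 6 = Suc c \<and> R 3 = of_bool (Suc c < k) \<and>
      (\<forall>j<Suc c. N 0 j = word_stream E j)) R N d e f g"
    if "c < k" "fresh R N \<and> f = 0 \<and> g = c \<and> R 6 = c \<and> R 3 = of_bool (c < k) \<and> (\<forall>j<c. N 0 j = word_stream E j)"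
    for c R N d e f g
  proof -
    have "R 33 = k" using that by (simp add: fresh_def const_regs_def)
    moreover have "c < cells" "Suc c < 2 ^ w" using that(1) cells_k w by linarith+
    ultimately show ?thesis using that w by (simp add: words_body_def word_size less_Suc_eq)
  qed
qed auto

lemma blocks_phase:
  "\<exists>t. runs (Seq (compile blocks_init) (While 3 (compile blocks_body)))
    (\<lambda>R N d e f g. fresh R N \<and> f = 0 \<and> g = k \<and> R 6 = k \<and> R 3 = of_bool (k < k) \<and> (\<forall>j<k. N 0 j = word_stream E j))
    (\<lambda>R N d e f g. fresh R N \<and> f = 0 \<and> g = k \<and> (\<forall>j<k. N 0 j = word_stream E j) \<and> R 6 = k * 2 ^ kap \<and>
      R 5 = start (k * 2 ^ kap) \<and> R 3 = of_bool (k * 2 ^ kap < k * 2 ^ kap) \<and>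
      (\<forall>G\<le>k * 2 ^ kap. N 1 G = start G)) t"
proof (rule runs_count[where J = "\<lambda>c R N d e f g. fresh R N \<and> f = 0 \<and> g = k \<and>
    (\<forall>j<k. N 0 j = word_stream E j) \<and> R 6 = c \<and> R 5 = start c \<and>
    R 3 = of_bool (c < k * 2 ^ kap) \<and> (\<forall>G\<le>c. N 1 G = start G)"])
  note w = w_basic
  have s0: "start 0 = 0" by (simp add: start_def)
  show "vc blocks_init (\<lambda>R N d e f g. fresh R N \<and> f = 0 \<and> g = k \<and> (\<forall>j<k. N 0 j = word_stream E j) \<and>
      R 6 = 0 \<and> R 5 = start 0 \<and> R 3 = of_bool (0 < k * 2 ^ kap) \<and> (\<forall>G\<le>0. N 1 G = start G)) R N d e f g"
    if "fresh R N \<and> f = 0 \<and> g = k \<and> R 6 = k \<and> R 3 = of_bool (k < k) \<and> (\<forall>j<k. N 0 j = word_stream E j)"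
    for R N d e f g
  proof -
    have "R 20 = k * 2 ^ kap" using that by (simp add: fresh_def const_regs_def)
    then show ?thesis using that w by (simp add: blocks_init_def word_size s0)
  qed
  show "vc blocks_body (\<lambda>R N d e f g. fresh R N \<and> f = 0 \<and> g = k \<and> (\<forall>j<k. N 0 j = word_stream E j) \<and>
      R 6 = Suc c \<and> R 5 = start (Suc c) \<and> R 3 = of_bool (Suc c < k * 2 ^ kap) \<and>
      (\<forall>G\<le>Suc c. N 1 G = start G)) R N d e f g"
    if c: "c < k * 2 ^ kap" and a: "fresh R N \<and> f = 0 \<and> g = k \<and> (\<forall>j<k. N 0 j = word_stream E j) \<and>
      R 6 = c \<and> R 5 = start c \<and> R 3 = of_bool (c < k * 2 ^ kap) \<and> (\<forall>G\<le>c. N 1 G = start G)"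
    for c R N d e f g
  proof -
    have r: "R 20 = k * 2 ^ kap" "R 21 = 2 ^ kap" "R 33 = k" "R 34 = bl" "R 35 = A"
      using a by (simp_all add: fresh_def const_regs_def)
    define j where "j = c div 2 ^ kap"
    have j: "j < k" unfolding j_def using c by (simp add: less_mult_imp_div_less)
    have "Suc j * A \<le> Suc k * A" using j by (intro mult_right_mono) auto
    then have jA: "Suc j * A < 2 ^ w" using A_word by linarith
    then have jA2: "j * A < 2 ^ w" by simp
    have jA': "A + j * A < 2 ^ w" using jA by simp
    have mono: "j * A div k \<le> (A + j * A) div k" by (rule div_le_mono) simp
    have bs: "start (Suc c) = start c + (bl + ((A + j * A) div k - j * A div k))"
      by (simp add: start_def block_size_def j_def)
    have sw: "start (Suc c) < 2 ^ w" using start_le[of "Suc c"] nfilters_less c by simp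
    have qw: "(A + j * A) div k < 2 ^ w" using div_le_dividend[of "A + j * A" k] jA' by linarith
    have jw: "Suc j < 2 ^ w" using j cells_k w by linarith
    have cc: "Suc c < cells" "Suc c < 2 ^ w" using c cells_blocks w by linarith+
    have bw: "bl + ((A + j * A) div k - j * A div k) < 2 ^ w"
      "start c + (bl + ((A + j * A) div k - j * A div k)) < 2 ^ w" using bs sw by linarith+
    show ?thesis
      using a r w jA2 jA' mono bw qw jw cc j_def[symmetric]
      by (simp add: blocks_body_def word_size bs le_Suc_eq)
  qed
qed auto

lemma sample_phase:
  "\<exists>t. runs (Seq (compile sample_init) (While 3 (compile sample_body)))
    (\<lambda>R N d e f g. fresh R N \<and> f = 0 \<and> g = k \<and> (\<forall>j<k. N 0 j = word_stream E j) \<and> R 6 = k * 2 ^ kap \<and>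
      R 5 = start (k * 2 ^ kap) \<and> R 3 = of_bool (k * 2 ^ kap < k * 2 ^ kap) \<and>
      (\<forall>G\<le>k * 2 ^ kap. N 1 G = start G))
    (\<lambda>R N d e f g. fresh R N \<and> f = nfilters \<and> g = k \<and> (\<forall>j<k. N 0 j = word_stream E j) \<and>
      (\<forall>G\<le>k * 2 ^ kap. N 1 G = start G) \<and> R 6 = nfilters \<and> R 3 = of_bool (nfilters < nfilters)) t"
proof (rule runs_count[where J = "\<lambda>c R N d e f g. fresh R N \<and> f = c \<and> g = k \<and> (\<forall>j<k. N 0 j = word_stream E j) \<and>
      (\<forall>G\<le>k * 2 ^ kap. N 1 G = start G) \<and> R 6 = c \<and> R 3 = of_bool (c < nfilters)"])
  note w = w_basic
  show "vc sample_init (\<lambda>R N d e f g. fresh R N \<and> f = 0 \<and> g = k \<and> (\<forall>j<k. N 0 j = word_stream E j) \<and>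
      (\<forall>G\<le>k * 2 ^ kap. N 1 G = start G) \<and> R 6 = 0 \<and> R 3 = of_bool (0 < nfilters)) R N d e f g"
    if "fresh R N \<and> f = 0 \<and> g = k \<and> (\<forall>j<k. N 0 j = word_stream E j) \<and> R 6 = k * 2 ^ kap \<and>
      R 5 = start (k * 2 ^ kap) \<and> R 3 = of_bool (k * 2 ^ kap < k * 2 ^ kap) \<and> (\<forall>G\<le>k * 2 ^ kap. N 1 G = start G)"
    for R N d e f g
  proof -
    have "R 27 = nfilters" using that by (simp add: fresh_def const_regs_def)
    then show ?thesis using that w by (simp add: sample_init_def word_size)
  qed
  show "vc sample_body (\<lambda>R N d e f g. fresh R N \<and> f = Suc c \<and> g = k \<and> (\<forall>j<k. N 0 j = word_stream E j) \<and>
      (\<forall>G\<le>k * 2 ^ kap. N 1 G = start G) \<and> R 6 = Suc c \<and> R 3 = of_bool (Suc c < nfilters)) R N d e f g"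
    if "c < nfilters" "fresh R N \<and> f = c \<and> g = k \<and> (\<forall>j<k. N 0 j = word_stream E j) \<and>
      (\<forall>G\<le>k * 2 ^ kap. N 1 G = start G) \<and> R 6 = c \<and> R 3 = of_bool (c < nfilters)" for c R N d e f g
  proof -
    have "R 27 = nfilters" using that by (simp add: fresh_def const_regs_def)
    moreover have "Suc c < 2 ^ w" using that(1) nfilters_less by simp
    ultimately show ?thesis using that w by (simp add: sample_body_def word_size)
  qed
qed auto

lemma roots_phase:
  "\<exists>t. runs (Seq (compile roots_init) (While 3 (compile roots_body)))
    (\<lambda>R N d e f g. fresh R N \<and> f = nfilters \<and> g = k \<and> (\<forall>j<k. N 0 j = word_stream E j) \<and>
      (\<forall>G\<le>k * 2 ^ kap. N 1 G = start G) \<and> R 6 = nfilters \<and> R 3 = of_bool (nfilters < nfilters))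
    (\<lambda>R N d e f g. fresh R N \<and> f = nfilters \<and> g = k \<and> (\<forall>j<k. N 0 j = word_stream E j) \<and>
      (\<forall>G\<le>k * 2 ^ kap. N 1 G = start G) \<and> R 6 = 2 ^ kap \<and> R 3 = of_bool ((2::nat) ^ kap < 2 ^ kap) \<and>
      (\<forall>t<2 ^ kap. N 4 t = t * 2 ^ (l - kap))) t"
proof (rule runs_count[where J = "\<lambda>c R N d e f g. fresh R N \<and> f = nfilters \<and> g = k \<and>
      (\<forall>j<k. N 0 j = word_stream E j) \<and> (\<forall>G\<le>k * 2 ^ kap. N 1 G = start G) \<and> R 6 = c \<and>
      R 3 = of_bool (c < 2 ^ kap) \<and> (\<forall>t<c. N 4 t = t * 2 ^ (l - kap))"])
  note w = w_basic
  show "vc roots_init (\<lambda>R N d e f g. fresh R N \<and> f = nfilters \<and> g = k \<and> (\<forall>j<k. N 0 j = word_stream E j) \<and>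
      (\<forall>G\<le>k * 2 ^ kap. N 1 G = start G) \<and> R 6 = 0 \<and> R 3 = of_bool ((0::nat) < 2 ^ kap) \<and>
      (\<forall>t<0. N 4 t = t * 2 ^ (l - kap))) R N d e f g"
    if "fresh R N \<and> f = nfilters \<and> g = k \<and> (\<forall>j<k. N 0 j = word_stream E j) \<and>
      (\<forall>G\<le>k * 2 ^ kap. N 1 G = start G) \<and> R 6 = nfilters \<and> R 3 = of_bool (nfilters < nfilters)" for R N d e f g
  proof -
    have "R 21 = 2 ^ kap" using that by (simp add: fresh_def const_regs_def)
    then show ?thesis using that w by (simp add: roots_init_def word_size)
  qed
  show "vc roots_body (\<lambda>R N d e f g. fresh R N \<and> f = nfilters \<and> g = k \<and> (\<forall>j<k. N 0 j = word_stream E j) \<and>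
      (\<forall>G\<le>k * 2 ^ kap. N 1 G = start G) \<and> R 6 = Suc c \<and> R 3 = of_bool (Suc c < 2 ^ kap) \<and>
      (\<forall>t<Suc c. N 4 t = t * 2 ^ (l - kap))) R N d e f g"
    if "c < 2 ^ kap" "fresh R N \<and> f = nfilters \<and> g = k \<and> (\<forall>j<k. N 0 j = word_stream E j) \<and>
      (\<forall>G\<le>k * 2 ^ kap. N 1 G = start G) \<and> R 6 = c \<and> R 3 = of_bool (c < 2 ^ kap) \<and>
      (\<forall>t<c. N 4 t = t * 2 ^ (l - kap))" for c R N d e f g
  proof -
    have r: "R 21 = 2 ^ kap" "R 37 = 2 ^ (l - kap)" using that by (simp_all add: fresh_def const_regs_def)
    have "c * 2 ^ (l - kap) < 2 ^ kap * 2 ^ (l - kap)" using that(1) by simp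
    also have "\<dots> = 2 ^ l" using kap_le by (simp flip: power_add)
    also have "(2::nat) ^ l \<le> 2 ^ w" using l_le by simp
    finally have "c * 2 ^ (l - kap) < 2 ^ w" .
    moreover have "c < cells" "Suc c < 2 ^ w" using that(1) cells_FU w by linarith+
    ultimately show ?thesis using that w r by (simp add: roots_body_def word_size less_Suc_eq)
  qed
qed auto

lemma lsf_prepare:
  "\<exists>t. runs lsf_prepare (\<lambda>R N d e f g. fresh R N \<and> f = 0 \<and> g = 0) (\<lambda>R N d e f g. idle R N f g (\<lambda>_. [])) t"
proof -
  obtain t1 t2 t3 t4 where t: "runs lsf_prepare (\<lambda>R N d e f g. fresh R N \<and> f = 0 \<and> g = 0)
    (\<lambda>R N d e f g. fresh R N \<and> f = nfilters \<and> g = k \<and> (\<forall>j<k. N 0 j = word_stream E j) \<and>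
      (\<forall>G\<le>k * 2 ^ kap. N 1 G = start G) \<and> R 6 = 2 ^ kap \<and> R 3 = of_bool ((2::nat) ^ kap < 2 ^ kap) \<and>
      (\<forall>t<2 ^ kap. N 4 t = t * 2 ^ (l - kap))) (t1 + (t2 + (t3 + t4)))"
    unfolding lsf_prepare_def
    using words_phase blocks_phase sample_phase roots_phase runs_Seq by meson
  have e: "entries (\<lambda>_. []) = (\<lambda>_. None)" by (auto simp: entries_def)
  have li: "links (\<lambda>_. []) (\<lambda>_. 0) (\<lambda>_. 0) (entries (\<lambda>_. []))"
    by (auto simp: links_def e)
  have "runs lsf_prepare (\<lambda>R N d e f g. fresh R N \<and> f = 0 \<and> g = 0) (\<lambda>R N d e f g. idle R N f g (\<lambda>_. []))
    (t1 + (t2 + (t3 + t4)))"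
    by (rule runs_conseq[OF t]) (use li in \<open>auto simp: idle_def fresh_def tables_def intro!: exI[of _ "\<lambda>_. []"]\<close>)
  then show ?thesis by blast
qed

end

section \<open>Operation sequences\<close>

text \<open>Every parameter reaches the machine through a register, so one program text serves all
  instances, as a data structure chosen before the instance requires.\<close>

definition lsf_regs :: "nat \<Rightarrow> nat \<Rightarrow> nat \<Rightarrow> nat \<Rightarrow> nat \<Rightarrow> nat \<Rightarrow> nat \<Rightarrow> nat \<Rightarrow> nat \<Rightarrow> nat \<Rightarrow> nat \<Rightarrow> nat \<Rightarrow> reg \<Rightarrow> nat" where
  "lsf_regs w k kap l lt bl A n B FU FQ DQ t =
     (if t = 20 then k * 2 ^ kap else if t = 21 then 2 ^ kap else if t = 22 then l else if t = 23 then l - kap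
      else if t = 24 then w - l else if t = 25 then l - lt else if t = 26 then k * 2 ^ l
      else if t = 27 then lsf_tree.nfilters k kap bl A else if t = 28 then B else if t = 29 then n * B + 1
      else if t = 30 then FU else if t = 31 then FQ else if t = 32 then DQ else if t = 33 then k
      else if t = 34 then bl else if t = 35 then A else if t = 36 then 2 ^ l else if t = 37 then 2 ^ (l - kap)
      else 0)"

lemma contents_snoc: "contents (os @ [a]) = contents_after a (contents os)"
  by (simp add: contents_def)

lemma valid_ops_snoc:
  "valid_ops X n (os @ [a]) \<longleftrightarrow> valid_ops X n os \<and> admissible X n (contents os) a"
  unfolding valid_ops_def by (auto simp: nth_append less_Suc_eq)

lemma contents_bound:
  assumes "valid_ops X n os" "contents os i = Some y"
  shows "i < n \<and> y \<in> X"
  using assms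
proof (induction os arbitrary: y rule: rev_induct)
  case Nil
  then show ?case by (simp add: contents_def)
next
  case (snoc a os)
  then show ?case
    by (cases a) (auto simp: contents_snoc valid_ops_snoc split: if_splits)
qed

lemma count_list_conv_card: "count_list xs h = card {t. t < length xs \<and> xs ! t = h}"
proof -
  have "count_list xs h = length (filter (\<lambda>y. y = h) xs)"
    by (induction xs) auto
  then show ?thesis by (simp add: length_filter_conv_card)
qed

lemma count_list_take_le: "count_list (take q xs) h \<le> count_list xs h"
proof -
  have "count_list xs h = count_list (take q xs @ drop q xs) h" by simp
  then show ?thesis unfolding count_list_append by simp
qed

lemma sum_list_sum_swap: "(\<Sum>b\<leftarrow>xs. \<Sum>i\<in>I. f i b) = (\<Sum>i\<in>I. \<Sum>b\<leftarrow>xs. f i b :: 'b :: comm_monoid_add)"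
  by (induction xs) (simp_all add: sum.distrib)

text \<open>One arbitrary outcome of the random choices. Invariants and resource bounds hold for
  each of them, and chance enters only through the predicate \<open>lucky\<close>.\<close>

locale lsf_env = lsf +
  fixes E :: "'a env" and D :: data_structure and R0 :: "reg \<Rightarrow> nat"
  assumes word_size: "word_size E = w" and n_pos: "1 \<le> n" and bl_word: "bl < 2 ^ w"
    and prepare: "prepare_code D = lsf_prepare" and insert: "insert_code D = lsf_insert"
    and delete: "delete_code D = lsf_delete" and query: "query_code D = lsf_query"
    and R0: "R0 = lsf_regs w k kap l lt bl A n B FU FQ DQ"
begin

abbreviation upd_tree :: "'a \<Rightarrow> nat \<Rightarrow> bool" where
  "upd_tree y \<equiv> (\<lambda>j. y \<in> snd (filter_stream E j))"

abbreviation qry_tree :: "'a \<Rightarrow> nat \<Rightarrow> bool" where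
  "qry_tree y \<equiv> (\<lambda>j. y \<in> fst (filter_stream E j))"

lemma run: "lsf_run w k kap l lt bl A n B FU FQ DQ cells E"
  by unfold_locales (use word_size cells_word cells_3 in auto)

abbreviation "ws \<equiv> word_stream E"

definition stored_at :: "'a option \<Rightarrow> nat list \<Rightarrow> bool" where
  "stored_at p lv \<longleftrightarrow> (case p of None \<Rightarrow> lv = [] | Some y \<Rightarrow>
     (\<exists>q. lv = take q (leaves (upd_tree y) ws)) \<and> length lv \<le> B \<and>
     (work (upd_tree y) ws \<le> FU \<and> length (leaves (upd_tree y) ws) \<le> B \<longrightarrow> lv = leaves (upd_tree y) ws))"

definition stored :: "(nat \<Rightarrow> 'a option) \<Rightarrow> (nat \<Rightarrow> nat list) \<Rightarrow> bool" where
  "stored P lvs \<longleftrightarrow> (\<forall>i. stored_at (P i) (lvs i))"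

lemma stored_upd: "stored P lvs \<Longrightarrow> stored_at p lv \<Longrightarrow> stored (P(i := p)) (lvs(i := lv))"
  by (simp add: stored_def)

lemma stored_atD: "stored P lvs \<Longrightarrow> stored_at (P i) (lvs i)"
  by (simp add: stored_def)

definition ready :: "'a state \<Rightarrow> (nat \<Rightarrow> 'a option) \<Rightarrow> (nat \<Rightarrow> nat list) \<Rightarrow> bool" where
  "ready s P lvs \<longleftrightarrow> lsf_run.idle w k kap l lt bl A n B FU FQ DQ E (regs s) (areas (mem s)) (filters_drawn s) (words_drawn s) lvs \<and>
     slots s = P \<and> used_space s \<le> 8 * cells \<and> stored P lvs"

text \<open>The start state truncates registers to words, so each parameter has to be below
  \<open>2 ^ w\<close>.\<close>

lemma const_regs_R0: "const_regs (\<lambda>t. R0 t mod 2 ^ w)"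
proof -
  have w: "8 * cells \<le> 2 ^ w" "3 \<le> cells" using cells_word cells_3 by auto
  have "1 * B \<le> n * B" using n_pos by (intro mult_right_mono) auto
  then have b: "B < 2 ^ w" "n * B + 1 < 2 ^ w" "FU < 2 ^ w" "FQ < 2 ^ w" "k < 2 ^ w" "k * 2 ^ kap < 2 ^ w"
    "2 ^ kap < (2::nat) ^ w" "DQ < 2 ^ w"
    using w cells_links cells_FU cells_FQ cells_k cells_blocks DQ_word by linarith+
  have "w < 2 ^ w" by (rule less_exp)
  then have l: "l < 2 ^ w" "l - kap < 2 ^ w" "w - l < 2 ^ w" "l - lt < 2 ^ w" using l_le by linarith+
  have "1 * 2 ^ l * 1 \<le> Suc k * 2 ^ l * (nfilters + 1)" by (intro mult_mono) auto
  from le_less_trans[OF this key_word] have p2: "2 ^ l < (2::nat) ^ w" by (simp only: mult_1 mult_1_right)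
  have p: "k * 2 ^ l < 2 ^ w" by (rule node_less) simp
  have "2 ^ (l - kap) \<le> (2::nat) ^ l" by simp
  then have p3: "2 ^ (l - kap) < (2::nat) ^ w" using p2 by linarith
  have "A \<le> Suc k * A" by simp
  then have a: "A < 2 ^ w" using A_word by linarith
  have nf: "lsf_tree.nfilters k kap bl A = nfilters" ..
  show ?thesis
    unfolding const_regs_def R0 lsf_regs_def
    using b l p p2 p3 a bl_word nfilters_less by (simp add: mod_less)
qed

lemma reaches_Nil_ready: "\<exists>s. reaches E D R0 [] s \<and> ready s (\<lambda>_. None) (\<lambda>_. [])"
proof -
  interpret r: lsf_run w k kap l lt bl A n B FU FQ DQ cells E None "\<lambda>_. None" by (rule run)
  obtain t where t: "r.runs lsf_prepare (\<lambda>R N d e f g. r.fresh R N \<and> f = 0 \<and> g = 0)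
    (\<lambda>R N d e f g. r.idle R N f g (\<lambda>_. [])) t" using r.lsf_prepare by blast
  let ?s0 = "start_state w R0"
  have "areas (\<lambda>_. 0) = (\<lambda>_ _. 0)" by (auto simp: areas_def)
  then have "r.holds (\<lambda>R N d e f g. r.fresh R N \<and> f = 0 \<and> g = 0) ?s0"
    using const_regs_R0 by (simp add: r.holds_def start_state_def r.fresh_def)
  then obtain s where s: "exec E lsf_prepare ?s0 s" "r.holds (\<lambda>R N d e f g. r.idle R N f g (\<lambda>_. [])) s"
    using t unfolding r.runs_def by blast
  have "reaches E D R0 [] s" using s(1) by (intro reaches_Nil) (simp add: prepare word_size)
  moreover have "ready s (\<lambda>_. None) (\<lambda>_. [])"
    using s(2) by (auto simp: ready_def r.holds_def stored_def stored_at_def)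
  ultimately show ?thesis by blast
qed

lemma perform_Insert_ready:
  assumes s: "ready s P lvs" and i: "i < n" "P i = None"
  shows "\<exists>s' lvs'. perform E D (Insert i y) s s' \<and> ready s' (P(i := Some y)) lvs' \<and>
    ops s' \<le> lsf_run.insert_cost B FU \<and> dists s' = 0 \<and> evals s' \<le> nfilters"
proof -
  let ?P = "P(i := Some y)"
  interpret r: lsf_run w k kap l lt bl A n B FU FQ DQ cells E "Some y" ?P by (rule run)
  have lvs: "lvs i = []" using s i stored_atD[of P lvs i] by (auto simp: ready_def stored_at_def)
  let ?s0 = "set_reg 0 i (begin_op (Some y) (s\<lparr>slots := (slots s)(i := Some y)\<rparr>))"
  let ?S = "\<lambda>j. y \<in> side_set UpdateSide (filter_stream E j)"
  have "r.holds (\<lambda>R N d e f g. r.idle R N f g lvs \<and> R 0 = i \<and> d = 0 \<and> e = 0) ?s0"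
    using s by (auto simp: r.holds_def ready_def set_reg_def begin_op_def r.idle_def)
  then obtain s' where s': "exec E lsf_insert ?s0 s'" "ops s' \<le> ops ?s0 + r.insert_cost"
    and h: "r.holds (\<lambda>R N d e f g. d = 0 \<and> e \<le> nfilters \<and> (\<exists>q. let lv = take q (leaves ?S ws) in
       r.idle R N f g (lvs(i := lv)) \<and> length lv \<le> B \<and>
       (work ?S ws \<le> FU \<and> length (leaves ?S ws) \<le> B \<longrightarrow> lv = leaves ?S ws))) s'"
    using r.lsf_insert[OF i(1), where lvs = lvs and y = y and S = ?S, OF lvs refl refl] unfolding r.runs_def by blast
  have S: "?S = upd_tree y" by simp
  obtain q where q: "r.idle (regs s') (areas (mem s')) (filters_drawn s') (words_drawn s') (lvs(i := take q (leaves (upd_tree y) ws)))"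
    "length (take q (leaves (upd_tree y) ws)) \<le> B"
    "work (upd_tree y) ws \<le> FU \<and> length (leaves (upd_tree y) ws) \<le> B \<longrightarrow> take q (leaves (upd_tree y) ws) = leaves (upd_tree y) ws"
    using h unfolding r.holds_def S Let_def by blast
  have "stored ?P (lvs(i := take q (leaves (upd_tree y) ws)))"
  proof (rule stored_upd)
    show "stored P lvs" using s by (simp add: ready_def)
    show "stored_at (Some y) (take q (leaves (upd_tree y) ws))"
      unfolding stored_at_def using q(2,3) by (auto intro: exI[of _ q])
  qed
  then have "ready s' ?P (lvs(i := take q (leaves (upd_tree y) ws)))"
    using q(1) h by (auto simp: ready_def r.holds_def)
  moreover have "perform E D (Insert i y) s s'" using s'(1) by (intro perform_Insert) (simp add: insert)
  moreover have "ops s' \<le> r.insert_cost" "dists s' = 0" "evals s' \<le> nfilters"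
    using s'(2) h by (auto simp: r.holds_def set_reg_def begin_op_def)
  ultimately show ?thesis by blast
qed

lemma perform_Delete_ready:
  assumes s: "ready s P lvs" and i: "i < n"
  shows "\<exists>s' lvs'. perform E D (Delete i) s s' \<and> ready s' (P(i := None)) lvs' \<and>
    ops s' \<le> lsf_run.delete_cost B \<and> dists s' = 0 \<and> evals s' \<le> nfilters"
proof -
  have sl: "slots s = P" using s by (simp add: ready_def)
  interpret r: lsf_run w k kap l lt bl A n B FU FQ DQ cells E "P i" P by (rule run)
  let ?s0 = "set_reg 0 i (begin_op (slots s i) s)"
  have "r.holds (\<lambda>R N d e f g. r.idle R N f g lvs \<and> R 0 = i \<and> d = 0 \<and> e = 0) ?s0"
    using s by (auto simp: r.holds_def ready_def set_reg_def begin_op_def r.idle_def)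
  then obtain s' where s': "exec E lsf_delete ?s0 s'" "ops s' \<le> ops ?s0 + r.delete_cost"
    and h: "r.holds (\<lambda>R N d e f g. d = 0 \<and> e = 0 \<and> r.idle R N f g (lvs(i := []))) s'"
    using r.lsf_delete[OF i] unfolding r.runs_def by blast
  let ?s' = "s'\<lparr>slots := (slots s')(i := None)\<rparr>"
  have "stored (P(i := None)) (lvs(i := []))"
    using s by (intro stored_upd) (auto simp: ready_def stored_at_def)
  then have "ready ?s' (P(i := None)) (lvs(i := []))" using h by (auto simp: ready_def r.holds_def)
  moreover have "perform E D (Delete i) s ?s'" using s'(1) by (intro perform_Delete) (simp add: delete)
  moreover have "ops ?s' \<le> r.delete_cost" "dists ?s' = 0" "evals ?s' \<le> nfilters"
    using s'(2) h by (auto simp: r.holds_def set_reg_def begin_op_def)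
  ultimately show ?thesis by blast
qed

text \<open>An upper bound for the far cells in the buckets of a query. It refers to the full trees
  of the stored points and not to the stored prefixes, so it depends on the contents and the random
  choices, but not on the history of the machine.\<close>

definition far_pairs :: "(nat \<Rightarrow> 'a option) \<Rightarrow> 'a \<Rightarrow> nat" where
  "far_pairs P x = (\<Sum>i<n. case P i of None \<Rightarrow> 0 | Some y \<Rightarrow>
     if distance E x y \<le> threshold E then 0
     else (\<Sum>h\<leftarrow>leaves (qry_tree x) ws. count_list (leaves (upd_tree y) ws) h))"

definition lucky :: "(nat \<Rightarrow> 'a option) \<Rightarrow> 'a \<Rightarrow> 'a \<Rightarrow> bool" where
  "lucky P x y \<longleftrightarrow> work (upd_tree y) ws \<le> FU \<and> length (leaves (upd_tree y) ws) \<le> B \<and>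
     work (qry_tree x) ws \<le> FQ \<and> set (leaves (qry_tree x) ws) \<inter> set (leaves (upd_tree y) ws) \<noteq> {} \<and>
     far_pairs P x < DQ"

text \<open>For a lucky outcome the absence of an answer is contradictory. If all lists were walked,
  the common bucket contained a cell of the near point; if the budget ran out, \<open>DQ\<close> far
  cells were visited, although there are fewer than \<open>DQ\<close> of them.\<close>

lemma perform_Query_ready:
  assumes s: "ready s P lvs" and P: "\<And>i y. P i = Some y \<Longrightarrow> i < n"
  shows "\<exists>s'. perform E D (Query x) s s' \<and> ready s' P lvs \<and>
    ops s' \<le> lsf_run.query_cost FQ DQ \<and> dists s' \<le> DQ \<and> evals s' \<le> nfilters \<and>
    (\<forall>i y. P i = Some y \<and> distance E x y \<le> threshold E \<and> lucky P x y \<longrightarrow>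
      (\<exists>j y'. regs s' 0 = Suc j \<and> P j = Some y' \<and> distance E x y' \<le> threshold E))"
proof -
  interpret r: lsf_run w k kap l lt bl A n B FU FQ DQ cells E "Some x" P by (rule run)
  let ?s0 = "begin_op (Some x) s"
  let ?S = "\<lambda>j. x \<in> side_set QuerySide (filter_stream E j)"
  have S: "?S = qry_tree x" by simp
  have st: "stored P lvs" using s by (simp add: ready_def)
  have lv: "P i = Some y \<Longrightarrow> (\<exists>q. lvs i = take q (leaves (upd_tree y) ws)) \<and> length (lvs i) \<le> B \<and>
     (work (upd_tree y) ws \<le> FU \<and> length (leaves (upd_tree y) ws) \<le> B \<longrightarrow> lvs i = leaves (upd_tree y) ws)"
    and lv0: "P i = None \<Longrightarrow> lvs i = []" for i y
    using stored_atD[OF st, of i] by (auto simp: stored_at_def)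
  have occ: "lvs j \<noteq> [] \<Longrightarrow> P j \<noteq> None" for j using lv0 by auto
  have h0: "r.holds (\<lambda>R N d e f g. r.idle R N f g lvs \<and> d = 0 \<and> e = 0) ?s0"
    using s by (auto simp: r.holds_def ready_def begin_op_def)
  let ?pre = "\<lambda>R N d e f g. r.idle R N f g lvs \<and> d = 0 \<and> e = 0"
  let ?post = "\<lambda>R N d e f g. d \<le> DQ \<and> e \<le> nfilters \<and> r.idle R N f g lvs \<and> (R 0 \<noteq> 0 \<longrightarrow> r.near x (R 0 - 1)) \<and>
       (R 0 = 0 \<longrightarrow> (\<exists>L q lvl. lvl = take q (leaves (qry_tree x) ws) \<and>
          (work (qry_tree x) ws \<le> FQ \<longrightarrow> lvl = leaves (qry_tree x) ws) \<and>
          (\<forall>h<2 ^ lt. distinct (L h) \<and> set (L h) = {e. entries lvs e = Some h}) \<and>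
          (\<exists>vis rest. concat (map L lvl) = vis @ rest \<and> (\<forall>c\<in>set vis. \<not> r.near x ((c - 1) div B)) \<and>
             (rest = [] \<or> length vis = DQ))))"
  have "r.runs lsf_query ?pre ?post r.query_cost"
    by (rule r.lsf_query) (use occ in auto)
  then obtain s' where s': "exec E lsf_query ?s0 s'" "ops s' \<le> ops ?s0 + r.query_cost" and h: "r.holds ?post s'"
    using h0 unfolding r.runs_def by blast
  have H: "dists s' \<le> DQ" "evals s' \<le> nfilters"
    "r.idle (regs s') (areas (mem s')) (filters_drawn s') (words_drawn s') lvs"
    "regs s' 0 \<noteq> 0 \<longrightarrow> r.near x (regs s' 0 - 1)" "slots s' = P" "used_space s' \<le> 8 * cells"
    and H0: "regs s' 0 = 0 \<longrightarrow> (\<exists>L q lvl. lvl = take q (leaves (qry_tree x) ws) \<and>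
          (work (qry_tree x) ws \<le> FQ \<longrightarrow> lvl = leaves (qry_tree x) ws) \<and>
          (\<forall>h<2 ^ lt. distinct (L h) \<and> set (L h) = {e. entries lvs e = Some h}) \<and>
          (\<exists>vis rest. concat (map L lvl) = vis @ rest \<and> (\<forall>c\<in>set vis. \<not> r.near x ((c - 1) div B)) \<and>
             (rest = [] \<or> length vis = DQ)))"
    using h unfolding r.holds_def by - (elim conjE, assumption)+
  have succ: "\<exists>j y'. regs s' 0 = Suc j \<and> P j = Some y' \<and> distance E x y' \<le> threshold E"
    if near: "P i0 = Some y0" "distance E x y0 \<le> threshold E" and lucky: "lucky P x y0" for i0 y0
  proof (cases "regs s' 0 = 0")
    case False
    then have "r.near x (regs s' 0 - 1)" using H(4) by blast
    then show ?thesis using False unfolding r.near_def by (intro exI[of _ "regs s' 0 - 1"]) auto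
  next
    case True
    let ?lx = "leaves (qry_tree x) ws"
    from mp[OF H0 True] obtain L q lvl vis rest where lvl: "work (qry_tree x) ws \<le> FQ \<longrightarrow> lvl = ?lx"
      and L: "\<forall>h<2 ^ lt. distinct (L h) \<and> set (L h) = {e. entries lvs e = Some h}"
      and W0: "concat (map L lvl) = vis @ rest"
      and vis: "\<forall>c\<in>set vis. \<not> r.near x ((c - 1) div B)" and stop: "rest = [] \<or> length vis = DQ"
      by (elim exE conjE) (rule that)
    have "lvl = ?lx" using lvl lucky by (simp add: lucky_def)
    then have W: "concat (map L ?lx) = vis @ rest" using W0 by simp
    show ?thesis
    proof (cases "rest = []")
      case True
      have full: "lvs i0 = leaves (upd_tree y0) ws" using lv[OF near(1)] lucky by (simp add: lucky_def)
      obtain b where b: "b \<in> set ?lx" "b \<in> set (lvs i0)" using lucky full by (auto simp: lucky_def)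
      then obtain t where t: "t < length (lvs i0)" "lvs i0 ! t = b" by (auto simp: in_set_conv_nth)
      let ?c = "i0 * B + 1 + t"
      have tB: "t < B" using t lv[OF near(1)] by simp
      have i0: "i0 < n" using P near by blast
      have "entries lvs ?c = Some b"
        using cell_decomp[OF tB, of i0] cell_range[OF i0 tB] t by (simp add: entries_def)
      then have "?c \<in> set (L b)" using L leaves_less[OF b(1)] by auto
      then have "?c \<in> set vis" using W True b by auto
      then have "\<not> r.near x i0" using vis cell_decomp(1)[OF tB, of i0] by auto
      then show ?thesis using near by (auto simp: r.near_def)
    next
      case False
      then have len: "length vis = DQ" using stop by simp
      let ?far = "\<lambda>c. \<not> r.near x ((c - 1) div B)"
      define cnt where "cnt i b = (case P i of None \<Rightarrow> 0 | Some y \<Rightarrow>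
         if distance E x y \<le> threshold E then 0 else count_list (leaves (upd_tree y) ws) b)" for i b
      \<comment> \<open>A cell is determined by its identifier and its position in the stored list.
        The stored list is a prefix of the leaves, so replacing it by all leaves can only increase
        the count.\<close>
      have per: "length (filter ?far (L b)) \<le> (\<Sum>i<n. cnt i b)" if b: "b < 2 ^ lt" for b
      proof -
        let ?A = "{e. entries lvs e = Some b \<and> ?far e}"
        let ?B = "SIGMA i:{i. i < n \<and> \<not> r.near x i}. {t. t < length (lvs i) \<and> lvs i ! t = b}"
        have "distinct (filter ?far (L b))" using L b by simp
        then have "length (filter ?far (L b)) = card (set (filter ?far (L b)))"
          by (rule distinct_card[symmetric])
        also have "set (filter ?far (L b)) = ?A" using L b by auto
        also have "card ?A \<le> card ?B"
        proof (rule card_inj_on_le)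
          show "inj_on (\<lambda>e. ((e - 1) div B, (e - 1) mod B)) ?A"
          proof (rule inj_onI)
            fix e e' assume e: "e \<in> ?A" "e' \<in> ?A"
              and eq: "((e - 1) div B, (e - 1) mod B) = ((e' - 1) div B, (e' - 1) mod B)"
            then have "e - 1 = e' - 1" by (metis div_mult_mod_eq prod.inject)
            moreover have "1 \<le> e" "1 \<le> e'" using e by (auto simp: entries_def split: if_splits)
            ultimately show "e = e'" by simp
          qed
          show "(\<lambda>e. ((e - 1) div B, (e - 1) mod B)) ` ?A \<subseteq> ?B"
          proof
            fix z assume "z \<in> (\<lambda>e. ((e - 1) div B, (e - 1) mod B)) ` ?A"
            then obtain e where e: "e \<in> ?A" "z = ((e - 1) div B, (e - 1) mod B)" by blast
            then have en: "1 \<le> e" "e \<le> n * B" "(e - 1) mod B < length (lvs ((e - 1) div B))"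
              "lvs ((e - 1) div B) ! ((e - 1) mod B) = b"
              by (auto simp: entries_def split: if_splits)
            have "e - 1 < n * B" using en(1,2) by linarith
            then have "(e - 1) div B < n" by (simp add: less_mult_imp_div_less)
            then show "z \<in> ?B" using e en by auto
          qed
          show "finite ?B" by auto
        qed
        also have "card ?B = (\<Sum>i\<in>{i. i < n \<and> \<not> r.near x i}. count_list (lvs i) b)"
          by (subst card_SigmaI) (auto simp: count_list_conv_card)
        also have "\<dots> \<le> (\<Sum>i\<in>{i. i < n \<and> \<not> r.near x i}. cnt i b)"
        proof (rule sum_mono)
          fix i assume i: "i \<in> {i. i < n \<and> \<not> r.near x i}"
          show "count_list (lvs i) b \<le> cnt i b"
          proof (cases "P i")
            case None
            then show ?thesis using lv0 by (simp add: cnt_def)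
          next
            case (Some y)
            then have "\<not> distance E x y \<le> threshold E" using i by (auto simp: r.near_def)
            moreover obtain q where "lvs i = take q (leaves (upd_tree y) ws)" using lv[OF Some] by blast
            ultimately show ?thesis using Some by (simp add: cnt_def count_list_take_le)
          qed
        qed
        also have "\<dots> \<le> (\<Sum>i<n. cnt i b)" by (rule sum_mono2) auto
        finally show ?thesis .
      qed
      have "DQ = length (filter ?far vis)" using len vis by (simp add: filter_True)
      also have "\<dots> \<le> length (filter ?far (concat (map L ?lx)))" unfolding W by simp
      also have "\<dots> = (\<Sum>b\<leftarrow>?lx. length (filter ?far (L b)))"
        by (simp add: filter_concat length_concat comp_def)
      also have "\<dots> \<le> (\<Sum>b\<leftarrow>?lx. \<Sum>i<n. cnt i b)"
        by (rule sum_list_mono) (use per leaves_less in blast)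
      also have "\<dots> = (\<Sum>i<n. \<Sum>b\<leftarrow>?lx. cnt i b)"
        by (rule sum_list_sum_swap)
      also have "\<dots> = far_pairs P x"
        unfolding far_pairs_def cnt_def by (intro sum.cong refl) (simp split: option.split)
      finally show ?thesis using lucky by (simp add: lucky_def)
    qed
  qed
  have "ready s' P lvs" unfolding ready_def using H st by (intro conjI)
  moreover have "perform E D (Query x) s s'" using s'(1) by (intro perform_Query) (simp add: query)
  moreover have "ops s' \<le> r.query_cost" using s'(2) by (simp add: begin_op_def)
  ultimately show ?thesis using succ H(1,2) by (intro exI[of _ s'] conjI allI impI) (assumption | blast)+
qed

definition update_cost :: nat where
  "update_cost = lsf_run.insert_cost B FU + lsf_run.delete_cost B"

lemma reaches_ready:
  assumes "valid_ops X n os"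
  shows "\<exists>s lvs. reaches E D R0 os s \<and> ready s (contents os) lvs \<and>
    (os \<noteq> [] \<longrightarrow> (case last os of
        Query x \<Rightarrow> ops s \<le> lsf_run.query_cost FQ DQ \<and> dists s \<le> DQ \<and> evals s \<le> nfilters
      | _ \<Rightarrow> ops s \<le> update_cost \<and> dists s = 0 \<and> evals s \<le> nfilters))"
  using assms
proof (induction os rule: rev_induct)
  case Nil
  then show ?case using reaches_Nil_ready by (auto simp: contents_def)
next
  case (snoc a os)
  then have v: "valid_ops X n os" and adm: "admissible X n (contents os) a" by (auto simp: valid_ops_snoc)
  from snoc.IH[OF v] obtain s lvs where s: "reaches E D R0 os s" "ready s (contents os) lvs" by blast
  show ?case
  proof (cases a)
    case (Insert i y)
    then have "i < n" "contents os i = None" using adm by auto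
    from perform_Insert_ready[OF s(2) this, of y] obtain s' lvs' where s':
      "perform E D (Insert i y) s s'" "ready s' ((contents os)(i := Some y)) lvs'"
      "ops s' \<le> lsf_run.insert_cost B FU" "dists s' = 0" "evals s' \<le> nfilters" by blast
    have "reaches E D R0 (os @ [a]) s'" using s(1) s'(1) unfolding Insert by (rule reaches_snoc)
    then show ?thesis using s' Insert
      by (intro exI[of _ s'] exI[of _ lvs']) (auto simp: contents_snoc update_cost_def fun_upd_def)
  next
    case (Delete i)
    then obtain y where "contents os i = Some y" using adm by auto
    then have "i < n" using contents_bound[OF v] by blast
    from perform_Delete_ready[OF s(2) this] obtain s' lvs' where s':
      "perform E D (Delete i) s s'" "ready s' ((contents os)(i := None)) lvs'"
      "ops s' \<le> lsf_run.delete_cost B" "dists s' = 0" "evals s' \<le> nfilters" by blast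
    have "reaches E D R0 (os @ [a]) s'" using s(1) s'(1) unfolding Delete by (rule reaches_snoc)
    then show ?thesis using s' Delete
      by (intro exI[of _ s'] exI[of _ lvs']) (auto simp: contents_snoc update_cost_def fun_upd_def)
  next
    case (Query x)
    from perform_Query_ready[OF s(2), of x] contents_bound[OF v] obtain s' where s':
      "perform E D (Query x) s s'" "ready s' (contents os) lvs"
      "ops s' \<le> lsf_run.query_cost FQ DQ" "dists s' \<le> DQ" "evals s' \<le> nfilters" by blast
    have "reaches E D R0 (os @ [a]) s'" using s(1) s'(1) unfolding Query by (rule reaches_snoc)
    then show ?thesis using s' Query
      by (intro exI[of _ s'] exI[of _ lvs]) (auto simp: contents_snoc)
  qed
qed

lemma ready_draws: "ready s P lvs \<Longrightarrow> filters_drawn s = nfilters \<and> words_drawn s = k \<and> used_space s \<le> 8 * cells"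
proof -
  assume a: "ready s P lvs"
  interpret r: lsf_run w k kap l lt bl A n B FU FQ DQ cells E None "\<lambda>_. None" by (rule run)
  show ?thesis using a by (auto simp: ready_def r.idle_def)
qed

lemma reaches_lucky:
  assumes v: "valid_ops X n os" and y: "contents os i = Some y" "distance E x y \<le> threshold E"
    and lucky: "lucky (contents os) x y"
  shows "\<exists>s. reaches E D R0 (os @ [Query x]) s \<and> correct_answer (distance E) (threshold E) (contents os) x s"
proof -
  from reaches_ready[OF v] obtain s lvs where s: "reaches E D R0 os s" "ready s (contents os) lvs" by blast
  from perform_Query_ready[OF s(2), of x] contents_bound[OF v] obtain s' where s':
    "perform E D (Query x) s s'"
    "\<forall>i y. contents os i = Some y \<and> distance E x y \<le> threshold E \<and> lucky (contents os) x y \<longrightarrow>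
      (\<exists>j y'. regs s' 0 = Suc j \<and> contents os j = Some y' \<and> distance E x y' \<le> threshold E)" by blast
  have "reaches E D R0 (os @ [Query x]) s'" using s(1) s'(1) by (rule reaches_snoc)
  moreover have "correct_answer (distance E) (threshold E) (contents os) x s'"
    using s'(2) y lucky unfolding correct_answer_def by blast
  ultimately show ?thesis by blast
qed

end

section \<open>Multiply-shift hashing\<close>

text \<open>Residues with the same leading part differ by less than \<open>m\<close>, so on the
  cycle of length \<open>W\<close> their difference is close to 0 from one side or the other. These
  two sides are the origin of the 2 in the collision probability \<open>2 / 2 ^ l'\<close>.\<close>

lemma mod_diff_close:
  fixes x y W m :: nat
  assumes eq: "x mod W div m = y mod W div m" and m: "0 < m" and W: "0 < W" and le: "y \<le> x"
  shows "(x - y) mod W < m \<or> W - m < (x - y) mod W"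
proof -
  define p where "p = x mod W"
  define q where "q = y mod W"
  have pq: "p < W" "q < W" using W by (auto simp: p_def q_def)
  have close: "p < q + m \<and> q < p + m"
  proof -
    have "p = p div m * m + p mod m" "q = q div m * m + q mod m" by simp_all
    moreover have "p div m = q div m" using eq by (simp add: p_def q_def)
    moreover have "p mod m < m" "q mod m < m" using m by auto
    ultimately have "p = p div m * m + p mod m" "q = p div m * m + q mod m" "p mod m < m" "q mod m < m"
      by auto
    then show ?thesis by linarith
  qed
  have "int ((x - y) mod W) = (int x - int y) mod int W"
    using le by (simp add: zmod_int of_nat_diff)
  also have "\<dots> = (int p - int q) mod int W"
    unfolding p_def q_def by (simp add: zmod_int mod_simps)
  finally have d: "int ((x - y) mod W) = (int p - int q) mod int W" .
  show ?thesis
  proof (cases "q \<le> p")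
    case True
    then have "(int p - int q) mod int W = int p - int q" using pq by (intro mod_pos_pos_trivial) auto
    then show ?thesis using d close True by linarith
  next
    case False
    have "(int p - int q) mod int W = (int p - int q + int W) mod int W" by simp
    also have "\<dots> = int p - int q + int W" using pq False by (intro mod_pos_pos_trivial) auto
    finally show ?thesis using d close False pq by linarith
  qed
qed

lemma card_residues_le:
  assumes "finite C" "C \<subseteq> {..<M}"
  shows "card {b :: nat. b < r * M \<and> b mod M \<in> C} \<le> r * card C"
proof -
  have "card {b. b < r * M \<and> b mod M \<in> C} \<le> card ({..<r} \<times> C)"
  proof (rule card_inj_on_le)
    show "inj_on (\<lambda>b. (b div M, b mod M)) {b. b < r * M \<and> b mod M \<in> C}"
    proof (rule inj_onI)
      fix a b assume "(a div M, a mod M) = (b div M, b mod M)"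
      then have "a div M * M + a mod M = b div M * M + b mod M" by simp
      then show "a = b" by simp
    qed
    show "(\<lambda>b. (b div M, b mod M)) ` {b. b < r * M \<and> b mod M \<in> C} \<subseteq> {..<r} \<times> C"
      by (auto simp: less_mult_imp_div_less)
    show "finite ({..<r} \<times> C)" using assms by simp
  qed
  then show ?thesis by (simp only: card_cartesian_product card_lessThan)
qed

lemma odd_part_exists: "(n :: nat) \<noteq> 0 \<Longrightarrow> \<exists>r u. n = 2 ^ r * u \<and> odd u"
proof (induction n rule: less_induct)
  case (less n)
  show ?case
  proof (cases "odd n")
    case True
    then show ?thesis by (intro exI[of _ 0] exI[of _ n]) simp
  next
    case False
    then have "even n" by simp
    then obtain m where m: "n = 2 * m" by (elim evenE)
    then obtain r u where "m = 2 ^ r * u" "odd u" using less.IH[of m] less.prems by auto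
    then show ?thesis using m by (intro exI[of _ "Suc r"] exI[of _ u]) simp
  qed
qed

lemma odd_mult_mod_inj:
  fixes u a b :: nat
  assumes "odd u" "u * a mod 2 ^ w = u * b mod 2 ^ w" "a < 2 ^ w" "b < 2 ^ w"
  shows "a = b"
  using assms(2-4)
proof (induction a b rule: linorder_wlog)
  case (le a b)
  have "2 ^ w dvd u * b - u * a"
    using le by (subst mod_eq_dvd_iff_nat[symmetric]) auto
  then have "2 ^ w dvd u * (b - a)" by (simp add: diff_mult_distrib2)
  moreover have "coprime (2 ^ w) u" using assms(1) by simp
  ultimately have "2 ^ w dvd b - a" using coprime_dvd_mult_right_iff by blast
  then have "\<not> 0 < b - a" using le by (auto dest: dvd_imp_le)
  then show ?case using le by simp
qed auto

text \<open>Multiplication by the odd part of the difference of the keys permutes the words, so only the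
  power of two in the difference matters; it leaves the leading bits uniform.\<close>

lemma multiply_shift_collision_less:
  fixes v v' :: nat
  assumes vv: "v' < v" and v: "v < 2 ^ (w - l)" and l: "l' \<le> l" "l \<le> w"
  shows "card {a. a < 2 ^ w \<and> v * a mod 2 ^ w div 2 ^ (w - l') = v' * a mod 2 ^ w div 2 ^ (w - l')}
    \<le> 2 * 2 ^ (w - l')" (is "card ?A \<le> _")
proof -
  define m where "m = w - l'"
  have "v - v' \<noteq> 0" using vv by simp
  then obtain r u where ru: "v - v' = 2 ^ r * u" "odd u"
    using odd_part_exists by blast
  have "2 ^ r * 1 \<le> 2 ^ r * u" using ru(2) by (intro mult_left_mono) (auto elim: oddE)
  then have "2 ^ r < (2::nat) ^ (w - l)" using ru(1) v by linarith
  \<comment> \<open>Because keys have at most \<open>w - l\<close> bits, the power of two dividing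
    their difference cannot reach the bits that are extracted.\<close>
  then have "r < w - l" by simp
  then have r: "r \<le> m" "r \<le> w" using l unfolding m_def by auto
  have mw: "m \<le> w" unfolding m_def by simp
  let ?M = "2 ^ (w - r) :: nat"
  let ?C = "{c. c < 2 ^ (m - r)} \<union> {c. ?M - 2 ^ (m - r) < c \<and> c < ?M}"
  have W: "2 ^ w = 2 ^ r * ?M" using r by (simp flip: power_add)
  have mm: "2 ^ m = 2 ^ r * (2::nat) ^ (m - r)" using r by (simp flip: power_add)
  have mM: "(2::nat) ^ (m - r) \<le> ?M" using mw by simp
  have "card ?A \<le> card {b. b < 2 ^ r * ?M \<and> b mod ?M \<in> ?C}"
  proof (rule card_inj_on_le)
    show "inj_on (\<lambda>a. u * a mod 2 ^ w) ?A"
      using ru(2) by (auto intro!: inj_onI dest: odd_mult_mod_inj)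
    show "(\<lambda>a. u * a mod 2 ^ w) ` ?A \<subseteq> {b. b < 2 ^ r * ?M \<and> b mod ?M \<in> ?C}"
    proof (intro image_subsetI CollectI conjI)
      fix a assume "a \<in> ?A"
      then have a: "a < 2 ^ w" "v * a mod 2 ^ w div 2 ^ (w - l') = v' * a mod 2 ^ w div 2 ^ (w - l')" by auto
      let ?b = "u * a mod 2 ^ w"
      show "?b < 2 ^ r * ?M" unfolding W[symmetric] by simp
      have "v * a - v' * a = 2 ^ r * (u * a)"
        unfolding diff_mult_distrib[symmetric] ru(1) by (rule mult.assoc)
      moreover have "(v * a - v' * a) mod 2 ^ w < 2 ^ m \<or> 2 ^ w - 2 ^ m < (v * a - v' * a) mod 2 ^ w"
        using a(2) vv unfolding m_def by (intro mod_diff_close) auto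
      ultimately have "2 ^ r * (u * a) mod 2 ^ w < 2 ^ m \<or> 2 ^ w - 2 ^ m < 2 ^ r * (u * a) mod 2 ^ w" by simp
      moreover have "2 ^ r * (u * a) mod 2 ^ w = 2 ^ r * (u * a mod ?M)"
        unfolding W by (rule mult_mod_right[symmetric])
      moreover have "u * a mod ?M = ?b mod ?M" unfolding W by (rule mod_mod_cancel[symmetric]) (rule dvd_triv_right)
      ultimately have "2 ^ r * (?b mod ?M) < 2 ^ r * 2 ^ (m - r) \<or>
          2 ^ r * ?M - 2 ^ r * 2 ^ (m - r) < 2 ^ r * (?b mod ?M)"
        by (simp only: W mm)
      then have "?b mod ?M < 2 ^ (m - r) \<or> ?M - 2 ^ (m - r) < ?b mod ?M"
        unfolding diff_mult_distrib2[symmetric] by (simp only: nat_mult_less_cancel1 zero_less_power zero_less_numeral)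
      moreover have "?b mod ?M < ?M" by simp
      ultimately show "?b mod ?M \<in> ?C" by blast
    qed
    show "finite {b. b < 2 ^ r * ?M \<and> b mod ?M \<in> ?C}" by simp
  qed
  also have "\<dots> \<le> 2 ^ r * card ?C"
  proof (rule card_residues_le)
    show "?C \<subseteq> {..<?M}" using less_le_trans[OF _ mM] by blast
  qed simp
  also have "card ?C \<le> 2 ^ (m - r) + 2 ^ (m - r)"
  proof (rule order_trans[OF card_Un_le add_mono])
    show "card {c. c < (2::nat) ^ (m - r)} \<le> 2 ^ (m - r)" by simp
    have "{c. ?M - 2 ^ (m - r) < c \<and> c < ?M} = {?M - 2 ^ (m - r)<..<?M}" by auto
    then show "card {c. ?M - 2 ^ (m - r) < c \<and> c < ?M} \<le> 2 ^ (m - r)" using mM by simp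
  qed
  finally have "card ?A \<le> 2 ^ r * (2 ^ (m - r) + 2 ^ (m - r))" by simp
  also have "\<dots> = 2 * 2 ^ m" unfolding mm by simp
  finally show ?thesis unfolding m_def .
qed

lemma multiply_shift_collision:
  fixes v v' :: nat
  assumes "v \<noteq> v'" "v < 2 ^ (w - l)" "v' < 2 ^ (w - l)" "l' \<le> l" "l \<le> w"
  shows "card {a. a < 2 ^ w \<and> v * a mod 2 ^ w div 2 ^ (w - l') = v' * a mod 2 ^ w div 2 ^ (w - l')}
    \<le> 2 * 2 ^ (w - l')"
proof (cases "v' < v")
  case True
  then show ?thesis using assms by (intro multiply_shift_collision_less) auto
next
  case False
  then have "v < v'" using assms by simp
  from multiply_shift_collision_less[OF this assms(3,4,5)] show ?thesis
    by (simp add: eq_commute)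
qed

section \<open>Uniform words and integrals over discrete distributions\<close>

definition word_pmf :: "nat \<Rightarrow> nat pmf" where
  "word_pmf w = pmf_of_set {..<2 ^ w}"

lemma nn_integral_word_le:
  assumes "card {a. a < 2 ^ w \<and> P a} \<le> 2 * 2 ^ (w - l')" "l' \<le> w"
  shows "(\<integral>\<^sup>+a. of_bool (P a) \<partial>word_pmf w) \<le> ennreal (2 / 2 ^ l')"
proof -
  have "0 \<in> {..<(2::nat) ^ w}" by simp
  then have ne: "{..<(2::nat) ^ w} \<noteq> {}" "finite {..<(2::nat) ^ w}" by blast+
  have "(\<integral>\<^sup>+a. of_bool (P a) \<partial>word_pmf w) = (\<integral>\<^sup>+a. indicator {a. P a} a \<partial>word_pmf w)"
    by (intro nn_integral_cong) (auto simp: indicator_def)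
  also have "\<dots> = emeasure (word_pmf w) {a. P a}" by (rule nn_integral_indicator) simp
  also have "\<dots> = ennreal (real (card ({..<2 ^ w} \<inter> {a. P a})) / 2 ^ w)"
    unfolding word_pmf_def by (simp add: emeasure_pmf_of_set[OF ne])
  also have "{..<2 ^ w} \<inter> {a. P a} = {a. a < 2 ^ w \<and> P a}" by auto
  also have "real (card {a. a < 2 ^ w \<and> P a}) / 2 ^ w \<le> 2 / 2 ^ l'"
  proof -
    have "real (card {a. a < 2 ^ w \<and> P a}) \<le> real (2 * 2 ^ (w - l'))" using assms(1) by (rule of_nat_mono)
    also have "\<dots> = 2 / 2 ^ l' * 2 ^ w"
    proof -
      have "(2::real) ^ w = 2 ^ l' * 2 ^ (w - l')" using assms(2) by (simp flip: power_add)
      then show ?thesis by simp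
    qed
    finally show ?thesis by (simp add: divide_le_eq)
  qed
  then have "ennreal (real (card {a. a < 2 ^ w \<and> P a}) / 2 ^ w) \<le> ennreal (2 / 2 ^ l')" by (rule ennreal_leI)
  finally show ?thesis .
qed

lemma nn_integral_pmf_swap:
  "(\<integral>\<^sup>+a. \<integral>\<^sup>+b. f a b \<partial>measure_pmf B \<partial>measure_pmf A) = (\<integral>\<^sup>+b. \<integral>\<^sup>+a. f a b \<partial>measure_pmf A \<partial>measure_pmf B)"
proof -
  have "(\<integral>\<^sup>+x. f (fst x) (snd x) \<partial>pair_pmf A B) = (\<integral>\<^sup>+x. f (snd x) (fst x) \<partial>pair_pmf B A)"
    by (subst pair_commute_pmf) (simp add: case_prod_beta)
  then show ?thesis by (simp add: nn_integral_pair_pmf')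
qed

lemma nn_integral_sum_list:
  "(\<integral>\<^sup>+x. (\<Sum>i\<leftarrow>xs. f i x) \<partial>measure_pmf M) = (\<Sum>i\<leftarrow>xs. \<integral>\<^sup>+x. f i x \<partial>measure_pmf M)"
  by (induction xs) (simp_all add: nn_integral_add)

lemma sum_list_mono_ennreal:
  "(\<And>x. x \<in> set xs \<Longrightarrow> f x \<le> g x) \<Longrightarrow> (\<Sum>x\<leftarrow>xs. f x) \<le> (\<Sum>x\<leftarrow>xs. g x :: ennreal)"
  by (induction xs) (auto intro: add_mono)

lemma sum_list_cmult: "(\<Sum>x\<leftarrow>xs. c * f x) = c * (\<Sum>x\<leftarrow>xs. f x :: ennreal)"
  by (induction xs) (auto simp: distrib_left)

text \<open>The two ways in which a pair of paths can meet the filters of a level: different filters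
  are independent, while a shared filter has to contain both points at once.\<close>

lemma nn_integral_Pi_pmf_two:
  fixes p :: "'f pmf"
  assumes "finite A" "i \<in> A" "i' \<in> A"
  shows "(\<integral>\<^sup>+x. of_bool (S (x i)) * of_bool (S' (x i')) \<partial>Pi_pmf A d (\<lambda>_. p)) =
    (if i = i' then ennreal (measure_pmf.prob p {f. S f \<and> S' f})
     else ennreal (measure_pmf.prob p {f. S f} * measure_pmf.prob p {f. S' f}))"
proof -
  let ?B = "\<lambda>j. {f. (j = i \<longrightarrow> S f) \<and> (j = i' \<longrightarrow> S' f)}"
  have "(\<integral>\<^sup>+x. of_bool (S (x i)) * of_bool (S' (x i')) \<partial>Pi_pmf A d (\<lambda>_. p)) =
    (\<integral>\<^sup>+x. indicator (Pi A ?B) x \<partial>Pi_pmf A d (\<lambda>_. p))"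
    using assms by (intro nn_integral_cong) (auto simp: indicator_def Pi_def)
  also have "\<dots> = ennreal (measure_pmf.prob (Pi_pmf A d (\<lambda>_. p)) (Pi A ?B))"
    by (simp add: measure_pmf.emeasure_eq_measure)
  also have "measure_pmf.prob (Pi_pmf A d (\<lambda>_. p)) (Pi A ?B) = (\<Prod>j\<in>A. measure_pmf.prob p (?B j))"
    using assms(1) by (rule measure_Pi_pmf_Pi)
  also have "\<dots> = (\<Prod>j\<in>{i, i'}. measure_pmf.prob p (?B j))"
    using assms by (intro prod.mono_neutral_right) auto
  finally show ?thesis by (cases "i = i'") auto
qed

section \<open>Moments of the filter tree\<close>

lemma sum_list_concat_map: "(\<Sum>x\<leftarrow>concat (map f xs). g x) = (\<Sum>y\<leftarrow>xs. \<Sum>x\<leftarrow>f y. g x :: 'b :: comm_monoid_add)"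
  by (induction xs) simp_all

lemma sum_list_filter_upt:
  "(\<Sum>i\<leftarrow>filter P [a..<b]. g i) = (\<Sum>i=a..<b. of_bool (P i) * g i :: ennreal)"
proof -
  have "(\<Sum>i\<leftarrow>filter P xs. g i) = (\<Sum>i\<leftarrow>xs. of_bool (P i) * g i)" for xs
    by (induction xs) simp_all
  then show ?thesis by (simp add: interv_sum_list_conv_sum_set_nat)
qed

section \<open>Filters and multipliers seen by each level\<close>

context lsf_tree
begin

lemma start_Suc: "start (Suc G) = start G + block_size (G div 2 ^ kap)"
  by (simp add: start_def)

definition cells_of :: "nat \<Rightarrow> nat set" where
  "cells_of N = {start (block N)..<start (Suc (block N))}"

lemma block_div: "block N div 2 ^ kap = N div 2 ^ l"
  unfolding block_def using kap_le by (simp flip: div_mult2_eq power_add)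

lemma card_cells_of: "card (cells_of N) = block_size (N div 2 ^ l)" "finite (cells_of N)"
  by (simp_all add: cells_of_def start_Suc block_div)

definition level :: "nat \<Rightarrow> nat set" where
  "level j = {start (j * 2 ^ kap)..<start (Suc j * 2 ^ kap)}"

lemma cells_of_level:
  assumes "N div 2 ^ l = j"
  shows "cells_of N \<subseteq> level j"
proof -
  have d: "block N div 2 ^ kap = j" using assms by (simp add: block_div)
  have "j * 2 ^ kap \<le> block N" unfolding d[symmetric] by simp
  moreover have "Suc (block N) \<le> Suc j * 2 ^ kap"
    unfolding d[symmetric] using dividend_less_div_times[of "2 ^ kap" "block N"] by simp
  ultimately show ?thesis
    unfolding cells_of_def level_def using start_mono by (auto dest: start_mono)
qed

lemma cells_of_disjoint:
  assumes "block N \<noteq> block N'"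
  shows "cells_of N \<inter> cells_of N' = {}"
proof -
  have "Suc (block N) \<le> block N' \<or> Suc (block N') \<le> block N" using assms by linarith
  then show ?thesis unfolding cells_of_def using start_mono by fastforce
qed

lemma level_upto: "j \<le> k \<Longrightarrow> start (j * 2 ^ kap) \<le> nfilters"
  unfolding nfilters_def by (intro start_mono mult_right_mono) auto

lemma cells_of_less:
  assumes "N div 2 ^ l < j" "i \<in> cells_of N"
  shows "i < start (j * 2 ^ kap)"
proof -
  have "i < start (Suc (N div 2 ^ l) * 2 ^ kap)" using cells_of_level[OF refl, of N] assms(2) by (auto simp: level_def)
  also have "\<dots> \<le> start (j * 2 ^ kap)" using assms(1) by (intro start_mono mult_right_mono) auto
  finally show ?thesis .
qed

text \<open>Blocks are numbered level by level, so a front depends on an initial segment of the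
  filters and of the multipliers. This is what permits conditioning on the past, one level at a
  time.\<close>

lemma front_cong:
  assumes "\<And>i. i < start (j * 2 ^ kap) \<Longrightarrow> S i = S' i" "\<And>i. i < j \<Longrightarrow> ws i = ws' i"
  shows "front S ws j = front S' ws' j"
  using assms
proof (induction j)
  case (Suc j)
  have "start (j * 2 ^ kap) \<le> start (Suc j * 2 ^ kap)" by (intro start_mono) simp
  then have eq: "front S ws j = front S' ws' j" using Suc by auto
  have "children S ws N = children S' ws' N" if "N \<in> set (front S ws j)" for N
  proof -
    have N: "N div 2 ^ l = j" using that by (rule front_level)
    have "filter S [start (block N)..<start (Suc (block N))] = filter S' [start (block N)..<start (Suc (block N))]"
      using cells_of_less[of N "Suc j"] N Suc.prems(1) by (intro filter_cong) (auto simp: cells_of_def)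
    moreover have "child ws N = child ws' N"
      using N Suc.prems(2)[of j] by (intro ext) (simp add: child_def)
    ultimately show ?thesis by (simp add: children_def)
  qed
  then show ?case using eq by (simp cong: map_cong)
qed simp

definition node :: "nat \<Rightarrow> nat \<Rightarrow> nat \<Rightarrow> nat \<Rightarrow> nat" where
  "node j a N i = Suc j * 2 ^ l + hash a (N * nfilters + i)"

text \<open>Separates the past, given by \<open>S0\<close> and \<open>ws\<close>, from the fresh
  filters \<open>S\<close> and the fresh multiplier \<open>a\<close> of level \<open>j\<close>. With
  the past fixed, the right-hand side is a finite sum in which each random choice appears
  explicitly.\<close>

lemma sum_front_Suc:
  assumes j: "j < k" and fs: "\<And>i. i \<in> level j \<Longrightarrow> S' i = S i" and old: "\<And>i. i < start (j * 2 ^ kap) \<Longrightarrow> S' i = S0 i"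
    and ws: "\<And>i. i < j \<Longrightarrow> ws' i = ws i" "ws' j = a"
  shows "(\<Sum>M\<leftarrow>front S' ws' (Suc j). g M) =
    (\<Sum>N\<leftarrow>front S0 ws j. \<Sum>i\<in>cells_of N. of_bool (S i) * g (node j a N i) :: ennreal)"
proof -
  have f: "front S' ws' j = front S0 ws j" using old ws by (intro front_cong) auto
  have "(\<Sum>M\<leftarrow>front S' ws' (Suc j). g M) = (\<Sum>N\<leftarrow>front S0 ws j. \<Sum>M\<leftarrow>children S' ws' N. g M)"
    by (simp add: sum_list_concat_map f)
  also have "\<dots> = (\<Sum>N\<leftarrow>front S0 ws j. \<Sum>i\<in>cells_of N. of_bool (S i) * g (node j a N i))"
  proof (intro arg_cong[where f = sum_list] map_cong refl)
    fix N assume "N \<in> set (front S0 ws j)"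
    then have N: "N div 2 ^ l = j" by (rule front_level)
    then have "N < k * 2 ^ l" using j by (simp add: div_less_iff_less_mult[symmetric])
    then have "(\<Sum>M\<leftarrow>children S' ws' N. g M) =
      (\<Sum>i\<leftarrow>filter S' [start (block N)..<start (Suc (block N))]. g (child ws' N i))"
      by (simp add: children_def comp_def)
    also have "\<dots> = (\<Sum>i\<in>cells_of N. of_bool (S' i) * g (child ws' N i))"
      by (simp add: sum_list_filter_upt cells_of_def)
    also have "\<dots> = (\<Sum>i\<in>cells_of N. of_bool (S i) * g (node j a N i))"
    proof (rule sum.cong)
      fix i assume "i \<in> cells_of N"
      then have "S' i = S i" using cells_of_level[OF N] fs by blast
      moreover have "child ws' N i = node j a N i" using N ws by (simp add: child_def node_def)
      ultimately show "of_bool (S' i) * g (child ws' N i) = of_bool (S i) * g (node j a N i)" by simp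
    qed simp
    finally show "(\<Sum>M\<leftarrow>children S' ws' N. g M) = (\<Sum>i\<in>cells_of N. of_bool (S i) * g (node j a N i))" .
  qed
  finally show ?thesis .
qed

end

section \<open>Revealing the randomness level by level\<close>

locale lsf_prob = lsf_tree +
  fixes p :: "'f pmf" and dflt :: 'f
  assumes keys: "Suc k * 2 ^ l * (nfilters + 1) * 2 ^ l \<le> 2 ^ w"
begin

definition outcome :: "nat \<Rightarrow> ((nat \<Rightarrow> 'f) \<times> (nat \<Rightarrow> nat)) pmf" where
  "outcome j = pair_pmf (Pi_pmf {..<start (j * 2 ^ kap)} dflt (\<lambda>_. p)) (Pi_pmf {..<j} 0 (\<lambda>_. word_pmf w))"

abbreviation "merge_level j fs fl \<equiv> (\<lambda>i. if i < start (j * 2 ^ kap) then fs i else fl i)"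

text \<open>The past is integrated outermost, then the filters of the new level, then its
  multiplier. All three are independent, so the inner integrals are conditional expectations for a
  fixed front.\<close>

lemma outcome_Suc:
  "(\<integral>\<^sup>+x. \<phi> (fst x) (snd x) \<partial>outcome (Suc j)) = (\<integral>\<^sup>+x. \<integral>\<^sup>+fl. \<integral>\<^sup>+a.
     \<phi> (merge_level j (fst x) fl) ((snd x)(j := a)) \<partial>word_pmf w \<partial>Pi_pmf (level j) dflt (\<lambda>_. p) \<partial>outcome j)"
proof -
  let ?P = "Pi_pmf {..<start (j * 2 ^ kap)} dflt (\<lambda>_. p)" and ?W = "Pi_pmf {..<j} 0 (\<lambda>_. word_pmf w)"
  let ?L = "Pi_pmf (level j) dflt (\<lambda>_. p)"
  have "start (j * 2 ^ kap) \<le> start (Suc j * 2 ^ kap)" by (intro start_mono) simp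
  then have un: "{..<start (Suc j * 2 ^ kap)} = {..<start (j * 2 ^ kap)} \<union> level j"
    by (auto simp: level_def)
  have P: "Pi_pmf {..<start (Suc j * 2 ^ kap)} dflt (\<lambda>_. p) = map_pmf (\<lambda>(f, g) x. if x \<in> {..<start (j * 2 ^ kap)} then f x else g x) (pair_pmf ?P ?L)"
    unfolding un by (rule Pi_pmf_union) (auto simp: level_def)
  have W: "Pi_pmf {..<Suc j} 0 (\<lambda>_. word_pmf w) = map_pmf (\<lambda>(y, f). f(j := y)) (pair_pmf (word_pmf w) ?W)"
    unfolding lessThan_Suc by (rule Pi_pmf_insert) auto
  have "(\<integral>\<^sup>+x. \<phi> (fst x) (snd x) \<partial>outcome (Suc j)) =
    (\<integral>\<^sup>+fs. \<integral>\<^sup>+fl. \<integral>\<^sup>+a. \<integral>\<^sup>+ws. \<phi> (merge_level j fs fl) (ws(j := a)) \<partial>?W \<partial>word_pmf w \<partial>?L \<partial>?P)"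
    unfolding outcome_def P W by (simp add: nn_integral_pair_pmf' case_prod_beta) (simp only: fst_conv snd_conv)
  also have "\<dots> = (\<integral>\<^sup>+fs. \<integral>\<^sup>+fl. \<integral>\<^sup>+ws. \<integral>\<^sup>+a. \<phi> (merge_level j fs fl) (ws(j := a)) \<partial>word_pmf w \<partial>?W \<partial>?L \<partial>?P)"
    by (subst nn_integral_pmf_swap) (rule refl)
  also have "\<dots> = (\<integral>\<^sup>+fs. \<integral>\<^sup>+ws. \<integral>\<^sup>+fl. \<integral>\<^sup>+a. \<phi> (merge_level j fs fl) (ws(j := a)) \<partial>word_pmf w \<partial>?L \<partial>?W \<partial>?P)"
    by (subst nn_integral_pmf_swap) (rule refl)
  also have "\<dots> = (\<integral>\<^sup>+x. \<integral>\<^sup>+fl. \<integral>\<^sup>+a. \<phi> (merge_level j (fst x) fl) ((snd x)(j := a)) \<partial>word_pmf w \<partial>?L \<partial>outcome j)"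
    unfolding outcome_def by (simp add: nn_integral_pair_pmf') (simp only: fst_conv snd_conv)
  finally show ?thesis .
qed

abbreviation frnt :: "('f \<Rightarrow> bool) \<Rightarrow> (nat \<Rightarrow> 'f) \<times> (nat \<Rightarrow> nat) \<Rightarrow> nat \<Rightarrow> nat list" where
  "frnt S x j \<equiv> front (\<lambda>i. S (fst x i)) (snd x) j"

text \<open>Levels that a quantity does not depend on integrate to 1.\<close>

lemma outcome_mono:
  assumes dep: "\<And>fs fs' ws ws'. (\<And>i. i < start (j * 2 ^ kap) \<Longrightarrow> fs i = fs' i) \<Longrightarrow> (\<And>i. i < j \<Longrightarrow> ws i = ws' i) \<Longrightarrow>
      \<phi> fs ws = \<phi> fs' ws'" and "j \<le> m"
  shows "(\<integral>\<^sup>+x. \<phi> (fst x) (snd x) \<partial>outcome m) = (\<integral>\<^sup>+x. \<phi> (fst x) (snd x) \<partial>outcome j)"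
  using \<open>j \<le> m\<close>
proof (induction m rule: dec_induct)
  case (step m)
  have le: "start (j * 2 ^ kap) \<le> start (m * 2 ^ kap)" using step(1) by (intro start_mono mult_right_mono) auto
  have "\<phi> (merge_level m (fst x) fl) ((snd x)(m := a)) = \<phi> (fst x) (snd x)" for x fl a
    using step(1) le by (intro dep) auto
  then have "(\<integral>\<^sup>+x. \<phi> (fst x) (snd x) \<partial>outcome (Suc m)) = (\<integral>\<^sup>+x. \<phi> (fst x) (snd x) \<partial>outcome m)"
    unfolding outcome_Suc by simp
  then show ?case using step by simp
qed simp

text \<open>Collisions merge names but not the paths that are counted, and each filter of a fresh
  level is independent of the past. By linearity the mean is that of a branching process, whatever
  the multipliers are.\<close>

lemma expected_front:
  assumes "j \<le> k"
  shows "(\<integral>\<^sup>+x. of_nat (length (frnt S x j)) \<partial>outcome j) =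
    ennreal (2 ^ kap * (\<Prod>i<j. real (block_size i) * measure_pmf.prob p {f. S f}))"
  using assms
proof (induction j)
  case 0
  then show ?case by (simp add: roots_def ennreal_of_nat_eq_real_of_nat)
next
  case (Suc j)
  let ?s = "measure_pmf.prob p {f. S f}"
  have len: "of_nat (length xs) = (\<Sum>M\<leftarrow>xs. 1 :: ennreal)" for xs :: "nat list" by (induction xs) auto
  have fl: "(\<integral>\<^sup>+fl. of_bool (S (fl i)) \<partial>Pi_pmf (level j) dflt (\<lambda>_. p)) = ennreal ?s" if "i \<in> level j" for i
    using nn_integral_Pi_pmf_two[where A = "level j" and i = i and i' = i and S = S and S' = S and d = dflt and p = p] that
    by (simp add: level_def flip: of_bool_conj)
  have "(\<integral>\<^sup>+x. of_nat (length (frnt S x (Suc j))) \<partial>outcome (Suc j)) =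
    (\<integral>\<^sup>+x. \<integral>\<^sup>+fl. \<integral>\<^sup>+a. of_nat (length (front (\<lambda>i. S (merge_level j (fst x) fl i)) ((snd x)(j := a)) (Suc j)))
       \<partial>word_pmf w \<partial>Pi_pmf (level j) dflt (\<lambda>_. p) \<partial>outcome j)"
    by (rule outcome_Suc)
  also have "\<dots> = (\<integral>\<^sup>+x. ennreal (real (block_size j) * ?s) * of_nat (length (frnt S x j)) \<partial>outcome j)"
  proof (rule nn_integral_cong)
    fix x
    have "(\<integral>\<^sup>+fl. \<integral>\<^sup>+a. of_nat (length (front (\<lambda>i. S (merge_level j (fst x) fl i)) ((snd x)(j := a)) (Suc j)))
       \<partial>word_pmf w \<partial>Pi_pmf (level j) dflt (\<lambda>_. p)) =
      (\<integral>\<^sup>+fl. \<integral>\<^sup>+a. (\<Sum>N\<leftarrow>frnt S x j. \<Sum>i\<in>cells_of N. of_bool (S (fl i))) \<partial>word_pmf w \<partial>Pi_pmf (level j) dflt (\<lambda>_. p))"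
    proof (intro nn_integral_cong)
      fix fl a
      show "of_nat (length (front (\<lambda>i. S (merge_level j (fst x) fl i)) ((snd x)(j := a)) (Suc j))) =
        (\<Sum>N\<leftarrow>frnt S x j. \<Sum>i\<in>cells_of N. of_bool (S (fl i)) :: ennreal)"
        unfolding len
        by (subst sum_front_Suc[where S = "\<lambda>i. S (fl i)" and S0 = "\<lambda>i. S (fst x i)" and ws = "snd x" and a = a])
          (use Suc.prems in \<open>auto simp: level_def\<close>)
    qed
    also have "\<dots> = (\<Sum>N\<leftarrow>frnt S x j. \<Sum>i\<in>cells_of N. \<integral>\<^sup>+fl. of_bool (S (fl i)) \<partial>Pi_pmf (level j) dflt (\<lambda>_. p))"
      by (simp add: nn_integral_sum_list nn_integral_sum)
    also have "\<dots> = (\<Sum>N\<leftarrow>frnt S x j. ennreal (real (block_size j) * ?s))"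
    proof (intro arg_cong[where f = sum_list] map_cong refl)
      fix N assume "N \<in> set (frnt S x j)"
      then have N: "N div 2 ^ l = j" by (rule front_level)
      have "(\<Sum>i\<in>cells_of N. \<integral>\<^sup>+fl. of_bool (S (fl i)) \<partial>Pi_pmf (level j) dflt (\<lambda>_. p)) = (\<Sum>i\<in>cells_of N. ennreal ?s)"
        using cells_of_level[OF N] fl by (intro sum.cong) auto
      also have "\<dots> = ennreal (real (block_size j) * ?s)"
        using card_cells_of[of N] N by (simp add: ennreal_mult ennreal_of_nat_eq_real_of_nat)
      finally show "(\<Sum>i\<in>cells_of N. \<integral>\<^sup>+fl. of_bool (S (fl i)) \<partial>Pi_pmf (level j) dflt (\<lambda>_. p)) = ennreal (real (block_size j) * ?s)" .
    qed
    also have "\<dots> = ennreal (real (block_size j) * ?s) * of_nat (length (frnt S x j))"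
      by (simp add: sum_list_triv mult.commute)
    finally show "(\<integral>\<^sup>+fl. \<integral>\<^sup>+a. of_nat (length (front (\<lambda>i. S (merge_level j (fst x) fl i)) ((snd x)(j := a)) (Suc j)))
       \<partial>word_pmf w \<partial>Pi_pmf (level j) dflt (\<lambda>_. p)) = ennreal (real (block_size j) * ?s) * of_nat (length (frnt S x j))" .
  qed
  also have "\<dots> = ennreal (real (block_size j) * ?s) * (\<integral>\<^sup>+x. of_nat (length (frnt S x j)) \<partial>outcome j)"
    by (rule nn_integral_cmult) simp
  also have "\<dots> = ennreal (real (block_size j) * ?s) * ennreal (2 ^ kap * (\<Prod>i<j. real (block_size i) * ?s))"
    using Suc by simp
  also have "\<dots> = ennreal (2 ^ kap * (\<Prod>i<Suc j. real (block_size i) * ?s))"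
    by (subst ennreal_mult[symmetric]) (auto intro!: prod_nonneg mult_nonneg_nonneg simp: mult_ac)
  finally show ?case .
qed

text \<open>A joint moment of the trees of two points. The relation \<open>g\<close> will be the
  full relation, equality of names, or equality of leading bits, which covers blocks and
  buckets.\<close>

definition pairs :: "('f \<Rightarrow> bool) \<Rightarrow> ('f \<Rightarrow> bool) \<Rightarrow> (nat \<Rightarrow> nat \<Rightarrow> bool) \<Rightarrow> nat \<Rightarrow> ennreal" where
  "pairs S S' g j = (\<integral>\<^sup>+x. (\<Sum>N\<leftarrow>frnt S x j. \<Sum>N'\<leftarrow>frnt S' x j. of_bool (g N N')) \<partial>outcome j)"

text \<open>The relation is tested on children, hence with the multiplier of level \<open>j\<close>.
  Equal pairs of node and filter are exempt, as they give the same child with certainty.\<close>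

definition universal :: "nat \<Rightarrow> (nat \<Rightarrow> nat \<Rightarrow> bool) \<Rightarrow> real \<Rightarrow> bool" where
  "universal j g \<epsilon> \<longleftrightarrow> (\<forall>N N' i i'. N div 2 ^ l = j \<longrightarrow> N' div 2 ^ l = j \<longrightarrow> i < nfilters \<longrightarrow> i' < nfilters \<longrightarrow>
     (N, i) \<noteq> (N', i') \<longrightarrow> (\<integral>\<^sup>+a. of_bool (g (node j a N i) (node j a N' i')) \<partial>word_pmf w) \<le> ennreal \<epsilon>)"

text \<open>Children of two nodes have the same key only if the nodes and the filters agree. Every other
  pair of children collides with probability at most \<open>\<epsilon>\<close>, and two filters are independent unless
  they are the same filter of a common block.\<close>

lemma pairs_Suc:
  fixes S S' :: "'f \<Rightarrow> bool" and j :: nat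
  assumes j: "j < k" and uni: "universal j g \<epsilon>" and \<epsilon>: "0 \<le> \<epsilon>"
  defines "b \<equiv> real (block_size j)" and "s \<equiv> measure_pmf.prob p {f. S f}" and "s' \<equiv> measure_pmf.prob p {f. S' f}"
    and "z \<equiv> measure_pmf.prob p {f. S f \<and> S' f}"
  shows "pairs S S' g (Suc j) \<le>
    ennreal \<epsilon> * (ennreal (b\<^sup>2 * s * s') * pairs S S' (\<lambda>_ _. True) j + ennreal (b * z) * pairs S S' (\<lambda>N N'. block N = block N') j) +
    ennreal (b * z) * pairs S S' (=) j"
proof -
  let ?L = "Pi_pmf (level j) dflt (\<lambda>_. p)"
  have nn: "0 \<le> b" "0 \<le> s" "0 \<le> s'" "0 \<le> z" by (auto simp: b_def s_def s'_def z_def)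
  \<comment> \<open>The contribution of one pair of nodes: arbitrary filters on both sides and one
    filter of a common block each need a collision, whereas one filter below one node yields a
    common child without any.\<close>
  define c where "c N N' = ennreal \<epsilon> * (ennreal (b\<^sup>2 * s * s') + ennreal (b * z) * of_bool (block N = block N')) +
    ennreal (b * z) * of_bool (N = N')" for N N'
  have step: "(\<integral>\<^sup>+fl. \<integral>\<^sup>+a. (\<Sum>M\<leftarrow>front (\<lambda>i. S (merge_level j (fst x) fl i)) ((snd x)(j := a)) (Suc j).
      \<Sum>M'\<leftarrow>front (\<lambda>i. S' (merge_level j (fst x) fl i)) ((snd x)(j := a)) (Suc j). of_bool (g M M'))
      \<partial>word_pmf w \<partial>?L) \<le> (\<Sum>N\<leftarrow>frnt S x j. \<Sum>N'\<leftarrow>frnt S' x j. c N N')" for x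
  proof -
    have "(\<integral>\<^sup>+fl. \<integral>\<^sup>+a. (\<Sum>M\<leftarrow>front (\<lambda>i. S (merge_level j (fst x) fl i)) ((snd x)(j := a)) (Suc j).
      \<Sum>M'\<leftarrow>front (\<lambda>i. S' (merge_level j (fst x) fl i)) ((snd x)(j := a)) (Suc j). of_bool (g M M'))
      \<partial>word_pmf w \<partial>?L) =
     (\<integral>\<^sup>+fl. \<integral>\<^sup>+a. (\<Sum>N\<leftarrow>frnt S x j. \<Sum>N'\<leftarrow>frnt S' x j. \<Sum>i\<in>cells_of N. \<Sum>i'\<in>cells_of N'.
        of_bool (S (fl i)) * of_bool (S' (fl i')) * of_bool (g (node j a N i) (node j a N' i'))) \<partial>word_pmf w \<partial>?L)"
    proof (intro nn_integral_cong)
      fix fl a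
      have 1: "(\<Sum>M\<leftarrow>front (\<lambda>i. T (merge_level j (fst x) fl i)) ((snd x)(j := a)) (Suc j). h M) =
        (\<Sum>N\<leftarrow>frnt T x j. \<Sum>i\<in>cells_of N. of_bool (T (fl i)) * h (node j a N i) :: ennreal)" for T h
        by (rule sum_front_Suc) (use j in \<open>auto simp: level_def\<close>)
      show "(\<Sum>M\<leftarrow>front (\<lambda>i. S (merge_level j (fst x) fl i)) ((snd x)(j := a)) (Suc j).
        \<Sum>M'\<leftarrow>front (\<lambda>i. S' (merge_level j (fst x) fl i)) ((snd x)(j := a)) (Suc j). of_bool (g M M')) =
        (\<Sum>N\<leftarrow>frnt S x j. \<Sum>N'\<leftarrow>frnt S' x j. \<Sum>i\<in>cells_of N. \<Sum>i'\<in>cells_of N'.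
        of_bool (S (fl i)) * of_bool (S' (fl i')) * of_bool (g (node j a N i) (node j a N' i')) :: ennreal)"
        unfolding 1 sum_list_sum_swap
        by (simp only: sum_list_cmult[symmetric] sum_distrib_left mult.assoc)
    qed
    also have "\<dots> = (\<Sum>N\<leftarrow>frnt S x j. \<Sum>N'\<leftarrow>frnt S' x j. \<Sum>i\<in>cells_of N. \<Sum>i'\<in>cells_of N'.
        (\<integral>\<^sup>+fl. of_bool (S (fl i)) * of_bool (S' (fl i')) \<partial>?L) *
        (\<integral>\<^sup>+a. of_bool (g (node j a N i) (node j a N' i')) \<partial>word_pmf w))"
      by (simp add: nn_integral_sum_list nn_integral_sum nn_integral_cmult nn_integral_multc)
    also have "\<dots> \<le> (\<Sum>N\<leftarrow>frnt S x j. \<Sum>N'\<leftarrow>frnt S' x j. c N N')"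
    proof (intro sum_list_mono_ennreal)
      fix N N' assume "N \<in> set (frnt S x j)" "N' \<in> set (frnt S' x j)"
      then have N: "N div 2 ^ l = j" "N' div 2 ^ l = j" by (auto dest: front_level)
      have lev: "i \<in> level j \<and> i < nfilters" if "i \<in> cells_of N \<or> i \<in> cells_of N'" for i
      proof -
        have "i \<in> level j" using cells_of_level N that by blast
        moreover have "start (Suc j * 2 ^ kap) \<le> nfilters" using j by (intro level_upto) simp
        ultimately show ?thesis by (auto simp: level_def)
      qed
      have "(\<Sum>i\<in>cells_of N. \<Sum>i'\<in>cells_of N'. (\<integral>\<^sup>+fl. of_bool (S (fl i)) * of_bool (S' (fl i')) \<partial>?L) *
        (\<integral>\<^sup>+a. of_bool (g (node j a N i) (node j a N' i')) \<partial>word_pmf w)) \<le>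
        (\<Sum>i\<in>cells_of N. \<Sum>i'\<in>cells_of N'. ennreal \<epsilon> * ennreal (s * s') + ennreal \<epsilon> * (ennreal z * of_bool (i = i')) +
          ennreal z * of_bool (N = N' \<and> i = i'))"
      proof (intro sum_mono)
        fix i i' assume i: "i \<in> cells_of N" "i' \<in> cells_of N'"
        let ?a = "\<integral>\<^sup>+a. of_bool (g (node j a N i) (node j a N' i')) \<partial>word_pmf w"
        have fl: "(\<integral>\<^sup>+fl. of_bool (S (fl i)) * of_bool (S' (fl i')) \<partial>?L) = (if i = i' then ennreal z else ennreal (s * s'))"
          unfolding s_def s'_def z_def
          by (rule nn_integral_Pi_pmf_two) (use lev i in \<open>auto simp: level_def\<close>)
        have a1: "?a \<le> 1"
          by (rule order_trans[OF nn_integral_mono[of _ _ "\<lambda>_. 1"]]) auto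
        have a\<epsilon>: "?a \<le> ennreal \<epsilon>" if "(N, i) \<noteq> (N', i')"
          using uni that N lev i unfolding universal_def by blast
        show "(\<integral>\<^sup>+fl. of_bool (S (fl i)) * of_bool (S' (fl i')) \<partial>?L) * ?a \<le>
          ennreal \<epsilon> * ennreal (s * s') + ennreal \<epsilon> * (ennreal z * of_bool (i = i')) + ennreal z * of_bool (N = N' \<and> i = i')"
        proof (cases "i = i'")
          case True
          show ?thesis
          proof (cases "N = N'")
            case NN: True
            have "ennreal z * ?a \<le> ennreal z * 1" using a1 by (rule mult_left_mono) simp
            then show ?thesis unfolding fl using True NN by (simp add: add_increasing)
          next
            case False
            have "ennreal z * ?a \<le> ennreal z * ennreal \<epsilon>" using a\<epsilon> False by (intro mult_left_mono) auto
            then show ?thesis unfolding fl using True False by (simp add: add_increasing mult.commute)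
          qed
        next
          case False
          have "ennreal (s * s') * ?a \<le> ennreal (s * s') * ennreal \<epsilon>" using a\<epsilon> False by (intro mult_left_mono) auto
          then show ?thesis unfolding fl using False by (simp add: mult.commute)
        qed
      qed
      also have "\<dots> = (\<Sum>i\<in>cells_of N. \<Sum>i'\<in>cells_of N'. ennreal \<epsilon> * ennreal (s * s')) +
          ennreal \<epsilon> * (ennreal z * (\<Sum>i\<in>cells_of N. \<Sum>i'\<in>cells_of N'. of_bool (i = i'))) +
          ennreal z * (\<Sum>i\<in>cells_of N. \<Sum>i'\<in>cells_of N'. of_bool (N = N' \<and> i = i'))"
        by (simp only: sum.distrib sum_distrib_left)
      also have "(\<Sum>i\<in>cells_of N. \<Sum>i'\<in>cells_of N'. ennreal \<epsilon> * ennreal (s * s')) = ennreal \<epsilon> * ennreal (b\<^sup>2 * s * s')"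
        using nn N card_cells_of[of N] card_cells_of[of N'] \<epsilon>
        by (simp add: b_def ennreal_of_nat_eq_real_of_nat power2_eq_square mult_ac flip: ennreal_mult)
      also have "(\<Sum>i\<in>cells_of N. \<Sum>i'\<in>cells_of N'. of_bool (i = i')) = ennreal b * of_bool (block N = block N')"
      proof (cases "block N = block N'")
        case True
        then have "cells_of N' = cells_of N" by (simp add: cells_of_def)
        then show ?thesis using True N card_cells_of[of N]
          by (simp add: of_bool_def sum.delta b_def ennreal_of_nat_eq_real_of_nat)
      next
        case False
        then show ?thesis using cells_of_disjoint[OF False]
          by (auto intro!: sum.neutral simp: of_bool_def)
      qed
      also have "(\<Sum>i\<in>cells_of N. \<Sum>i'\<in>cells_of N'. of_bool (N = N' \<and> i = i')) = ennreal b * of_bool (N = N')"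
      proof (cases "N = N'")
        case True
        then show ?thesis using N card_cells_of[of N]
          by (simp add: of_bool_def sum.delta b_def ennreal_of_nat_eq_real_of_nat)
      qed simp
      also have "ennreal \<epsilon> * ennreal (b\<^sup>2 * s * s') + ennreal \<epsilon> * (ennreal z * (ennreal b * of_bool (block N = block N'))) +
          ennreal z * (ennreal b * of_bool (N = N')) = c N N'"
        unfolding c_def using nn by (simp add: ennreal_mult distrib_left mult_ac)
      finally show "(\<Sum>i\<in>cells_of N. \<Sum>i'\<in>cells_of N'. (\<integral>\<^sup>+fl. of_bool (S (fl i)) * of_bool (S' (fl i')) \<partial>?L) *
        (\<integral>\<^sup>+a. of_bool (g (node j a N i) (node j a N' i')) \<partial>word_pmf w)) \<le> c N N'" .
    qed
    finally show ?thesis .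
  qed
  have lin: "(\<integral>\<^sup>+x. c0 * (c1 * u x + c2 * v x) + c3 * t x \<partial>outcome j) =
    c0 * (c1 * (\<integral>\<^sup>+x. u x \<partial>outcome j) + c2 * (\<integral>\<^sup>+x. v x \<partial>outcome j)) + c3 * (\<integral>\<^sup>+x. t x \<partial>outcome j)"
    for c0 c1 c2 c3 u v t
    by (simp add: nn_integral_add nn_integral_cmult)
  have "pairs S S' g (Suc j) = (\<integral>\<^sup>+x. \<integral>\<^sup>+fl. \<integral>\<^sup>+a.
      (\<Sum>M\<leftarrow>front (\<lambda>i. S (merge_level j (fst x) fl i)) ((snd x)(j := a)) (Suc j).
      \<Sum>M'\<leftarrow>front (\<lambda>i. S' (merge_level j (fst x) fl i)) ((snd x)(j := a)) (Suc j). of_bool (g M M'))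
      \<partial>word_pmf w \<partial>?L \<partial>outcome j)"
    unfolding pairs_def by (rule outcome_Suc)
  also have "\<dots> \<le> (\<integral>\<^sup>+x. (\<Sum>N\<leftarrow>frnt S x j. \<Sum>N'\<leftarrow>frnt S' x j. c N N') \<partial>outcome j)"
    by (intro nn_integral_mono step)
  also have "\<dots> = (\<integral>\<^sup>+x. ennreal \<epsilon> * (ennreal (b\<^sup>2 * s * s') * (\<Sum>N\<leftarrow>frnt S x j. \<Sum>N'\<leftarrow>frnt S' x j. of_bool True) +
      ennreal (b * z) * (\<Sum>N\<leftarrow>frnt S x j. \<Sum>N'\<leftarrow>frnt S' x j. of_bool (block N = block N'))) +
      ennreal (b * z) * (\<Sum>N\<leftarrow>frnt S x j. \<Sum>N'\<leftarrow>frnt S' x j. of_bool (N = N')) \<partial>outcome j)"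
    unfolding c_def by (simp only: sum_list_addf sum_list_cmult distrib_left of_bool_eq mult_1_right)
      (simp only: sum_list_cmult[symmetric] mult_1_right)
  also have "\<dots> = ennreal \<epsilon> * (ennreal (b\<^sup>2 * s * s') * pairs S S' (\<lambda>_ _. True) j +
      ennreal (b * z) * pairs S S' (\<lambda>N N'. block N = block N') j) + ennreal (b * z) * pairs S S' (=) j"
    unfolding pairs_def by (rule lin)
  finally show ?thesis .
qed

end

text \<open>\<open>x\<close> is the number of pairs divided by
  \<open>K ^ 2 * \<sigma> * \<tau>\<close>, where \<open>\<sigma>\<close> and \<open>\<tau>\<close>
  are the growths of the two trees. Replacing \<open>b ^ 2 * s * s'\<close> by \<open>b * z\<close>,
  which is at most \<open>b * s\<close>, loses the factor \<open>b * s'\<close>, and this factor is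
  at least \<open>1 / 2\<close>. Pairs in one block carry a factor \<open>2 / K\<close>, and pairs
  with equal names are of order \<open>K\<close> instead of \<open>K ^ 2\<close>; by
  \<open>k \<le> K\<close> each is a fraction of order \<open>1 / k\<close>.\<close>

lemma recurrence_step:
  fixes b s s' z zb K k \<sigma> \<tau> \<zeta> \<Sigma> x e C :: real
  assumes nn: "0 \<le> b" "0 \<le> z" "0 \<le> s'" "0 \<le> \<zeta>" "0 \<le> \<tau>" "0 \<le> x" "0 \<le> e" "0 \<le> C"
    and z: "z \<le> s" and \<zeta>: "\<zeta> \<le> \<sigma>" and bs: "1 / 2 \<le> b * s'" and k: "1 \<le> k" "k \<le> K"
    and \<tau>1: "1 \<le> 16 * (b * s' * \<tau>)" and \<Sigma>: "0 \<le> \<Sigma>" "\<Sigma> \<le> 16 * k * (b * s' * \<tau>)" and eC: "e * C * k\<^sup>2 \<le> 1"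
  shows "b\<^sup>2 * s * s' * (x * K\<^sup>2 * \<sigma> * \<tau>) + b * z * (2 / K * (x * K\<^sup>2 * \<sigma> * \<tau>) + (K * \<zeta> + e * C * K\<^sup>2 * \<sigma> * \<Sigma>)) +
    b * z * (K * \<zeta> + e * C * K\<^sup>2 * \<sigma> * \<Sigma>) \<le> ((1 + 8 / k) * x + 64 / k) * K\<^sup>2 * (b * s * \<sigma>) * (b * s' * \<tau>)"
proof -
  define S where "S = b * s * \<sigma>"
  define T where "T = b * s' * \<tau>"
  have s: "0 \<le> s" using nn z by simp
  have \<sigma>: "0 \<le> \<sigma>" using nn \<zeta> by simp
  have S: "0 \<le> S" and T: "0 \<le> T" using nn s \<sigma> by (auto simp: S_def T_def)
  have K: "0 < K" "K \<le> K\<^sup>2 / k" using k by (auto simp: field_simps power2_eq_square)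
  have bz: "b * z \<le> b * s" using nn z by (intro mult_left_mono)
  have t1: "b\<^sup>2 * s * s' * (x * K\<^sup>2 * \<sigma> * \<tau>) = x * K\<^sup>2 * S * T"
    by (simp add: S_def T_def power2_eq_square)
  have \<tau>T: "\<tau> \<le> 2 * T"
  proof -
    have "1 / 2 * \<tau> \<le> b * s' * \<tau>" using bs nn by (intro mult_right_mono)
    then show ?thesis by (simp add: T_def)
  qed
  have t2: "b * z * (2 / K * (x * K\<^sup>2 * \<sigma> * \<tau>)) \<le> 8 / k * x * K\<^sup>2 * S * T"
  proof -
    have "b * z * (2 / K * (x * K\<^sup>2 * \<sigma> * \<tau>)) \<le> b * s * (2 / K * (x * K\<^sup>2 * \<sigma> * \<tau>))"
      using bz nn \<sigma> K by (intro mult_right_mono) auto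
    also have "\<dots> = 2 * x * K * S * \<tau>" using K by (simp add: S_def power2_eq_square)
    also have "\<dots> \<le> 2 * x * K * S * (2 * T)" using \<tau>T nn K S by (intro mult_left_mono) auto
    also have "\<dots> = 4 * x * S * T * K" by simp
    also have "\<dots> \<le> 4 * x * S * T * (K\<^sup>2 / k)" using K nn S T by (intro mult_left_mono) auto
    also have "\<dots> \<le> 8 * x * S * T * (K\<^sup>2 / k)" using K nn S T k by (intro mult_right_mono) auto
    also have "\<dots> = 8 / k * x * K\<^sup>2 * S * T" by simp
    finally show ?thesis .
  qed
  have t3: "b * z * (K * \<zeta> + e * C * K\<^sup>2 * \<sigma> * \<Sigma>) \<le> 32 / k * K\<^sup>2 * S * T"
  proof -
    have kk: "e * C * K\<^sup>2 * (16 * k * T) \<le> 16 * (K\<^sup>2 / k) * T"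
    proof -
      have "e * C * k \<le> 1 / k" using eC k by (simp add: field_simps power2_eq_square)
      then have "e * C * k * (16 * K\<^sup>2 * T) \<le> 1 / k * (16 * K\<^sup>2 * T)" using T by (intro mult_right_mono) auto
      then show ?thesis by (simp add: mult_ac)
    qed
    have "b * z * (K * \<zeta> + e * C * K\<^sup>2 * \<sigma> * \<Sigma>) \<le> b * s * (K * \<sigma> + e * C * K\<^sup>2 * \<sigma> * \<Sigma>)"
      using bz nn \<sigma> K \<Sigma> \<zeta> s z by (intro mult_mono add_mono mult_left_mono) auto
    also have "\<dots> = S * (K * 1 + e * C * K\<^sup>2 * \<Sigma>)" by (simp add: S_def distrib_left mult_ac)
    also have "\<dots> \<le> S * (K\<^sup>2 / k * (16 * T) + e * C * K\<^sup>2 * (16 * k * T))"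
      using S K nn \<Sigma> \<tau>1 k unfolding T_def[symmetric] by (intro mult_left_mono add_mono mult_mono) auto
    also have "\<dots> \<le> S * (K\<^sup>2 / k * (16 * T) + 16 * (K\<^sup>2 / k) * T)"
      by (rule mult_left_mono[OF add_left_mono[OF kk] S])
    also have "\<dots> = 32 / k * K\<^sup>2 * S * T" by (simp add: field_simps)
    finally show ?thesis .
  qed
  have "b\<^sup>2 * s * s' * (x * K\<^sup>2 * \<sigma> * \<tau>) + b * z * (2 / K * (x * K\<^sup>2 * \<sigma> * \<tau>) + (K * \<zeta> + e * C * K\<^sup>2 * \<sigma> * \<Sigma>)) +
    b * z * (K * \<zeta> + e * C * K\<^sup>2 * \<sigma> * \<Sigma>) \<le> x * K\<^sup>2 * S * T + (8 / k * x * K\<^sup>2 * S * T + 32 / k * K\<^sup>2 * S * T) + 32 / k * K\<^sup>2 * S * T"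
    unfolding distrib_left[of "b * z" "2 / K * (x * K\<^sup>2 * \<sigma> * \<tau>)"] t1
    using t2 t3 by (intro add_mono order_refl)
  also have "\<dots> = ((1 + 8 / k) * x + 64 / k) * K\<^sup>2 * S * T" by (simp add: algebra_simps)
  finally show ?thesis unfolding S_def T_def .
qed

text \<open>The recurrence \<open>x' = (1 + 8 / k) * x + 64 / k\<close> multiplies
  \<open>x + 8\<close> by \<open>1 + 8 / k\<close>. Started at \<open>x = 1\<close>, it stays below
  \<open>9 * exp 8\<close> for \<open>k\<close> steps.\<close>

definition moment_const :: real where
  "moment_const = 9 * exp 8"

context lsf_prob
begin

lemma universal_True: "universal j (\<lambda>_ _. True) 1"
  by (simp add: universal_def)

text \<open>Leading bits of a multiply-shift value form a multiply-shift value with fewer bits, and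
  distinct pairs of node and filter have distinct keys. One collision bound thus covers names,
  blocks and buckets.\<close>

lemma universal_leading:
  assumes l': "l' \<le> l" and j: "j < k"
  shows "universal j (\<lambda>N N'. N div 2 ^ (l - l') = N' div 2 ^ (l - l')) (2 / 2 ^ l')"
  unfolding universal_def
proof (intro allI impI)
  fix N N' i i' assume N: "N div 2 ^ l = j" "N' div 2 ^ l = j" and i: "i < nfilters" "i' < nfilters"
    and ne: "(N, i) \<noteq> (N', i')"
  let ?v = "N * nfilters + i" and ?v' = "N' * nfilters + i'"
  have key: "M * nfilters + c < 2 ^ (w - l)" if "M div 2 ^ l = j" "c < nfilters" for M c
  proof -
    have "M < Suc k * 2 ^ l" using that j by (simp only: div_less_iff_less_mult[symmetric] zero_less_power zero_less_numeral)
    have "M * nfilters + c < (M + 1) * nfilters" using that by simp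
    also have "\<dots> \<le> (Suc k * 2 ^ l) * (nfilters + 1)" using \<open>M < Suc k * 2 ^ l\<close> by (intro mult_mono) auto
    finally have "(M * nfilters + c) * 2 ^ l < Suc k * 2 ^ l * (nfilters + 1) * 2 ^ l" by simp
    also have "\<dots> \<le> 2 ^ w" by (rule keys)
    also have "\<dots> = 2 ^ (w - l) * (2::nat) ^ l" using l_le by (simp flip: power_add)
    finally show ?thesis by simp
  qed
  have v: "?v < 2 ^ (w - l)" "?v' < 2 ^ (w - l)" using key N i by blast+
  have vne: "?v \<noteq> ?v'"
  proof
    assume eq: "?v = ?v'"
    have "?v div nfilters = N" "?v' div nfilters = N'" "?v mod nfilters = i" "?v' mod nfilters = i'"
      using i by auto
    then show False using eq ne by auto
  qed
  have hd: "node j a M c div 2 ^ (l - l') = Suc j * 2 ^ l' + (M * nfilters + c) * a mod 2 ^ w div 2 ^ (w - l')" for a M c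
  proof -
    have "(2::nat) ^ l = 2 ^ l' * 2 ^ (l - l')" using l' by (simp flip: power_add)
    then have "Suc j * 2 ^ l = (Suc j * 2 ^ l') * 2 ^ (l - l')" by (simp only: mult.assoc)
    then have "node j a M c div 2 ^ (l - l') = Suc j * 2 ^ l' + hash a (M * nfilters + c) div 2 ^ (l - l')"
      unfolding node_def by (simp only: div_mult_self3 power_not_zero zero_neq_numeral) simp
    also have "hash a (M * nfilters + c) div 2 ^ (l - l') = (M * nfilters + c) * a mod 2 ^ w div (2 ^ (w - l) * 2 ^ (l - l'))"
      unfolding hash_def by (simp only: div_mult2_eq)
    also have "2 ^ (w - l) * 2 ^ (l - l') = (2::nat) ^ (w - l')" using l' l_le by (simp flip: power_add)
    finally show ?thesis .
  qed
  have "(\<integral>\<^sup>+a. of_bool (node j a N i div 2 ^ (l - l') = node j a N' i' div 2 ^ (l - l')) \<partial>word_pmf w) =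
    (\<integral>\<^sup>+a. of_bool (?v * a mod 2 ^ w div 2 ^ (w - l') = ?v' * a mod 2 ^ w div 2 ^ (w - l')) \<partial>word_pmf w)"
    unfolding hd by simp
  also have "\<dots> \<le> ennreal (2 / 2 ^ l')"
    using multiply_shift_collision[OF vne v l' l_le] l' l_le by (intro nn_integral_word_le) auto
  finally show "(\<integral>\<^sup>+a. of_bool (node j a N i div 2 ^ (l - l') = node j a N' i' div 2 ^ (l - l')) \<partial>word_pmf w) \<le> ennreal (2 / 2 ^ l')" .
qed

lemma universal_eq: "j < k \<Longrightarrow> universal j (=) (2 / 2 ^ l)"
  using universal_leading[of l j] by simp

lemma universal_block: "j < k \<Longrightarrow> universal j (\<lambda>N N'. block N = block N') (2 / 2 ^ kap)"
  using universal_leading[of kap j] kap_le by (simp add: block_def)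

lemma roots_sum:
  "(\<Sum>N\<leftarrow>roots. \<Sum>N'\<leftarrow>roots. of_bool (g N N')) = (\<Sum>t<2 ^ kap. \<Sum>t'<2 ^ kap. of_bool (g (t * 2 ^ (l - kap)) (t' * 2 ^ (l - kap))) :: ennreal)"
  by (simp add: roots_def comp_def interv_sum_list_conv_sum_set_nat atLeast0LessThan)

text \<open>Roots lie in pairwise different blocks, so equal blocks mean equal roots, and there are
  \<open>2 ^ kap\<close> such pairs.\<close>

lemma pairs_0:
  "pairs S S' (\<lambda>_ _. True) 0 \<le> ennreal ((2 ^ kap)\<^sup>2)"
  "pairs S S' (=) 0 \<le> ennreal (2 ^ kap)"
  "pairs S S' (\<lambda>N N'. block N = block N') 0 \<le> ennreal (2 ^ kap)"
proof -
  have p: "pairs S S' g 0 = (\<Sum>t<2 ^ kap. \<Sum>t'<2 ^ kap. of_bool (g (t * 2 ^ (l - kap)) (t' * 2 ^ (l - kap))))" for g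
    unfolding pairs_def front.simps roots_sum by simp
  have d: "(\<Sum>t<(2::nat) ^ kap. \<Sum>t'<2 ^ kap. of_bool (t = t')) = (2 ^ kap :: ennreal)"
    by (simp add: of_bool_def sum.delta)
  have e: "(2 ^ kap :: ennreal) = ennreal (2 ^ kap)" by (simp add: ennreal_power[symmetric])
  show "pairs S S' (\<lambda>_ _. True) 0 \<le> ennreal ((2 ^ kap)\<^sup>2)"
    unfolding p by (simp add: e power2_eq_square flip: ennreal_mult)
  show "pairs S S' (=) 0 \<le> ennreal (2 ^ kap)" unfolding p using d by (simp add: e)
  show "pairs S S' (\<lambda>N N'. block N = block N') 0 \<le> ennreal (2 ^ kap)"
    unfolding p block_def using d by (simp add: e)
qed

lemma pairs_Suc_real:
  fixes S S' :: "'f \<Rightarrow> bool" and j :: nat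
  assumes "j < k" "universal j g \<epsilon>" "0 \<le> \<epsilon>"
    and X: "pairs S S' (\<lambda>_ _. True) j \<le> ennreal X" "0 \<le> X"
    and Y: "pairs S S' (\<lambda>N N'. block N = block N') j \<le> ennreal Y" "0 \<le> Y"
    and G: "pairs S S' (=) j \<le> ennreal G" "0 \<le> G"
  defines "b \<equiv> real (block_size j)" and "s \<equiv> measure_pmf.prob p {f. S f}" and "s' \<equiv> measure_pmf.prob p {f. S' f}"
    and "z \<equiv> measure_pmf.prob p {f. S f \<and> S' f}"
  shows "pairs S S' g (Suc j) \<le> ennreal (\<epsilon> * (b\<^sup>2 * s * s' * X + b * z * Y) + b * z * G)"
proof -
  have nn: "0 \<le> b" "0 \<le> s" "0 \<le> s'" "0 \<le> z" by (auto simp: b_def s_def s'_def z_def)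
  have "pairs S S' g (Suc j) \<le> ennreal \<epsilon> * (ennreal (b\<^sup>2 * s * s') * pairs S S' (\<lambda>_ _. True) j +
      ennreal (b * z) * pairs S S' (\<lambda>N N'. block N = block N') j) + ennreal (b * z) * pairs S S' (=) j"
    unfolding b_def s_def s'_def z_def by (rule pairs_Suc[OF assms(1-3)])
  also have "\<dots> \<le> ennreal \<epsilon> * (ennreal (b\<^sup>2 * s * s') * ennreal X + ennreal (b * z) * ennreal Y) + ennreal (b * z) * ennreal G"
    using X Y G by (intro add_mono mult_left_mono) auto
  also have "\<dots> = ennreal (\<epsilon> * (b\<^sup>2 * s * s' * X + b * z * Y) + b * z * G)"
    using nn assms X Y G by (simp add: ennreal_mult ennreal_plus)
  finally show ?thesis .
qed

text \<open>The expected number of paths of length \<open>j\<close> below one root if each filter is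
  passed with probability \<open>s\<close>.\<close>

definition growth :: "real \<Rightarrow> nat \<Rightarrow> real" where
  "growth s j = (\<Prod>i<j. real (block_size i) * s)"

lemma growth_Suc: "growth s (Suc j) = real (block_size j) * s * growth s j"
  by (simp add: growth_def)

lemma growth_nonneg: "0 \<le> s \<Longrightarrow> 0 \<le> growth s j"
  unfolding growth_def by (intro prod_nonneg) auto

lemma growth_mono: "0 \<le> s \<Longrightarrow> s \<le> t \<Longrightarrow> growth s j \<le> growth t j"
  unfolding growth_def by (intro prod_mono) (auto intro: mult_left_mono)

text \<open>Three bounds support each other: \<open>X\<close> for all pairs, \<open>G\<close> for
  pairs with equal names, and \<open>2 / K * X + G\<close> for pairs in one block. The first term of
  \<open>G\<close> counts genuinely common paths and grows at the rate \<open>zb\<close> only, which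
  is small for far points. The second term counts paths that were merged by a collision at some
  level \<open>i\<close>; from there on both follow one path, so only one of the two growths
  continues.\<close>

lemma pair_bounds:
  fixes S S' :: "'f \<Rightarrow> bool" and zb :: real
  defines "s \<equiv> measure_pmf.prob p {f. S f}" and "s' \<equiv> measure_pmf.prob p {f. S' f}"
    and "z \<equiv> measure_pmf.prob p {f. S f \<and> S' f}" and "K \<equiv> 2 ^ kap :: real" and "e \<equiv> 2 / 2 ^ l :: real"
  assumes zb: "z \<le> zb" "zb \<le> s" and k: "1 \<le> k" "real k \<le> K"
    and bs: "\<And>j. j < k \<Longrightarrow> 1 / 2 \<le> real (block_size j) * s'"
    and gr: "\<And>i j. i \<le> j \<Longrightarrow> j \<le> k \<Longrightarrow> growth s' i \<le> 16 * growth s' j"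
    and eC: "e * moment_const * (real k)\<^sup>2 \<le> 1"
  shows "j \<le> k \<Longrightarrow> pairs S S' (\<lambda>_ _. True) j \<le> ennreal (moment_const * K\<^sup>2 * growth s j * growth s' j)"
    and "lt' \<le> l \<Longrightarrow> pairs S S' (\<lambda>N N'. N div 2 ^ (l - lt') = N' div 2 ^ (l - lt')) k \<le>
      ennreal (2 / 2 ^ lt' * moment_const * K\<^sup>2 * growth s k * growth s' k +
        (K * growth zb k + e * moment_const * K\<^sup>2 * growth s k * (\<Sum>i\<le>k. growth s' i)))"
proof -
  define C where "C = moment_const"
  \<comment> \<open>The solution of the recurrence with \<open>x 0 = 1\<close>; the fixed point of
    the recurrence is \<open>-8\<close>.\<close>
  define x where "x j = 9 * (1 + 8 / real k) ^ j - 8" for j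
  define G where "G j = K * growth zb j + e * C * K\<^sup>2 * growth s j * (\<Sum>i\<le>j. growth s' i)" for j
  define X where "X j = x j * K\<^sup>2 * growth s j * growth s' j" for j
  have nn: "0 \<le> s" "0 \<le> s'" "0 \<le> z" "0 \<le> e" "0 \<le> K" "0 \<le> zb" "0 \<le> C"
    using zb by (auto simp: s_def s'_def z_def e_def K_def C_def moment_const_def intro: order_trans[rotated])
  have k0: "0 < real k" using k by simp
  have x1: "1 \<le> x j" for j
  proof -
    have "1 \<le> (1 + 8 / real k) ^ j" using k0 by (intro one_le_power) auto
    then show ?thesis by (simp add: x_def)
  qed
  have xC: "x j \<le> C" if "j \<le> k" for j
  proof -
    have "(1 + 8 / real k) ^ j \<le> (1 + 8 / real k) ^ k" using that k0 by (intro power_increasing) auto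
    also have "\<dots> \<le> exp (8 / real k) ^ k" using k0 by (intro power_mono exp_ge_add_one_self) auto
    also have "\<dots> = exp 8" using k0 by (simp flip: exp_of_nat_mult)
    finally show ?thesis by (simp add: x_def C_def moment_const_def)
  qed
  have xS: "x (Suc j) = (1 + 8 / real k) * x j + 64 / real k" for j
    by (simp add: x_def algebra_simps)
  have gn: "0 \<le> growth s j" "0 \<le> growth s' j" "0 \<le> growth zb j" for j using nn by (auto intro: growth_nonneg)
  have Gn: "0 \<le> G j" for j unfolding G_def using nn gn by (intro add_nonneg_nonneg mult_nonneg_nonneg sum_nonneg) auto
  have Xn: "0 \<le> X j" for j unfolding X_def using x1[of j] gn by (intro mult_nonneg_nonneg) auto
  have K0: "0 < K" by (simp add: K_def)
  have step: "real (block_size j) ^ 2 * s * s' * X j + real (block_size j) * z * (2 / K * X j + G j) + real (block_size j) * z * G j \<le> X (Suc j)"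
    if j: "j < k" for j
  proof -
    \<comment> \<open>Growth never drops by more than a factor 16, so the sum over all levels at
      which a collision may have happened is at most \<open>16 * k\<close> times its value at the
      current level.\<close>
    have S1: "(\<Sum>i\<le>j. growth s' i) \<le> (\<Sum>i\<le>j. 16 * growth s' (Suc j))" using gr j by (intro sum_mono) auto
    also have "\<dots> = real (Suc j) * (16 * growth s' (Suc j))" by simp
    also have "\<dots> \<le> real k * (16 * growth s' (Suc j))" using j gn by (intro mult_right_mono) auto
    finally have S: "(\<Sum>i\<le>j. growth s' i) \<le> 16 * real k * (real (block_size j) * s' * growth s' j)"
      by (simp add: growth_Suc)
    have one: "1 \<le> 16 * (real (block_size j) * s' * growth s' j)"
      using gr[of 0 "Suc j"] j by (simp add: growth_Suc) (simp add: growth_def)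
    show ?thesis
      unfolding X_def G_def xS growth_Suc
      by (rule recurrence_step)
        (use nn gn zb k bs[OF j] one S eC x1[of j] growth_mono[of zb s] in
          \<open>auto simp: C_def intro: sum_nonneg order_trans[of 0 1]\<close>)
  qed
  have Gstep: "real (block_size j) * z * G j + e * C * K\<^sup>2 * growth s (Suc j) * growth s' (Suc j) \<le> G (Suc j)" for j
  proof -
    let ?b = "real (block_size j)" let ?S = "\<Sum>i\<le>j. growth s' i"
    have "0 \<le> ?S" using gn by (intro sum_nonneg) auto
    have "?b * z * G j = ?b * z * (K * growth zb j) + ?b * z * (e * C * K\<^sup>2 * growth s j * ?S)"
      by (simp add: G_def distrib_left)
    also have "\<dots> \<le> ?b * zb * (K * growth zb j) + ?b * s * (e * C * K\<^sup>2 * growth s j * ?S)"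
      using nn gn zb \<open>0 \<le> ?S\<close> by (intro add_mono mult_right_mono mult_left_mono) auto
    also have "\<dots> = K * growth zb (Suc j) + e * C * K\<^sup>2 * growth s (Suc j) * ?S"
      by (simp add: growth_Suc)
    finally show ?thesis by (simp add: G_def distrib_left)
  qed
  have XC: "X j \<le> C * K\<^sup>2 * growth s j * growth s' j" if "j \<le> k" for j
    unfolding X_def using xC[OF that] gn by (intro mult_right_mono) auto
  have main: "pairs S S' (\<lambda>_ _. True) j \<le> ennreal (X j) \<and> pairs S S' (=) j \<le> ennreal (G j) \<and>
     pairs S S' (\<lambda>N N'. block N = block N') j \<le> ennreal (2 / K * X j + G j)" if "j \<le> k" for j
    using that
  proof (induction j)
    case 0
    have "growth t 0 = 1" for t by (simp add: growth_def)
    then have "X 0 = K\<^sup>2" "G 0 = K + e * C * K\<^sup>2" by (simp_all add: X_def G_def x_def)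
    moreover have "0 \<le> e * C * K\<^sup>2" "0 \<le> 2 / K * K\<^sup>2" using nn K0 by auto
    ultimately show ?case
      using pairs_0[of S S', folded K_def] by (auto elim!: order_trans intro!: ennreal_leI)
  next
    case (Suc j)
    let ?b = "real (block_size j)"
    define Y where "Y = 2 / K * X j + G j"
    have Yn: "0 \<le> Y" unfolding Y_def using Xn Gn K0 by (intro add_nonneg_nonneg mult_nonneg_nonneg) auto
    have j: "j < k" using Suc by simp
    have IH: "pairs S S' (\<lambda>_ _. True) j \<le> ennreal (X j)" "pairs S S' (=) j \<le> ennreal (G j)"
      "pairs S S' (\<lambda>N N'. block N = block N') j \<le> ennreal Y" using Suc by (auto simp: Y_def)
    note P = pairs_Suc_real[OF j _ _ IH(1) Xn IH(3) Yn IH(2) Gn, folded s_def s'_def z_def]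
    have bzG: "0 \<le> ?b * z * G j" using nn Gn by auto
    have U: "?b ^ 2 * s * s' * X j + ?b * z * Y \<le> X (Suc j)" using step[OF j] bzG by (simp add: Y_def)
    have G1: "?b * z * G j \<le> G (Suc j)"
      using Gstep[of j] nn gn by (smt (verit) mult_nonneg_nonneg zero_le_power2)
    have 1: "pairs S S' (\<lambda>_ _. True) (Suc j) \<le> ennreal (X (Suc j))"
      using P[OF universal_True] step[OF j] by (auto simp: Y_def intro: order_trans ennreal_leI)
    have "e * (?b ^ 2 * s * s' * X j + ?b * z * Y) + ?b * z * G j \<le> e * (C * K\<^sup>2 * growth s (Suc j) * growth s' (Suc j)) + ?b * z * G j"
      using U XC[OF Suc.prems] nn by (intro add_mono mult_left_mono) auto
    also have "\<dots> \<le> G (Suc j)" using Gstep[of j] by (simp add: mult_ac)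
    finally have 2: "pairs S S' (=) (Suc j) \<le> ennreal (G (Suc j))"
      using P[OF universal_eq[OF j]] nn unfolding e_def[symmetric] by (auto intro: order_trans ennreal_leI)
    have "2 / K * (?b ^ 2 * s * s' * X j + ?b * z * Y) + ?b * z * G j \<le> 2 / K * X (Suc j) + G (Suc j)"
      using U G1 K0 by (intro add_mono mult_left_mono) auto
    then have 3: "pairs S S' (\<lambda>N N'. block N = block N') (Suc j) \<le> ennreal (2 / K * X (Suc j) + G (Suc j))"
      using P[OF universal_block[OF j]] K0 unfolding K_def[symmetric] by (auto intro: order_trans ennreal_leI)
    show ?case using 1 2 3 by blast
  qed
  show "j \<le> k \<Longrightarrow> pairs S S' (\<lambda>_ _. True) j \<le> ennreal (moment_const * K\<^sup>2 * growth s j * growth s' j)"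
    using main[of j] XC[of j] unfolding C_def[symmetric] by (auto intro: order_trans ennreal_leI)
  assume lt': "lt' \<le> l"
  \<comment> \<open>The last level is treated again, now comparing \<open>lt'\<close> leading bits,
    since only leaves are put into buckets.\<close>
  obtain j where j: "k = Suc j" using k by (cases k) auto
  then have jk: "j < k" "j \<le> k" by auto
  let ?b = "real (block_size j)"
  define Y where "Y = 2 / K * X j + G j"
  have Yn: "0 \<le> Y" unfolding Y_def using Xn Gn K0 by (intro add_nonneg_nonneg mult_nonneg_nonneg) auto
  have IH: "pairs S S' (\<lambda>_ _. True) j \<le> ennreal (X j)" "pairs S S' (=) j \<le> ennreal (G j)"
    "pairs S S' (\<lambda>N N'. block N = block N') j \<le> ennreal Y" using main[OF jk(2)] by (auto simp: Y_def)
  note P = pairs_Suc_real[OF jk(1) universal_leading[OF lt' jk(1)] _ IH(1) Xn IH(3) Yn IH(2) Gn, folded s_def s'_def z_def]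
  have "0 \<le> ?b * z * G j" using nn Gn by auto
  then have "?b ^ 2 * s * s' * X j + ?b * z * Y \<le> X k" using step[OF jk(1)] by (simp add: Y_def j)
  also have "X k \<le> C * K\<^sup>2 * growth s k * growth s' k" by (rule XC) simp
  finally have U: "?b ^ 2 * s * s' * X j + ?b * z * Y \<le> C * K\<^sup>2 * growth s k * growth s' k" .
  have "?b * z * G j \<le> G k"
    using Gstep[of j] nn gn unfolding j by (smt (verit) mult_nonneg_nonneg zero_le_power2)
  then have "2 / 2 ^ lt' * (?b ^ 2 * s * s' * X j + ?b * z * Y) + ?b * z * G j \<le>
    2 / 2 ^ lt' * (C * K\<^sup>2 * growth s k * growth s' k) + G k"
    using U by (intro add_mono mult_left_mono) auto
  then show "pairs S S' (\<lambda>N N'. N div 2 ^ (l - lt') = N' div 2 ^ (l - lt')) k \<le>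
      ennreal (2 / 2 ^ lt' * moment_const * K\<^sup>2 * growth s k * growth s' k +
        (K * growth zb k + e * moment_const * K\<^sup>2 * growth s k * (\<Sum>i\<le>k. growth s' i)))"
    using P unfolding j[symmetric] C_def[symmetric] G_def[symmetric] by (auto simp: mult.assoc intro: order_trans ennreal_leI)
qed

end

lemma moment_const_pos: "0 < moment_const"
  by (simp add: moment_const_def)

section \<open>Common leaves and shared buckets\<close>

context lsf_tree
begin

text \<open>Paths through filters that contain both points are paths in the trees of either point,
  so their ends are common leaves.\<close>

lemma front_subset:
  assumes "\<And>i. S i \<Longrightarrow> S' i"
  shows "set (front S ws j) \<subseteq> set (front S' ws j)"
proof (induction j)
  case (Suc j)
  have "set (children S ws N) \<subseteq> set (children S' ws N)" for N
    using assms by (auto simp: children_def)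
  then show ?case using Suc by fastforce
qed simp

lemma bucket_div: "N div 2 ^ l = k \<Longrightarrow> N div 2 ^ (l - lt) = k * 2 ^ lt + bucket N"
proof -
  assume "N div 2 ^ l = k"
  then have "k * 2 ^ l \<le> N" by auto
  define d where "d = N - k * 2 ^ l"
  have N: "N = k * 2 ^ l + d" using \<open>k * 2 ^ l \<le> N\<close> by (simp add: d_def)
  have "(2::nat) ^ l = 2 ^ lt * 2 ^ (l - lt)" using lt_le by (simp flip: power_add)
  then have "k * 2 ^ l = (k * 2 ^ lt) * 2 ^ (l - lt)" by (simp only: mult.assoc)
  then have "N div 2 ^ (l - lt) = ((k * 2 ^ lt) * 2 ^ (l - lt) + d) div 2 ^ (l - lt)" by (simp only: N)
  also have "\<dots> = k * 2 ^ lt + d div 2 ^ (l - lt)" by (rule div_mult_self3) simp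
  finally show ?thesis by (simp add: bucket_def d_def)
qed

text \<open>Leaves have the same level, so equal buckets are equal leading bits. This expresses the
  comparisons of a query by \<open>pairs\<close>.\<close>

lemma leaf_collisions:
  "of_nat (\<Sum>h\<leftarrow>leaves S ws. count_list (leaves S' ws) h) =
   (\<Sum>N\<leftarrow>front S ws k. \<Sum>N'\<leftarrow>front S' ws k. of_bool (N div 2 ^ (l - lt) = N' div 2 ^ (l - lt)) :: ennreal)"
proof -
  have cnt: "of_nat (count_list (map f xs) h) = (\<Sum>N'\<leftarrow>xs. of_bool (h = f N') :: ennreal)" for f :: "nat \<Rightarrow> nat" and xs h
    by (induction xs) auto
  have ofn: "of_nat (\<Sum>h\<leftarrow>xs. c h) = (\<Sum>h\<leftarrow>xs. of_nat (c h) :: ennreal)" for c :: "nat \<Rightarrow> nat" and xs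
    by (induction xs) auto
  show ?thesis
    unfolding ofn leaves_def cnt map_map comp_def
  proof (intro arg_cong[where f = sum_list] map_cong refl)
    fix N N' assume "N \<in> set (front S ws k)" "N' \<in> set (front S' ws k)"
    then have "N div 2 ^ l = k" "N' div 2 ^ l = k" by (auto dest: front_level)
    then show "of_bool (bucket N = bucket N') = (of_bool (N div 2 ^ (l - lt) = N' div 2 ^ (l - lt)) :: ennreal)"
      by (simp add: bucket_div)
  qed
qed

end

context lsf_prob
begin

abbreviation treeS :: "('f \<Rightarrow> bool) \<Rightarrow> (nat \<Rightarrow> 'f) \<times> (nat \<Rightarrow> nat) \<Rightarrow> nat \<Rightarrow> bool" where
  "treeS S x \<equiv> (\<lambda>i. S (fst x i))"

lemma expected_front_final:
  assumes "j \<le> k"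
  shows "(\<integral>\<^sup>+x. of_nat (length (frnt S x j)) \<partial>outcome k) = ennreal (2 ^ kap * growth (measure_pmf.prob p {f. S f}) j)"
proof -
  have "(\<integral>\<^sup>+x. of_nat (length (frnt S x j)) \<partial>outcome k) = (\<integral>\<^sup>+x. of_nat (length (frnt S x j)) \<partial>outcome j)"
  proof (rule outcome_mono[where \<phi> = "\<lambda>fs ws. of_nat (length (front (\<lambda>i. S (fs i)) ws j))"])
    show "of_nat (length (front (\<lambda>i. S (fs i)) ws j)) = of_nat (length (front (\<lambda>i. S (fs' i)) ws' j))"
      if "\<And>i. i < start (j * 2 ^ kap) \<Longrightarrow> fs i = fs' i" "\<And>i. i < j \<Longrightarrow> ws i = ws' i" for fs fs' ws ws'
      using front_cong[of j "\<lambda>i. S (fs i)" "\<lambda>i. S (fs' i)" ws ws'] that by simp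
  qed fact
  then show ?thesis using expected_front[OF assms] by (simp add: growth_def)
qed

lemma expected_hits:
  "(\<integral>\<^sup>+x. of_nat (length (filter (treeS S x) [0..<nfilters])) \<partial>outcome k) =
    ennreal (real nfilters * measure_pmf.prob p {f. S f})"
proof -
  have len: "of_nat (length (filter P [0..<nfilters])) = (\<Sum>i<nfilters. of_bool (P i) :: ennreal)" for P
  proof -
    have "of_nat (length (filter P xs)) = (\<Sum>i\<leftarrow>xs. of_bool (P i) :: ennreal)" for xs by (induction xs) auto
    then show ?thesis by (simp add: interv_sum_list_conv_sum_set_nat atLeast0LessThan)
  qed
  have "(\<integral>\<^sup>+x. of_bool (S (fst x i)) \<partial>outcome k) = ennreal (measure_pmf.prob p {f. S f})" if "i < nfilters" for i
  proof -
    have i: "i \<in> {..<start (k * 2 ^ kap)}" using that by (simp add: nfilters_def)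
    have "(\<integral>\<^sup>+x. of_bool (S (fst x i)) \<partial>outcome k) = (\<integral>\<^sup>+fs. of_bool (S (fs i)) \<partial>Pi_pmf {..<start (k * 2 ^ kap)} dflt (\<lambda>_. p))"
      by (simp add: outcome_def nn_integral_pair_pmf')
    also have "\<dots> = (\<integral>\<^sup>+f. of_bool (S f) \<partial>map_pmf (\<lambda>fs. fs i) (Pi_pmf {..<start (k * 2 ^ kap)} dflt (\<lambda>_. p)))"
      by simp
    also have "\<dots> = (\<integral>\<^sup>+f. of_bool (S f) \<partial>p)" using i by (subst Pi_pmf_component) auto
    also have "\<dots> = (\<integral>\<^sup>+f. indicator {f. S f} f \<partial>p)" by (intro nn_integral_cong) (auto simp: indicator_def)
    also have "\<dots> = ennreal (measure_pmf.prob p {f. S f})" by (simp add: measure_pmf.emeasure_eq_measure)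
    finally show ?thesis .
  qed
  note one = this
  have "(\<integral>\<^sup>+x. of_nat (length (filter (treeS S x) [0..<nfilters])) \<partial>outcome k) =
    (\<Sum>i<nfilters. \<integral>\<^sup>+x. of_bool (S (fst x i)) \<partial>outcome k)"
    unfolding len by (rule nn_integral_sum) simp
  also have "\<dots> = (\<Sum>i<nfilters. ennreal (measure_pmf.prob p {f. S f}))"
    using one by (intro sum.cong) auto
  finally show ?thesis by (simp add: ennreal_mult ennreal_of_nat_eq_real_of_nat)
qed

end

text \<open>Near criticality is required on every level and not only at the leaves, because the
  second moment involves ratios of growths between two levels. \<open>ids\<close> asks for names so
  long that their collisions contribute a lower order term.\<close>

locale lsf_balanced = lsf_prob w k kap l lt bl A p dflt
  for w k kap l lt bl A and p :: "'f pmf" and dflt +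
  fixes p1 :: real
  assumes p1: "0 < p1" "p1 \<le> 1" and k1: "1 \<le> k" and kK: "real k \<le> 2 ^ kap"
    and balanced: "\<And>j. j \<le> k \<Longrightarrow> 1 / 16 \<le> growth p1 j" "\<And>j. j \<le> k \<Longrightarrow> growth p1 j \<le> 1"
    and block_p1: "\<And>j. j < k \<Longrightarrow> 1 / 2 \<le> real (block_size j) * p1" "\<And>j. j < k \<Longrightarrow> real (block_size j) * p1 \<le> 2"
    and ids: "2 / 2 ^ l * moment_const * (real k)\<^sup>2 \<le> 1"
begin

lemma growth_scale: "growth s j = growth p1 j * (s / p1) ^ j"
  using p1 by (induction j) (simp_all add: growth_def)

lemma growth_le:
  assumes "j \<le> k" "0 \<le> s" "s \<le> t" "p1 \<le> t"
  shows "growth s j \<le> (t / p1) ^ k"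
proof -
  have "growth s j \<le> growth t j" using assms by (intro growth_mono)
  also have "\<dots> \<le> 1 * (t / p1) ^ j"
    unfolding growth_scale[of t] using balanced(2)[OF assms(1)] assms p1 by (intro mult_right_mono) auto
  also have "\<dots> \<le> (t / p1) ^ k" using assms p1 by (simp add: power_increasing)
  finally show ?thesis .
qed

text \<open>The balanced factor varies between \<open>1 / 16\<close> and 1, and the remaining factor
  \<open>(s / p1) ^ j\<close> increases with \<open>j\<close>.\<close>

lemma growth_ratio:
  assumes "p1 \<le> s" "i \<le> j" "j \<le> k"
  shows "growth s i \<le> 16 * growth s j"
proof -
  have "growth s i = growth p1 i * (s / p1) ^ i" by (rule growth_scale)
  also have "\<dots> \<le> 1 * (s / p1) ^ j"
    using balanced(2)[of i] assms p1 growth_nonneg[of p1 i] by (intro mult_mono power_increasing) auto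
  also have "\<dots> \<le> 16 * growth p1 j * (s / p1) ^ j"
    using balanced(1)[of j] assms p1 by (intro mult_right_mono) auto
  also have "\<dots> = 16 * growth s j" by (simp add: growth_scale[of s])
  finally show ?thesis .
qed

text \<open>The 7 is composed of 2 for the hits, 1 for the blocks and 4 for the nodes, which count
  twice on each of \<open>k + 1\<close> levels, at most \<open>2 * k\<close>.\<close>

lemma expected_work:
  assumes "p1 \<le> measure_pmf.prob p {f. S f}" "measure_pmf.prob p {f. S f} \<le> pu"
  shows "(\<integral>\<^sup>+x. of_nat (work (treeS S x) (snd x)) \<partial>outcome k) \<le> ennreal (7 * real k * 2 ^ kap * (pu / p1) ^ k)"
proof -
  let ?s = "measure_pmf.prob p {f. S f}" let ?u = "(pu / p1) ^ k" let ?K = "2 ^ kap :: real"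
  have pu: "p1 \<le> pu" using assms by simp
  have u1: "pu / p1 \<le> ?u" "1 \<le> ?u"
    using pu p1 k1 power_increasing[of 1 k "pu / p1"] by (auto intro: one_le_power)
  have hits: "real nfilters * ?s \<le> 2 * real k * ?K * ?u"
  proof -
    have "real nfilters * p1 = (\<Sum>g<k * 2 ^ kap. real (block_size (g div 2 ^ kap)) * p1)"
      by (simp add: nfilters_def start_def sum_distrib_right)
    also have "\<dots> \<le> (\<Sum>g<k * 2 ^ kap. 2)"
      by (intro sum_mono block_p1(2)) (simp add: less_mult_imp_div_less)
    also have "\<dots> = 2 * real k * ?K" by simp
    finally have h: "real nfilters * p1 \<le> 2 * real k * ?K" .
    have "real nfilters * p1 * (pu / p1) \<le> 2 * real k * ?K * ?u"
      by (rule mult_mono[OF h u1(1)]) (use pu p1 in auto)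
    moreover have "real nfilters * ?s \<le> real nfilters * pu" using assms by (intro mult_left_mono) auto
    ultimately show ?thesis using p1 by simp
  qed
  have fr: "(\<Sum>j\<le>k. ?K * growth ?s j) \<le> 2 * real k * ?K * ?u"
  proof -
    have "(\<Sum>j\<le>k. ?K * growth ?s j) \<le> (\<Sum>j\<le>k. ?K * ?u)"
      using assms p1 pu by (intro sum_mono mult_left_mono growth_le) auto
    also have "\<dots> = (real k + 1) * (?K * ?u)" by simp
    also have "\<dots> \<le> (2 * real k) * (?K * ?u)" using k1 u1 by (intro mult_right_mono) auto
    finally show ?thesis by simp
  qed
  have bfs_len: "of_nat (length (bfs T ws)) = (\<Sum>j\<le>k. of_nat (length (front T ws j)) :: ennreal)" for T ws
  proof -
    have "length (bfs T ws) = (\<Sum>j\<leftarrow>[0..<Suc k]. length (front T ws j))"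
      by (simp add: bfs_def length_concat comp_def del: upt_Suc)
    also have "\<dots> = (\<Sum>j\<le>k. length (front T ws j))"
      by (simp only: interv_sum_list_conv_sum_set_nat set_upt atLeast0LessThan lessThan_Suc_atMost)
    finally show ?thesis by simp
  qed
  have "(\<integral>\<^sup>+x. of_nat (work (treeS S x) (snd x)) \<partial>outcome k) =
    (\<integral>\<^sup>+x. of_nat (length (filter (treeS S x) [0..<nfilters])) + of_nat (k * 2 ^ kap) +
      2 * (\<Sum>j\<le>k. of_nat (length (frnt S x j))) \<partial>outcome k)"
    by (simp add: work_def bfs_len)
  also have "\<dots> = (\<integral>\<^sup>+x. of_nat (length (filter (treeS S x) [0..<nfilters])) \<partial>outcome k) + of_nat (k * 2 ^ kap) +
      2 * (\<Sum>j\<le>k. \<integral>\<^sup>+x. of_nat (length (frnt S x j)) \<partial>outcome k)"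
    by (simp add: nn_integral_add nn_integral_cmult nn_integral_sum)
  also have "\<dots> = ennreal (real nfilters * ?s) + ennreal (real k * ?K) + 2 * (\<Sum>j\<le>k. ennreal (?K * growth ?s j))"
  proof -
    have "of_nat (k * 2 ^ kap) = ennreal (real k * ?K)" by (simp add: ennreal_of_nat_eq_real_of_nat)
    moreover have "(\<Sum>j\<le>k. \<integral>\<^sup>+x. of_nat (length (frnt S x j)) \<partial>outcome k) = (\<Sum>j\<le>k. ennreal (?K * growth ?s j))"
      by (intro sum.cong refl expected_front_final) simp
    ultimately show ?thesis unfolding expected_hits by (simp only:)
  qed
  also have "\<dots> = ennreal (real nfilters * ?s + real k * ?K + 2 * (\<Sum>j\<le>k. ?K * growth ?s j))"
  proof -
    have "(\<Sum>j\<le>k. ennreal (?K * growth ?s j)) = ennreal (\<Sum>j\<le>k. ?K * growth ?s j)"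
      by (intro sum_ennreal mult_nonneg_nonneg growth_nonneg) auto
    moreover have "0 \<le> (\<Sum>j\<le>k. ?K * growth ?s j)" by (intro sum_nonneg mult_nonneg_nonneg growth_nonneg) auto
    moreover have "ennreal a + ennreal b + 2 * ennreal c = ennreal (a + b + 2 * c)" if "0 \<le> a" "0 \<le> b" "0 \<le> c" for a b c
    proof -
      have "2 * ennreal c = ennreal (2 * c)" using that by (simp add: ennreal_mult)
      then show ?thesis using that by (simp flip: ennreal_plus)
    qed
    ultimately show ?thesis by simp
  qed
  also have "\<dots> \<le> ennreal (7 * real k * ?K * ?u)"
  proof (rule ennreal_leI)
    have "real k * ?K * 1 \<le> real k * ?K * ?u" using u1 by (intro mult_left_mono) auto
    then show "real nfilters * ?s + real k * ?K + 2 * (\<Sum>j\<le>k. ?K * growth ?s j) \<le> 7 * real k * ?K * ?u"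
      using hits fr by linarith
  qed
  finally show ?thesis .
qed

text \<open>The second moment enters through the pointwise inequality
  \<open>2 \<theta> Z \<le> 1[Z > 0] + \<theta>\<^sup>2 Z\<^sup>2\<close>, which also absorbs the bad events via Markov's inequality.\<close>

lemma success_probability:
  fixes Q U :: "'f \<Rightarrow> bool" and V :: "'i \<Rightarrow> 'f \<Rightarrow> bool" and I :: "'i set"
  assumes near: "p1 \<le> measure_pmf.prob p {f. Q f \<and> U f}"
    and Q: "measure_pmf.prob p {f. Q f} \<le> pq" and U: "measure_pmf.prob p {f. U f} \<le> pu"
    and V: "\<And>i. i \<in> I \<Longrightarrow> p1 \<le> measure_pmf.prob p {f. V i f}" "\<And>i. i \<in> I \<Longrightarrow> measure_pmf.prob p {f. V i f} \<le> pu"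
      "\<And>i. i \<in> I \<Longrightarrow> measure_pmf.prob p {f. Q f \<and> V i f} \<le> p2"
    and I: "finite I" "card I \<le> n" and p2: "0 \<le> p2"
    and FU: "8 * moment_const * (7 * real k * 2 ^ kap * (pu / p1) ^ k) \<le> real FU + 1"
    and FQ: "8 * moment_const * (7 * real k * 2 ^ kap * (pq / p1) ^ k) \<le> real FQ + 1"
    and B: "8 * moment_const * (2 ^ kap * (pu / p1) ^ k) \<le> real B + 1"
    and DQ: "8 * moment_const * (real n * (2 / 2 ^ lt * moment_const * (2 ^ kap)\<^sup>2 * (pq / p1) ^ k * (pu / p1) ^ k +
      (2 ^ kap * (p2 / p1) ^ k + 2 / 2 ^ l * moment_const * (2 ^ kap)\<^sup>2 * (pq / p1) ^ k * ((real k + 1) * (pu / p1) ^ k)))) \<le> real DQ"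
    and DQ_pos: "0 < DQ"
  shows "1 / (2 * moment_const) \<le> measure_pmf.prob (outcome k) {x.
     work (treeS U x) (snd x) \<le> FU \<and> length (leaves (treeS U x) (snd x)) \<le> B \<and>
     work (treeS Q x) (snd x) \<le> FQ \<and> set (leaves (treeS Q x) (snd x)) \<inter> set (leaves (treeS U x) (snd x)) \<noteq> {} \<and>
     (\<Sum>i\<in>I. \<Sum>h\<leftarrow>leaves (treeS Q x) (snd x). count_list (leaves (treeS (V i) x) (snd x)) h) < DQ}"
    (is "_ \<le> measure_pmf.prob _ {x. ?Good x}")
proof -
  let ?C = moment_const let ?K = "2 ^ kap :: real" let ?q = "(pq / p1) ^ k" let ?u = "(pu / p1) ^ k"
  let ?QU = "\<lambda>f. Q f \<and> U f"
  let ?s = "measure_pmf.prob p {f. ?QU f}"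
  have C: "0 < ?C" by (rule moment_const_pos)
  have sQ: "p1 \<le> measure_pmf.prob p {f. Q f}" and sU: "p1 \<le> measure_pmf.prob p {f. U f}"
  proof -
    have "?s \<le> measure_pmf.prob p {f. Q f}" "?s \<le> measure_pmf.prob p {f. U f}"
      by (rule measure_pmf.finite_measure_mono; auto)+
    then show "p1 \<le> measure_pmf.prob p {f. Q f}" "p1 \<le> measure_pmf.prob p {f. U f}" using near by linarith+
  qed
  have pq: "p1 \<le> pq" and pu: "p1 \<le> pu" using sQ Q sU U by auto
  \<comment> \<open>\<open>Z\<close> counts the paths all of whose filters contain both points. It
    bounds the common leaves from below in the sense that \<open>Z x > 0\<close> forces one, and as
    the front of a single predicate its first two moments are known.\<close>
  define Z where "Z x = length (frnt ?QU x k)" for x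
  define far where "far x = (\<Sum>i\<in>I. \<Sum>h\<leftarrow>leaves (treeS Q x) (snd x). count_list (leaves (treeS (V i) x) (snd x)) h)" for x
  define g where "g = growth ?s k"
  have g0: "0 < g"
  proof -
    have "1 / 16 \<le> g" unfolding g_def using balanced(1)[of k] growth_mono[of p1 ?s k] near p1 by simp
    then show ?thesis by simp
  qed
  \<comment> \<open>With mean \<open>?K * g\<close> and second moment at most \<open>?C\<close>
    times the squared mean, this choice leaves \<open>2 / ?C - 1 / ?C\<close>. The four Markov terms
    take at most \<open>1 / (8 * ?C)\<close> each, and \<open>1 / (2 * ?C)\<close> remains.\<close>
  define \<theta> where "\<theta> = 1 / (?C * ?K * g)"
  have \<theta>: "0 < \<theta>" using C g0 by (simp add: \<theta>_def)
  have EZ: "(\<integral>\<^sup>+x. of_nat (Z x) \<partial>outcome k) = ennreal (?K * g)"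
    unfolding Z_def g_def by (rule expected_front_final) simp
  have EZ2: "(\<integral>\<^sup>+x. of_nat (Z x) * of_nat (Z x) \<partial>outcome k) \<le> ennreal (?C * ?K\<^sup>2 * g * g)"
  proof -
    have "(\<integral>\<^sup>+x. of_nat (Z x) * of_nat (Z x) \<partial>outcome k) = pairs ?QU ?QU (\<lambda>_ _. True) k"
      unfolding pairs_def Z_def by (simp add: sum_list_triv)
    also have "\<dots> \<le> ennreal (?C * ?K\<^sup>2 * growth ?s k * growth ?s k)"
    proof (rule pair_bounds(1)[where zb = ?s])
      show "1 / 2 \<le> real (block_size j) * ?s" if "j < k" for j
        using block_p1(1)[OF that] near by (meson mult_left_mono of_nat_0_le_iff order_trans)
    qed (use k1 kK ids near growth_ratio in auto)
    finally show ?thesis unfolding g_def .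
  qed
  have EU: "(\<integral>\<^sup>+x. of_nat (work (treeS U x) (snd x)) \<partial>outcome k) \<le> ennreal (7 * real k * ?K * ?u)"
    using sU U by (rule expected_work)
  have EQ: "(\<integral>\<^sup>+x. of_nat (work (treeS Q x) (snd x)) \<partial>outcome k) \<le> ennreal (7 * real k * ?K * ?q)"
    using sQ Q by (rule expected_work)
  have EL: "(\<integral>\<^sup>+x. of_nat (length (leaves (treeS U x) (snd x))) \<partial>outcome k) \<le> ennreal (?K * ?u)"
    unfolding leaves_def length_map expected_front_final[OF order_refl]
    using U pu by (intro ennreal_leI mult_left_mono growth_le) auto
  define D where "D = 2 / 2 ^ lt * ?C * ?K\<^sup>2 * ?q * ?u + (?K * (p2 / p1) ^ k + 2 / 2 ^ l * ?C * ?K\<^sup>2 * ?q * ((real k + 1) * ?u))"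
  have qu: "0 \<le> ?q" "0 \<le> ?u" using pq pu p1 by auto
  have D0: "0 \<le> D" unfolding D_def using C qu p2 p1 by (intro add_nonneg_nonneg mult_nonneg_nonneg) auto
  have EF: "(\<integral>\<^sup>+x. of_nat (far x) \<partial>outcome k) \<le> ennreal (real n * D)"
  proof -
    have one: "(\<integral>\<^sup>+x. of_nat (\<Sum>h\<leftarrow>leaves (treeS Q x) (snd x). count_list (leaves (treeS (V i) x) (snd x)) h) \<partial>outcome k) \<le> ennreal D"
      if i: "i \<in> I" for i
    proof -
      let ?sQ = "measure_pmf.prob p {f. Q f}" let ?sV = "measure_pmf.prob p {f. V i f}"
      \<comment> \<open>\<open>pair_bounds\<close> asks for a bound that does not exceed the
        probability of the query side, and \<open>p2\<close> alone may exceed it.\<close>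
      let ?zb = "min ?sQ p2"
      have z: "measure_pmf.prob p {f. Q f \<and> V i f} \<le> ?zb"
      proof -
        have "measure_pmf.prob p {f. Q f \<and> V i f} \<le> measure_pmf.prob p {f. Q f}"
          by (rule measure_pmf.finite_measure_mono) auto
        then show ?thesis using V(3)[OF i] by simp
      qed
      have "(\<integral>\<^sup>+x. of_nat (\<Sum>h\<leftarrow>leaves (treeS Q x) (snd x). count_list (leaves (treeS (V i) x) (snd x)) h) \<partial>outcome k) =
        pairs Q (V i) (\<lambda>N N'. N div 2 ^ (l - lt) = N' div 2 ^ (l - lt)) k"
        unfolding pairs_def leaf_collisions ..
      also have "\<dots> \<le> ennreal (2 / 2 ^ lt * ?C * ?K\<^sup>2 * growth ?sQ k * growth ?sV k +
        (?K * growth ?zb k + 2 / 2 ^ l * ?C * ?K\<^sup>2 * growth ?sQ k * (\<Sum>i\<le>k. growth ?sV i)))"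
      proof (rule pair_bounds(2))
        show "1 / 2 \<le> real (block_size j) * ?sV" if "j < k" for j
          using block_p1(1)[OF that] V(1)[OF i] by (meson mult_left_mono of_nat_0_le_iff order_trans)
      qed (use k1 kK ids z V(1)[OF i] growth_ratio lt_le in auto)
      also have "\<dots> \<le> ennreal D"
      proof (rule ennreal_leI)
        have gq: "growth ?sQ k \<le> ?q" using Q pq by (intro growth_le) auto
        have gv: "growth ?sV j \<le> ?u" if "j \<le> k" for j using V(2)[OF i] pu that by (intro growth_le) auto
        have gn: "0 \<le> growth ?sQ j" "0 \<le> growth ?sV j" for j by (auto intro: growth_nonneg)
        have gz: "growth ?zb k \<le> (p2 / p1) ^ k"
        proof -
          have "growth ?zb k \<le> growth p2 k" using p2 by (intro growth_mono) auto
          also have "\<dots> \<le> 1 * (p2 / p1) ^ k" unfolding growth_scale[of p2]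
            using balanced(2)[of k] p2 p1 by (intro mult_right_mono) auto
          finally show ?thesis by simp
        qed
        have gs: "(\<Sum>i\<le>k. growth ?sV i) \<le> (real k + 1) * ?u"
          using sum_mono[of "{..k}" "growth ?sV" "\<lambda>_. ?u"] gv by (simp add: add.commute)
        have gs0: "0 \<le> (\<Sum>i\<le>k. growth ?sV i)" using gn by (intro sum_nonneg) auto
        show "2 / 2 ^ lt * ?C * ?K\<^sup>2 * growth ?sQ k * growth ?sV k +
          (?K * growth ?zb k + 2 / 2 ^ l * ?C * ?K\<^sup>2 * growth ?sQ k * (\<Sum>i\<le>k. growth ?sV i)) \<le> D"
          unfolding D_def using C gq gv[of k] gn gz gs gs0 qu
          by (intro add_mono mult_mono mult_left_mono) auto
      qed
      finally show ?thesis .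
    qed
    have "(\<integral>\<^sup>+x. of_nat (far x) \<partial>outcome k) =
      (\<Sum>i\<in>I. \<integral>\<^sup>+x. of_nat (\<Sum>h\<leftarrow>leaves (treeS Q x) (snd x). count_list (leaves (treeS (V i) x) (snd x)) h) \<partial>outcome k)"
      unfolding far_def of_nat_sum by (rule nn_integral_sum) simp
    also have "\<dots> \<le> (\<Sum>i\<in>I. ennreal D)" by (rule sum_mono) (rule one)
    also have "\<dots> = ennreal (real (card I) * D)" by (simp add: ennreal_mult' ennreal_of_nat_eq_real_of_nat)
    also have "\<dots> \<le> ennreal (real n * D)" using I D0 by (intro ennreal_leI mult_right_mono) auto
    finally show ?thesis .
  qed
  have pt: "2 * \<theta> * real (Z x) \<le> of_bool (?Good x) + \<theta>\<^sup>2 * (real (Z x) * real (Z x)) +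
      real (work (treeS U x) (snd x)) / (real FU + 1) + real (length (leaves (treeS U x) (snd x))) / (real B + 1) +
      real (work (treeS Q x) (snd x)) / (real FQ + 1) + real (far x) / real DQ" for x
  proof -
    have sq: "2 * \<theta> * real (Z x) \<le> 1 + \<theta>\<^sup>2 * (real (Z x) * real (Z x))"
      using zero_le_power2[of "\<theta> * real (Z x) - 1"] by (simp add: power2_eq_square algebra_simps)
    have nn: "0 \<le> real (work (treeS U x) (snd x)) / (real FU + 1)" "0 \<le> real (length (leaves (treeS U x) (snd x))) / (real B + 1)"
      "0 \<le> real (work (treeS Q x) (snd x)) / (real FQ + 1)" "0 \<le> real (far x) / real DQ" "0 \<le> \<theta>\<^sup>2 * (real (Z x) * real (Z x))"
      by auto
    have big: "1 \<le> real a / (real b + 1)" if "\<not> a \<le> b" for a b :: nat using that by simp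
    have bigD: "1 \<le> real (far x) / real DQ" if "\<not> far x < DQ" using that DQ_pos by simp
    show ?thesis
    proof (cases "Z x = 0")
      case True
      then show ?thesis using nn by simp
    next
      case False
      then obtain N where N: "N \<in> set (frnt ?QU x k)" by (metis Z_def length_0_conv list.set_intros(1) neq_Nil_conv)
      have "N \<in> set (frnt Q x k)" "N \<in> set (frnt U x k)"
        using N front_subset[of "\<lambda>i. ?QU (fst x i)" "\<lambda>i. Q (fst x i)" "snd x" k]
          front_subset[of "\<lambda>i. ?QU (fst x i)" "\<lambda>i. U (fst x i)" "snd x" k] by auto
      then have "set (leaves (treeS Q x) (snd x)) \<inter> set (leaves (treeS U x) (snd x)) \<noteq> {}"
        unfolding leaves_def by auto
      then have "?Good x \<or> \<not> work (treeS U x) (snd x) \<le> FU \<or> \<not> length (leaves (treeS U x) (snd x)) \<le> B \<or>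
        \<not> work (treeS Q x) (snd x) \<le> FQ \<or> \<not> far x < DQ" unfolding far_def by blast
      then show ?thesis
      proof (elim disjE)
        assume "?Good x"
        then have "of_bool (?Good x) = (1::real)" by simp
        then show ?thesis using sq nn by linarith
      qed (use sq nn big bigD of_bool_def in \<open>smt (verit, best) zero_le_one of_bool_less_eq_iff zero_less_eq_of_bool\<close>)+
    qed
  qed
  have lin: "(\<integral>\<^sup>+x. a0 x + c1 * a1 x + c2 * a2 x + c3 * a3 x + c4 * a4 x + c5 * a5 x \<partial>outcome k) =
    (\<integral>\<^sup>+x. a0 x \<partial>outcome k) + c1 * (\<integral>\<^sup>+x. a1 x \<partial>outcome k) + c2 * (\<integral>\<^sup>+x. a2 x \<partial>outcome k) +
    c3 * (\<integral>\<^sup>+x. a3 x \<partial>outcome k) + c4 * (\<integral>\<^sup>+x. a4 x \<partial>outcome k) + c5 * (\<integral>\<^sup>+x. a5 x \<partial>outcome k)"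
    for a0 a1 a2 a3 a4 a5 c1 c2 c3 c4 c5
    by (simp add: nn_integral_add nn_integral_cmult)
  define P where "P = measure_pmf.prob (outcome k) {x. ?Good x}"
  have "ennreal (2 * \<theta>) * (\<integral>\<^sup>+x. of_nat (Z x) \<partial>outcome k) = (\<integral>\<^sup>+x. ennreal (2 * \<theta> * real (Z x)) \<partial>outcome k)"
    using \<theta> by (simp add: ennreal_mult ennreal_of_nat_eq_real_of_nat nn_integral_cmult)
  also have "\<dots> \<le> (\<integral>\<^sup>+x. of_bool (?Good x) + ennreal (\<theta>\<^sup>2) * (of_nat (Z x) * of_nat (Z x)) +
      ennreal (1 / (real FU + 1)) * of_nat (work (treeS U x) (snd x)) +
      ennreal (1 / (real B + 1)) * of_nat (length (leaves (treeS U x) (snd x))) +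
      ennreal (1 / (real FQ + 1)) * of_nat (work (treeS Q x) (snd x)) + ennreal (1 / real DQ) * of_nat (far x) \<partial>outcome k)"
  proof (rule nn_integral_mono)
    fix x
    have ob: "(of_bool b :: ennreal) = ennreal (of_bool b)" for b by (cases b) auto
    show "ennreal (2 * \<theta> * real (Z x)) \<le> of_bool (?Good x) + ennreal (\<theta>\<^sup>2) * (of_nat (Z x) * of_nat (Z x)) +
      ennreal (1 / (real FU + 1)) * of_nat (work (treeS U x) (snd x)) +
      ennreal (1 / (real B + 1)) * of_nat (length (leaves (treeS U x) (snd x))) +
      ennreal (1 / (real FQ + 1)) * of_nat (work (treeS Q x) (snd x)) + ennreal (1 / real DQ) * of_nat (far x)"
      unfolding ob ennreal_of_nat_eq_real_of_nat
      using ennreal_leI[OF pt[of x]] \<theta> by (simp flip: ennreal_mult ennreal_plus)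
  qed
  also have "\<dots> = (\<integral>\<^sup>+x. of_bool (?Good x) \<partial>outcome k) + ennreal (\<theta>\<^sup>2) * (\<integral>\<^sup>+x. of_nat (Z x) * of_nat (Z x) \<partial>outcome k) +
      ennreal (1 / (real FU + 1)) * (\<integral>\<^sup>+x. of_nat (work (treeS U x) (snd x)) \<partial>outcome k) +
      ennreal (1 / (real B + 1)) * (\<integral>\<^sup>+x. of_nat (length (leaves (treeS U x) (snd x))) \<partial>outcome k) +
      ennreal (1 / (real FQ + 1)) * (\<integral>\<^sup>+x. of_nat (work (treeS Q x) (snd x)) \<partial>outcome k) +
      ennreal (1 / real DQ) * (\<integral>\<^sup>+x. of_nat (far x) \<partial>outcome k)"
    by (rule lin)
  also have "(\<integral>\<^sup>+x. of_bool (?Good x) \<partial>outcome k) = ennreal P"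
  proof -
    have "(\<integral>\<^sup>+x. of_bool (?Good x) \<partial>outcome k) = (\<integral>\<^sup>+x. indicator {x. ?Good x} x \<partial>outcome k)"
      by (intro nn_integral_cong) (simp add: indicator_def)
    also have "\<dots> = ennreal P" unfolding P_def by (simp add: measure_pmf.emeasure_eq_measure)
    finally show ?thesis .
  qed
  also have "ennreal P + ennreal (\<theta>\<^sup>2) * (\<integral>\<^sup>+x. of_nat (Z x) * of_nat (Z x) \<partial>outcome k) +
      ennreal (1 / (real FU + 1)) * (\<integral>\<^sup>+x. of_nat (work (treeS U x) (snd x)) \<partial>outcome k) +
      ennreal (1 / (real B + 1)) * (\<integral>\<^sup>+x. of_nat (length (leaves (treeS U x) (snd x))) \<partial>outcome k) +
      ennreal (1 / (real FQ + 1)) * (\<integral>\<^sup>+x. of_nat (work (treeS Q x) (snd x)) \<partial>outcome k) +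
      ennreal (1 / real DQ) * (\<integral>\<^sup>+x. of_nat (far x) \<partial>outcome k) \<le>
     ennreal P + ennreal (\<theta>\<^sup>2) * ennreal (?C * ?K\<^sup>2 * g * g) + ennreal (1 / (real FU + 1)) * ennreal (7 * real k * ?K * ?u) +
      ennreal (1 / (real B + 1)) * ennreal (?K * ?u) + ennreal (1 / (real FQ + 1)) * ennreal (7 * real k * ?K * ?q) +
      ennreal (1 / real DQ) * ennreal (real n * D)"
    using EZ2 EU EQ EL EF by (intro add_mono mult_left_mono order_refl) auto
  also have "\<dots> = ennreal (P + \<theta>\<^sup>2 * (?C * ?K\<^sup>2 * g * g) + 1 / (real FU + 1) * (7 * real k * ?K * ?u) +
      1 / (real B + 1) * (?K * ?u) + 1 / (real FQ + 1) * (7 * real k * ?K * ?q) + 1 / real DQ * (real n * D))"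
    using C g0 qu D0 by (simp add: P_def flip: ennreal_mult ennreal_plus)
  finally have "ennreal (2 * \<theta> * (?K * g)) \<le> ennreal (P + \<theta>\<^sup>2 * (?C * ?K\<^sup>2 * g * g) + 1 / (real FU + 1) * (7 * real k * ?K * ?u) +
      1 / (real B + 1) * (?K * ?u) + 1 / (real FQ + 1) * (7 * real k * ?K * ?q) + 1 / real DQ * (real n * D))"
    unfolding EZ using \<theta> g0 by (simp add: ennreal_mult)
  then have main: "2 * \<theta> * (?K * g) \<le> P + \<theta>\<^sup>2 * (?C * ?K\<^sup>2 * g * g) + 1 / (real FU + 1) * (7 * real k * ?K * ?u) +
      1 / (real B + 1) * (?K * ?u) + 1 / (real FQ + 1) * (7 * real k * ?K * ?q) + 1 / real DQ * (real n * D)"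
    using C g0 qu D0 by (subst (asm) ennreal_le_iff) (auto simp: P_def intro!: add_nonneg_nonneg mult_nonneg_nonneg)
  have e1: "2 * \<theta> * (?K * g) = 2 / ?C" "\<theta>\<^sup>2 * (?C * ?K\<^sup>2 * g * g) = 1 / ?C"
    using C g0 by (simp_all add: \<theta>_def field_simps power2_eq_square)
  have quarter: "1 / a * t \<le> 1 / (8 * ?C)" if "8 * ?C * t \<le> a" "0 < a" for a t
    using that C by (simp add: field_simps)
  have "1 / (real FU + 1) * (7 * real k * ?K * ?u) \<le> 1 / (8 * ?C)" using FU by (rule quarter) simp
  moreover have "1 / (real B + 1) * (?K * ?u) \<le> 1 / (8 * ?C)" using B by (rule quarter) simp
  moreover have "1 / (real FQ + 1) * (7 * real k * ?K * ?q) \<le> 1 / (8 * ?C)" using FQ by (rule quarter) simp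
  moreover have "1 / real DQ * (real n * D) \<le> 1 / (8 * ?C)" using DQ DQ_pos unfolding D_def by (intro quarter) auto
  ultimately have "2 / ?C \<le> P + 1 / ?C + 4 * (1 / (8 * ?C))" using main unfolding e1 by linarith
  then show ?thesis unfolding P_def using C by (simp add: field_simps)
qed

end

section \<open>Dependence on the random choices\<close>

text \<open>Indistinguishability for runs that draw at most \<open>W\<close> words and
  \<open>M\<close> filters and evaluate filters only on points of \<open>Y\<close>.\<close>

definition agree :: "'a env \<Rightarrow> 'a env \<Rightarrow> nat \<Rightarrow> nat \<Rightarrow> 'a set \<Rightarrow> bool" where
  "agree E E' W M Y \<longleftrightarrow> word_size E = word_size E' \<and> distance E = distance E' \<and> threshold E = threshold E' \<and>
     (\<forall>i<W. word_stream E i = word_stream E' i) \<and>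
     (\<forall>y\<in>Y. \<forall>i<M. \<forall>z. y \<in> side_set z (filter_stream E i) \<longleftrightarrow> y \<in> side_set z (filter_stream E' i))"

text \<open>Draw counters never decrease, so a bound on the final state holds throughout the
  execution.\<close>

lemma exec_frame:
  "exec E c s s' \<Longrightarrow> words_drawn s \<le> words_drawn s' \<and> filters_drawn s \<le> filters_drawn s' \<and>
     slots s' = slots s \<and> arg s' = arg s"
proof (induction rule: exec.induct)
  case (exec_Do i s s')
  then show ?case
    by (cases i) (auto simp: tick_def set_reg_def touch_def Let_def split: option.splits if_splits)
qed (auto simp: tick_def)

lemma scan_stop_cong:
  assumes "\<And>i. i < b \<Longrightarrow> P i = P' i"
  shows "scan_stop P a b = scan_stop P' a b"
proof -
  have "(\<lambda>j. a \<le> j \<and> (b \<le> j \<or> P j)) = (\<lambda>j. a \<le> j \<and> (b \<le> j \<or> P' j))"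
  proof
    fix j
    show "(a \<le> j \<and> (b \<le> j \<or> P j)) = (a \<le> j \<and> (b \<le> j \<or> P' j))"
      using assms[of j] by (cases "j < b") auto
  qed
  then show ?thesis unfolding scan_stop_def by (rule arg_cong)
qed

lemma step_cong:
  assumes "agree E E' W M Y" "step E i s = Some s'" "words_drawn s' \<le> W" "filters_drawn s \<le> M"
    and "\<And>x. arg s = Some x \<Longrightarrow> x \<in> Y"
  shows "step E' i s = Some s'"
proof (cases i)
  case (Scan z t a b)
  then obtain x where x: "arg s = Some x" and le: "regs s b \<le> filters_drawn s"
    using assms(2) by (auto split: option.splits if_splits)
  have "scan_stop (\<lambda>i. x \<in> side_set z (filter_stream E i)) (regs s a) (regs s b) =
    scan_stop (\<lambda>i. x \<in> side_set z (filter_stream E' i)) (regs s a) (regs s b)"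
  proof (rule scan_stop_cong)
    fix i assume "i < regs s b"
    then have "i < M" using le assms(4) by simp
    then show "(x \<in> side_set z (filter_stream E i)) = (x \<in> side_set z (filter_stream E' i))"
      using assms(1) assms(5)[OF x] unfolding agree_def by blast
  qed
  then show ?thesis using assms(2) x le Scan by simp
next
  case (RandomWord t)
  then show ?thesis using assms unfolding agree_def by (auto simp: set_reg_def)
next
  case (Near t j)
  then show ?thesis using assms(1,2) unfolding agree_def by (auto split: option.splits)
qed (use assms(1,2) in \<open>auto simp: agree_def\<close>)

lemma exec_cong:
  assumes "exec E c s s'" and ag: "agree E E' W M Y"
    and "words_drawn s' \<le> W" "filters_drawn s' \<le> M" "\<And>x. arg s = Some x \<Longrightarrow> x \<in> Y"
  shows "exec E' c s s'"
  using assms(1,3-)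
proof (induction rule: exec.induct)
  case (exec_Do i s s')
  have "exec E (Do i) s (tick s')" using exec_Do(1) by (rule exec.exec_Do)
  from exec_frame[OF this] have "filters_drawn s \<le> M" "words_drawn s' \<le> W"
    using exec_Do by (auto simp: tick_def)
  then have "step E' i s = Some s'" using step_cong[OF ag exec_Do(1)] exec_Do by blast
  then show ?case by (rule exec.exec_Do)
next
  case (exec_Seq c1 s s1 c2 s2)
  note f1 = exec_frame[OF exec_Seq.hyps(1)] and f2 = exec_frame[OF exec_Seq.hyps(2)]
  have "words_drawn s1 \<le> W" "filters_drawn s1 \<le> M" using f2 exec_Seq.prems(1,2) by linarith+
  then have 1: "exec E' c1 s s1" using exec_Seq.prems(3) by (rule exec_Seq.IH(1))
  have "arg s1 = arg s" using f1 by blast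
  then have "x \<in> Y" if "arg s1 = Some x" for x using exec_Seq.prems(3) that by simp
  then have "exec E' c2 s1 s2" using exec_Seq.prems(1,2) by (intro exec_Seq.IH(2))
  with 1 show ?case by (rule exec.exec_Seq)
next
  case (exec_If_True s b c1 s' c2)
  have "x \<in> Y" if "arg (tick s) = Some x" for x using exec_If_True.prems(3) that by (simp add: tick_def)
  then have "exec E' c1 (tick s) s'" using exec_If_True.prems(1,2) by (intro exec_If_True.IH)
  then show ?case using exec_If_True.hyps(1) by (intro exec.exec_If_True)
next
  case (exec_If_False s b c2 s' c1)
  have "x \<in> Y" if "arg (tick s) = Some x" for x using exec_If_False.prems(3) that by (simp add: tick_def)
  then have "exec E' c2 (tick s) s'" using exec_If_False.prems(1,2) by (intro exec_If_False.IH)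
  then show ?case using exec_If_False.hyps(1) by (intro exec.exec_If_False)
next
  case (exec_While_True s b c s1 s2)
  note f1 = exec_frame[OF exec_While_True.hyps(2)] and f2 = exec_frame[OF exec_While_True.hyps(3)]
  have a: "x \<in> Y" if "arg (tick s) = Some x" for x using exec_While_True.prems(3) that by (simp add: tick_def)
  have "words_drawn s1 \<le> W" "filters_drawn s1 \<le> M" using f2 exec_While_True.prems(1,2) by linarith+
  then have 1: "exec E' c (tick s) s1" using a by (intro exec_While_True.IH(1))
  have "arg s1 = arg (tick s)" using f1 by blast
  then have "x \<in> Y" if "arg s1 = Some x" for x using a that by simp
  then have "exec E' (While b c) s1 s2" using exec_While_True.prems(1,2) by (intro exec_While_True.IH(2))
  with exec_While_True.hyps(1) 1 show ?case by (rule exec.exec_While_True)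
next
  case (exec_While_False s b c)
  then show ?case by (intro exec.exec_While_False)
qed

fun op_points :: "'a operation \<Rightarrow> 'a set" where
  "op_points (Insert i y) = {y}"
| "op_points (Delete i) = {}"
| "op_points (Query x) = {x}"

text \<open>A deletion runs with the stored point as its argument, so this point has to be known as
  one of the points of the operation sequence.\<close>

lemma reaches_slots:
  assumes "reaches E D R os s" "slots s i = Some x"
  shows "x \<in> (\<Union>a\<in>set os. op_points a)"
  using assms
proof (induction arbitrary: i x rule: reaches.induct)
  case (reaches_Nil s)
  then show ?case using exec_frame[OF reaches_Nil(1)] by (simp add: start_state_def)
next
  case (reaches_snoc os s a s')
  from reaches_snoc(2) show ?case
  proof cases
    case (perform_Insert j y)
    then have "slots s' = (slots s)(j := Some y)"
      using exec_frame[OF perform_Insert(2)] by (simp add: set_reg_def begin_op_def)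
    then show ?thesis using reaches_snoc perform_Insert by (auto split: if_splits)
  next
    case (perform_Delete j s'')
    then have "slots s'' = slots s" using exec_frame[OF perform_Delete(3)] by (simp add: set_reg_def begin_op_def)
    then show ?thesis using reaches_snoc perform_Delete by (auto split: if_splits)
  next
    case (perform_Query y)
    then have "slots s' = slots s" using exec_frame[OF perform_Query(2)] by (simp add: begin_op_def)
    then show ?thesis using reaches_snoc by auto
  qed
qed

lemma reaches_cong:
  assumes "reaches E D R os s" and ag: "agree E E' W M Y"
    and "words_drawn s \<le> W" "filters_drawn s \<le> M" "(\<Union>a\<in>set os. op_points a) \<subseteq> Y"
  shows "reaches E' D R os s"
  using assms(1,3-)
proof (induction rule: reaches.induct)
  case (reaches_Nil s)
  have "exec E' (prepare_code D) (start_state (word_size E) R) s"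
    using reaches_Nil by (intro exec_cong[OF _ ag]) (auto simp: start_state_def)
  then show ?case using ag by (intro reaches.reaches_Nil) (simp add: agree_def)
next
  case (reaches_snoc os s a s')
  have "perform E' D a s s' \<and> words_drawn s \<le> words_drawn s' \<and> filters_drawn s \<le> filters_drawn s'"
    using reaches_snoc(2)
  proof cases
    case (perform_Insert i y)
    have "exec E' (insert_code D) (set_reg 0 i (begin_op (Some y) (s\<lparr>slots := (slots s)(i := Some y)\<rparr>))) s'"
      using perform_Insert reaches_snoc by (intro exec_cong[OF perform_Insert(2) ag]) (auto simp: set_reg_def begin_op_def)
    then show ?thesis using perform_Insert exec_frame[OF perform_Insert(2)]
      by (auto intro: perform.perform_Insert simp: set_reg_def begin_op_def)
  next
    case (perform_Delete i s'')
    have "x \<in> Y" if "slots s i = Some x" for x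
      using reaches_slots[OF reaches_snoc(1) that] reaches_snoc(6) by auto
    then have "exec E' (delete_code D) (set_reg 0 i (begin_op (slots s i) s)) s''"
      using perform_Delete reaches_snoc by (intro exec_cong[OF perform_Delete(3) ag]) (auto simp: set_reg_def begin_op_def)
    then have "perform E' D (Delete i) s (s''\<lparr>slots := (slots s'')(i := None)\<rparr>)" by (rule perform.perform_Delete)
    moreover have "words_drawn s \<le> words_drawn s''" "filters_drawn s \<le> filters_drawn s''"
      using exec_frame[OF perform_Delete(3)] by (auto simp: set_reg_def begin_op_def)
    ultimately show ?thesis using perform_Delete by simp
  next
    case (perform_Query x)
    have "exec E' (query_code D) (begin_op (Some x) s) s'"
      using perform_Query reaches_snoc by (intro exec_cong[OF perform_Query(2) ag]) (auto simp: begin_op_def)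
    then show ?thesis using perform_Query exec_frame[OF perform_Query(2)]
      by (auto intro: perform.perform_Query simp: begin_op_def)
  qed
  then show ?case using reaches_snoc by (intro reaches.reaches_snoc[of E' D R os s]) auto
qed

text \<open>A map with finitely many values and measurable fibres is governed by its point masses.
  Every event it determines is a finite union of fibres, hence measurable for arbitrary
  \<open>V\<close>.\<close>

lemma discretize:
  assumes M: "prob_space M" and R: "finite R" "\<And>x. x \<in> space M \<Longrightarrow> \<phi> x \<in> R"
    and ms: "\<And>v. v \<in> R \<Longrightarrow> {x \<in> space M. \<phi> x = v} \<in> sets M"
    and q: "\<And>v. v \<in> R \<Longrightarrow> pmf q v = measure M {x \<in> space M. \<phi> x = v}"
  shows "{x \<in> space M. \<phi> x \<in> V} \<in> sets M" "measure M {x \<in> space M. \<phi> x \<in> V} = measure_pmf.prob q V"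
proof -
  interpret prob_space M by (rule M)
  have un: "{x \<in> space M. \<phi> x \<in> A} = (\<Union>v\<in>A \<inter> R. {x \<in> space M. \<phi> x = v})" for A using R by auto
  show "{x \<in> space M. \<phi> x \<in> V} \<in> sets M" for V unfolding un using R(1) ms by (intro sets.finite_UN) auto
  have eq: "measure M {x \<in> space M. \<phi> x \<in> A} = measure_pmf.prob q (A \<inter> R)" for A
  proof -
    have "measure M {x \<in> space M. \<phi> x \<in> A} = (\<Sum>v\<in>A \<inter> R. measure M {x \<in> space M. \<phi> x = v})"
      unfolding un using R(1) ms
      by (intro finite_measure_finite_Union) (auto simp: disjoint_family_on_def)
    also have "\<dots> = (\<Sum>v\<in>A \<inter> R. pmf q v)" using q by simp
    also have "\<dots> = measure_pmf.prob q (A \<inter> R)" using R(1) by (simp add: measure_measure_pmf_finite)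
    finally show ?thesis .
  qed
  \<comment> \<open>All mass lies on \<open>R\<close>, which extends the formula from subsets of
    \<open>R\<close> to arbitrary sets of values.\<close>
  have "measure_pmf.prob q (UNIV \<inter> R) = 1" unfolding eq[symmetric] by (simp add: prob_space)
  then have one: "measure_pmf.prob q R = 1" by simp
  have "measure_pmf.prob q ((V \<inter> R) \<union> (V - R)) = measure_pmf.prob q (V \<inter> R) + measure_pmf.prob q (V - R)"
    by (rule measure_pmf.finite_measure_Union) auto
  moreover have "(V \<inter> R) \<union> (V - R) = V" by auto
  moreover have "measure_pmf.prob q (R \<union> (V - R)) = measure_pmf.prob q R + measure_pmf.prob q (V - R)"
    by (rule measure_pmf.finite_measure_Union) auto
  moreover have "measure_pmf.prob q (R \<union> (V - R)) \<le> 1" by (rule measure_pmf.prob_le_1)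
  moreover have "0 \<le> measure_pmf.prob q (V - R)" by simp
  ultimately show "measure M {x \<in> space M. \<phi> x \<in> V} = measure_pmf.prob q V"
    unfolding eq using one by simp
qed

lemma discretize_exists:
  assumes M: "prob_space M" and R: "finite R" "\<And>x. x \<in> space M \<Longrightarrow> \<phi> x \<in> R"
    and ms: "\<And>v. v \<in> R \<Longrightarrow> {x \<in> space M. \<phi> x = v} \<in> sets M"
  shows "\<exists>q. (\<forall>v\<in>R. pmf q v = measure M {x \<in> space M. \<phi> x = v}) \<and>
    (\<forall>V. measure M {x \<in> space M. \<phi> x \<in> V} = measure_pmf.prob q V)"
proof -
  interpret prob_space M by (rule M)
  define f where "f v = (if v \<in> R then measure M {x \<in> space M. \<phi> x = v} else 0)" for v
  have "(\<Sum>v\<in>R. measure M {x \<in> space M. \<phi> x = v}) = measure M (\<Union>v\<in>R. {x \<in> space M. \<phi> x = v})"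
    using R(1) ms by (intro finite_measure_finite_Union[symmetric]) (auto simp: disjoint_family_on_def)
  also have "(\<Union>v\<in>R. {x \<in> space M. \<phi> x = v}) = space M" using R by auto
  finally have "(\<Sum>v\<in>R. f v) = 1" by (simp add: f_def prob_space)
  moreover have "(\<integral>\<^sup>+v. ennreal (f v) \<partial>count_space UNIV) = (\<Sum>v\<in>R. ennreal (f v))"
    using R(1) by (intro nn_integral_count_space') (auto simp: f_def)
  moreover have "(\<Sum>v\<in>R. ennreal (f v)) = ennreal (\<Sum>v\<in>R. f v)" by (intro sum_ennreal) (simp add: f_def)
  ultimately have "(\<integral>\<^sup>+v. ennreal (f v) \<partial>count_space UNIV) = 1" by simp
  then have "pmf (embed_pmf f) v = f v" for v by (intro pmf_embed_pmf) (auto simp: f_def)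
  then have q: "pmf (embed_pmf f) v = measure M {x \<in> space M. \<phi> x = v}" if "v \<in> R" for v
    using that by (simp add: f_def)
  then show ?thesis using discretize(2)[where \<phi> = \<phi>, OF M R ms q] by blast
qed

definition restrict_filter :: "'a set \<Rightarrow> 'a set \<times> 'a set \<Rightarrow> 'a set \<times> 'a set" where
  "restrict_filter Y f = (fst f \<inter> Y, snd f \<inter> Y)"

text \<open>Only the membership of single points is known to be measurable, and a trace on a finite
  set is a finite Boolean combination of such events.\<close>

lemma restrict_filter_measurable:
  assumes Y: "finite Y" and ms: "\<And>x. x \<in> Y \<Longrightarrow> {f \<in> space F. x \<in> fst f} \<in> sets F \<and> {f \<in> space F. x \<in> snd f} \<in> sets F"
  shows "{f \<in> space F. restrict_filter Y f = v} \<in> sets F"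
proof (cases "fst v \<subseteq> Y \<and> snd v \<subseteq> Y")
  case True
  have eq: "{f \<in> space F. restrict_filter Y f = v} = {f \<in> space F. \<forall>y\<in>Y. (y \<in> fst f \<longleftrightarrow> y \<in> fst v) \<and> (y \<in> snd f \<longleftrightarrow> y \<in> snd v)}"
    using True by (cases v) (auto simp: restrict_filter_def)
  have "{f \<in> space F. (y \<in> fst f \<longleftrightarrow> y \<in> fst v) \<and> (y \<in> snd f \<longleftrightarrow> y \<in> snd v)} \<in> sets F" if y: "y \<in> Y" for y
  proof -
    note m = ms[OF y]
    have 1: "{f \<in> space F. y \<in> fst f \<longleftrightarrow> y \<in> fst v} \<in> sets F"
      using m by (cases "y \<in> fst v") (auto intro: sets.sets_Collect_neg)
    have 2: "{f \<in> space F. y \<in> snd f \<longleftrightarrow> y \<in> snd v} \<in> sets F"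
      using m by (cases "y \<in> snd v") (auto intro: sets.sets_Collect_neg)
    have "{f \<in> space F. (y \<in> fst f \<longleftrightarrow> y \<in> fst v) \<and> (y \<in> snd f \<longleftrightarrow> y \<in> snd v)} =
      {f \<in> space F. y \<in> fst f \<longleftrightarrow> y \<in> fst v} \<inter> {f \<in> space F. y \<in> snd f \<longleftrightarrow> y \<in> snd v}" by auto
    then show ?thesis using sets.Int[OF 1 2] by (simp only:)
  qed
  then show ?thesis unfolding eq using Y by (intro sets.sets_Collect_finite_All) auto
next
  case False
  then have "{f \<in> space F. restrict_filter Y f = v} = {}" by (cases v) (auto simp: restrict_filter_def)
  then show ?thesis by (simp only: sets.empty_sets)
qed

text \<open>Coordinates beyond those drawn are set to the defaults of \<open>Pi_pmf\<close>, so that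
  the image is finite and the discrete product has exactly the distribution of the view.\<close>

definition view :: "nat \<Rightarrow> nat \<Rightarrow> 'a set \<Rightarrow> 'a set \<times> 'a set \<Rightarrow> (nat \<Rightarrow> 'a set \<times> 'a set) \<times> (nat \<Rightarrow> nat) \<Rightarrow>
    (nat \<Rightarrow> 'a set \<times> 'a set) \<times> (nat \<Rightarrow> nat)" where
  "view m k Y d \<omega> = (\<lambda>i. if i < m then restrict_filter Y (fst \<omega> i) else d, \<lambda>j. if j < k then snd \<omega> j else 0)"

lemma prob_space_randomness: "prob_space F \<Longrightarrow> prob_space (randomness F w)"
proof -
  assume F: "prob_space F"
  have "0 \<in> {..<(2::nat) ^ w}" by simp
  then have "prob_space (uniform_count_measure {..<(2::nat) ^ w})"
    by (intro prob_space_uniform_count_measure) blast+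
  then show ?thesis unfolding randomness_def
    using F by (intro prob_space_pair prob_space_PiM)
qed

text \<open>The fibres of the view are cylinders over finitely many coordinates, and the product
  measure gives them the point masses of the discrete product. \<open>discretize\<close> carries
  this over to all events.\<close>

lemma randomness_view:
  fixes F :: "('a set \<times> 'a set) measure"
  assumes F: "prob_space F" and Y: "finite Y"
    and ms: "\<And>x. x \<in> Y \<Longrightarrow> {f \<in> space F. x \<in> fst f} \<in> sets F \<and> {f \<in> space F. x \<in> snd f} \<in> sets F"
    and q: "\<And>v. v \<in> Pow Y \<times> Pow Y \<Longrightarrow> pmf q v = measure F {f \<in> space F. restrict_filter Y f = v}"
  shows "{\<omega> \<in> space (randomness F w). view m k Y d \<omega> \<in> V} \<in> sets (randomness F w)"
    "measure (randomness F w) {\<omega> \<in> space (randomness F w). view m k Y d \<omega> \<in> V} =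
     measure_pmf.prob (pair_pmf (Pi_pmf {..<m} d (\<lambda>_. q)) (Pi_pmf {..<k} 0 (\<lambda>_. word_pmf w))) V"
proof -
  let ?U = "uniform_count_measure {..<(2::nat) ^ w}"
  let ?P = "\<Pi>\<^sub>M i\<in>(UNIV::nat set). F" let ?W = "\<Pi>\<^sub>M i\<in>(UNIV::nat set). ?U"
  have z: "0 \<in> {..<(2::nat) ^ w}" by simp
  have U: "prob_space ?U" using z by (intro prob_space_uniform_count_measure) blast+
  interpret pF: prob_space F by (rule F)
  interpret pU: prob_space ?U by (rule U)
  interpret P: product_prob_space "\<lambda>_. F" "UNIV :: nat set" ..
  interpret W: product_prob_space "\<lambda>_. ?U" "UNIV :: nat set" ..
  have sf: "sigma_finite_measure ?W"
    by (intro prob_space_imp_sigma_finite prob_space_PiM U)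
  let ?R = "PiE_dflt {..<m} d (\<lambda>_. Pow Y \<times> Pow Y) \<times> PiE_dflt {..<k} 0 (\<lambda>_. {..<(2::nat) ^ w})"
  have R: "finite ?R" using Y by (intro finite_cartesian_product finite_PiE_dflt) auto
  have spW: "\<omega> j < 2 ^ w" if "\<omega> \<in> space ?W" for \<omega> j
    using that by (auto simp: space_PiM space_uniform_count_measure PiE_def Pi_def)
  have in_R: "view m k Y d \<omega> \<in> ?R" if "\<omega> \<in> space (randomness F w)" for \<omega>
    using that spW[of "snd \<omega>"] by (auto simp: view_def PiE_dflt_def restrict_filter_def randomness_def space_pair_measure)
  have single: "{\<omega> \<in> space (randomness F w). view m k Y d \<omega> = v} \<in> sets (randomness F w) \<and>
      measure (randomness F w) {\<omega> \<in> space (randomness F w). view m k Y d \<omega> = v} =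
      pmf (pair_pmf (Pi_pmf {..<m} d (\<lambda>_. q)) (Pi_pmf {..<k} 0 (\<lambda>_. word_pmf w))) v" if v: "v \<in> ?R" for v
  proof -
    obtain fv wv where v': "v = (fv, wv)" by (cases v)
    have fv: "\<And>i. i < m \<Longrightarrow> fv i \<in> Pow Y \<times> Pow Y" "\<And>i. \<not> i < m \<Longrightarrow> fv i = d"
      and wv: "\<And>i. i < k \<Longrightarrow> wv i < 2 ^ w" "\<And>i. \<not> i < k \<Longrightarrow> wv i = 0"
      using v unfolding v' PiE_dflt_def by auto
    let ?A = "{x \<in> space ?P. \<forall>i\<in>{..<m}. x i \<in> {f \<in> space F. restrict_filter Y f = fv i}}"
    let ?B = "{x \<in> space ?W. \<forall>j\<in>{..<k}. x j \<in> {wv j}}"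
    have eq: "{\<omega> \<in> space (randomness F w). view m k Y d \<omega> = v} = ?A \<times> ?B"
    proof (intro set_eqI iffI)
      fix \<omega> assume w: "\<omega> \<in> {\<omega> \<in> space (randomness F w). view m k Y d \<omega> = v}"
      then have sp: "fst \<omega> \<in> space ?P" "snd \<omega> \<in> space ?W" by (auto simp: randomness_def space_pair_measure)
      have e: "(\<lambda>i. if i < m then restrict_filter Y (fst \<omega> i) else d) = fv" "(\<lambda>j. if j < k then snd \<omega> j else 0) = wv"
        using w by (auto simp: view_def v')
      have "restrict_filter Y (fst \<omega> i) = fv i" if "i < m" for i using fun_cong[OF e(1), of i] that by simp
      moreover have "snd \<omega> j = wv j" if "j < k" for j using fun_cong[OF e(2), of j] that by simp
      moreover have "fst \<omega> i \<in> space F" for i using sp(1) by (auto simp: space_PiM PiE_def Pi_def)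
      ultimately show "\<omega> \<in> ?A \<times> ?B" using sp by (cases \<omega>) auto
    next
      fix \<omega> assume w: "\<omega> \<in> ?A \<times> ?B"
      then show "\<omega> \<in> {\<omega> \<in> space (randomness F w). view m k Y d \<omega> = v}"
        using fv(2) wv(2) by (auto simp: randomness_def space_pair_measure view_def v' fun_eq_iff)
    qed
    have A: "?A \<in> sets ?P" "emeasure ?P ?A = (\<Prod>i\<in>{..<m}. emeasure F {f \<in> space F. restrict_filter Y f = fv i})"
    proof -
      show "emeasure ?P ?A = (\<Prod>i\<in>{..<m}. emeasure F {f \<in> space F. restrict_filter Y f = fv i})"
        using restrict_filter_measurable[OF Y ms] by (intro P.emeasure_PiM_Collect) auto
      show "?A \<in> sets ?P"
        using restrict_filter_measurable[OF Y ms]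
        by (intro sets.sets_Collect_finite_All measurable_sets_Collect[OF measurable_component_singleton]) auto
    qed
    have B: "?B \<in> sets ?W" "emeasure ?W ?B = (\<Prod>j\<in>{..<k}. emeasure ?U {wv j})"
    proof -
      have s: "{wv j} \<in> sets ?U" if "j < k" for j using wv(1)[OF that] by (simp add: sets_uniform_count_measure)
      show "emeasure ?W ?B = (\<Prod>j\<in>{..<k}. emeasure ?U {wv j})"
        using s by (intro W.emeasure_PiM_Collect) auto
      show "?B \<in> sets ?W"
        by (intro sets.sets_Collect_finite_All measurable_sets_Collect[OF measurable_component_singleton])
          (auto simp: sets_uniform_count_measure space_uniform_count_measure)
    qed
    have "?A \<times> ?B \<in> sets (randomness F w)" unfolding randomness_def using A(1) B(1) by (rule pair_measureI)
    moreover have "measure (randomness F w) (?A \<times> ?B) = (\<Prod>i<m. measure F {f \<in> space F. restrict_filter Y f = fv i}) * (\<Prod>j<k. measure ?U {wv j})"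
    proof -
      have "emeasure (randomness F w) (?A \<times> ?B) = emeasure ?P ?A * emeasure ?W ?B"
        unfolding randomness_def using A(1) B(1) by (rule sigma_finite_measure.emeasure_pair_measure_Times[OF sf])
      also have "\<dots> = ennreal ((\<Prod>i<m. measure F {f \<in> space F. restrict_filter Y f = fv i}) * (\<Prod>j<k. measure ?U {wv j}))"
        unfolding A(2) B(2) pF.emeasure_eq_measure pU.emeasure_eq_measure
        by (simp add: prod_ennreal ennreal_mult prod_nonneg)
      finally show ?thesis unfolding measure_def[of "randomness F w"] by (simp add: prod_nonneg)
    qed
    moreover have "pmf (pair_pmf (Pi_pmf {..<m} d (\<lambda>_. q)) (Pi_pmf {..<k} 0 (\<lambda>_. word_pmf w))) v =
      (\<Prod>i<m. measure F {f \<in> space F. restrict_filter Y f = fv i}) * (\<Prod>j<k. measure ?U {wv j})"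
    proof -
      have "pmf (word_pmf w) (wv j) = measure ?U {wv j}" if "j < k" for j
      proof -
        have "{..<(2::nat) ^ w} \<noteq> {}" using z by blast
        then have "pmf (word_pmf w) (wv j) = 1 / 2 ^ w"
          using wv(1)[OF that] unfolding word_pmf_def by (subst pmf_of_set) auto
        then show ?thesis using wv(1)[OF that] by (simp add: measure_uniform_count_measure)
      qed
      moreover have "pmf q (fv i) = measure F {f \<in> space F. restrict_filter Y f = fv i}" if "i < m" for i
        using fv(1)[OF that] by (rule q)
      moreover have "pmf (Pi_pmf {..<m} d (\<lambda>_. q)) fv = (\<Prod>i<m. pmf q (fv i))"
        using fv(2) by (intro pmf_Pi') auto
      moreover have "pmf (Pi_pmf {..<k} 0 (\<lambda>_. word_pmf w)) wv = (\<Prod>j<k. pmf (word_pmf w) (wv j))"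
        using wv(2) by (intro pmf_Pi') auto
      ultimately show ?thesis unfolding v' pmf_pair by simp
    qed
    ultimately show ?thesis unfolding eq by simp
  qed
  note d = discretize[OF prob_space_randomness[OF F] R in_R single[THEN conjunct1] single[THEN conjunct2, symmetric]]
  show "{\<omega> \<in> space (randomness F w). view m k Y d \<omega> \<in> V} \<in> sets (randomness F w)" by (rule d(1))
  show "measure (randomness F w) {\<omega> \<in> space (randomness F w). view m k Y d \<omega> \<in> V} =
     measure_pmf.prob (pair_pmf (Pi_pmf {..<m} d (\<lambda>_. q)) (Pi_pmf {..<k} 0 (\<lambda>_. word_pmf w))) V" by (rule d(2))
qed

section \<open>Balanced block sizes\<close>

lemma perform_deterministic: "perform E D a s s1 \<Longrightarrow> perform E D a s s2 \<Longrightarrow> s2 = s1"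
proof (induction rule: perform.induct)
  case (perform_Insert i y s s')
  from perform_Insert(2) show ?case
    by cases (use perform_Insert(1) exec_deterministic in blast)
next
  case (perform_Delete i s s')
  from perform_Delete(2) obtain s'' where "exec E (delete_code D) (set_reg 0 i (begin_op (slots s i) s)) s''"
    "s2 = s''\<lparr>slots := (slots s'')(i := None)\<rparr>" by cases auto
  then show ?case using exec_deterministic[OF perform_Delete(1)] by blast
next
  case (perform_Query x s s')
  from perform_Query(2) show ?case
    by cases (use perform_Query(1) exec_deterministic in blast)
qed

text \<open>Identifies a run that was assumed to succeed with the run for which the invariants, in
  particular the numbers of draws, were proved.\<close>

lemma reaches_deterministic: "reaches E D R os s1 \<Longrightarrow> reaches E D R os s2 \<Longrightarrow> s2 = s1"
proof (induction arbitrary: s2 rule: reaches.induct)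
  case (reaches_Nil s)
  from reaches_Nil(2) show ?case
    by cases (use reaches_Nil(1) exec_deterministic in auto)
next
  case (reaches_snoc os s a s')
  from reaches_snoc(4) obtain t where "reaches E D R os t" "perform E D a t s2" by cases auto
  then show ?case using reaches_snoc.IH[of t] perform_deterministic[OF reaches_snoc(2)] by blast
qed

text \<open>In logarithms a level contributes \<open>Lm \<le> 0\<close> with \<open>bl\<close>
  filters and \<open>Lp > 0\<close> with \<open>bl + 1\<close>. The fraction \<open>\<theta>\<close>
  of larger levels makes the mean vanish, and spreading these levels evenly keeps all partial sums
  bounded. Rounding down throughout keeps the products below 1.\<close>

lemma balanced_blocks:
  fixes p1 :: real and k :: nat
  assumes p1: "0 < p1" "p1 \<le> 1" and k: "1 \<le> k"
  defines "bl \<equiv> nat \<lfloor>1 / p1\<rfloor>"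
  shows "\<exists>A\<le>k. \<forall>j\<le>k. 1 / 16 \<le> (\<Prod>i<j. real (bl + (Suc i * A div k - i * A div k)) * p1) \<and>
      (\<Prod>i<j. real (bl + (Suc i * A div k - i * A div k)) * p1) \<le> 1"
    and "A \<le> k \<Longrightarrow> 1 / 2 \<le> real (bl + (Suc i * A div k - i * A div k)) * p1"
    and "A \<le> k \<Longrightarrow> real (bl + (Suc i * A div k - i * A div k)) * p1 \<le> 2"
    and "1 \<le> bl" "real bl \<le> 1 / p1"
proof -
  have f: "1 \<le> \<lfloor>1 / p1\<rfloor>" using p1 by (simp add: le_floor_iff)
  then have "0 \<le> \<lfloor>1 / p1\<rfloor>" by linarith
  then have blr: "real bl = of_int \<lfloor>1 / p1\<rfloor>" unfolding bl_def by (rule of_nat_nat)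
  show bl1: "1 \<le> bl" unfolding bl_def using f by linarith
  show ble: "real bl \<le> 1 / p1" unfolding blr by (rule of_int_floor_le)
  have blg: "1 / p1 < real bl + 1" unfolding blr by linarith
  have b1: "real bl * p1 \<le> 1" using ble p1 by (simp add: field_simps)
  have b2: "1 < (real bl + 1) * p1" using blg p1 by (simp add: field_simps)
  have b3: "(real bl + 1) * p1 \<le> 2"
    using b1 p1 by (simp add: algebra_simps)
  have b4: "1 / 2 \<le> real bl * p1"
  proof -
    have "(real bl + 1) * p1 \<le> (2 * real bl) * p1" using bl1 p1 by (intro mult_right_mono) auto
    then show ?thesis using b2 by simp
  qed
  have inc: "Suc i * A div k - i * A div k \<le> 1" if "A \<le> k" for A i
  proof -
    have "Suc i * A \<le> i * A + k" using that by simp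
    then have "Suc i * A div k \<le> (i * A + k) div k" by (rule div_le_mono)
    also have "\<dots> = i * A div k + 1" using k by simp
    finally show ?thesis by simp
  qed
  show "A \<le> k \<Longrightarrow> 1 / 2 \<le> real (bl + (Suc i * A div k - i * A div k)) * p1"
  proof -
    have "real bl * p1 \<le> real (bl + (Suc i * A div k - i * A div k)) * p1" using p1 by (intro mult_right_mono) auto
    then show ?thesis using b4 by simp
  qed
  show "A \<le> k \<Longrightarrow> real (bl + (Suc i * A div k - i * A div k)) * p1 \<le> 2"
  proof -
    assume "A \<le> k"
    then have "real (bl + (Suc i * A div k - i * A div k)) * p1 \<le> (real bl + 1) * p1"
      using inc[of A i] p1 by (intro mult_right_mono) auto
    then show ?thesis using b3 by simp
  qed
  define Lm where "Lm = ln (real bl * p1)"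
  define Lp where "Lp = ln ((real bl + 1) * p1)"
  define \<Delta> where "\<Delta> = Lp - Lm"
  have Lm: "Lm \<le> 0" unfolding Lm_def using b1 b4 by simp
  have Lp: "0 < Lp" unfolding Lp_def using b2 by simp
  have D: "0 < \<Delta>" "- Lm \<le> \<Delta>" using Lm Lp by (auto simp: \<Delta>_def)
  have D2: "\<Delta> \<le> ln 2"
  proof -
    have "\<Delta> = ln (((real bl + 1) * p1) / (real bl * p1))"
      unfolding \<Delta>_def Lp_def Lm_def using b1 b4 b2 by (subst ln_div) auto
    also have "\<dots> \<le> ln 2"
    proof -
      have "((real bl + 1) * p1) / (real bl * p1) = (real bl + 1) / real bl" using p1 by simp
      also have "\<dots> \<le> 2" using bl1 by (simp add: field_simps)
      finally show ?thesis using p1 bl1 by (intro ln_mono) auto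
    qed
    finally show ?thesis .
  qed
  define \<theta> where "\<theta> = - Lm / \<Delta>"
  have th: "0 \<le> \<theta>" unfolding \<theta>_def using Lm D(1) by (intro divide_nonneg_pos) auto
  have th1: "\<theta> \<le> 1" unfolding \<theta>_def using D by (subst pos_divide_le_eq) auto
  define A where "A = nat \<lfloor>real k * \<theta>\<rfloor>"
  have kt: "0 \<le> real k * \<theta>" using th by simp
  have Ar: "real A \<le> real k * \<theta>" "real k * \<theta> < real A + 1" 
  proof -
    have "real A = of_int \<lfloor>real k * \<theta>\<rfloor>" unfolding A_def using kt by (intro of_nat_nat) simp
    then show "real A \<le> real k * \<theta>" "real k * \<theta> < real A + 1" by linarith+
  qed
  have "real k * \<theta> \<le> real k * 1" using th1 by (intro mult_left_mono) auto
  then have Ak: "A \<le> k" using Ar by linarith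
  have bounds: "1 / 16 \<le> (\<Prod>i<j. real (bl + (Suc i * A div k - i * A div k)) * p1) \<and>
      (\<Prod>i<j. real (bl + (Suc i * A div k - i * A div k)) * p1) \<le> 1" if j: "j \<le> k" for j
  proof -
    let ?d = "\<lambda>i. Suc i * A div k - i * A div k"
    define c where "c = j * A div k"
    have pos: "0 < real (bl + ?d i) * p1" for i using bl1 p1 by simp
    have lnb: "ln (real (bl + ?d i) * p1) = Lm + real (?d i) * \<Delta>" for i
    proof -
      define e where "e = ?d i"
      have "e = 0 \<or> e = 1" using inc[OF Ak, of i] unfolding e_def by linarith
      then have "ln (real (bl + e) * p1) = Lm + real e * \<Delta>"
        by (elim disjE) (simp_all add: Lm_def \<Delta>_def Lp_def add.commute)
      then show ?thesis unfolding e_def .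
    qed
    have tel: "(\<Sum>i<j. ?d i) = c"
    proof -
      have "(\<Sum>i<m. ?d i) = m * A div k" for m
      proof (induction m)
        case (Suc m)
        have "m * A div k \<le> Suc m * A div k" by (rule div_le_mono) simp
        then show ?case using Suc by (simp del: mult_Suc)
      qed simp
      then show ?thesis unfolding c_def .
    qed
    have "ln (\<Prod>i<j. real (bl + ?d i) * p1) = (\<Sum>i<j. ln (real (bl + ?d i) * p1))"
    proof (rule ln_prod)
      show "real (bl + ?d i) * p1 \<noteq> 0" for i using pos[of i] by linarith
    qed simp
    also have "\<dots> = real j * Lm + real (\<Sum>i<j. ?d i) * \<Delta>"
      by (simp only: lnb sum.distrib sum_constant card_lessThan of_nat_sum sum_distrib_right)
    also have "\<dots> = real j * Lm + real c * \<Delta>" by (simp only: tel)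
    also have "\<dots> = \<Delta> * (real c - real j * \<theta>)" using D by (simp add: \<theta>_def field_simps)
    finally have ln: "ln (\<Prod>i<j. real (bl + ?d i) * p1) = \<Delta> * (real c - real j * \<theta>)" .
    have P: "0 < (\<Prod>i<j. real (bl + ?d i) * p1)" by (rule prod_pos) (use pos in blast)
    have c1: "real c \<le> real j * \<theta>"
    proof -
      have "real c * real k \<le> real j * real A"
        unfolding c_def by (metis div_times_less_eq_dividend of_nat_le_iff of_nat_mult)
      also have "\<dots> \<le> real j * (real k * \<theta>)" using Ar by (intro mult_left_mono) auto
      finally have "real c * real k \<le> (real j * \<theta>) * real k" by (simp add: mult_ac)
      then show ?thesis using k by simp
    qed
    \<comment> \<open>One unit is lost by rounding \<open>real k * \<theta>\<close> down to
      \<open>A\<close> and one by the division in \<open>c\<close>. Each unit is worth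
      \<open>\<Delta>\<close>, at most \<open>ln 2\<close>, so the products stay above
      \<open>1 / 4\<close>.\<close>
    have c2: "real j * \<theta> - 2 \<le> real c"
    proof -
      have "j * A < (c + 1) * k" unfolding c_def using dividend_less_div_times[of k "j * A"] k by (simp add: add.commute)
      then have "real (j * A) < real ((c + 1) * k)" by (rule of_nat_less_iff[THEN iffD2])
      then have 1: "real j * real A < (real c + 1) * real k" by (simp add: algebra_simps)
      have "real j * (real k * \<theta>) \<le> real j * (real A + 1)" using Ar by (intro mult_left_mono) auto
      also have "\<dots> \<le> real j * real A + real k" using j by (simp add: algebra_simps)
      finally have "(real j * \<theta>) * real k \<le> (real c + 2) * real k" using 1 by (simp add: algebra_simps)
      then show ?thesis using k by simp
    qed
    have "ln (\<Prod>i<j. real (bl + ?d i) * p1) \<le> 0"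
      unfolding ln using c1 D by (simp add: mult_le_0_iff)
    moreover have "- (2 * ln 2) \<le> ln (\<Prod>i<j. real (bl + ?d i) * p1)"
    proof -
      have "- (2 * ln 2) \<le> \<Delta> * (- 2)" using D2 by simp
      also have "\<dots> \<le> \<Delta> * (real c - real j * \<theta>)" using c2 D by (intro mult_left_mono) auto
      finally show ?thesis unfolding ln .
    qed
    moreover have "exp (- (2 * ln 2)) = (1 / 4 :: real)"
    proof -
      have "exp (2 * ln 2) = (4::real)" by (simp add: exp_double)
      then show ?thesis by (simp add: exp_minus)
    qed
    ultimately have "1 / 4 \<le> exp (ln (\<Prod>i<j. real (bl + ?d i) * p1))" "exp (ln (\<Prod>i<j. real (bl + ?d i) * p1)) \<le> 1"
      by (metis exp_le_cancel_iff, metis exp_le_one_iff)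
    then show ?thesis unfolding exp_ln[OF P] by linarith
  qed
  show "\<exists>A\<le>k. \<forall>j\<le>k. 1 / 16 \<le> (\<Prod>i<j. real (bl + (Suc i * A div k - i * A div k)) * p1) \<and>
      (\<Prod>i<j. real (bl + (Suc i * A div k - i * A div k)) * p1) \<le> 1"
    using Ak bounds by blast
qed

context lsf_tree
begin

lemma leaves_cong:
  assumes "\<And>i. i < nfilters \<Longrightarrow> S i = S' i" "\<And>i. i < k \<Longrightarrow> ws i = ws' i"
  shows "leaves S ws = leaves S' ws'"
proof -
  have "front S ws k = front S' ws' k" using assms by (intro front_cong) (auto simp: nfilters_def)
  then show ?thesis by (simp add: leaves_def)
qed

lemma work_cong:
  assumes "\<And>i. i < nfilters \<Longrightarrow> S i = S' i" "\<And>i. i < k \<Longrightarrow> ws i = ws' i"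
  shows "work S ws = work S' ws'"
proof -
  have "front S ws j = front S' ws' j" if "j \<le> k" for j
    using assms level_upto[OF that] that by (intro front_cong) auto
  then have "bfs S ws = bfs S' ws'"
    unfolding bfs_def by (intro arg_cong[where f = concat] map_cong) (auto simp del: upt_Suc)
  moreover have "filter S [0..<nfilters] = filter S' [0..<nfilters]" using assms by (intro filter_cong) auto
  ultimately show ?thesis by (simp add: work_def)
qed

end

section \<open>One set of parameters under all random outcomes\<close>

locale lsf_instance = lsf +
  fixes D :: data_structure and R0 :: "reg \<Rightarrow> nat"
  assumes n_pos: "1 \<le> n" and bl_word: "bl < 2 ^ w"
    and prepare: "prepare_code D = lsf_prepare" and insert: "insert_code D = lsf_insert"
    and delete: "delete_code D = lsf_delete" and query: "query_code D = lsf_query"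
    and R0: "R0 = lsf_regs w k kap l lt bl A n B FU FQ DQ"
begin

lemma env: "lsf_env w k kap l lt bl A n B FU FQ DQ cells (make_env w d cr \<omega>) D R0"
  by unfold_locales (use n_pos bl_word prepare insert delete query R0 in \<open>auto simp: make_env_def\<close>)

lemma within_bounds:
  assumes "real (8 * cells) \<le> sp" "real nfilters \<le> fl" "real (lsf_run.query_cost FQ DQ) \<le> qo" "real DQ \<le> qd"
    "real nfilters \<le> qf" "real (lsf_run.insert_cost B FU + lsf_run.delete_cost B) \<le> uo" "real nfilters \<le> uf"
  shows "within_bounds D R0 w n X d F cr sp fl qo qd qf uo uf"
  unfolding within_bounds_def
proof (intro ballI allI impI)
  fix \<omega> os assume v: "valid_ops X n os"
  interpret e: lsf_env w k kap l lt bl A n B FU FQ DQ cells "make_env w d cr \<omega>" D R0 by (rule env)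
  from e.reaches_ready[OF v] obtain s lvs where s: "reaches (make_env w d cr \<omega>) D R0 os s" "e.ready s (contents os) lvs"
    and b: "os \<noteq> [] \<longrightarrow> (case last os of
        Query x \<Rightarrow> ops s \<le> lsf_run.query_cost FQ DQ \<and> dists s \<le> DQ \<and> evals s \<le> nfilters
      | _ \<Rightarrow> ops s \<le> e.update_cost \<and> dists s = 0 \<and> evals s \<le> nfilters)" by blast
  have "real (used_space s) \<le> sp" "real (filters_drawn s) \<le> fl"
    using e.ready_draws[OF s(2)] assms by linarith+
  moreover have "os \<noteq> [] \<longrightarrow> (case last os of
      Query x \<Rightarrow> real (ops s) \<le> qo \<and> real (dists s) \<le> qd \<and> real (evals s) \<le> qf
    | _ \<Rightarrow> real (ops s) \<le> uo \<and> dists s = 0 \<and> real (evals s) \<le> uf)"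
  proof
    assume "os \<noteq> []"
    then show "case last os of
      Query x \<Rightarrow> real (ops s) \<le> qo \<and> real (dists s) \<le> qd \<and> real (evals s) \<le> qf
    | _ \<Rightarrow> real (ops s) \<le> uo \<and> dists s = 0 \<and> real (evals s) \<le> uf"
      using b assms unfolding e.update_cost_def by (cases "last os") auto
  qed
  ultimately show "\<exists>s. reaches (make_env w d cr \<omega>) D R0 os s \<and> real (used_space s) \<le> sp \<and> real (filters_drawn s) \<le> fl \<and>
    (os \<noteq> [] \<longrightarrow> (case last os of
      Query x \<Rightarrow> real (ops s) \<le> qo \<and> real (dists s) \<le> qd \<and> real (evals s) \<le> qf
    | _ \<Rightarrow> real (ops s) \<le> uo \<and> dists s = 0 \<and> real (evals s) \<le> uf))" using s(1) by blast
qed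

definition success :: "('a \<Rightarrow> 'a \<Rightarrow> real) \<Rightarrow> real \<Rightarrow> 'a operation list \<Rightarrow> 'a \<Rightarrow> (nat \<Rightarrow> 'a set \<times> 'a set) \<times> (nat \<Rightarrow> nat) \<Rightarrow> bool" where
  "success d cr os x \<omega> \<longleftrightarrow> (\<exists>s. reaches (make_env w d cr \<omega>) D R0 (os @ [Query x]) s \<and>
     correct_answer d cr (contents os) x s)"

text \<open>The run draws exactly \<open>nfilters\<close> filters and \<open>k\<close> words and
  evaluates filters on points of \<open>Y\<close> only, so success is a function of the
  view.\<close>

lemma success_cong:
  assumes v: "valid_ops X n os" "x \<in> X" and Y: "(\<Union>a\<in>set (os @ [Query x]). op_points a) \<subseteq> Y"
    and eq: "view nfilters k Y dflt \<omega> = view nfilters k Y dflt \<omega>'" and s: "success d cr os x \<omega>"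
  shows "success d cr os x \<omega>'"
proof -
  interpret e: lsf_env w k kap l lt bl A n B FU FQ DQ cells "make_env w d cr \<omega>" D R0 by (rule env)
  from s obtain s where s: "reaches (make_env w d cr \<omega>) D R0 (os @ [Query x]) s" "correct_answer d cr (contents os) x s"
    by (auto simp: success_def)
  have "valid_ops X n (os @ [Query x])" using v by (simp add: valid_ops_snoc)
  from e.reaches_ready[OF this] obtain s' lvs where s': "reaches (make_env w d cr \<omega>) D R0 (os @ [Query x]) s'"
    "e.ready s' (contents (os @ [Query x])) lvs" by blast
  have "s' = s" using s(1) s'(1) by (rule reaches_deterministic)
  then have dr: "filters_drawn s = nfilters" "words_drawn s = k" using e.ready_draws[OF s'(2)] by auto
  have "restrict_filter Y (fst \<omega> i) = restrict_filter Y (fst \<omega>' i)" if "i < nfilters" for i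
    using arg_cong[OF eq, of "\<lambda>v. fst v i"] that by (simp add: view_def)
  then have "y \<in> side_set z (fst \<omega> i) \<longleftrightarrow> y \<in> side_set z (fst \<omega>' i)" if "i < nfilters" "y \<in> Y" for i y z
    using that by (cases z) (auto simp: restrict_filter_def set_eq_iff)
  moreover have "snd \<omega> j = snd \<omega>' j" if "j < k" for j
    using arg_cong[OF eq, of "\<lambda>v. snd v j"] that by (simp add: view_def)
  ultimately have "agree (make_env w d cr \<omega>) (make_env w d cr \<omega>') k nfilters Y"
    by (simp add: agree_def make_env_def)
  from reaches_cong[OF s(1) this] dr Y have "reaches (make_env w d cr \<omega>') D R0 (os @ [Query x]) s" by simp
  then show ?thesis using s(2) by (auto simp: success_def)
qed

end

lemma finite_op_points: "finite (op_points a)"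
  by (cases a) auto

lemma contents_points: "contents os i = Some y \<Longrightarrow> y \<in> (\<Union>a\<in>set os. op_points a)"
proof (induction os arbitrary: y rule: rev_induct)
  case Nil
  then show ?case by (simp add: contents_def)
next
  case (snoc a os)
  then show ?case by (cases a) (auto simp: contents_snoc split: if_splits)
qed

lemma valid_ops_points: "valid_ops X n os \<Longrightarrow> (\<Union>a\<in>set os. op_points a) \<subseteq> X"
proof (induction os rule: rev_induct)
  case (snoc a os)
  then show ?case by (cases a) (auto simp: valid_ops_snoc)
qed simp

context lsf_instance
begin

lemma solves_balanced:
  fixes X :: "'a set"
  assumes fam: "sensitive_filter_family X d F r cr p1 p2 pq pu" and sp: "dissimilarity_space X d"
    and r: "0 < r" "r \<le> cr" and p2: "0 \<le> p2" and bal: "lsf_balanced w k kap l lt bl A p1"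
    and FU: "8 * moment_const * (7 * real k * 2 ^ kap * (pu / p1) ^ k) \<le> real FU + 1"
    and FQ: "8 * moment_const * (7 * real k * 2 ^ kap * (pq / p1) ^ k) \<le> real FQ + 1"
    and B: "8 * moment_const * (2 ^ kap * (pu / p1) ^ k) \<le> real B + 1"
    and DQ: "8 * moment_const * (real n * (2 / 2 ^ lt * moment_const * (2 ^ kap)\<^sup>2 * (pq / p1) ^ k * (pu / p1) ^ k +
      (2 ^ kap * (p2 / p1) ^ k + 2 / 2 ^ l * moment_const * (2 ^ kap)\<^sup>2 * (pq / p1) ^ k * ((real k + 1) * (pu / p1) ^ k)))) \<le> real DQ"
    and DQ_pos: "0 < DQ"
  shows "solves_near_neighbor D R0 w n X d F r cr (1 / (2 * moment_const))"
  unfolding solves_near_neighbor_def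
proof (intro allI impI)
  fix os x assume v: "valid_ops X n os" and x: "x \<in> X" and "\<exists>i y. contents os i = Some y \<and> d x y \<le> r"
  then obtain i0 y where y: "contents os i0 = Some y" "d x y \<le> r" by blast
  define Y where "Y = (\<Union>a\<in>set (os @ [Query x]). op_points a)"
  have Yfin: "finite Y" unfolding Y_def by (intro finite_UN_I finite_op_points) simp
  have YX: "Y \<subseteq> X" using valid_ops_points[OF v] x by (simp add: Y_def)
  have xY: "x \<in> Y" by (simp add: Y_def)
  have cY: "y' \<in> Y" if "contents os i = Some y'" for i y' using contents_points[OF that] by (simp add: Y_def)
  have F: "prob_space F"
    and ms0: "\<forall>x\<in>X. {f \<in> space F. x \<in> fst f} \<in> sets F \<and> {f \<in> space F. x \<in> snd f} \<in> sets F"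
    and pair0: "\<forall>x\<in>X. \<forall>y\<in>X. (d x y \<le> r \<longrightarrow> p1 \<le> measure F {f \<in> space F. x \<in> fst f \<and> y \<in> snd f}) \<and>
        (cr < d x y \<longrightarrow> measure F {f \<in> space F. x \<in> fst f \<and> y \<in> snd f} \<le> p2)"
    and upper0: "\<forall>x\<in>X. measure F {f \<in> space F. x \<in> fst f} \<le> pq \<and> measure F {f \<in> space F. x \<in> snd f} \<le> pu"
    using fam unfolding sensitive_filter_family_def by - (elim conjE, assumption)+
  have ms: "{f \<in> space F. a \<in> fst f} \<in> sets F \<and> {f \<in> space F. a \<in> snd f} \<in> sets F" if "a \<in> Y" for a
    using bspec[OF ms0 subsetD[OF YX that]] .
  have "\<exists>q. (\<forall>v\<in>Pow Y \<times> Pow Y. pmf q v = measure F {f \<in> space F. restrict_filter Y f = v}) \<and>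
    (\<forall>V. measure F {f \<in> space F. restrict_filter Y f \<in> V} = measure_pmf.prob q V)"
    by (rule discretize_exists[OF F]) (use Yfin restrict_filter_measurable[OF Yfin ms] in \<open>auto simp: restrict_filter_def\<close>)
  then obtain q where q0: "\<forall>v\<in>Pow Y \<times> Pow Y. pmf q v = measure F {f \<in> space F. restrict_filter Y f = v}"
    and qV0: "\<forall>V. measure F {f \<in> space F. restrict_filter Y f \<in> V} = measure_pmf.prob q V" by (elim exE conjE) (rule that)
  have q: "pmf q v = measure F {f \<in> space F. restrict_filter Y f = v}" if "v \<in> Pow Y \<times> Pow Y" for v
    using that by (rule bspec[OF q0])
  have qV: "measure_pmf.prob q V = measure F {f \<in> space F. restrict_filter Y f \<in> V}" for V
    by (rule qV0[rule_format, symmetric])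
  have q1: "measure_pmf.prob q {f. a \<in> fst f} = measure F {f \<in> space F. a \<in> fst f}"
    "measure_pmf.prob q {f. a \<in> snd f} = measure F {f \<in> space F. a \<in> snd f}" if "a \<in> Y" for a
    unfolding qV using that by (simp_all add: restrict_filter_def)
  have q2: "measure_pmf.prob q {f. a \<in> fst f \<and> b \<in> snd f} = measure F {f \<in> space F. a \<in> fst f \<and> b \<in> snd f}"
    if "a \<in> Y" "b \<in> Y" for a b
    unfolding qV using that by (simp add: restrict_filter_def)
  have close: "p1 \<le> measure_pmf.prob q {f. a \<in> fst f \<and> b \<in> snd f}" if "a \<in> Y" "b \<in> Y" "d a b \<le> r" for a b
    unfolding q2[OF that(1,2)] using bspec[OF bspec[OF pair0 subsetD[OF YX that(1)]] subsetD[OF YX that(2)]] that(3) by simp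
  have far: "measure_pmf.prob q {f. a \<in> fst f \<and> b \<in> snd f} \<le> p2" if "a \<in> Y" "b \<in> Y" "\<not> d a b \<le> cr" for a b
    unfolding q2[OF that(1,2)] using bspec[OF bspec[OF pair0 subsetD[OF YX that(1)]] subsetD[OF YX that(2)]] that(3) by simp
  have upper: "measure_pmf.prob q {f. a \<in> fst f} \<le> pq" "measure_pmf.prob q {f. a \<in> snd f} \<le> pu" if "a \<in> Y" for a
    unfolding q1[OF that] using bspec[OF upper0 subsetD[OF YX that]] by simp_all
  interpret b: lsf_balanced w k kap l lt bl A q "({}, {})" p1 by (rule bal)
  define I where "I = {i. i < n \<and> (\<exists>y'. contents os i = Some y' \<and> \<not> d x y' \<le> cr)}"
  define Q where "Q f \<longleftrightarrow> x \<in> fst f" for f :: "'a set \<times> 'a set"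
  define U where "U f \<longleftrightarrow> y \<in> snd f" for f :: "'a set \<times> 'a set"
  define V where "V i f \<longleftrightarrow> the (contents os i) \<in> snd f" for i and f :: "'a set \<times> 'a set"
  define Good where "Good = {x.
     work (b.treeS U x) (snd x) \<le> FU \<and> length (leaves (b.treeS U x) (snd x)) \<le> B \<and>
     work (b.treeS Q x) (snd x) \<le> FQ \<and> set (leaves (b.treeS Q x) (snd x)) \<inter> set (leaves (b.treeS U x) (snd x)) \<noteq> {} \<and>
     (\<Sum>i\<in>I. \<Sum>h\<leftarrow>leaves (b.treeS Q x) (snd x). count_list (leaves (b.treeS (V i) x) (snd x)) h) < DQ}"
  have Iy: "\<exists>y'. contents os i = Some y' \<and> the (contents os i) = y' \<and> y' \<in> Y \<and> \<not> d x y' \<le> cr" if "i \<in> I" for i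
    using that cY by (auto simp: I_def)
  have prob: "1 / (2 * moment_const) \<le> measure_pmf.prob (b.outcome k) Good"
    unfolding Good_def
  proof (rule b.success_probability[where n = n])
    show "p1 \<le> measure_pmf.prob q {f. Q f \<and> U f}" unfolding Q_def U_def using xY cY[OF y(1)] y(2) by (rule close)
    show "measure_pmf.prob q {f. Q f} \<le> pq" unfolding Q_def using xY by (rule upper)
    show "measure_pmf.prob q {f. U f} \<le> pu" unfolding U_def using cY[OF y(1)] by (rule upper)
    show "card I \<le> n"
      using card_mono[of "{..<n}" I] by (auto simp: I_def)
    show "finite I" by (simp add: I_def)
    fix i assume "i \<in> I"
    then obtain y' where y': "the (contents os i) = y'" "y' \<in> Y" "\<not> d x y' \<le> cr" using Iy by blast
    \<comment> \<open>A stored point is near itself. This gives its update side the probability at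
      least \<open>p1\<close> that the moment bounds demand of far points too.\<close>
    have "d y' y' \<le> r" using sp r subsetD[OF YX y'(2)] unfolding dissimilarity_space_def by simp
    then have "p1 \<le> measure_pmf.prob q {f. y' \<in> fst f \<and> y' \<in> snd f}" using close y' by blast
    also have "\<dots> \<le> measure_pmf.prob q {f. y' \<in> snd f}" by (rule measure_pmf.finite_measure_mono) auto
    finally show "p1 \<le> measure_pmf.prob q {f. V i f}" unfolding V_def y'(1) .
    show "measure_pmf.prob q {f. V i f} \<le> pu" unfolding V_def y'(1) using y'(2) by (rule upper)
    show "measure_pmf.prob q {f. Q f \<and> V i f} \<le> p2" unfolding Q_def V_def y'(1) using xY y'(2,3) by (rule far)
  qed (use p2 FU FQ B DQ DQ_pos in auto)
  let ?v = "view nfilters k Y ({}, {})"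
  let ?M = "randomness F w"
  interpret M: prob_space ?M using F by (rule prob_space_randomness)
  have good: "success d cr os x \<omega>" if "?v \<omega> \<in> Good" for \<omega>
  proof -
    interpret e: lsf_env w k kap l lt bl A n B FU FQ DQ cells "make_env w d cr \<omega>" D R0 by (rule env)
    let ?E = "make_env w d cr \<omega>"
    have lu: "leaves (e.upd_tree a) e.ws = leaves (\<lambda>i. a \<in> snd (fst (?v \<omega>) i)) (snd (?v \<omega>))"
      "work (e.upd_tree a) e.ws = work (\<lambda>i. a \<in> snd (fst (?v \<omega>) i)) (snd (?v \<omega>))" if "a \<in> Y" for a
      by (rule leaves_cong work_cong; use that in \<open>simp add: make_env_def view_def restrict_filter_def\<close>)+
    have lq: "leaves (e.qry_tree x) e.ws = leaves (\<lambda>i. x \<in> fst (fst (?v \<omega>) i)) (snd (?v \<omega>))"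
      "work (e.qry_tree x) e.ws = work (\<lambda>i. x \<in> fst (fst (?v \<omega>) i)) (snd (?v \<omega>))"
      by (rule leaves_cong work_cong; use xY in \<open>simp add: make_env_def view_def restrict_filter_def\<close>)+
    let ?g = "\<lambda>i. \<Sum>h\<leftarrow>leaves (b.treeS Q (?v \<omega>)) (snd (?v \<omega>)). count_list (leaves (b.treeS (V i) (?v \<omega>)) (snd (?v \<omega>))) h"
    have "e.far_pairs (contents os) x = (\<Sum>i<n. if i \<in> I then ?g i else 0)"
      unfolding e.far_pairs_def
    proof (intro sum.cong refl)
      fix i assume i: "i \<in> {..<n}"
      show "(case contents os i of None \<Rightarrow> 0 | Some y \<Rightarrow> if distance ?E x y \<le> threshold ?E then 0
         else (\<Sum>h\<leftarrow>leaves (e.qry_tree x) e.ws. count_list (leaves (e.upd_tree y) e.ws) h)) = (if i \<in> I then ?g i else 0)"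
      proof (cases "contents os i")
        case None
        then show ?thesis by (simp add: I_def)
      next
        case (Some a)
        have dt: "distance ?E x a \<le> threshold ?E \<longleftrightarrow> d x a \<le> cr" by (simp add: make_env_def)
        have I: "i \<in> I \<longleftrightarrow> \<not> d x a \<le> cr" using i Some by (simp add: I_def)
        show ?thesis unfolding Some option.case dt I lq(1) lu(1)[OF cY[OF Some]] unfolding Q_def V_def Some option.sel
          by (simp only: if_not_P if_P split: if_splits) simp
      qed
    qed
    also have "\<dots> = (\<Sum>i\<in>{..<n} \<inter> I. ?g i)" by (simp only: sum.inter_restrict[OF finite_lessThan])
    also have "{..<n} \<inter> I = I" by (auto simp: I_def)
    finally have fp: "e.far_pairs (contents os) x = (\<Sum>i\<in>I. ?g i)" .
    have "e.lucky (contents os) x y"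
      unfolding e.lucky_def fp lq lu[OF cY[OF y(1)]] using that unfolding Good_def U_def Q_def by simp
    moreover have "distance ?E x y \<le> threshold ?E" using y(2) r by (simp add: make_env_def)
    ultimately show ?thesis using e.reaches_lucky[OF v y(1)] by (simp add: success_def make_env_def)
  qed
  define Succ where "Succ = {\<omega> \<in> space ?M. success d cr os x \<omega>}"
  \<comment> \<open>Success is a union of fibres of the view; this is where its measurability comes
    from.\<close>
  have "Succ = {\<omega> \<in> space ?M. ?v \<omega> \<in> ?v ` Succ}"
  proof (intro equalityI subsetI)
    fix \<omega> assume "\<omega> \<in> {\<omega> \<in> space ?M. ?v \<omega> \<in> ?v ` Succ}"
    then obtain \<omega>' where w: "\<omega> \<in> space ?M" "success d cr os x \<omega>'" "?v \<omega>' = ?v \<omega>" by (auto simp: Succ_def)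
    have "success d cr os x \<omega>" using v x _ w(3,2) by (rule success_cong) (simp add: Y_def)
    then show "\<omega> \<in> Succ" using w by (simp add: Succ_def)
  qed (auto simp: Succ_def)
  also have "\<dots> \<in> sets ?M" by (rule randomness_view(1)[OF F Yfin ms q])
  finally have meas: "Succ \<in> sets ?M" .
  have "measure_pmf.prob (b.outcome k) Good = measure ?M {\<omega> \<in> space ?M. ?v \<omega> \<in> Good}"
    unfolding b.outcome_def nfilters_def[symmetric] by (rule randomness_view(2)[OF F Yfin ms q, symmetric])
  also have "\<dots> \<le> measure ?M Succ"
    by (rule M.finite_measure_mono[OF _ meas]) (use good in \<open>auto simp: Succ_def\<close>)
  finally have "1 / (2 * moment_const) \<le> measure ?M Succ" using prob by linarith
  then show "1 / (2 * moment_const) \<le> measure ?M {\<omega> \<in> space ?M. \<exists>s. reaches (make_env w d cr \<omega>) D R0 (os @ [Query x]) s \<and>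
      correct_answer d cr (contents os) x s}" unfolding Succ_def success_def .
qed

text \<open>With \<open>k = 0\<close> the single root is a leaf, so every point is filed once, in
  one common bucket. \<open>DQ\<close> exceeds the length of this list, and the query succeeds for
  every outcome.\<close>

lemma solves_linear:
  fixes X :: "'a set"
  assumes F: "prob_space F" and r: "r \<le> cr" and z: "k = 0" "kap = 0" "l = 0" "lt = 0"
    and b: "2 \<le> FU" "2 \<le> FQ" "n < DQ" and \<delta>: "\<delta> \<le> 1"
  shows "solves_near_neighbor D R0 w n X d F r cr \<delta>"
  unfolding solves_near_neighbor_def
proof (intro allI impI)
  fix os x assume v: "valid_ops X n os" and x: "x \<in> X" and "\<exists>i y. contents os i = Some y \<and> d x y \<le> r"
  then obtain i0 y where y: "contents os i0 = Some y" "d x y \<le> r" by blast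
  let ?M = "randomness F w"
  interpret M: prob_space ?M using F by (rule prob_space_randomness)
  have nf: "nfilters = 0" unfolding nfilters_def start_def using z(1) by simp
  have ro: "roots = [0]" unfolding roots_def by (simp add: z(2))
  have fr: "front S ws k = [0]" for S ws
    using arg_cong[OF z(1), of "front S ws"] by (simp only: front.simps(1) ro)
  have leaves: "leaves S ws = [0]" for S ws unfolding leaves_def fr by (simp add: bucket_def)
  have bfs: "bfs S ws = [0]" for S ws
  proof -
    have "[0..<Suc k] = [0]" using z(1) by simp
    then show ?thesis unfolding bfs_def by (simp only: list.map concat.simps front.simps(1) ro append_Nil2)
  qed
  have work: "work S ws = 2" for S ws unfolding work_def bfs nf using z(1) by simp
  have "success d cr os x \<omega>" for \<omega>
  proof -
    interpret e: lsf_env w k kap l lt bl A n B FU FQ DQ cells "make_env w d cr \<omega>" D R0 by (rule env)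
    let ?E = "make_env w d cr \<omega>"
    have "e.far_pairs (contents os) x \<le> (\<Sum>i<n. 1)"
      unfolding e.far_pairs_def leaves by (rule sum_mono) (simp split: option.split)
    then have "e.lucky (contents os) x y" unfolding e.lucky_def work leaves using b B_pos by simp
    moreover have "distance ?E x y \<le> threshold ?E" using y(2) r by (simp add: make_env_def)
    ultimately show ?thesis using e.reaches_lucky[OF v y(1)] by (simp add: success_def make_env_def)
  qed
  then have "{\<omega> \<in> space ?M. \<exists>s. reaches (make_env w d cr \<omega>) D R0 (os @ [Query x]) s \<and>
      correct_answer d cr (contents os) x s} = space ?M" unfolding success_def by blast
  then show "\<delta> \<le> measure ?M {\<omega> \<in> space ?M. \<exists>s. reaches (make_env w d cr \<omega>) D R0 (os @ [Query x]) s \<and>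
      correct_answer d cr (contents os) x s}" using M.prob_space \<delta> by (simp only:)
qed

end

section \<open>Parameters\<close>

text \<open>One generous constant above the cost of every program piece, so that running times
  become multiples of the loop budgets.\<close>

definition cost_factor :: nat where
  "cost_factor = 8 + cost scan_init + cost tree_init + cost (scan_body QuerySide) + cost tree_body +
     cost link_init + cost link_body + cost unlink_init + cost unlink_body + cost walk_init + cost walk_body"

context lsf_instance
begin

lemma cost_bounds:
  "lsf_run.query_cost FQ DQ \<le> cost_factor * (1 + FQ + DQ)"
  "lsf_run.insert_cost B FU + lsf_run.delete_cost B \<le> cost_factor * (1 + FU + B)"
proof -
  interpret e: lsf_env w k kap l lt bl A n B FU FQ DQ cells "make_env w d cr \<omega>" D R0 for d cr \<omega> by (rule env)
  interpret r: lsf_run w k kap l lt bl A n B FU FQ DQ cells "make_env w d cr \<omega>" None "\<lambda>_. None" for d cr \<omega> by (rule e.run)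
  have m: "a * x \<le> cost_factor * a" if "x \<le> cost_factor" for a x using that by (simp add: mult.commute)
  have "FQ * (Suc (cost (scan_body QuerySide)) + Suc (cost tree_body) + Suc (cost walk_body)) \<le> cost_factor * FQ"
    "DQ * Suc (cost walk_body) \<le> cost_factor * DQ"
    by (rule m; simp add: cost_factor_def)+
  moreover have "2 + (cost scan_init + cost tree_init + 2) + cost walk_init + 1 \<le> cost_factor"
    by (simp add: cost_factor_def)
  moreover have "lsf_run.query_cost FQ DQ = (2 + (cost scan_init + cost tree_init + 2) + cost walk_init + 1) +
      FQ * (Suc (cost (scan_body QuerySide)) + Suc (cost tree_body) + Suc (cost walk_body)) + DQ * Suc (cost walk_body)"
    by (simp only: r.query_cost_def r.enumerate_cost_def) (simp add: algebra_simps)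
  ultimately show "lsf_run.query_cost FQ DQ \<le> cost_factor * (1 + FQ + DQ)"
    unfolding add_mult_distrib2 mult_1_right by linarith
  have "FU * (Suc (cost (scan_body QuerySide)) + Suc (cost tree_body)) \<le> cost_factor * FU"
    "B * (Suc (cost link_body) + Suc (cost unlink_body)) \<le> cost_factor * B"
    by (rule m; simp add: cost_factor_def)+
  moreover have "2 + (cost scan_init + cost tree_init + 2) + cost link_init + 1 + cost unlink_init + 1 \<le> cost_factor"
    by (simp add: cost_factor_def)
  moreover have "lsf_run.insert_cost B FU + lsf_run.delete_cost B =
     (2 + (cost scan_init + cost tree_init + 2) + cost link_init + 1 + cost unlink_init + 1) +
      FU * (Suc (cost (scan_body QuerySide)) + Suc (cost tree_body)) + B * (Suc (cost link_body) + Suc (cost unlink_body))"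
    by (simp only: r.insert_cost_def r.delete_cost_def r.enumerate_cost_def) (simp add: algebra_simps)
  ultimately show "lsf_run.insert_cost B FU + lsf_run.delete_cost B \<le> cost_factor * (1 + FU + B)"
    unfolding add_mult_distrib2 mult_1_right by linarith
qed

end

lemma power_two_between: "1 \<le> (x::real) \<Longrightarrow> \<exists>m. x \<le> 2 ^ m \<and> 2 ^ m \<le> 2 * x"
proof -
  assume x: "1 \<le> x"
  define m where "m = (LEAST m. x \<le> 2 ^ m)"
  have "\<exists>m. x \<le> 2 ^ m" using real_arch_pow[of 2 x] by (auto intro: less_imp_le)
  then have "x \<le> 2 ^ m" unfolding m_def by (rule LeastI_ex)
  moreover have "2 ^ m \<le> 2 * x"
  proof (cases m)
    case 0
    then show ?thesis using x by simp
  next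
    case (Suc m')
    then have "\<not> x \<le> 2 ^ m'" using not_less_Least[of m' "\<lambda>m. x \<le> 2 ^ m"] unfolding m_def by simp
    then show ?thesis using Suc by simp
  qed
  ultimately show ?thesis by blast
qed

text \<open>\<open>exp 1 \<le> 3\<close> and \<open>9 * 3 ^ 8 \<le> 4 ^ 8\<close>. A power of 4 is
  convenient because word sizes are later compared with powers of a quantity that is at least
  4.\<close>

lemma moment_const_bounds: "1 \<le> moment_const" "moment_const \<le> 4 ^ 8"
proof -
  have "exp (8::real) = exp 1 ^ 8" using exp_of_nat_mult[of 8 "1::real"] by simp
  also have "\<dots> \<le> 3 ^ 8" by (rule power_mono[OF exp_le]) simp
  finally show "moment_const \<le> 4 ^ 8" by (simp add: moment_const_def)
  have "1 \<le> exp (8::real)" by simp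
  then show "1 \<le> moment_const" unfolding moment_const_def by linarith
qed

text \<open>Besides being positive, the depth enters only through the second inequality: the decay
  of far pairs relative to the query side makes up for the number of stored points.\<close>

lemma filter_depth_bounds:
  assumes n: "2 \<le> n" and p2: "0 < p2" "p2 < pq" and k: "k = filter_depth n p2 pq"
  shows "1 \<le> k" "real n * (p2 / pq) ^ k \<le> 1"
proof -
  have L: "0 < ln (pq / p2)" using p2 by simp
  have N: "0 < ln (real n)" using n by simp
  have pos: "0 < ln (real n) / ln (pq / p2)" using L N by simp
  then have "0 < \<lceil>ln (real n) / ln (pq / p2)\<rceil>" by simp
  then show "1 \<le> k" unfolding k filter_depth_def by linarith
  have "ln (real n) / ln (pq / p2) \<le> real k" unfolding k filter_depth_def by (rule real_nat_ceiling_ge)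
  then have "ln (real n) \<le> real k * ln (pq / p2)" using L by (simp add: field_simps)
  also have "\<dots> = ln ((pq / p2) ^ k)" using p2 by (simp add: ln_realpow)
  finally have "real n \<le> (pq / p2) ^ k" using n p2 by (subst (asm) ln_le_cancel_iff) auto
  moreover have "(p2 / pq) ^ k = 1 / (pq / p2) ^ k" by (simp add: power_divide)
  ultimately show "real n * (p2 / pq) ^ k \<le> 1" using p2 by (simp add: field_simps)
qed

text \<open>The first alternative is a linear scan: without levels all points share one bucket.\<close>

definition suitable :: "nat \<Rightarrow> real \<Rightarrow> real \<Rightarrow> real \<Rightarrow> real \<Rightarrow> nat \<Rightarrow> (reg \<Rightarrow> nat) \<Rightarrow> bool" where
  "suitable n p1 p2 pq pu w R \<longleftrightarrow> (\<exists>k kap l lt bl A B FU FQ DQ cells.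
     R = lsf_regs w k kap l lt bl A n B FU FQ DQ \<and> lsf w k kap l lt bl A n B FU FQ DQ cells \<and> bl < 2 ^ w \<and>
     (let h = filter_depth n p2 pq; u = (pu / p1) ^ h; q = (pq / p1) ^ h; C = moment_const; K = 2 ^ kap; M = 2080 * C * C in
       real (8 * cells) \<le> M * (real h * real n * u) \<and> real (lsf_tree.nfilters k kap bl A) \<le> M * ((real h)\<^sup>2 / p1) \<and>
       real FU \<le> M * ((real h)\<^sup>2 * u) \<and> real B \<le> M * ((real h)\<^sup>2 * u) \<and>
       real FQ \<le> M * ((real h)\<^sup>2 * q) \<and> real DQ \<le> M * (real h * q) \<and>
       (k = 0 \<and> kap = 0 \<and> l = 0 \<and> lt = 0 \<and> 2 \<le> FU \<and> 2 \<le> FQ \<and> n < DQ \<or>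
        k = h \<and> lsf_balanced w k kap l lt bl A p1 \<and>
        8 * C * (7 * real k * K * u) \<le> real FU + 1 \<and> 8 * C * (7 * real k * K * q) \<le> real FQ + 1 \<and>
        8 * C * (K * u) \<le> real B + 1 \<and>
        8 * C * (real n * (2 / 2 ^ lt * C * K\<^sup>2 * q * u +
          (K * (p2 / p1) ^ k + 2 / 2 ^ l * C * K\<^sup>2 * q * ((real k + 1) * u)))) \<le> real DQ \<and> 0 < DQ)))"

lemma suitableI:
  assumes "h = filter_depth n p2 pq" "u = (pu / p1) ^ h" "q = (pq / p1) ^ h" "C = moment_const"
    and "lsf w k kap l lt bl A n B FU FQ DQ cells" "bl < 2 ^ w"
    "real (8 * cells) \<le> 2080 * C * C * (real h * real n * u)" "real (lsf_tree.nfilters k kap bl A) \<le> 2080 * C * C * ((real h)\<^sup>2 / p1)"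
    "real FU \<le> 2080 * C * C * ((real h)\<^sup>2 * u)" "real B \<le> 2080 * C * C * ((real h)\<^sup>2 * u)"
    "real FQ \<le> 2080 * C * C * ((real h)\<^sup>2 * q)" "real DQ \<le> 2080 * C * C * (real h * q)"
    "k = 0 \<and> kap = 0 \<and> l = 0 \<and> lt = 0 \<and> 2 \<le> FU \<and> 2 \<le> FQ \<and> n < DQ \<or>
        k = h \<and> lsf_balanced w k kap l lt bl A p1 \<and>
        8 * C * (7 * real k * 2 ^ kap * u) \<le> real FU + 1 \<and> 8 * C * (7 * real k * 2 ^ kap * q) \<le> real FQ + 1 \<and>
        8 * C * (2 ^ kap * u) \<le> real B + 1 \<and>
        8 * C * (real n * (2 / 2 ^ lt * C * (2 ^ kap)\<^sup>2 * q * u +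
          (2 ^ kap * (p2 / p1) ^ k + 2 / 2 ^ l * C * (2 ^ kap)\<^sup>2 * q * ((real k + 1) * u)))) \<le> real DQ \<and> 0 < DQ"
  shows "suitable n p1 p2 pq pu w (lsf_regs w k kap l lt bl A n B FU FQ DQ)"
  unfolding suitable_def Let_def assms(1-4)[symmetric]
  by (rule exI[of _ k], rule exI[of _ kap], rule exI[of _ l], rule exI[of _ lt], rule exI[of _ bl], rule exI[of _ A],
      rule exI[of _ B], rule exI[of _ FU], rule exI[of _ FQ], rule exI[of _ DQ], rule exI[of _ cells])
    (intro conjI refl assms(5-))

text \<open>The permitted number of distance computations reaches \<open>n\<close> here, so
  comparing the query with all points is affordable, and no filters are drawn.\<close>

lemma suitable_linear:
  assumes p: "0 < p1" "p1 \<le> pq" "p1 \<le> pu" "0 < p2" "p2 < pq" and n: "2 \<le> n" and k: "k = filter_depth n p2 pq"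
    and X: "X = real n + real k * real n * (pu / p1) ^ k + (real k)\<^sup>2 / p1" and w: "X ^ 40 \<le> 2 ^ w"
    and few: "real n \<le> real k * (pq / p1) ^ k"
  shows "\<exists>R. suitable n p1 p2 pq pu w R"
proof -
  let ?u = "(pu / p1) ^ k" let ?q = "(pq / p1) ^ k" let ?M = "2080 * moment_const * moment_const"
  have k1: "1 \<le> k" using filter_depth_bounds n p k by blast
  have u1: "1 \<le> ?u" and q1: "1 \<le> ?q" using p by (auto intro!: one_le_power)
  have kk: "1 \<le> (real k)\<^sup>2" using k1 by (intro one_le_power) simp
  have CC: "1 \<le> moment_const * moment_const" using mult_mono[OF moment_const_bounds(1) moment_const_bounds(1)] moment_const_bounds(1) by simp
  have kq: "1 \<le> real k * ?q" using mult_mono[of 1 "real k" 1 ?q] k1 q1 by simp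
  have ku: "1 \<le> real k * ?u" using mult_mono[of 1 "real k" 1 ?u] k1 u1 by simp
  have k2u: "1 \<le> (real k)\<^sup>2 * ?u" using mult_mono[of 1 "(real k)\<^sup>2" 1 ?u] kk u1 by simp
  have k2q: "1 \<le> (real k)\<^sup>2 * ?q" using mult_mono[of 1 "(real k)\<^sup>2" 1 ?q] kk q1 by simp
  have a: "real n \<le> real k * real n * ?u" using mult_left_mono[OF ku, of "real n"] by (simp add: mult_ac)
  have up: "y \<le> ?M * z" if "y \<le> 2080 * z" "0 \<le> z" for y z
  proof -
    have "2080 * z * 1 \<le> 2080 * z * (moment_const * moment_const)" using CC that by (intro mult_left_mono) auto
    then show ?thesis using that by (simp add: mult_ac)
  qed
  have "0 \<le> (real k)\<^sup>2 / p1" and n2: "2 \<le> real n" using p n by simp_all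
  then have X4: "4 \<le> X" and nX: "real n \<le> X" unfolding X using a by linarith+
  have "8 * (real n + 20) \<le> X ^ 40"
  proof -
    have "8 * (real n + 20) \<le> 4 ^ 5 * X" using nX X4 by simp
    also have "\<dots> \<le> X ^ 5 * X" using X4 by (intro mult_right_mono power_mono) auto
    also have "\<dots> = X ^ 6" using power_add[of X 5 1] by simp
    also have "\<dots> \<le> X ^ 40" using X4 by (intro power_increasing) auto
    finally show ?thesis .
  qed
  then have "real (8 * (n + 20)) \<le> real (2 ^ w)" using w by simp
  then have cw: "8 * (n + 20) \<le> 2 ^ w" by (simp only: of_nat_le_iff)
  have nf: "lsf_tree.nfilters 0 0 0 0 = 0"
  proof -
    interpret lsf_tree w 0 0 0 0 0 0 by unfold_locales auto
    show ?thesis by (simp add: nfilters_def start_def)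
  qed
  have lsf: "lsf w 0 0 0 0 0 0 n 1 2 2 (n + 1) (n + 20)"
    by unfold_locales (use cw n nf in auto)
  have "real (8 * (n + 20)) = 8 * real n + 160" by simp
  then have "real (8 * (n + 20)) \<le> ?M * (real k * real n * ?u)" using a n2 by (intro up) linarith+
  moreover have "real (lsf_tree.nfilters 0 0 0 0) \<le> ?M * ((real k)\<^sup>2 / p1)" unfolding nf using p CC by simp
  moreover have "real 2 \<le> ?M * ((real k)\<^sup>2 * ?u)" "real 1 \<le> ?M * ((real k)\<^sup>2 * ?u)" "real 2 \<le> ?M * ((real k)\<^sup>2 * ?q)"

  proof -
    have "real 2 \<le> ?M * z" "real 1 \<le> ?M * z" if "1 \<le> z" for z by (rule up; use that in simp)+
    then show "real 2 \<le> ?M * ((real k)\<^sup>2 * ?u)" "real 1 \<le> ?M * ((real k)\<^sup>2 * ?u)" "real 2 \<le> ?M * ((real k)\<^sup>2 * ?q)"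
      using k2u k2q by blast+
  qed
  moreover have "real (n + 1) \<le> ?M * (real k * ?q)" using few kq by (intro up) auto
  ultimately have "suitable n p1 p2 pq pu w (lsf_regs w 0 0 0 0 0 0 n 1 2 2 (n + 1))"
    using lsf by (intro suitableI[OF k refl refl refl]) (assumption | simp)+
  then show ?thesis by blast
qed

text \<open>\<open>many\<close> is what makes the working space of a query fit: its queue is of
  order \<open>k ^ 2 * (pq / p1) ^ k\<close>, while the permitted memory
  \<open>k * n * (pu / p1) ^ k\<close> does not mention \<open>pq\<close>.\<close>

lemma suitable_tree:
  assumes p: "0 < p1" "p1 \<le> 1" "p1 \<le> pq" "p1 \<le> pu" "0 < p2" "p2 < pq" and n: "2 \<le> n" and k: "k = filter_depth n p2 pq"
    and X: "X = real n + real k * real n * (pu / p1) ^ k + (real k)\<^sup>2 / p1" and w: "X ^ 40 \<le> 2 ^ w"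
    and many: "real k * (pq / p1) ^ k < real n"
  shows "\<exists>R. suitable n p1 p2 pq pu w R"
proof -
  define u where "u = (pu / p1) ^ k" define q where "q = (pq / p1) ^ k" define C where "C = moment_const"
  define x where "x = real k" define N where "N = real n"
  define a where "a = x * N * u"
  have C1: "1 \<le> C" and C8: "C \<le> 4 ^ 8" using moment_const_bounds by (simp_all add: C_def)
  have k1: "1 \<le> k" and np: "N * (p2 / pq) ^ k \<le> 1" using filter_depth_bounds n p k by (auto simp: N_def)
  have x1: "1 \<le> x" using k1 by (simp add: x_def)
  have u1: "1 \<le> u" and q1: "1 \<le> q" using p by (auto intro!: one_le_power simp: u_def q_def)
  have N2: "2 \<le> N" using n by (simp add: N_def)
  have up: "y \<le> y * z" if "0 \<le> y" "1 \<le> z" for y z :: real using mult_left_mono[OF that(2,1)] by simp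
  have xq: "x * q \<le> N" using many by (simp add: x_def q_def N_def)
  have xN: "x \<le> N" using up[of x q] x1 q1 xq by linarith
  have Na: "N \<le> a"
    using up[of N "x * u"] N2 mult_mono[OF x1 u1] x1 by (simp add: a_def mult_ac)
  have xa: "x \<le> a" using xN Na by linarith
  have a2: "2 \<le> a" using N2 Na by linarith
  have xxu: "x\<^sup>2 * u \<le> a"
    using mult_right_mono[OF mult_left_mono[OF xN, of x], of u] x1 u1 by (simp add: a_def power2_eq_square)
  have xxq: "x\<^sup>2 * q \<le> a"
  proof -
    have "x\<^sup>2 * q \<le> x * N" using mult_left_mono[OF xq, of x] x1 by (simp add: power2_eq_square mult_ac)
    also have "\<dots> \<le> a" unfolding a_def using x1 N2 u1 by (intro up) auto
    finally show ?thesis .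
  qed
  have xx: "x\<^sup>2 \<le> a" using up[of "x\<^sup>2" u] u1 xxu by simp
  have x2: "1 \<le> x\<^sup>2" using x1 by (rule one_le_power)
  have xp: "1 / p1 \<le> x\<^sup>2 / p1" using x2 p by (simp add: divide_right_mono)
  have Xe: "X = N + a + x\<^sup>2 / p1" by (simp add: X N_def a_def x_def u_def)
  have xp0: "0 \<le> x\<^sup>2 / p1" using p by simp
  have X4: "4 \<le> X" and aX: "a \<le> X" and XX: "x\<^sup>2 / p1 \<le> X"
    using Xe a2 N2 Na xp0 by linarith+
  have pX: "1 / p1 \<le> X" and xX: "x \<le> X" using xp XX xa aX by linarith+
  have Xp: "4 ^ i \<le> X ^ i" for i using X4 by (intro power_mono) auto
  have pw: "c * y \<le> X ^ (i + j)" if "c \<le> X ^ i" "0 \<le> y" "y \<le> X ^ j" for c y i j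
    unfolding power_add using that X4 by (intro mult_mono) auto
  have Xi: "X ^ i \<le> 2 ^ w" if "i \<le> 40" for i
    using power_increasing[OF that, of X] X4 w by linarith
  have Xs: "X ^ i < 2 ^ w" if "i < 40" for i
    using power_strict_increasing[OF that, of X] X4 w by linarith
  have CX: "C \<le> X ^ 8" using C8 Xp[of 8] by linarith
  obtain kap where kap: "x \<le> 2 ^ kap" "2 ^ kap \<le> 2 * x" using power_two_between[OF x1] by blast
  \<comment> \<open>\<open>a\<close> is the order of the total number of leaves of \<open>n\<close>
    stored points, so a bucket is expected to hold a bounded number of accidental entries.\<close>
  obtain lt where lt: "a \<le> 2 ^ lt" "2 ^ lt \<le> 2 * a" using power_two_between[of a] a2 by auto
  \<comment> \<open>Names with \<open>2 ^ l \<ge> 16 * e\<close> satisfy \<open>ids\<close> and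
    reduce the far comparisons caused by merged names to \<open>z\<close> in
    \<open>t3\<close>.\<close>
  define e where "e = C * (a * x)"
  have ae: "a \<le> e"
  proof -
    have "a \<le> a * x" using a2 x1 by (intro up) auto
    also have "\<dots> \<le> (a * x) * C" using a2 x1 C1 by (intro up) auto
    finally show ?thesis by (simp add: e_def mult_ac)
  qed
  obtain l where l: "16 * e \<le> 2 ^ l" "2 ^ l \<le> 2 * (16 * e)" using power_two_between[of "16 * e"] a2 ae by auto
  define K where "K = (2 ^ kap :: real)"
  have K: "x \<le> K" "K \<le> 2 * x" using kap by (simp_all add: K_def)
  have K0: "0 \<le> K" by (simp add: K_def)
  have K2: "K\<^sup>2 \<le> 4 * x\<^sup>2"
  proof -
    have "K\<^sup>2 \<le> (2 * x)\<^sup>2" using K K0 by (intro power_mono) auto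
    then show ?thesis by (simp add: power_mult_distrib)
  qed
  have pl: "i \<le> j" if "(2::real) ^ i \<le> 2 ^ j" for i j using that by (intro power_le_imp_le_exp[of "2::real"]) auto
  have kap_l: "kap \<le> l" using K xa ae a2 l unfolding K_def by (intro pl) linarith
  have lt_l: "lt \<le> l" using lt ae a2 l by (intro pl) linarith
  have eX: "e \<le> X ^ 10"
  proof -
    have "a * x \<le> X ^ (1 + 1)" using aX xX x1 by (intro pw) auto
    then have "C * (a * x) \<le> X ^ (8 + (1 + 1))" using a2 x1 by (intro pw[OF CX]) auto
    then show ?thesis by (simp add: e_def)
  qed
  have lX: "2 ^ l \<le> X ^ 13"
  proof -
    have "32 * e \<le> X ^ (3 + 10)" using Xp[of 3] eX ae a2 by (intro pw) auto
    then show ?thesis using l by simp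
  qed
  have l_w: "l \<le> w" using lX Xi[of 13] by (intro pl) linarith
  obtain A where A: "A \<le> k" "\<forall>j\<le>k. 1 / 16 \<le> (\<Prod>i<j. real (nat \<lfloor>1 / p1\<rfloor> + (Suc i * A div k - i * A div k)) * p1) \<and>
      (\<Prod>i<j. real (nat \<lfloor>1 / p1\<rfloor> + (Suc i * A div k - i * A div k)) * p1) \<le> 1"
    using balanced_blocks(1)[OF p(1,2) k1] by blast
  define bl where "bl = nat \<lfloor>1 / p1\<rfloor>"
  have bl: "real bl \<le> 1 / p1" unfolding bl_def by (rule balanced_blocks(5)[OF p(1,2) k1])
  interpret t: lsf_tree w k kap l lt bl A using kap_l lt_l l_w by unfold_locales
  have bs: "1 / 2 \<le> real (t.block_size j) * p1" "real (t.block_size j) * p1 \<le> 2" for j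
    unfolding t.block_size_def using balanced_blocks(2,3)[OF p(1,2) k1 A(1), folded bl_def] by blast+
  have nf: "real t.nfilters \<le> 4 * (x\<^sup>2 / p1)"
  proof -
    have "real (t.block_size j) \<le> 2 / p1" for j using bs(2)[of j] p by (simp add: field_simps)
    then have "(\<Sum>g<k * 2 ^ kap. real (t.block_size (g div 2 ^ kap))) \<le> (\<Sum>g<k * 2 ^ kap. 2 / p1)" by (intro sum_mono)
    also have "\<dots> = (x * (2 / p1)) * K" by (simp add: x_def K_def)
    also have "\<dots> \<le> (x * (2 / p1)) * (2 * x)" using K p x1 by (intro mult_left_mono) auto
    also have "\<dots> = 4 * (x\<^sup>2 / p1)" by (simp add: power2_eq_square)
    finally show ?thesis by (simp add: t.nfilters_def t.start_def)
  qed
  have xk: "real (Suc k) \<le> X ^ 2"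
  proof -
    have "real (Suc k) \<le> 4 * X" using xX X4 by (simp add: x_def)
    also have "\<dots> \<le> X * X" using X4 by (intro mult_right_mono) auto
    finally show ?thesis by (simp add: power2_eq_square)
  qed
  have keys: "Suc k * 2 ^ l * (t.nfilters + 1) * 2 ^ l \<le> 2 ^ w"
  proof -
    have "real t.nfilters + 1 \<le> 4 ^ 2 * X" using nf XX X4 by simp
    also have "\<dots> \<le> X ^ (2 + 1)" using X4 by (intro pw Xp) auto
    finally have nX: "real t.nfilters + 1 \<le> X ^ 3" by simp
    \<comment> \<open>The largest demand on the word length: the keys, with \<open>l\<close> further
      bits for the extraction, take 31 of the 40 powers of \<open>X\<close>.\<close>
    have "real (Suc k) * 2 ^ l * (real t.nfilters + 1) * 2 ^ l \<le> X ^ (2 + 13 + 3 + 13)"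
      by (intro pw xk lX nX) auto
    also have "\<dots> \<le> 2 ^ w" by (rule Xi) simp
    finally have "real (Suc k * 2 ^ l * (t.nfilters + 1) * 2 ^ l) \<le> real (2 ^ w)"
      by (simp only: of_nat_mult of_nat_add of_nat_1 of_nat_power of_nat_numeral)
    then show ?thesis by (simp only: of_nat_le_iff)
  qed
  have key_word: "Suc k * 2 ^ l * (t.nfilters + 1) < 2 ^ w"
  proof -
    have "(2::real) \<le> 2 ^ l" using l ae a2 by linarith
    then have "real 2 \<le> real (2 ^ l)" by simp
    then have "2 \<le> (2 ^ l :: nat)" by (simp only: of_nat_le_iff)
    then have "Suc k * 2 ^ l * (t.nfilters + 1) * 2 \<le> Suc k * 2 ^ l * (t.nfilters + 1) * 2 ^ l" by (rule mult_left_mono) simp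
    moreover have "0 < Suc k * 2 ^ l * (t.nfilters + 1)" by simp
    ultimately show ?thesis using keys by linarith
  qed
  have bal: "lsf_balanced w k kap l lt bl A p1"
  proof -
    \<comment> \<open>The balance conditions do not involve the filter distribution, so a trivial
      one serves to unfold them.\<close>
    interpret pr: lsf_prob w k kap l lt bl A "return_pmf ()" "()" using keys by unfold_locales
    show ?thesis
    proof unfold_locales
      show "1 / 16 \<le> pr.growth p1 j" "pr.growth p1 j \<le> 1" if "j \<le> k" for j
        unfolding pr.growth_def t.block_size_def using A(2)[folded bl_def] that by blast+
      have "2 * C * x\<^sup>2 \<le> 2 ^ l"
      proof -
        have "x * x \<le> a * x" using xa x1 by (intro mult_right_mono) auto
        then have "C * (x * x) \<le> e" unfolding e_def using C1 by (intro mult_left_mono) auto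
        then show ?thesis using l ae a2 by (simp add: power2_eq_square)
      qed
      then show "2 / 2 ^ l * moment_const * (real k)\<^sup>2 \<le> 1"
        unfolding C_def[symmetric] x_def[symmetric] by (simp add: field_simps)
    qed (use p k1 kap bs in \<open>auto simp: x_def\<close>)
  qed
  have ce: "t \<le> real (nat \<lceil>t\<rceil>)" "real (nat \<lceil>t\<rceil>) \<le> t + 1" if "0 \<le> t" for t
  proof -
    have "real (nat \<lceil>t\<rceil>) = of_int \<lceil>t\<rceil>" using that by (intro of_nat_nat) simp
    then show "t \<le> real (nat \<lceil>t\<rceil>)" "real (nat \<lceil>t\<rceil>) \<le> t + 1" by linarith+
  qed
  have CC: "y \<le> C * y" if "0 \<le> y" for y using up[OF that C1] by (simp add: mult.commute)
  have work: "8 * C * (7 * x * K * v) \<le> 112 * (C * (x\<^sup>2 * v))" if "1 \<le> v" for v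
  proof -
    have "8 * C * (7 * x * K * v) = (56 * C * x * v) * K" by simp
    also have "\<dots> \<le> (56 * C * x * v) * (2 * x)" using K C1 x1 that by (intro mult_left_mono) auto
    also have "\<dots> = 112 * (C * (x\<^sup>2 * v))" by (simp add: power2_eq_square)
    finally show ?thesis .
  qed
  have workn: "0 \<le> 8 * C * (7 * x * K * v)" "1 \<le> x\<^sup>2 * v" "1 \<le> C * (x\<^sup>2 * v)" if "1 \<le> v" for v
  proof -
    show "0 \<le> 8 * C * (7 * x * K * v)" using C1 x1 K0 that by simp
    show "1 \<le> x\<^sup>2 * v" using up[of "x\<^sup>2" v] x2 that by simp
    then show "1 \<le> C * (x\<^sup>2 * v)" using CC[of "x\<^sup>2 * v"] by linarith
  qed
  define FU where "FU = nat \<lceil>8 * C * (7 * x * K * u)\<rceil>"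
  define FQ where "FQ = nat \<lceil>8 * C * (7 * x * K * q)\<rceil>"
  define B where "B = nat \<lceil>8 * C * (K * u)\<rceil>"
  have FU: "8 * C * (7 * x * K * u) \<le> real FU" "real FU \<le> 113 * (C * (x\<^sup>2 * u))"
    using ce[OF workn(1)[OF u1]] work[OF u1] workn(3)[OF u1] unfolding FU_def by linarith+
  have FQ: "8 * C * (7 * x * K * q) \<le> real FQ" "real FQ \<le> 113 * (C * (x\<^sup>2 * q))"
    using ce[OF workn(1)[OF q1]] work[OF q1] workn(3)[OF q1] unfolding FQ_def by linarith+
  have xu: "1 \<le> x * u" using mult_mono[OF x1 u1] x1 by simp
  have Cu: "1 \<le> C * (x * u)" using CC[OF order_trans[OF zero_le_one xu]] xu by linarith
  have B: "8 * C * (K * u) \<le> real B" "real B \<le> 17 * (C * (x * u))" "1 \<le> B"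
  proof -
    have n0: "1 \<le> 8 * C * (K * u)"
    proof -
      have "C * (x * u) \<le> C * (K * u)" using K C1 u1 by (intro mult_left_mono mult_right_mono) auto
      then show ?thesis using Cu by simp
    qed
    have "8 * C * (K * u) = (8 * C * u) * K" by simp
    also have "\<dots> \<le> (8 * C * u) * (2 * x)" using K C1 u1 by (intro mult_left_mono) auto
    also have "\<dots> = 16 * (C * (x * u))" by simp
    finally have "8 * C * (K * u) \<le> 16 * (C * (x * u))" .
    then show "8 * C * (K * u) \<le> real B" "real B \<le> 17 * (C * (x * u))"
      using ce[of "8 * C * (K * u)"] n0 Cu unfolding B_def by linarith+
    then have "1 \<le> real B" using n0 by linarith
    then show "1 \<le> B" by simp
  qed
  \<comment> \<open>\<open>8 * C\<close> times the bound on the expected far comparisons. Its three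
    parts are accidental sharing of a bucket, genuinely common leaves, and merged names, estimated
    in \<open>t1\<close>, \<open>t2\<close> and \<open>t3\<close>.\<close>
  define T where "T = 8 * C * (N * (2 / 2 ^ lt * C * K\<^sup>2 * q * u + (K * (p2 / p1) ^ k + 2 / 2 ^ l * C * K\<^sup>2 * q * ((x + 1) * u))))"
  define z where "z = x * q"
  have z1: "1 \<le> z" using mult_mono[OF x1 q1] x1 by (simp add: z_def)
  have t1: "N * (2 / 2 ^ lt * C * K\<^sup>2 * q * u) \<le> 8 * C * z"
  proof -
    have "(2 * C * N * q * u) * K\<^sup>2 \<le> (2 * C * N * q * u) * (4 * x\<^sup>2)"
      using K2 C1 N2 q1 u1 by (intro mult_left_mono) auto
    also have "\<dots> = (8 * C * z) * a" by (simp add: z_def a_def power2_eq_square)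
    also have "\<dots> \<le> (8 * C * z) * 2 ^ lt" using lt C1 z1 by (intro mult_left_mono) auto
    finally show ?thesis by (simp add: field_simps)
  qed
  have t2: "N * (K * (p2 / p1) ^ k) \<le> 2 * z"
  proof -
    \<comment> \<open>Splits off the factor whose \<open>k\<close>-th power is compensated by
      \<open>N\<close>; what remains is \<open>q\<close>.\<close>
    have "p2 / p1 = p2 / pq * (pq / p1)" using p by simp
    then have "(p2 / p1) ^ k = (p2 / pq) ^ k * q" unfolding q_def by (simp only: power_mult_distrib)
    then have "N * (K * (p2 / p1) ^ k) = (K * q) * (N * (p2 / pq) ^ k)" by simp
    also have "\<dots> \<le> (K * q) * 1" using np K0 q1 by (intro mult_left_mono) auto
    also have "\<dots> \<le> 2 * z" using mult_right_mono[OF K(2), of q] q1 by (simp add: z_def)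
    finally show ?thesis .
  qed
  have t3: "N * (2 / 2 ^ l * C * K\<^sup>2 * q * ((x + 1) * u)) \<le> z"
  proof -
    have "(2 * C * N * q * u * (x + 1)) * K\<^sup>2 \<le> (2 * C * N * q * u * (2 * x)) * (4 * x\<^sup>2)"
      using K2 C1 N2 q1 u1 x1 by (intro mult_mono mult_left_mono) auto
    also have "\<dots> = (16 * e) * z" by (simp add: z_def a_def e_def power2_eq_square)
    also have "\<dots> \<le> 2 ^ l * z" using l z1 by (intro mult_right_mono) auto
    finally show ?thesis by (simp add: field_simps)
  qed
  have T: "T \<le> 88 * (C * C * z)"
  proof -
    have "T = 8 * C * (N * (2 / 2 ^ lt * C * K\<^sup>2 * q * u) + N * (K * (p2 / p1) ^ k) + N * (2 / 2 ^ l * C * K\<^sup>2 * q * ((x + 1) * u)))"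
      by (simp add: T_def distrib_left)
    also have "\<dots> \<le> 8 * C * (8 * C * z + 2 * z + z)" using C1 t1 t2 t3 by (intro mult_left_mono add_mono) auto
    also have "\<dots> = 64 * (C * C * z) + 24 * (C * z)" by (simp add: algebra_simps)
    also have "C * z \<le> C * (C * z)" using C1 z1 by (intro CC) auto
    finally show ?thesis by simp
  qed
  have T0: "0 \<le> T" unfolding T_def using C1 N2 q1 u1 K0 p x1 by (intro mult_nonneg_nonneg add_nonneg_nonneg) auto
  define DQ where "DQ = nat \<lceil>T\<rceil> + 1"
  have CCz: "1 \<le> C * C * z" 
  proof -
    have "1 \<le> C * z" using CC[OF order_trans[OF zero_le_one z1]] z1 by linarith
    then have "1 \<le> C * (C * z)" using CC[of "C * z"] by linarith
    then show ?thesis by (simp only: mult.assoc)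
  qed
  have DQ: "T \<le> real DQ" "real DQ \<le> 90 * (C * C * z)" "0 < DQ"
    using ce[OF T0] T CCz unfolding DQ_def by auto
  define cells where "cells = k * 2 ^ kap + FU + FQ + 2 ^ kap + n * B + 2 ^ lt + k + 10"
  \<comment> \<open>\<open>2080\<close> is \<open>8 * 260\<close>: eight arrays, each with at most
    \<open>260 * (C * a)\<close> cells.\<close>
  have cells: "real (8 * cells) \<le> 2080 * (C * a)"
  proof -
    have "real cells = x * K + real FU + real FQ + K + N * real B + 2 ^ lt + x + 10"
      by (simp add: cells_def x_def K_def N_def)
    moreover have "x * K \<le> 2 * a"

    proof -
      have "x * K \<le> x * (2 * x)" using K(2) x1 by (intro mult_left_mono) auto
      also have "\<dots> = 2 * x\<^sup>2" by (simp add: power2_eq_square)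
      finally show ?thesis using xx by linarith
    qed
    moreover have "real FU \<le> 113 * (C * a)" "real FQ \<le> 113 * (C * a)"
      using FU FQ mult_left_mono[OF xxu, of C] mult_left_mono[OF xxq, of C] C1 by linarith+
    moreover have "N * real B \<le> 17 * (C * a)"

    proof -
      have "N * real B \<le> N * (17 * (C * (x * u)))" using B(2) N2 by (intro mult_left_mono) auto
      then show ?thesis by (simp add: a_def mult_ac)
    qed
    moreover have "a \<le> C * a" using a2 by (intro CC) simp
    ultimately have "real cells \<le> 260 * (C * a)" using K(2) xa lt a2 by linarith
    then show ?thesis by simp
  qed
  have cw: "8 * cells \<le> 2 ^ w"
  proof -
    have "C * a \<le> X ^ (8 + 1)" using aX a2 by (intro pw CX) auto
    then have "2080 * (C * a) \<le> X ^ (6 + (8 + 1))" using Xp[of 6] C1 a2 by - (rule pw, auto)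
    also have "\<dots> \<le> 2 ^ w" by (rule Xi) simp
    finally have "real (8 * cells) \<le> real (2 ^ w)" using cells by simp
    then show ?thesis by (simp only: of_nat_le_iff)
  qed
  have DQw: "2 * DQ < 2 ^ w"
  proof -
    have zX: "z \<le> X ^ 1" using xq Na aX by (simp add: z_def)
    have "C * C * z \<le> X ^ (8 + 8 + 1)" using zX z1 C1 by (intro pw CX) auto
    then have "180 * (C * C * z) \<le> X ^ (4 + (8 + 8 + 1))" using Xp[of 4] CCz by - (rule pw, auto)
    also have "\<dots> < 2 ^ w" by (rule Xs) simp
    finally have "real (2 * DQ) < real (2 ^ w)" using DQ by simp
    then show ?thesis by (simp only: of_nat_less_iff)
  qed
  have Aw: "Suc k * A < 2 ^ w"
  proof -
    have "real A \<le> X ^ 1" using A(1) xX by (simp add: x_def)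
    then have "real (Suc k) * real A \<le> X ^ (2 + 1)" by (intro pw xk) auto
    also have "\<dots> < 2 ^ w" by (rule Xs) simp
    finally have "real (Suc k * A) < real (2 ^ w)" by (simp only: of_nat_mult of_nat_power of_nat_numeral)
    then show ?thesis by (simp only: of_nat_less_iff)
  qed
  have blw: "bl < 2 ^ w"
  proof -
    have "X < 2 ^ w" using Xs[of 1] by simp
    moreover have "real (2 ^ w) = (2::real) ^ w" by simp
    ultimately have "real bl < real (2 ^ w)" using bl pX by linarith
    then show ?thesis by (simp only: of_nat_less_iff)
  qed
  have lsf: "lsf w k kap l lt bl A n B FU FQ DQ cells"
    by unfold_locales (use B(3) cw key_word DQw Aw in \<open>auto simp: cells_def\<close>)
  let ?M = "2080 * C * C"
  have M: "c * y \<le> ?M * y" if "c \<le> 2080 * C" "0 \<le> y" for c y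
  proof -
    have "2080 * C \<le> ?M" using C1 up[of "2080 * C" C] by simp
    then show ?thesis using that by (intro mult_right_mono) linarith+
  qed
  have "real (8 * cells) \<le> ?M * (x * N * u)"

  proof -
    have "real (8 * cells) \<le> 2080 * C * a" using cells by (simp only: mult.assoc)
    also have "\<dots> \<le> ?M * a" using a2 by (intro M) auto
    finally show ?thesis unfolding a_def .
  qed
  moreover have "real t.nfilters \<le> ?M * (x\<^sup>2 / p1)" using nf M[of 4 "x\<^sup>2 / p1"] C1 xp0 by linarith
  moreover have "real FU \<le> ?M * (x\<^sup>2 * u)"

  proof -
    have "real FU \<le> 113 * C * (x\<^sup>2 * u)" using FU(2) by (simp only: mult.assoc)
    also have "\<dots> \<le> ?M * (x\<^sup>2 * u)" using C1 workn(2)[OF u1] by (intro M) auto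
    finally show ?thesis .
  qed
  moreover have "real B \<le> ?M * (x\<^sup>2 * u)"
  proof -
    have "x * u \<le> x\<^sup>2 * u" using up[of "x * u" x] x1 u1 by (simp add: power2_eq_square mult_ac)
    then have "17 * (C * (x * u)) \<le> 17 * (C * (x\<^sup>2 * u))" using C1 by (intro mult_left_mono) auto
    then have "real B \<le> 17 * C * (x\<^sup>2 * u)" using order_trans[OF B(2)] by (simp only: mult.assoc)
    also have "\<dots> \<le> ?M * (x\<^sup>2 * u)" using C1 workn(2)[OF u1] by (intro M) auto
    finally show ?thesis .
  qed
  moreover have "real FQ \<le> ?M * (x\<^sup>2 * q)"

  proof -
    have "real FQ \<le> 113 * C * (x\<^sup>2 * q)" using FQ(2) by (simp only: mult.assoc)
    also have "\<dots> \<le> ?M * (x\<^sup>2 * q)" using C1 workn(2)[OF q1] by (intro M) auto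
    finally show ?thesis .
  qed
  moreover have "real DQ \<le> ?M * (x * q)"

  proof -
    have "real DQ \<le> 2080 * (C * C * z)" using DQ(2) CCz by linarith
    then show ?thesis by (simp only: z_def mult.assoc)
  qed
  ultimately have "suitable n p1 p2 pq pu w (lsf_regs w k kap l lt bl A n B FU FQ DQ)"
    using lsf blw bal FU(1) FQ(1) B(1) DQ(1,3)
    unfolding x_def N_def K_def T_def by (intro suitableI[OF k u_def q_def C_def]) (assumption | linarith | simp)+
  then show ?thesis by blast
qed

text \<open>The programs are fixed and only the registers vary. The choice operator turns the
  existence of suitable parameters into a function of the quantities that \<open>params\<close> may
  depend on.\<close>

definition lsf_structure :: data_structure where
  "lsf_structure = \<lparr>params = (\<lambda>n p1 p2 pq pu w. SOME R. suitable n p1 p2 pq pu w R), prepare_code = lsf_prepare,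
     insert_code = lsf_insert, delete_code = lsf_delete, query_code = lsf_query\<rparr>"

text \<open>A point is near itself, so \<open>p1\<close> is a lower bound for the probability of a
  filter that contains it on both sides. Hence \<open>pq / p1\<close> and \<open>pu / p1\<close> are
  at least 1, on which the monotonicity of their powers rests.\<close>

lemma sensitive_probabilities:
  assumes sp: "dissimilarity_space X d" and r: "0 < r" and fam: "sensitive_filter_family X d F r cr p1 p2 pq pu"
  shows "prob_space F" "p1 \<le> 1" "p1 \<le> pq" "p1 \<le> pu"
proof -
  obtain x where x: "x \<in> X" "d x x = 0" using sp unfolding dissimilarity_space_def by blast
  show F: "prob_space F" using fam unfolding sensitive_filter_family_def by (elim conjE)
  interpret prob_space F by (rule F)
  have ms: "\<forall>x\<in>X. {f \<in> space F. x \<in> fst f} \<in> sets F \<and> {f \<in> space F. x \<in> snd f} \<in> sets F"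
    and pair: "\<forall>x\<in>X. \<forall>y\<in>X. (d x y \<le> r \<longrightarrow> p1 \<le> measure F {f \<in> space F. x \<in> fst f \<and> y \<in> snd f}) \<and>
        (cr < d x y \<longrightarrow> measure F {f \<in> space F. x \<in> fst f \<and> y \<in> snd f} \<le> p2)"
    and upper: "\<forall>x\<in>X. measure F {f \<in> space F. x \<in> fst f} \<le> pq \<and> measure F {f \<in> space F. x \<in> snd f} \<le> pu"
    using fam unfolding sensitive_filter_family_def by - (elim conjE, assumption)+
  have p: "p1 \<le> measure F {f \<in> space F. x \<in> fst f \<and> x \<in> snd f}"
    using bspec[OF bspec[OF pair x(1)] x(1)] x(2) r by simp
  have "measure F {f \<in> space F. x \<in> fst f \<and> x \<in> snd f} \<le> measure F {f \<in> space F. x \<in> fst f}"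
    by (rule finite_measure_mono) (use bspec[OF ms x(1)] in auto)
  then show "p1 \<le> pq" using p bspec[OF upper x(1)] by linarith
  have "measure F {f \<in> space F. x \<in> fst f \<and> x \<in> snd f} \<le> measure F {f \<in> space F. x \<in> snd f}"
    by (rule finite_measure_mono) (use bspec[OF ms x(1)] in auto)
  then show "p1 \<le> pu" using p bspec[OF upper x(1)] by linarith
  show "p1 \<le> 1" using p prob_le_1[of "{f \<in> space F. x \<in> fst f \<and> x \<in> snd f}"] by linarith
qed

lemma lsf_structure_correct:
  fixes X :: "'a set"
  assumes sp: "dissimilarity_space X d" and r: "0 < r" "1 \<le> c" and p: "0 < p1" "0 < p2" "p2 < pq"
    and fam: "sensitive_filter_family X d F r (c * r) p1 p2 pq pu" and n: "2 \<le> n" and k: "k = filter_depth n p2 pq"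
    and w: "sufficient_word_size 40 n k p1 pu w"
  defines "R \<equiv> params lsf_structure n p1 p2 pq pu w" and "C \<equiv> 3 * real cost_factor * (2080 * moment_const * moment_const)"
  shows "solves_near_neighbor lsf_structure R w n X d F r (c * r) (1 / (2 * moment_const))"
    and "within_bounds lsf_structure R w n X d F (c * r)
         (C * (real k * real n * (pu / p1) ^ k)) (C * ((real k)\<^sup>2 / p1)) (C * ((real k)\<^sup>2 * (pq / p1) ^ k))
         (C * (real k * (pq / p1) ^ k)) (C * ((real k)\<^sup>2 / p1)) (C * ((real k)\<^sup>2 * (pu / p1) ^ k)) (C * ((real k)\<^sup>2 / p1))"
proof -
  note F = sensitive_probabilities[OF sp r(1) fam]
  let ?M = "2080 * moment_const * moment_const"
  define u where "u = (pu / p1) ^ k" define q where "q = (pq / p1) ^ k"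
  have k1: "1 \<le> real k" using filter_depth_bounds(1)[OF n p(2,3) k] by simp
  have u1: "1 \<le> u" and q1: "1 \<le> q" using p F by (auto intro!: one_le_power simp: u_def q_def)
  define Xs where "Xs = real n + real k * real n * (pu / p1) ^ k + (real k)\<^sup>2 / p1"
  have X0: "0 < Xs" unfolding Xs_def using n k1 u1 p by (intro add_pos_nonneg) (auto simp: u_def[symmetric])
  have "40 * log 2 Xs \<le> real w" using w unfolding sufficient_word_size_def Xs_def .
  then have "2 powr (40 * log 2 Xs) \<le> 2 powr real w" by simp
  moreover have "2 powr (40 * log 2 Xs) = Xs ^ 40"
  proof -
    have "2 powr (40 * log 2 Xs) = (2 powr log 2 Xs) powr 40" by (simp add: powr_powr mult.commute)
    also have "\<dots> = Xs powr 40" using X0 by simp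
    also have "\<dots> = Xs ^ 40" using powr_realpow[OF X0, of 40] by simp
    finally show ?thesis .
  qed
  ultimately have w40: "Xs ^ 40 \<le> 2 ^ w" by (simp add: powr_realpow)
  have "\<exists>R. suitable n p1 p2 pq pu w R"
  proof (cases "real n \<le> real k * (pq / p1) ^ k")
    case True
    show ?thesis by (rule suitable_linear[OF p(1) F(3,4) p(2,3) n k Xs_def w40 True])
  next
    case False
    then have "real k * (pq / p1) ^ k < real n" by simp
    then show ?thesis by (rule suitable_tree[OF p(1) F(2,3,4) p(2,3) n k Xs_def w40])
  qed
  then have "suitable n p1 p2 pq pu w (SOME R. suitable n p1 p2 pq pu w R)" by (rule someI_ex)
  then have "suitable n p1 p2 pq pu w R" by (simp add: R_def lsf_structure_def)
  then obtain k' kap l lt bl A B FU FQ DQ cells where R: "R = lsf_regs w k' kap l lt bl A n B FU FQ DQ"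
    and lsf: "lsf w k' kap l lt bl A n B FU FQ DQ cells" and bl: "bl < 2 ^ w"
    and cells: "real (8 * cells) \<le> ?M * (real k * real n * u)"
    and nf: "real (lsf_tree.nfilters k' kap bl A) \<le> ?M * ((real k)\<^sup>2 / p1)"
    and FU: "real FU \<le> ?M * ((real k)\<^sup>2 * u)" and B: "real B \<le> ?M * ((real k)\<^sup>2 * u)"
    and FQ: "real FQ \<le> ?M * ((real k)\<^sup>2 * q)" and DQ: "real DQ \<le> ?M * (real k * q)"
    and mode: "k' = 0 \<and> kap = 0 \<and> l = 0 \<and> lt = 0 \<and> 2 \<le> FU \<and> 2 \<le> FQ \<and> n < DQ \<or>
        k' = k \<and> lsf_balanced w k' kap l lt bl A p1 \<and>
        8 * moment_const * (7 * real k' * 2 ^ kap * u) \<le> real FU + 1 \<and> 8 * moment_const * (7 * real k' * 2 ^ kap * q) \<le> real FQ + 1 \<and>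
        8 * moment_const * (2 ^ kap * u) \<le> real B + 1 \<and>
        8 * moment_const * (real n * (2 / 2 ^ lt * moment_const * (2 ^ kap)\<^sup>2 * q * u +
          (2 ^ kap * (p2 / p1) ^ k' + 2 / 2 ^ l * moment_const * (2 ^ kap)\<^sup>2 * q * ((real k' + 1) * u)))) \<le> real DQ \<and> 0 < DQ"
    unfolding suitable_def Let_def k[symmetric] u_def[symmetric] q_def[symmetric] by (elim exE conjE) (rule that)
  interpret lsf w k' kap l lt bl A n B FU FQ DQ cells by (rule lsf)
  interpret lsf_instance w k' kap l lt bl A n B FU FQ DQ cells lsf_structure R
    by unfold_locales (use n bl R in \<open>simp_all add: lsf_structure_def\<close>)
  have rc: "r \<le> c * r" using mult_right_mono[OF r(2), of r] r(1) by simp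
  show "solves_near_neighbor lsf_structure R w n X d F r (c * r) (1 / (2 * moment_const))"
    using mode
  proof (elim disjE conjE)
    assume z: "k' = 0" "kap = 0" "l = 0" "lt = 0" "2 \<le> FU" "2 \<le> FQ" "n < DQ"
    have "1 / (2 * moment_const) \<le> 1" using moment_const_bounds(1) by simp
    then show ?thesis by (rule solves_linear[OF F(1) rc z])
  next
    assume z: "lsf_balanced w k' kap l lt bl A p1" "8 * moment_const * (7 * real k' * 2 ^ kap * u) \<le> real FU + 1"
      "8 * moment_const * (7 * real k' * 2 ^ kap * q) \<le> real FQ + 1" "8 * moment_const * (2 ^ kap * u) \<le> real B + 1"
      "8 * moment_const * (real n * (2 / 2 ^ lt * moment_const * (2 ^ kap)\<^sup>2 * q * u +
          (2 ^ kap * (p2 / p1) ^ k' + 2 / 2 ^ l * moment_const * (2 ^ kap)\<^sup>2 * q * ((real k' + 1) * u)))) \<le> real DQ" "0 < DQ"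
      and k': "k' = k"
    show ?thesis
      by (rule solves_balanced[OF fam sp r(1) rc less_imp_le[OF p(2)] z[unfolded u_def q_def k'[symmetric]]])
  qed
  have G: "1 \<le> real cost_factor" by (simp add: cost_factor_def)
  have M1: "1 \<le> ?M"
  proof -
    have "1 * 1 \<le> moment_const * moment_const" using moment_const_bounds(1) by (intro mult_mono) auto
    then show ?thesis by simp
  qed
  have MC: "?M \<le> C" using mult_right_mono[of 1 "3 * real cost_factor" ?M] G M1 by (simp add: C_def)
  have C: "t \<le> C * y" if "t \<le> ?M * y" "0 \<le> y" for t y
    using mult_right_mono[OF MC that(2)] that(1) by linarith
  \<comment> \<open>Three summands, each at most \<open>?M * y\<close>, account for the factor 3 in
    \<open>C\<close>.\<close>
  have work: "real (cost_factor * (1 + a + b)) \<le> C * y" if "real a \<le> ?M * y" "real b \<le> ?M * y" "1 \<le> y" for a b y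
  proof -
    have "1 * 1 \<le> ?M * y" using M1 that(3) by (intro mult_mono) auto
    then have "1 + real a + real b \<le> 3 * (?M * y)" using that by linarith
    then have "real cost_factor * (1 + real a + real b) \<le> real cost_factor * (3 * (?M * y))" by (rule mult_left_mono) simp
    also have "\<dots> = C * y" by (simp add: C_def)
    finally show ?thesis by (simp only: of_nat_mult of_nat_add of_nat_1)
  qed
  have sq: "real k \<le> (real k)\<^sup>2" using mult_left_mono[OF k1, of "real k"] by (simp add: power2_eq_square)
  have one: "1 \<le> (real k)\<^sup>2 * v" if "1 \<le> v" for v
    using mult_mono[of 1 "(real k)\<^sup>2" 1 v] that k1 sq by simp
  have DQ': "real DQ \<le> ?M * ((real k)\<^sup>2 * q)"
  proof -
    have "?M * (real k * q) \<le> ?M * ((real k)\<^sup>2 * q)" using M1 sq q1 by (intro mult_left_mono mult_right_mono) auto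
    then show ?thesis using DQ by linarith
  qed
  have nf': "real nfilters \<le> C * ((real k)\<^sup>2 / p1)" by (rule C[OF nf]) (use p in simp)
  show "within_bounds lsf_structure R w n X d F (c * r)
         (C * (real k * real n * (pu / p1) ^ k)) (C * ((real k)\<^sup>2 / p1)) (C * ((real k)\<^sup>2 * (pq / p1) ^ k))
         (C * (real k * (pq / p1) ^ k)) (C * ((real k)\<^sup>2 / p1)) (C * ((real k)\<^sup>2 * (pu / p1) ^ k)) (C * ((real k)\<^sup>2 / p1))"
    unfolding u_def[symmetric] q_def[symmetric]
  proof (rule within_bounds)
    show "real (8 * cells) \<le> C * (real k * real n * u)" by (rule C[OF cells]) (use u1 in simp)
    show "real nfilters \<le> C * ((real k)\<^sup>2 / p1)" by (rule nf')
    show "real nfilters \<le> C * ((real k)\<^sup>2 / p1)" by (rule nf')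
    show "real nfilters \<le> C * ((real k)\<^sup>2 / p1)" by (rule nf')
    show "real DQ \<le> C * (real k * q)" by (rule C[OF DQ]) (use q1 in simp)
    show "real (lsf_run.query_cost FQ DQ) \<le> C * ((real k)\<^sup>2 * q)"
      by (rule order_trans[OF of_nat_mono[OF cost_bounds(1)] work[OF FQ DQ' one[OF q1]]])
    show "real (lsf_run.insert_cost B FU + lsf_run.delete_cost B) \<le> C * ((real k)\<^sup>2 * u)"
      by (rule order_trans[OF of_nat_mono[OF cost_bounds(2)] work[OF FU B one[OF u1]]])
  qed
qed

theorem theorem3p28:
  shows "\<exists>(D :: data_structure) (C :: real) (\<delta> :: real) (\<beta> :: real).
    C > 0 \<and> \<delta> > 0 \<and> \<beta> > 0 \<and>
    (\<forall>(X :: 'a set) (d :: 'a \<Rightarrow> 'a \<Rightarrow> real) (F :: ('a set \<times> 'a set) measure)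
       (r :: real) (c :: real) (p1 :: real) (p2 :: real) (pq :: real) (pu :: real)
       (n :: nat) (w :: nat) (k :: nat).
       dissimilarity_space X d \<longrightarrow> r > 0 \<longrightarrow> c \<ge> 1 \<longrightarrow>
       p1 > 0 \<longrightarrow> p2 > 0 \<longrightarrow> p2 < pq \<longrightarrow>
       sensitive_filter_family X d F r (c * r) p1 p2 pq pu \<longrightarrow>
       n \<ge> 2 \<longrightarrow> k = filter_depth n p2 pq \<longrightarrow>
       sufficient_word_size \<beta> n k p1 pu w \<longrightarrow>
       solves_near_neighbor D (params D n p1 p2 pq pu w) w n X d F r (c * r) \<delta> \<and>
       within_bounds D (params D n p1 p2 pq pu w) w n X d F (c * r)
         (C * (real k * real n * (pu / p1) ^ k))
         (C * ((real k)\<^sup>2 / p1))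
         (C * ((real k)\<^sup>2 * (pq / p1) ^ k))
         (C * (real k * (pq / p1) ^ k))
         (C * ((real k)\<^sup>2 / p1))
         (C * ((real k)\<^sup>2 * (pu / p1) ^ k))
         (C * ((real k)\<^sup>2 / p1)))"
proof (rule exI[of _ lsf_structure], rule exI[of _ "3 * real cost_factor * (2080 * moment_const * moment_const)"],
    rule exI[of _ "1 / (2 * moment_const)"], rule exI[of _ 40], intro conjI allI impI)
  have C: "0 < moment_const" using moment_const_bounds(1) by linarith
  show "0 < 3 * real cost_factor * (2080 * moment_const * moment_const)"
    using C by (simp add: cost_factor_def)
  show "0 < 1 / (2 * moment_const)" using C by simp
  show "0 < (40::real)" by simp
qed (rule lsf_structure_correct; assumption)+

end
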